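(* Let $k$ be a field of characteristic $0$. Suppose that $f\in k[X]$ and a Siegel function $g\in k(X)$ form a minimally reducible pair, and that $f=h\circ f_r$ with $h\in k[X]$ and $f_r\in k[X]$ indecomposable with $\mathrm{Mon}_k(f_r)$ solvable. If $g\notin k[X]$, assume further that $\deg(f)$ is odd. Then the kernel $K:=\ker(\mathrm{Mon}_k(f)\to\mathrm{Mon}_k(h))$ is either a diagonal subgroup of $\mathrm{Mon}_k(f_r)^{\deg(h)}$, or $\deg(f_r)=2$ and $K\cong C_2\times C_2$.
   Context: Let $t$ be transcendental over $k$. For $\varphi=\varphi_1/\varphi_2\in k(X)\setminus k$ (coprime numerator and denominator), $\mathrm{Mon}_k(\varphi)$ is the Galois group of $\varphi_1(X)-t\varphi_2(X)$ over $k(t)$ acting on its roots; $\varphi$ is indecomposable if $\deg\varphi>1$ and $\varphi$ is not a composition of two rational functions in $k(X)$ of degree $>1$. A Siegel function is $g\in k(X)\setminus k$ with $|g^{-1}(\infty)|\le 2$ (distinct points of $\mathbb{P}^1(\bar k)$). Let $x$, $y$ be roots of $f(X)-t$ and of (the numerator of) $g(Y)-t$ in an algebraic closure of $k(t)$. The pair $f,g$ is minimally reducible if $k(x)$ and $k(y)$ are not linearly disjoint over $k(t)$, but for all intermediate fields $k(t)\subseteq L\subseteq k(x)$, $k(t)\subseteq M\subseteq k(y)$ with $(L,M)\neq(k(x),k(y))$, $L$ and $M$ are linearly disjoint over $k(t)$. For $f=h\circ f_r$, $\mathrm{Mon}_k(f)$ acts on the roots of $h(X)-t$ (giving the map onto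 $\mathrm{Mon}_k(h)$), and the kernel $K$ acts on each of the $\deg(h)$ blocks $f_r^{-1}(z)$, $z$ a root of $h(X)-t$, via a group identified with a subgroup of $\mathrm{Mon}_k(f_r)$; this embeds $K$ into $\mathrm{Mon}_k(f_r)^{\deg(h)}$. $K$ is diagonal if each of the $\deg(h)$ coordinate projections is injective. *)

theory Defs
  imports
    "HOL-Algebra.Algebraic_Closure_Type"
    "HOL-Algebra.Generated_Fields"
    "HOL-Algebra.Embedded_Algebras"
    "HOL-Algebra.Solvable_Groups"
    "HOL-Algebra.Product_Groups"
    "HOL-Algebra.Elementary_Groups"
    "HOL-Algebra.Bij"
begin

section \<open>Rational functions over a field\<close>

text \<open>The field \<open>k(X)\<close> is \<open>'k poly fract\<close>; a polynomial \<open>f\<close> is the element \<open>to_fract f\<close>.\<close>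

text \<open>Requiring a monic denominator makes the coprime pair unique, see \<open>rf_quot_unique\<close> below.\<close>

definition rf_quot :: "'k::field poly fract \<Rightarrow> 'k poly \<times> 'k poly" where
  "rf_quot \<phi> = (THE r. \<phi> = to_fract (fst r) / to_fract (snd r) \<and>
                       coprime (fst r) (snd r) \<and> Polynomial.lead_coeff (snd r) = 1)"

definition rf_num :: "'k::field poly fract \<Rightarrow> 'k poly" where
  "rf_num \<phi> = fst (rf_quot \<phi>)"

definition rf_den :: "'k::field poly fract \<Rightarrow> 'k poly" where
  "rf_den \<phi> = snd (rf_quot \<phi>)"

definition rf_degree :: "'k::field poly fract \<Rightarrow> nat" where
  "rf_degree \<phi> = max (Polynomial.degree (rf_num \<phi>)) (Polynomial.degree (rf_den \<phi>))"

definition rf_const :: "'k::field \<Rightarrow> 'k poly fract" where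
  "rf_const c = to_fract [:c:]"

text \<open>Only meaningful for a nonconstant \<open>\<psi>\<close>: otherwise the denominator may vanish.\<close>

definition rf_compose :: "'k::field poly fract \<Rightarrow> 'k poly fract \<Rightarrow> 'k poly fract" where
  "rf_compose \<phi> \<psi> =
     poly (map_poly rf_const (rf_num \<phi>)) \<psi> / poly (map_poly rf_const (rf_den \<phi>)) \<psi>"

definition indecomposable :: "'k::field poly fract \<Rightarrow> bool" where
  "indecomposable \<phi> \<longleftrightarrow> rf_degree \<phi> > 1 \<and>
     \<not> (\<exists>\<alpha> \<beta>. rf_degree \<alpha> > 1 \<and> rf_degree \<beta> > 1 \<and> \<phi> = rf_compose \<alpha> \<beta>)"

text \<open>The map on the projective line over the algebraic closure of \<open>k\<close> induced by a rational
  function; \<open>None\<close> is the point at infinity.\<close>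

definition rf_P1 :: "'k::field poly fract \<Rightarrow> 'k alg_closure option \<Rightarrow> 'k alg_closure option" where
  "rf_P1 \<phi> P =
     (let p = map_poly to_ac (rf_num \<phi>); q = map_poly to_ac (rf_den \<phi>) in
      case P of
        Some a \<Rightarrow> if poly q a = 0 then None else Some (poly p a / poly q a)
      | None \<Rightarrow> if Polynomial.degree p > Polynomial.degree q then None
                else Some (Polynomial.coeff p (Polynomial.degree q) / Polynomial.lead_coeff q))"

definition siegel_function :: "'k::field poly fract \<Rightarrow> bool" where
  "siegel_function g \<longleftrightarrow> g \<notin> range rf_const \<and> card {P. rf_P1 g P = None} \<le> 2"


section \<open>Subfields of the algebraic closure of \<open>k(t)\<close>\<close>

text \<open>All fields are subsets of the algebraic closure of \<open>k(t)\<close>, where \<open>k(t)\<close> is again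
  \<open>'k poly fract\<close>.\<close>

type_synonym 'k func_ac = "'k poly fract alg_closure"

abbreviation cl_ring :: "'a::field ring" where
  "cl_ring \<equiv> ring_of_type_algebra"

definition ac_const :: "'k::field \<Rightarrow> 'k func_ac" where
  "ac_const c = to_ac (to_fract [:c:])"

definition ac_t :: "'k::field func_ac" where
  "ac_t = to_ac (to_fract [:0, 1:])"

definition adjoin :: "'k::field func_ac \<Rightarrow> 'k func_ac set" where
  "adjoin x = generate_field cl_ring (insert x (range ac_const))"

definition linearly_disjoint :: "'a::field set \<Rightarrow> 'a set \<Rightarrow> 'a set \<Rightarrow> bool" where
  "linearly_disjoint F L M \<longleftrightarrow>
     (\<forall>us. set us \<subseteq> L \<and> ring.independent cl_ring F us \<longrightarrow> ring.independent cl_ring M us)"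

definition rf_fiber :: "'k::field poly fract \<Rightarrow> 'k func_ac \<Rightarrow> 'k func_ac set" where
  "rf_fiber \<phi> s =
     {x. poly (map_poly ac_const (rf_num \<phi>) - Polynomial.smult s (map_poly ac_const (rf_den \<phi>))) x = 0}"

text \<open>The condition does not depend on the choice of the roots \<open>x\<close> and \<open>y\<close>.\<close>

definition minimally_reducible :: "'k::field poly fract \<Rightarrow> 'k poly fract \<Rightarrow> bool" where
  "minimally_reducible f g \<longleftrightarrow>
     (\<exists>x \<in> rf_fiber f ac_t. \<exists>y \<in> rf_fiber g ac_t.
        \<not> linearly_disjoint (adjoin ac_t) (adjoin x) (adjoin y) \<and>
        (\<forall>L M. subfield L cl_ring \<and> adjoin ac_t \<subseteq> L \<and> L \<subseteq> adjoin x \<and>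
               subfield M cl_ring \<and> adjoin ac_t \<subseteq> M \<and> M \<subseteq> adjoin y \<and>
               (L, M) \<noteq> (adjoin x, adjoin y) \<longrightarrow>
               linearly_disjoint (adjoin ac_t) L M))"


section \<open>Monodromy groups\<close>

definition galois_group :: "'a::field set \<Rightarrow> 'a set \<Rightarrow> ('a \<Rightarrow> 'a) monoid" where
  "galois_group F L = (BijGroup L)
     \<lparr>carrier := {\<sigma> \<in> Bij L. \<sigma> \<in> ring_hom (cl_ring\<lparr>carrier := L\<rparr>) (cl_ring\<lparr>carrier := L\<rparr>) \<and>
                             (\<forall>a\<in>F. \<sigma> a = a)}\<rparr>"

definition split_field :: "'k::field poly fract \<Rightarrow> 'k func_ac \<Rightarrow> 'k func_ac set" where
  "split_field \<phi> s = generate_field cl_ring (adjoin s \<union> rf_fiber \<phi> s)"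

text \<open>The parameter \<open>s\<close> is any element that is transcendental over \<open>k\<close>. For another such
  element \<open>s'\<close>, the isomorphism from \<open>k(s)\<close> to \<open>k(s')\<close> that maps \<open>s\<close> to \<open>s'\<close> identifies
  \<open>monodromy_group \<phi> s\<close> with \<open>monodromy_group \<phi> s'\<close>. The action on the roots is the evaluation
  of an automorphism at a root.\<close>

definition monodromy_group ::
    "'k::field poly fract \<Rightarrow> 'k func_ac \<Rightarrow> ('k func_ac \<Rightarrow> 'k func_ac) monoid" where
  "monodromy_group \<phi> s = galois_group (adjoin s) (split_field \<phi> s)"

abbreviation Mon :: "'k::field poly fract \<Rightarrow> ('k func_ac \<Rightarrow> 'k func_ac) monoid" where
  "Mon \<phi> \<equiv> monodromy_group \<phi> ac_t"

text \<open>If \<open>f\<close> is the composition of \<open>h\<close> with some \<open>f\<^sub>r\<close>, then \<open>split_field h ac_t\<close> is contained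
  in \<open>split_field f ac_t\<close>, and restriction is the map from \<open>Mon f\<close> onto \<open>Mon h\<close> given by the
  action on the roots of \<open>h(X) - t\<close>.\<close>

definition mon_kernel ::
    "'k::field poly fract \<Rightarrow> 'k poly fract \<Rightarrow> ('k func_ac \<Rightarrow> 'k func_ac) set" where
  "mon_kernel f h = kernel (Mon f) (Mon h) (\<lambda>\<sigma>. restrict \<sigma> (split_field h ac_t))"

text \<open>The block over a root \<open>z\<close> of \<open>h(X) - t\<close> is \<open>rf_fiber f\<^sub>r z\<close>. An automorphism in the kernel
  fixes \<open>k(z)\<close>, so its action on this block is the element of \<open>monodromy_group f\<^sub>r z\<close> obtained by
  restriction to the field generated by the block over \<open>k(z)\<close>.\<close>

definition block_embedding ::
    "'k::field poly fract \<Rightarrow> 'k poly fract \<Rightarrow>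
     ('k func_ac \<Rightarrow> 'k func_ac) \<Rightarrow> ('k func_ac \<Rightarrow> 'k func_ac \<Rightarrow> 'k func_ac)" where
  "block_embedding h fr \<sigma> = (\<lambda>z\<in>rf_fiber h ac_t. restrict \<sigma> (split_field fr z))"

definition diagonal_kernel ::
    "'k::field poly fract \<Rightarrow> 'k poly fract \<Rightarrow> 'k poly fract \<Rightarrow> bool" where
  "diagonal_kernel f h fr \<longleftrightarrow>
     block_embedding h fr \<in> mon ((Mon f)\<lparr>carrier := mon_kernel f h\<rparr>)
       (product_group (rf_fiber h ac_t) (monodromy_group fr)) \<and>
     (\<forall>z\<in>rf_fiber h ac_t. inj_on (\<lambda>\<sigma>. block_embedding h fr \<sigma> z) (mon_kernel f h))"


section \<open>Basic facts\<close>

lemma coprime_poly_bezout: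
  fixes p q :: "'k::field poly"
  assumes "coprime p q"
  obtains a b where "a * p + b * q = 1"
proof -
  define I where "I = {d. d \<noteq> 0 \<and> (\<exists>a b. d = a * p + b * q)}"
  have "p \<noteq> 0 \<or> q \<noteq> 0" using assms by auto
  then have "\<exists>d. d \<in> I"
  proof
    assume "p \<noteq> 0"
    then have "p \<in> I" unfolding I_def by (auto intro: exI[of _ 1] exI[of _ 0])
    then show ?thesis ..
  next
    assume "q \<noteq> 0"
    then have "q \<in> I" unfolding I_def by (auto intro: exI[of _ 0] exI[of _ 1])
    then show ?thesis ..
  qed
  then obtain d0 where "d0 \<in> I" ..
  from arg_min_nat_lemma[of "\<lambda>d. d \<in> I", OF this, of Polynomial.degree]
  obtain d where d: "d \<in> I" "\<And>e. e \<in> I \<Longrightarrow> Polynomial.degree d \<le> Polynomial.degree e"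
    by blast
  obtain a b where ab: "d = a * p + b * q" and d0: "d \<noteq> 0" using d(1) by (auto simp: I_def)
  have dvd: "d dvd c" if c: "c = u * p + v * q" for c u v
  proof (rule ccontr)
    assume "\<not> d dvd c"
    then have nz: "c mod d \<noteq> 0" by (simp add: dvd_eq_mod_eq_0)
    have "c mod d = c - (c div d) * d" by (simp add: minus_div_mult_eq_mod)
    also have "\<dots> = (u - (c div d) * a) * p + (v - (c div d) * b) * q"
      by (subst (2) ab, subst (1) c) (simp add: algebra_simps)
    finally have "c mod d \<in> I" using nz unfolding I_def by blast
    with d(2) have "Polynomial.degree d \<le> Polynomial.degree (c mod d)" by blast
    with degree_mod_less'[OF d0 nz] show False by simp
  qed
  have "d dvd p" "d dvd q" using dvd[of p 1 0] dvd[of q 0 1] by auto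
  then have "d dvd 1" using assms coprime_common_divisor by blast
  then obtain e where "1 = d * e" by (auto elim: dvdE)
  then have "(e * a) * p + (e * b) * q = 1" by (simp add: ab algebra_simps)
  then show ?thesis by (rule that)
qed

lemma rf_quot_ex:
  fixes \<phi> :: "'k::field poly fract"
  shows "\<exists>p q. \<phi> = to_fract p / to_fract q \<and> coprime p q \<and> Polynomial.lead_coeff q = 1"
proof -
  define D where "D = {(p, q). q \<noteq> 0 \<and> \<phi> = to_fract p / to_fract q}"
  have "\<exists>r. r \<in> D"
  proof (cases \<phi>)
    case (Fract a b)
    then show ?thesis unfolding D_def by (auto simp: Fract_conv_to_fract)
  qed
  then obtain r0 where "r0 \<in> D" ..
  from arg_min_nat_lemma[of "\<lambda>r. r \<in> D", OF this, of "\<lambda>r. Polynomial.degree (snd r)"]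
  obtain r where r: "r \<in> D"
      "\<And>s. s \<in> D \<Longrightarrow> Polynomial.degree (snd r) \<le> Polynomial.degree (snd s)"
    by blast
  obtain p q where pq: "r = (p, q)" by (cases r)
  have q0: "q \<noteq> 0" and \<phi>: "\<phi> = to_fract p / to_fract q" using r(1) by (auto simp: D_def pq)
  have cop: "coprime p q"
  proof (rule coprimeI)
    fix c assume "c dvd p" "c dvd q"
    then obtain p' q' where p': "p = c * p'" and q': "q = c * q'" by (auto elim!: dvdE)
    have nz: "c \<noteq> 0" "q' \<noteq> 0" using q0 q' by auto
    have "(p', q') \<in> D" using nz unfolding D_def by (simp add: \<phi> p' q')
    with r(2) have "Polynomial.degree q \<le> Polynomial.degree q'" by (force simp: pq)
    also have "Polynomial.degree q = Polynomial.degree c + Polynomial.degree q'"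
      using nz q' by (simp add: degree_mult_eq)
    finally have "Polynomial.degree c = 0" by simp
    then show "is_unit c" using nz by (simp add: is_unit_iff_degree)
  qed
  define u where "u = inverse (Polynomial.lead_coeff q)"
  have u0: "u \<noteq> 0" using q0 by (simp add: u_def)
  then have U: "is_unit [:u:]" by (simp add: is_unit_iff_degree)
  have "\<phi> = to_fract ([:u:] * p) / to_fract ([:u:] * q)"
    using u0 by (simp only: \<phi> to_fract_mult) simp
  moreover have "coprime ([:u:] * p) ([:u:] * q)"
  proof (rule coprimeI)
    fix c assume "c dvd [:u:] * p" "c dvd [:u:] * q"
    then have "c dvd p" "c dvd q" using U by (simp_all only: dvd_mult_unit_iff')
    then show "is_unit c" using cop coprime_common_divisor by blast
  qed
  moreover have "Polynomial.lead_coeff ([:u:] * q) = 1"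
    using q0 by (simp add: u_def)
  ultimately show ?thesis by blast
qed

lemma rf_quot_unique:
  fixes p q :: "'k::field poly"
  assumes "coprime p q" "Polynomial.lead_coeff q = 1"
  shows "rf_quot (to_fract p / to_fract q) = (p, q)"
proof -
  have main: "q dvd q'" if cop: "coprime p q" and eq: "p * q' = p' * q" for p q p' q' :: "'k poly"
  proof -
    obtain a b where "a * p + b * q = 1" using coprime_poly_bezout[OF cop] by blast
    then have "q' = (a * p + b * q) * q'" by simp
    also have "\<dots> = a * (p * q') + b * q * q'" by (simp add: algebra_simps)
    also have "\<dots> = q * (a * p' + b * q')" by (simp add: eq algebra_simps)
    finally show ?thesis by (rule dvdI)
  qed
  have "r = (p, q)" if r: "to_fract p / to_fract q = to_fract (fst r) / to_fract (snd r)"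
    "coprime (fst r) (snd r)" "Polynomial.lead_coeff (snd r) = 1" for r
  proof -
    have nz: "q \<noteq> 0" "snd r \<noteq> 0" using assms r by auto
    have "to_fract (p * snd r) = to_fract (fst r * q)"
      using r(1) nz by (simp add: frac_eq_eq)
    then have eq: "p * snd r = fst r * q" by (simp only: to_fract_eq_iff)
    have "q dvd snd r" "snd r dvd q"
      using main[OF assms(1) eq] main[OF r(2) eq[symmetric]] by auto
    then obtain c where c: "snd r = q * c" and "Polynomial.degree (snd r) = Polynomial.degree q"
      using nz by (metis dvd_imp_degree_le dvdE le_antisym)
    then have "Polynomial.degree c = 0" using nz by (auto simp: degree_mult_eq)
    then obtain a where "c = [:a:]" using degree_eq_zeroE by blast
    with c r(3) assms(2) have "snd r = q" by (simp split: if_splits)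
    with eq nz show ?thesis by (simp add: prod_eq_iff)
  qed
  then show ?thesis
    unfolding rf_quot_def by (intro the_equality) (use assms in auto)
qed

lemma rf_num_den_poly [simp]:
  "rf_num (to_fract f) = f" "rf_den (to_fract f) = 1"
  using rf_quot_unique[of f 1] by (simp_all add: rf_num_def rf_den_def)

lemma rf_degree_poly [simp]: "rf_degree (to_fract f) = Polynomial.degree f"
  by (simp add: rf_degree_def)


end

theory Submission
  imports Defs "HOL-Algebra.Sylow"
begin

text \<open>Let \<open>G\<close> be the Galois group of the algebraic closure of \<open>k(t)\<close>, \<open>A\<close> the set of roots of
  \<open>f(X) - t\<close>, and \<open>K\<close> the subgroup of \<open>G\<close> fixing the roots of \<open>h(X) - t\<close>. Linear disjointness
  translates into transitivity: the stabiliser of \<open>y\<close> is transitive on the blocks but not on \<open>A\<close>,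
  and an element that acts trivially on \<open>A\<close> fixes \<open>y\<close>. Puiseux expansions at infinity give \<open>\<sigma> \<in> G\<close>
  that is a single cycle on \<open>A\<close> and has at most two orbits on the roots of \<open>g(Y) - t\<close>. As \<open>f\<^sub>r\<close> is
  indecomposable, a normal subgroup of \<open>G\<close> inside \<open>K\<close> is trivial or transitive on each block.

  By solvability \<open>K\<close> contains a normal subgroup \<open>N\<close> of \<open>G\<close> that acts on \<open>A\<close> as a nontrivial
  elementary abelian \<open>p\<close>-group. A power of \<open>\<sigma>\<close> permutes a block cyclically and normalises \<open>N\<close>, which
  forces the block size to be \<open>p\<close> or \<open>4\<close>. The same argument, applied to the orbit of \<open>y\<close> under the
  centraliser \<open>P\<close> of \<open>N\<close> in \<open>K\<close>, shows that this orbit has \<open>1\<close>, \<open>p\<close> or \<open>4\<close> elements. Comparing the two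
  actions, \<open>P\<close> is regular on every block, and then \<open>K\<close> is diagonal, or the blocks have size \<open>2\<close> and
  \<open>K = P\<close> has order \<open>4\<close>.\<close>

section \<open>Cyclic affine permutations of elementary abelian groups\<close>

text \<open>One group serves for all permutation arguments, because it acts on the roots of f(X) - t
  and of g(Y) - t at the same time. Its elements are not determined by their action on
  \<open>A\<close>, so "trivial" means trivial on \<open>A\<close>, and normal subgroups are
  measured by their orbits on \<open>A\<close>. The number 4 comes from affine maps: a single cycle
  on an elementary abelian group of order p^d can be affine only if d <= 1 or p^d = 4. Blocks of
  size 4 are the real obstacle. There the stabiliser of \<open>y\<close> in \<open>P\<close> may
  move points of \<open>A\<close>, and primitivity has to be used once more: for an orbit of
  \<open>y\<close> of size 2 with the elements of \<open>P\<close> all of whose conjugates fix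
  \<open>y\<close>, for size 4 with the square of the cycle on the blocks. If g is not a polynomial,
  the odd degree has two effects: two cycles of odd length cannot fill an orbit whose size is a
  power of an odd prime, and blocks of size 4 do not occur. The alternative with the four-group
  arises from blocks of size 2 and an orbit of \<open>y\<close> of size 4.\<close>

lemma prime_dvd_choose_prime_power:
  fixes p :: nat
  assumes p: "prime p" and i: "0 < i" "i < p ^ e"
  shows "p dvd (p ^ e choose i)"
proof (rule ccontr)
  assume n: "\<not> p dvd (p ^ e choose i)"
  obtain j m where j: "i = Suc j" and m: "p ^ e = Suc m"
    using i by (metis gr0_implies_Suc less_nat_zero_code neq0_conv)
  \<comment> \<open>By this absorption identity, a binomial coefficient prime to p would force p^e
    to divide i < p^e.\<close>
  have "i * (p ^ e choose i) = p ^ e * (m choose j)"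
    using Suc_times_binomial_eq[of m j] by (simp add: j m algebra_simps del: binomial_Suc_Suc)
  then have "p ^ e dvd i * (p ^ e choose i)" by simp
  moreover have "coprime (p ^ e) (p ^ e choose i)"
    using n p by (simp add: prime_imp_coprime)
  ultimately have "p ^ e dvd i" by (simp add: coprime_dvd_mult_left_iff)
  then show False using i by (auto dest: dvd_imp_le)
qed

text \<open>This is 1 + X + ... + X^(k-1). The recursion copies the orbit recursion s (k+1) = b + A
  (s k) of an affine map, to which it is applied in \<open>order_affine_cycle\<close>.\<close>

primrec geom_poly :: "nat \<Rightarrow> int poly" where
  "geom_poly 0 = 0"
| "geom_poly (Suc k) = pCons 1 (geom_poly k)"

lemma geom_poly_mult: "[:-1, 1:] * geom_poly k = [:0, 1:] ^ k - 1"
proof (induction k)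
  case (Suc k)
  have "[:-1, 1:] * geom_poly (Suc k) = [:-1, 1:] + [:0, 1:] * ([:-1, 1:] * geom_poly k)"
    by (simp add: algebra_simps)
  also have "\<dots> = [:-1, 1:] + [:0, 1:] * ([:0, 1:] ^ k - 1)" by (simp only: Suc)
  also have "\<dots> = [:0, 1:] ^ Suc k + ([:-1, 1:] - [:0, 1:])"
    by (simp add: algebra_simps)
  also have "[:-1, 1:] - [:0, 1:] = - (1 :: int poly)" by (simp add: one_pCons)
  finally show ?case by simp
qed auto

text \<open>Put Y = X - 1 and q = p^e. Then Y times the left side is (Y + 1)^q - 1. After expanding
  and cancelling Y, every binomial coefficient except the top one is divisible by p.\<close>

lemma geom_poly_prime_power:
  fixes p :: nat
  assumes p: "prime p"
  shows "\<exists>r. geom_poly (p ^ e) = [:-1, 1:] ^ (p ^ e - 1) + smult (int p) r"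
proof -
  define Y :: "int poly" where "Y = [:-1, 1:]"
  define q where "q = p ^ e"
  have q: "q > 0" using p by (simp add: q_def prime_gt_0_nat)
  have sm: "(\<Sum>i<n. Polynomial.smult c (F i)) = Polynomial.smult c (\<Sum>i<n. F i)" for n c and F :: "nat \<Rightarrow> int poly"
    by (induction n) (simp_all add: smult_add_right)
  have YX: "[:0, 1:] = Y + 1" by (simp add: Y_def one_pCons)
  have "Y * geom_poly q = (Y + 1) ^ q - 1"
    using geom_poly_mult[of q] by (simp add: YX flip: Y_def)
  also have "(Y + 1) ^ q = (\<Sum>i\<le>q. of_nat (q choose i) * Y ^ i)"
    by (subst binomial_ring) simp
  also have "\<dots> = 1 + (\<Sum>i=1..q. of_nat (q choose i) * Y ^ i)"
    by (simp add: atMost_atLeast0 sum.atLeast_Suc_atMost)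
  also have "(\<Sum>i=1..q. of_nat (q choose i) * Y ^ i) = (\<Sum>i<q. of_nat (q choose (Suc i)) * Y ^ (Suc i))"
    by (rule sum.reindex_bij_witness[of _ Suc "\<lambda>i. i - 1"]) auto
  also have "\<dots> = Y * (\<Sum>i<q. of_nat (q choose (Suc i)) * Y ^ i)"
    by (simp add: sum_distrib_left algebra_simps)
  finally have "Y * geom_poly q = Y * (\<Sum>i<q. of_nat (q choose (Suc i)) * Y ^ i)" by simp
  moreover have "Y \<noteq> 0" by (simp add: Y_def)
  ultimately have "geom_poly q = (\<Sum>i<q. of_nat (q choose (Suc i)) * Y ^ i)" by simp
  also have "\<dots> = (\<Sum>i<q - 1. of_nat (q choose (Suc i)) * Y ^ i) + Y ^ (q - 1)"
    using q by (cases q) (auto simp del: binomial_Suc_Suc)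
  also have "(\<Sum>i<q - 1. of_nat (q choose (Suc i)) * Y ^ i)
           = (\<Sum>i<q - 1. smult (int p) (of_nat ((q choose (Suc i)) div p) * Y ^ i))"
  proof (rule sum.cong)
    fix i assume "i \<in> {..<q - 1}"
    then have "p dvd (q choose (Suc i))"
      using prime_dvd_choose_prime_power[OF p, of "Suc i" e] by (auto simp: q_def)
    then obtain c where c: "q choose (Suc i) = p * c" by (auto elim: dvdE)
    have "p > 0" using p prime_gt_0_nat by blast
    then show "of_nat (q choose (Suc i)) * Y ^ i = smult (int p) (of_nat ((q choose (Suc i)) div p) * Y ^ i)"
      unfolding c by (simp add: of_nat_poly)
  qed auto
  also have "\<dots> = smult (int p) (\<Sum>i<q - 1. of_nat ((q choose (Suc i)) div p) * Y ^ i)"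
    by (rule sm)
  finally show ?thesis by (auto simp: Y_def q_def algebra_simps)
qed

text \<open>Cauchy's theorem, taken from Sylow: a prime r dividing the order yields a nontrivial
  element whose order divides both r and p, so r = p.\<close>

lemma (in group) order_prime_power:
  assumes fin: "finite (carrier G)" and p: "prime p"
    and exp: "\<And>x. x \<in> carrier G \<Longrightarrow> x [^] (p::nat) = \<one>"
  shows "\<exists>d. Coset.order G = p ^ d"
proof -
  have "r = p" if r: "prime r" "r dvd Coset.order G" for r
  proof -
    obtain m where m: "Coset.order G = r ^ 1 * m" using r by (auto elim: dvdE)
    obtain H where H: "subgroup H G" "card H = r"
      using sylow_thm[OF r(1) group_axioms m fin] by auto
    have "card H \<noteq> 1" using H r by auto
    moreover have "\<one> \<in> H" using H by (simp add: subgroup.one_closed)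
    ultimately obtain h where h: "h \<in> H" "h \<noteq> \<one>"
      by (metis card_1_singleton_iff empty_iff insertI1 subsetI subset_singleton_iff One_nat_def)
    have hc: "h \<in> carrier G" by (rule subgroup.mem_carrier[OF H(1) h(1)])
    interpret HG: group "G\<lparr>carrier := H\<rparr>" by (rule subgroup_imp_group[OF H(1)])
    have "h [^] r = \<one>"
      using HG.pow_order_eq_1[of h] h H by (simp add: Coset.order_def flip: nat_pow_consistent)
    then have "ord h dvd r" using hc pow_eq_id by blast
    moreover have "ord h dvd p" using exp[OF hc] hc pow_eq_id by blast
    moreover have "ord h \<noteq> 1" using h hc ord_eq_1 by blast
    ultimately show ?thesis using r p by (metis prime_nat_iff)
  qed
  then have fac: "r = p" if "r \<in> prime_factors (Coset.order G)" for r
    using that by auto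
  have nz: "Coset.order G \<noteq> 0" using fin order_gt_0_iff_finite by auto
  have "(\<Prod>r\<in>prime_factors (Coset.order G). r ^ multiplicity r (Coset.order G)) =
        (\<Prod>r\<in>prime_factors (Coset.order G). p ^ multiplicity r (Coset.order G))"
    by (rule prod.cong) (use fac in auto)
  also have "\<dots> = p ^ (\<Sum>r\<in>prime_factors (Coset.order G). multiplicity r (Coset.order G))"
    by (simp add: power_sum)
  finally show ?thesis using prime_factorization_nat[of "Coset.order G"] nz by auto
qed

text \<open>Modulo \<open>p\<close> the polynomial \<open>1 + X + \<dots> + X^(p^e - 1)\<close> is \<open>(X - 1)^(p^e - 1)\<close>, so the \<open>p^e\<close>-th
  power of an affine map whose linear part is unipotent is trivial once the rank is below \<open>p^e\<close>.\<close>

lemma (in comm_group) order_affine_cycle: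
  fixes p :: nat and s :: "nat \<Rightarrow> 'a"
  assumes fin: "finite (carrier G)" and p: "prime p"
    and exp: "\<And>x. x \<in> carrier G \<Longrightarrow> x [^] p = \<one>"
    and A: "A \<in> hom G G" "inj_on A (carrier G)" and b: "b \<in> carrier G"
    and s0: "s 0 = \<one>" and sS: "\<And>k. s (Suc k) = b \<otimes> A (s k)"
    and surj: "carrier G = range s"
  shows "Coset.order G = 1 \<or> Coset.order G = p \<or> p = 2 \<and> Coset.order G = 4"
proof -
  interpret A: group_hom G G A using A by unfold_locales
  obtain d where d: "Coset.order G = p ^ d" using order_prime_power[OF fin p exp] by blast
  \<comment> \<open>The group is seen as a module over Z[X] on which X acts through
    \<open>A\<close>. Then \<open>ev r\<close> is r(A) applied to \<open>b\<close>, computed by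
    Horner's scheme and written multiplicatively.\<close>
  define ev :: "int poly \<Rightarrow> 'a" where "ev r = fold_coeffs (\<lambda>a e. b [^] a \<otimes> A e) r \<one>" for r
  have ev0 [simp]: "ev 0 = \<one>" by (simp add: ev_def)
  have evC: "ev (pCons a r) = b [^] a \<otimes> A (ev r)" for a r
  proof (cases "a = 0 \<and> r = 0")
    case True then show ?thesis by simp
  next
    case False then show ?thesis by (cases "r = 0") (simp_all add: ev_def)
  qed
  have evc [simp]: "ev r \<in> carrier G" for r
    by (induction r) (auto simp: evC b)
  have eva: "ev (r + q) = ev r \<otimes> ev q" for r q
    by (induction r q rule: poly_induct2) (simp_all add: evC b int_pow_mult m_ac)
  have evs: "ev (Polynomial.smult a r) = ev r [^] a" for a r
    by (induction r) (simp_all add: evC b int_pow_pow int_pow_distrib A.hom_int_pow mult.commute)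
  have evm: "ev (q * r) = \<one>" if "ev r = \<one>" for q r
    by (induction q) (simp_all add: that eva evs evC)
  have evp: "ev (Polynomial.smult (int p) r) = \<one>" for r
    by (simp add: evs exp int_pow_int)
  have evn: "ev (r - q) = ev r \<otimes> inv (ev q)" for r q
    using eva[of r "Polynomial.smult (-1) q"] by (simp only: evs) (simp add: int_pow_neg)
  have sk: "s k = ev (geom_poly k)" for k
    by (induction k) (simp_all add: s0 sS evC b)
  define Y :: "int poly" where "Y = [:-1, 1:]"
  have geom: "ev (geom_poly (p ^ e)) = ev (Y ^ (p ^ e - 1))" for e
    using geom_poly_prime_power[OF p, of e] by (auto simp: eva evp Y_def)
  \<comment> \<open>\<open>s\<close> is the orbit of the neutral element under an injective affine
    map. Since it exhausts the group, its period is exactly the order p^d.\<close>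
  have inj: "inj_on s {..<p ^ d}" and per: "s (p ^ d) = \<one>"
  proof -
    have sc: "s k \<in> carrier G" for k using surj by auto
    have step: "s i = s j" if "s (Suc i) = s (Suc j)" for i j
      using that A(2) b sc by (simp add: sS inj_on_def)
    have return: "s (j - i) = s 0" if "s i = s j" "i \<le> j" for i j
      using that
    proof (induction i arbitrary: j)
      case (Suc i)
      then obtain j' where j': "j = Suc j'" by (cases j) auto
      with Suc step[of i j'] show ?case by auto
    qed simp
    have mult: "s (k + m) = s k" if "s m = s 0" for k m
      by (induction k) (use that sS in auto)
    have small: "card (carrier G) \<le> m" if "s m = s 0" "m > 0" for m
    proof -
      have "s k = s (k mod m)" for k
      proof (induction k rule: less_induct)
        case (less k)
        show ?case
        proof (cases "k < m")
          case False
          then have "s k = s (k - m)" using mult[OF that(1), of "k - m"] by simp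
          also have "\<dots> = s ((k - m) mod m)" by (rule less) (use False that in simp)
          also have "(k - m) mod m = k mod m" using False by (metis le_mod_geq not_less)
          finally show ?thesis .
        qed simp
      qed
      then have "carrier G \<subseteq> s ` {..<m}"
        unfolding surj using that(2) by (metis image_subsetI lessThan_iff mod_less_divisor rev_image_eqI)
      then show ?thesis using surj_card_le[of "{..<m}" "carrier G" s] by simp
    qed
    have q: "card (carrier G) = p ^ d" using d by (simp add: Coset.order_def)
    show inj: "inj_on s {..<p ^ d}"
    proof (rule linorder_inj_onI')
      fix i j assume ij: "i \<in> {..<p ^ d}" "j \<in> {..<p ^ d}" "i < j"
      show "s i \<noteq> s j"
      proof
        assume "s i = s j"
        then have "s (j - i) = s 0" using return ij by simp
        from small[OF this] ij q show False by simp
      qed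
    qed
    have "s ` {..<p ^ d} = carrier G"
      by (rule card_subset_eq[OF fin]) (use sc in \<open>auto simp: card_image[OF inj] q\<close>)
    then obtain i where i: "i < p ^ d" "s i = s (p ^ d)" using sc[of "p ^ d"] by (metis imageE lessThan_iff)
    have "s (p ^ d - i) = s 0" using return[OF i(2)] i(1) by simp
    from small[OF this] i q have "i = 0" by simp
    then show "s (p ^ d) = \<one>" using i s0 by simp
  qed
  \<comment> \<open>The submodule generated by Y^i b. These submodules descend to the trivial one,
    and every proper step loses at least a factor p; hence d steps suffice, that is, (A - 1)^d kills
    b.\<close>
  define J where "J i = ev ` range (\<lambda>q. Y ^ i * q)" for i
  have J: "subgroup (J i) G" for i
  proof (rule subgroupI)
    show "J i \<subseteq> carrier G" "J i \<noteq> {}" by (auto simp: J_def)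
    fix x assume "x \<in> J i"
    then obtain q where q: "x = ev (Y ^ i * q)" by (auto simp: J_def)
    have "inv x = ev (Y ^ i * (- q))" using evn[of 0 "Y ^ i * q"] by (simp add: q)
    then show "inv x \<in> J i" unfolding J_def by blast
    fix y assume "y \<in> J i"
    then obtain q' where q': "y = ev (Y ^ i * q')" by (auto simp: J_def)
    have "x \<otimes> y = ev (Y ^ i * (q + q'))" by (simp add: q q' distrib_left flip: eva)
    then show "x \<otimes> y \<in> J i" unfolding J_def by blast
  qed
  have Jsub: "J (Suc i) \<subseteq> J i" for i
  proof
    fix x assume "x \<in> J (Suc i)"
    then obtain q where "x = ev (Y ^ i * (Y * q))" by (auto simp: J_def algebra_simps)
    then show "x \<in> J i" unfolding J_def by blast
  qed
  \<comment> \<open>Once two consecutive members agree, the chain is constant. As it ends in the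
    trivial group, a repetition shows that this group has already been reached.\<close>
  have Jstat: "J (Suc (Suc i)) = J (Suc i)" if eq: "J (Suc i) = J i" for i
  proof
    show "J (Suc i) \<subseteq> J (Suc (Suc i))"
    proof
      fix x assume "x \<in> J (Suc i)"
      then obtain q where q: "x = ev (Y ^ Suc i * q)" by (auto simp: J_def)
      have "ev (Y ^ i * q) \<in> J (Suc i)" unfolding eq by (auto simp: J_def)
      then obtain q' where "ev (Y ^ i * q) = ev (Y ^ Suc i * q')" by (auto simp: J_def)
      then have "ev (Y ^ i * q - Y ^ Suc i * q') = \<one>" by (simp add: evn)
      then have "ev (Y * (Y ^ i * q - Y ^ Suc i * q')) = \<one>" by (rule evm)
      then have "ev (Y ^ Suc i * q - Y ^ Suc (Suc i) * q') = \<one>" by (simp add: algebra_simps)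
      then have "x = ev (Y ^ Suc (Suc i) * q')"
        by (simp only: evn q) (metis evc inv_equality inv_inv inv_closed)
      then show "x \<in> J (Suc (Suc i))" by (auto simp: J_def)
    qed
  qed (rule Jsub)
  have Yq: "ev (Y ^ (p ^ d - 1)) = \<one>" using geom[of d] per by (simp add: sk)
  have Jend: "J i = {\<one>}" if "i \<ge> p ^ d - 1" for i
  proof -
    have "ev (Y ^ i * q) = \<one>" for q
    proof -
      have "Y ^ i * q = (Y ^ (i - (p ^ d - 1)) * q) * Y ^ (p ^ d - 1)"
        using that by (simp add: algebra_simps flip: power_add)
      then show ?thesis by (simp only: evm[OF Yq])
    qed
    then show ?thesis by (simp add: J_def image_image)
  qed
  have Jc: "J i = {\<one>} \<or> (\<exists>e. e + i \<le> d \<and> card (J i) = p ^ e)" for i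
  proof (induction i)
    case 0
    have "card (J 0) dvd p ^ d" using lagrange[OF J, of 0] d by (metis dvd_triv_right)
    then show ?case using divides_primepow_nat[OF p] by auto
  next
    case (Suc i)
    show ?case
    proof (cases "J (Suc i) = J i")
      case True
      have "J (Suc (i + k)) = J (i + k) \<and> J (i + k) = J i" for k
        by (induction k) (simp_all add: True Jstat)
      from this[of "p ^ d"] have "J (i + p ^ d) = J i" by blast
      then show ?thesis using Jend[of "i + p ^ d"] True by simp
    next
      case False
      then have ps: "J (Suc i) \<subset> J i" using Jsub by blast
      moreover have finJ: "finite (J i)" using fin J subgroup.subset finite_subset by metis
      ultimately have lt: "card (J (Suc i)) < card (J i)" by (rule psubset_card_mono[rotated])
      have one: "\<one> \<in> J (Suc i)" using J subgroup.one_closed by blast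
      have "J i \<noteq> {\<one>}" using ps one by (metis empty_iff psubsetE subset_singletonD)
      then obtain e where e: "e + i \<le> d" "card (J i) = p ^ e" using Suc by blast
      have "card (J (Suc i)) dvd p ^ d" using lagrange[OF J, of "Suc i"] d by (metis dvd_triv_right)
      then obtain e' where e': "card (J (Suc i)) = p ^ e'" using divides_primepow_nat[OF p] by auto
      have "e' < e" using lt e e' p power_strict_increasing_iff[OF prime_gt_1_nat[OF p], of e' e] by simp
      then have "e' + Suc i \<le> d \<and> card (J (Suc i)) = p ^ e'" using e e' by simp
      then show ?thesis by blast
    qed
  qed
  have Yd: "ev (Y ^ d) = \<one>"
  proof -
    have "J d = {\<one>}"
    proof (cases "J d = {\<one>}")
      case False
      then have "card (J d) = 1" using Jc[of d] by auto
      moreover have "\<one> \<in> J d" using J subgroup.one_closed by blast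
      ultimately show ?thesis by (metis card_1_singletonE singletonD)
    qed
    moreover have "ev (Y ^ d * 1) \<in> J d" unfolding J_def by blast
    ultimately show ?thesis by simp
  qed
  \<comment> \<open>Otherwise p^(d-1) - 1 >= d, so Y^(p^(d-1)-1) kills b, and \<open>s\<close>
    returns to the neutral element at time p^(d-1), before its period p^d is over. The inequality
    leaves d = 1 and p = d = 2.\<close>
  have small: "p ^ (d - 1) \<le> d" if "d \<ge> 1"
  proof (rule ccontr)
    assume "\<not> ?thesis"
    then have "Y ^ (p ^ (d - 1) - 1) = Y ^ (p ^ (d - 1) - 1 - d) * Y ^ d"
      by (simp flip: power_add)
    then have "s (p ^ (d - 1)) = \<one>" by (simp only: sk geom evm[OF Yd])
    moreover have "p ^ (d - 1) < p ^ d" "0 < p ^ d" using that power_strict_increasing[of "d - 1" d p] prime_gt_1_nat[OF p] by simp_all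
    ultimately have "p ^ (d - 1) = 0" using inj s0 by (metis inj_onD lessThan_iff)
    then show False using p by auto
  qed
  have p2: "p \<ge> 2" using p by (rule prime_ge_2_nat)
  consider "d = 0" | "d = 1" | "d = 2" | e where "d = Suc (Suc (Suc e))"
    by (metis One_nat_def numeral_2_eq_2 not0_implies_Suc)
  then show ?thesis
  proof cases
    case 3
    then have "p = 2" using small p2 by simp
    then show ?thesis using d 3 by simp
  next
    case 4
    have "Suc (Suc (Suc e)) < 2 ^ Suc (Suc e)" by (induction e) auto
    also have "\<dots> \<le> p ^ Suc (Suc e)" using p2 by (rule power_mono) auto
    finally show ?thesis using small 4 by simp
  qed (use d in auto)
qed

section \<open>Permutation groups\<close>

abbreviation finv :: "('a \<Rightarrow> 'a) \<Rightarrow> 'a \<Rightarrow> 'a" where "finv g \<equiv> inv_into UNIV g"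

text \<open>Groups are plain sets of bijections of the whole type. One group can thus act on several
  sets of roots at once, without a separate homomorphism for each action.\<close>

locale perm_group =
  fixes G :: "('a \<Rightarrow> 'a) set"
  assumes id_mem: "id \<in> G"
    and comp_mem: "\<lbrakk>g \<in> G; h \<in> G\<rbrakk> \<Longrightarrow> g \<circ> h \<in> G"
    and inverse_ex: "g \<in> G \<Longrightarrow> \<exists>h\<in>G. g \<circ> h = id \<and> h \<circ> g = id"
begin

lemma bij: "g \<in> G \<Longrightarrow> bij g"
  using inverse_ex o_bij by metis

lemma finv_mem: "g \<in> G \<Longrightarrow> finv g \<in> G"
  using inverse_ex[of g] by (metis inv_unique_comp)

lemma finv_left [simp]: "g \<in> G \<Longrightarrow> finv g (g x) = x"
  using bij by (simp add: bij_is_inj)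

lemma finv_right [simp]: "g \<in> G \<Longrightarrow> g (finv g x) = x"
  using bij by (simp add: bij_is_surj surj_f_inv_f)

lemma inj_iff [simp]: "g \<in> G \<Longrightarrow> g x = g y \<longleftrightarrow> x = y"
  using bij by (meson bij_is_inj injD)

lemma funpow_mem: "g \<in> G \<Longrightarrow> g ^^ k \<in> G"
  by (induction k) (auto simp: id_mem comp_mem simp flip: id_def)

lemma conj_mem: "\<lbrakk>g \<in> G; h \<in> G\<rbrakk> \<Longrightarrow> g \<circ> h \<circ> finv g \<in> G"
  by (simp add: comp_mem finv_mem)

lemma conj_funpow: "g \<in> G \<Longrightarrow> ((g \<circ> h \<circ> finv g) ^^ k) x = g ((h ^^ k) (finv g x))"
  by (induction k) auto

lemma finv_finv: "g \<in> G \<Longrightarrow> finv (finv g) = g"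
  using bij by (simp add: inv_inv_eq)

end

lemma perm_groupI_finv:
  assumes "perm_group G" "P \<subseteq> G" "id \<in> P" "\<And>g h. \<lbrakk>g \<in> P; h \<in> P\<rbrakk> \<Longrightarrow> g \<circ> h \<in> P"
    "\<And>g. g \<in> P \<Longrightarrow> finv g \<in> P"
  shows "perm_group P"
proof
  interpret perm_group G by fact
  fix g assume g: "g \<in> P"
  then have "g \<circ> finv g = id" "finv g \<circ> g = id" using assms(2) by (auto simp: fun_eq_iff)
  then show "\<exists>h\<in>P. g \<circ> h = id \<and> h \<circ> g = id" using assms(5) g by blast
qed (use assms in auto)

lemma funpow_eq_mult:
  assumes "(r ^^ i) x = x"
  shows "(r ^^ (i * k)) x = x"
  by (induction k) (simp_all add: funpow_add assms)

lemma funpow_mod: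
  assumes "(r ^^ i) x = x"
  shows "(r ^^ k) x = (r ^^ (k mod i)) x"
proof -
  have "(r ^^ k) x = (r ^^ (k mod i + i * (k div i))) x" by simp
  also have "\<dots> = (r ^^ (k mod i)) ((r ^^ (i * (k div i))) x)" by (simp only: funpow_add o_apply)
  finally show ?thesis by (simp only: funpow_eq_mult[OF assms])
qed

lemma funpow_split: "i < j \<Longrightarrow> (r ^^ i) ((r ^^ (j - i)) x) = (r ^^ j) x"
  using funpow_add[of i "j - i" r] by simp

text \<open>Both parts come from identifying the size of the cycle with the least positive period
  \<open>l\<close>; reduction modulo \<open>l\<close> shows that \<open>l\<close> divides every
  period.\<close>

lemma cyclic_orbit:
  assumes inj: "inj r" and i: "(r ^^ i) x = x" "i > 0"
  shows "card (range (\<lambda>k. (r ^^ k) x)) dvd i"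
    and "(r ^^ card (range (\<lambda>k. (r ^^ k) x))) x = x"
proof -
  define l where "l = (LEAST l. l > 0 \<and> (r ^^ l) x = x)"
  have l: "l > 0" "(r ^^ l) x = x" using LeastI[of "\<lambda>l. l > 0 \<and> (r ^^ l) x = x" i] i by (auto simp: l_def)
  have least: "l \<le> m" if "m > 0" "(r ^^ m) x = x" for m
    unfolding l_def using that by (intro Least_le) auto
  have dvd: "l dvd m" if "(r ^^ m) x = x" for m
    using least[of "m mod l"] funpow_mod[OF l(2), of m] that l(1)
    by (metis dvd_eq_mod_eq_0 gr0I mod_less_divisor not_less)
  have "range (\<lambda>k. (r ^^ k) x) = (\<lambda>k. (r ^^ k) x) ` {..<l}"
  proof -
    have "(r ^^ k) x \<in> (\<lambda>k. (r ^^ k) x) ` {..<l}" for k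
      using funpow_mod[OF l(2), of k] l(1) by (intro image_eqI[of _ _ "k mod l"]) auto
    then show ?thesis by blast
  qed
  moreover have "inj_on (\<lambda>k. (r ^^ k) x) {..<l}"
  proof (rule linorder_inj_onI')
    fix a b assume ab: "a \<in> {..<l}" "b \<in> {..<l}" "a < b"
    show "(r ^^ a) x \<noteq> (r ^^ b) x"
    proof
      assume "(r ^^ a) x = (r ^^ b) x"
      also have "(r ^^ b) x = (r ^^ a) ((r ^^ (b - a)) x)"
        using ab by (simp only: funpow_split)
      finally have "(r ^^ (b - a)) x = x" using inj_fn[OF inj] by (metis injD)
      then show False using least[of "b - a"] ab by simp
    qed
  qed
  ultimately have "card (range (\<lambda>k. (r ^^ k) x)) = l" by (simp add: card_image)
  then show "card (range (\<lambda>k. (r ^^ k) x)) dvd i" "(r ^^ card (range (\<lambda>k. (r ^^ k) x))) x = x"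
    using dvd[OF i(1)] l by simp_all
qed

lemma finite_perm_period:
  assumes fin: "finite A" and sub: "\<And>a. a \<in> A \<Longrightarrow> r a \<in> A" and inj: "inj r"
  shows "\<exists>k>0. \<forall>a\<in>A. (r ^^ k) a = a"
proof -
  have per: "\<exists>k>0. (r ^^ k) a = a" if a: "a \<in> A" for a
  proof -
    have mem: "(r ^^ k) a \<in> A" for k by (induction k) (use a sub in auto)
    then have "finite (range (\<lambda>k. (r ^^ k) a))" by (intro finite_subset[OF _ fin]) auto
    then have "\<not> inj (\<lambda>k. (r ^^ k) a)" using finite_imageD infinite_UNIV_nat by blast
    then obtain i j where ij: "i < j" "(r ^^ i) a = (r ^^ j) a"
      using linorder_injI[of "\<lambda>k. (r ^^ k) a"] by blast
    then have "(r ^^ i) ((r ^^ (j - i)) a) = (r ^^ i) a" by (simp only: funpow_split)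
    then have "(r ^^ (j - i)) a = a" using inj_fn[OF inj] by (metis injD)
    then show ?thesis using \<open>i < j\<close> by (intro exI[of _ "j - i"]) simp
  qed
  then obtain k where k: "\<And>a. a \<in> A \<Longrightarrow> k a > 0 \<and> (r ^^ k a) a = a" by metis
  have "(r ^^ (\<Prod>a\<in>A. k a)) a = a" if "a \<in> A" for a
    using funpow_eq_mult[of "k a" r a "\<Prod>a\<in>A - {a}. k a"] k that fin
    by (simp add: prod.remove[of A a])
  moreover have "(\<Prod>a\<in>A. k a) > 0" using k by (simp add: prod_pos)
  ultimately show ?thesis by blast
qed

text \<open>Division with remainder in the set of exponents that preserve \<open>U\<close>. It
  singles out the power of a long cycle that acts inside one block.\<close>

lemma cyclic_block_stabilizer:
  assumes inj: "inj r" and ex: "n > 0" "(r ^^ n) ` U = U"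
  obtains j where "j > 0" "(r ^^ j) ` U = U" "\<And>i. (r ^^ i) ` U = U \<Longrightarrow> j dvd i"
proof -
  define j where "j = (LEAST j. j > 0 \<and> (r ^^ j) ` U = U)"
  have j: "j > 0" "(r ^^ j) ` U = U"
    using LeastI[of "\<lambda>j. j > 0 \<and> (r ^^ j) ` U = U" n] ex by (auto simp: j_def)
  have least: "j \<le> m" if "m > 0" "(r ^^ m) ` U = U" for m
    unfolding j_def using that by (intro Least_le) auto
  have jm: "(r ^^ (j * m)) ` U = U" for m
  proof (induction m)
    case (Suc m)
    have "(r ^^ (j * Suc m)) ` U = (r ^^ j) ` ((r ^^ (j * m)) ` U)"
      by (simp only: mult_Suc_right funpow_add image_comp)
    then show ?case using Suc j(2) by simp
  qed simp
  have "j dvd i" if i: "(r ^^ i) ` U = U" for i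
  proof -
    have "(r ^^ (i mod j)) ` U = (r ^^ (i mod j)) ` ((r ^^ (j * (i div j))) ` U)" by (simp only: jm)
    also have "\<dots> = (r ^^ (i mod j + j * (i div j))) ` U" by (simp only: funpow_add image_comp)
    also have "\<dots> = U" using i by simp
    finally show ?thesis using least[of "i mod j"] j(1)
      by (metis dvd_eq_mod_eq_0 gr0I mod_less_divisor not_less)
  qed
  with j show ?thesis by (rule that)
qed

text \<open>An orbit of an abelian action carries the group structure (g y)(h y) = g (h y).
  Commutation at the single point \<open>y\<close> is enough for independence of the
  representatives: if g y = g' y, then g (h y) = h (g y) = h (g' y) = g' (h y).\<close>

lemma (in perm_group) orbit_comm_group:
  assumes U: "U = (\<lambda>g. g y) ` G" and ab0: "\<forall>g\<in>G. \<forall>h\<in>G. g (h y) = h (g y)"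
  shows "\<exists>E :: 'a monoid. comm_group E \<and> carrier E = U \<and> one E = y \<and>
    (\<forall>g\<in>G. \<forall>h\<in>G. (g y) \<otimes>\<^bsub>E\<^esub> (h y) = g (h y)) \<and>
    (\<forall>g\<in>G. \<forall>n::nat. (g y) [^]\<^bsub>E\<^esub> n = (g ^^ n) y)"
proof -
  have ab: "g (h y) = h (g y)" if "g \<in> G" "h \<in> G" for g h using ab0 that by blast
  define r where "r a = (SOME g. g \<in> G \<and> g y = a)" for a
  have r: "r a \<in> G \<and> r a y = a" if "a \<in> U" for a
    using someI_ex[of "\<lambda>g. g \<in> G \<and> g y = a"] that U unfolding r_def by blast
  have gU: "g y \<in> U" if "g \<in> G" for g using that U by auto
  define E where "E = \<lparr>carrier = U, monoid.mult = (\<lambda>a b. r a b), one = y\<rparr>"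
  have mult: "(g y) \<otimes>\<^bsub>E\<^esub> (h y) = g (h y)" if gh: "g \<in> G" "h \<in> G" for g h
  proof -
    have "r (g y) (h y) = h (r (g y) y)" using ab r[OF gU[OF gh(1)]] gh by metis
    also have "\<dots> = h (g y)" using r[OF gU[OF gh(1)]] by simp
    finally show ?thesis using ab gh by (simp add: E_def)
  qed
  have [simp]: "carrier E = U" "one E = y" by (simp_all add: E_def)
  have gh: "(g \<circ> h) y = g (h y)" for g h :: "'a \<Rightarrow> 'a" by simp
  have yU: "y \<in> U" using gU[OF id_mem] by simp
  have E: "comm_group E"
  proof (rule comm_groupI)
    fix a b c assume abc: "a \<in> carrier E" "b \<in> carrier E"
    then obtain g h where g: "a = g y" "g \<in> G" "b = h y" "h \<in> G" using U by auto
    show "a \<otimes>\<^bsub>E\<^esub> b \<in> carrier E" "a \<otimes>\<^bsub>E\<^esub> b = b \<otimes>\<^bsub>E\<^esub> a"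
      using g mult[of g h] mult[of h g] ab[of g h] gU[OF comp_mem[of g h]] by simp_all
    assume c: "c \<in> carrier E"
    then obtain k where k: "c = k y" "k \<in> G" using U by auto
    show "a \<otimes>\<^bsub>E\<^esub> b \<otimes>\<^bsub>E\<^esub> c = a \<otimes>\<^bsub>E\<^esub> (b \<otimes>\<^bsub>E\<^esub> c)"
      using g k mult[of "g \<circ> h" k] mult[of g "h \<circ> k"] comp_mem by (simp add: mult)
  next
    fix a assume "a \<in> carrier E"
    then obtain g where g: "a = g y" "g \<in> G" using U by auto
    show "one E \<otimes>\<^bsub>E\<^esub> a = a" using mult[OF id_mem g(2)] g by simp
    show "\<exists>b\<in>carrier E. b \<otimes>\<^bsub>E\<^esub> a = one E"
      using mult[OF finv_mem[OF g(2)] g(2)] g gU[OF finv_mem[OF g(2)]] by auto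
  qed (use yU in simp)
  have pow: "(g y) [^]\<^bsub>E\<^esub> (n::nat) = (g ^^ n) y" if "g \<in> G" for g n
  proof (induction n)
    case 0 then show ?case by (simp add: nat_pow_def E_def)
  next
    case (Suc n)
    interpret E: comm_group E by (rule E)
    show ?case using Suc mult[OF funpow_mem[OF that] that] that
      by (simp add: E.nat_pow_Suc funpow_swap1)
  qed
  have "comm_group E \<and> carrier E = U \<and> one E = y" using E by simp
  then show ?thesis using mult pow by (intro exI[of _ E]) simp
qed

lemma (in perm_group) orbit_prime_power:
  assumes "U = (\<lambda>g. g y) ` G" "\<forall>g\<in>G. \<forall>h\<in>G. g (h y) = h (g y)"
    and fin: "finite U" and p: "prime p" and exp: "\<And>g. g \<in> G \<Longrightarrow> (g ^^ p) y = y"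
  shows "\<exists>d. card U = p ^ d"
proof -
  from orbit_comm_group[of U y, OF assms(1,2)] obtain E :: "'a monoid" where
    E: "comm_group E \<and> carrier E = U \<and> one E = y \<and>
      (\<forall>g\<in>G. \<forall>h\<in>G. (g y) \<otimes>\<^bsub>E\<^esub> (h y) = g (h y)) \<and>
      (\<forall>g\<in>G. \<forall>n::nat. (g y) [^]\<^bsub>E\<^esub> n = (g ^^ n) y)" ..
  have E1: "comm_group E" and E2 [simp]: "carrier E = U" and E3 [simp]: "one E = y" using E by auto
  have mult: "(g y) \<otimes>\<^bsub>E\<^esub> (h y) = g (h y)" if "g \<in> G" "h \<in> G" for g h using E that by auto
  have pow: "(g y) [^]\<^bsub>E\<^esub> (n::nat) = (g ^^ n) y" if "g \<in> G" for g n using E that by auto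
  interpret E: comm_group E by (rule E1)
  have "x [^]\<^bsub>E\<^esub> p = one E" if x: "x \<in> carrier E" for x
  proof -
    obtain g where "g \<in> G" "x = g y" using x unfolding E2 assms(1) by blast
    then show ?thesis using pow exp by simp
  qed
  then show ?thesis using E.order_prime_power[OF _ p] fin by (simp add: Coset.order_def)
qed

text \<open>In the group structure on the orbit, \<open>r\<close> is an affine map: r (g y) = (r g
  r^-1) (r y) is the product of the constant r y and the linear part g y -> (r g r^-1) y. So the
  cycle of \<open>r\<close> through \<open>y\<close> is a sequence as in
  \<open>order_affine_cycle\<close>.\<close>

lemma (in perm_group) orbit_affine_cycle:
  assumes U: "U = (\<lambda>g. g y) ` G" and ab0: "\<forall>g\<in>G. \<forall>h\<in>G. g (h y) = h (g y)"
    and fin: "finite U" and p: "prime p" and exp: "\<And>g. g \<in> G \<Longrightarrow> (g ^^ p) y = y"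
    and r: "bij r" "\<And>g. g \<in> G \<Longrightarrow> r \<circ> g \<circ> finv r \<in> G"
    and cyc: "U = range (\<lambda>k. (r ^^ k) y)"
  shows "card U = 1 \<or> card U = p \<or> p = 2 \<and> card U = 4"
proof -
  have ab: "g (h y) = h (g y)" if "g \<in> G" "h \<in> G" for g h using ab0 that by blast
  from orbit_comm_group[of U y, OF U ab0] obtain E :: "'a monoid" where
    E: "comm_group E \<and> carrier E = U \<and> one E = y \<and>
      (\<forall>g\<in>G. \<forall>h\<in>G. (g y) \<otimes>\<^bsub>E\<^esub> (h y) = g (h y)) \<and>
      (\<forall>g\<in>G. \<forall>n::nat. (g y) [^]\<^bsub>E\<^esub> n = (g ^^ n) y)" ..
  have E1: "comm_group E" and E2 [simp]: "carrier E = U" and E3 [simp]: "one E = y" using E by auto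
  have mult: "(g y) \<otimes>\<^bsub>E\<^esub> (h y) = g (h y)" if "g \<in> G" "h \<in> G" for g h using E that by auto
  have pow: "(g y) [^]\<^bsub>E\<^esub> (n::nat) = (g ^^ n) y" if "g \<in> G" for g n using E that by auto
  interpret E: comm_group E by (rule E1)
  have rr [simp]: "r (finv r a) = a" "finv r (r a) = a" for a
    using r(1) by (simp_all add: bij_is_surj surj_f_inv_f bij_is_inj)
  \<comment> \<open>Two elements with a common value at one point of the orbit agree on the whole
    orbit. This makes the linear part \<open>A\<close> below independent of the chosen
    representative.\<close>
  have agree: "g b = h b" if that': "g \<in> G" "h \<in> G" "a \<in> U" "b \<in> U" "g a = h a" for g h a b
  proof -
    obtain u v where uv: "a = u y" "b = v y" "u \<in> G" "v \<in> G" using that'(3,4) unfolding U by blast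
    define w where "w = v \<circ> finv u"
    have w: "w \<in> G" "b = w a" using uv by (simp_all add: w_def comp_mem finv_mem)
    have "g (w a) = w (g a)" "h (w a) = w (h a)"
      using ab[of g "w \<circ> u"] ab[of g u] ab[of h "w \<circ> u"] ab[of h u] ab[of w "g \<circ> u"] ab[of w "h \<circ> u"]
        that w uv comp_mem by (auto simp: o_def) 
    then show ?thesis using w that by simp
  qed
  have rU: "r a \<in> U" if "a \<in> U" for a
    using that unfolding cyc by (auto intro: range_eqI[of _ _ "Suc _"])
  have "r ` U = U" using rU fin r(1)
    by (intro endo_inj_surj) (auto simp: bij_is_inj intro: inj_on_subset[of _ UNIV])
  then have rU': "finv r a \<in> U" if "a \<in> U" for a using that rr by (metis imageE)
  have yU: "y \<in> U" unfolding U by (rule image_eqI[OF _ id_mem]) simp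
  define s where "s k = (r ^^ k) y" for k
  define A where "A a = r ((SOME g. g \<in> G \<and> g y = a) (finv r y))" for a
  have A: "A (g y) = (r \<circ> g \<circ> finv r) y" if "g \<in> G" for g
  proof -
    have "(SOME h. h \<in> G \<and> h y = g y) \<in> G \<and> (SOME h. h \<in> G \<and> h y = g y) y = g y"
      using someI_ex[of "\<lambda>h. h \<in> G \<and> h y = g y"] that by blast
    then have "(SOME h. h \<in> G \<and> h y = g y) (finv r y) = g (finv r y)"
      by (intro agree[OF _ that yU rU'[OF yU]]) auto
    then show ?thesis by (simp add: A_def)
  qed
  have gr: "(r \<circ> g \<circ> finv r) y \<in> U" if "g \<in> G" for g
    using r(2)[OF that] unfolding U by blast
  have "card U = 1 \<or> Coset.order E = p \<or> p = 2 \<and> Coset.order E = 4"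
  proof -
    have "Coset.order E = 1 \<or> Coset.order E = p \<or> p = 2 \<and> Coset.order E = 4"
    proof (rule E.order_affine_cycle[of p A "r y" s])
      show "x [^]\<^bsub>E\<^esub> p = one E" if "x \<in> carrier E" for x
        using that U pow exp by auto
      show "A \<in> hom E E"
      proof (rule homI)
        fix a assume "a \<in> carrier E"
        then obtain g where g: "a = g y" "g \<in> G" using U by auto
        show "A a \<in> carrier E" using gr[OF g(2)] by (simp only: g(1) A[OF g(2)] E2)
        fix b assume "b \<in> carrier E"
        then obtain h where h: "b = h y" "h \<in> G" using U by auto
        have "A (a \<otimes>\<^bsub>E\<^esub> b) = (r \<circ> (g \<circ> h) \<circ> finv r) y"
          using A[of "g \<circ> h"] g h mult comp_mem by simp
        also have "\<dots> = (r \<circ> g \<circ> finv r) ((r \<circ> h \<circ> finv r) y)" by simp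
        also have "\<dots> = A a \<otimes>\<^bsub>E\<^esub> A b"
          by (simp only: g(1) h(1) A[OF g(2)] A[OF h(2)] mult[OF r(2)[OF g(2)] r(2)[OF h(2)]])
        finally show "A (a \<otimes>\<^bsub>E\<^esub> b) = A a \<otimes>\<^bsub>E\<^esub> A b" .
      qed
      show "inj_on A (carrier E)"
      proof (rule inj_onI)
        fix a b assume "a \<in> carrier E" "b \<in> carrier E" and eq: "A a = A b"
        then obtain g h where g: "a = g y" "g \<in> G" "b = h y" "h \<in> G" using U by auto
        have "r (g (finv r y)) = r (h (finv r y))" using eq A g by simp
        then have "g (finv r y) = h (finv r y)" by (metis rr(2))
        then show "a = b" using agree[OF g(2,4) rU'[OF yU] yU] g by simp
      qed
      show "r y \<in> carrier E" using rU[OF yU] by simp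
      show "s 0 = one E" by (simp add: s_def)
      show "s (Suc k) = r y \<otimes>\<^bsub>E\<^esub> A (s k)" for k
      proof -
        have "s k \<in> U" by (simp add: s_def cyc)
        then obtain g where g: "s k = g y" "g \<in> G" using U by auto
        obtain h where h: "r y = h y" "h \<in> G" using rU[OF yU] U by auto
        have "s (Suc k) = (r \<circ> g \<circ> finv r) (h y)" by (simp add: s_def g(1)[unfolded s_def] flip: h(1))
        also have "\<dots> = (r \<circ> g \<circ> finv r) y \<otimes>\<^bsub>E\<^esub> h y" by (simp only: mult[OF r(2)[OF g(2)] h(2)])
        also have "\<dots> = r y \<otimes>\<^bsub>E\<^esub> A (s k)"
          using E.m_comm[of "(r \<circ> g \<circ> finv r) y" "h y"] gr[OF g(2)] rU[OF yU]
          by (simp only: g(1) A[OF g(2)] h(1) E2)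
        finally show ?thesis .
      qed
      show "carrier E = range s" by (simp add: s_def cyc)
    qed (use fin p in auto)
    then show ?thesis by (simp add: Coset.order_def)
  qed
  then show ?thesis by (simp add: Coset.order_def)
qed

section \<open>Imprimitive groups containing a full cycle\<close>

text \<open>In the application \<open>A\<close> is the set of roots of f(X) - t, \<open>pr\<close>
  is the map given by f_r, so that its fibres in \<open>A\<close> are the blocks, and
  \<open>\<sigma>\<close> is inertia at infinity. The assumption \<open>prim\<close> is the form in
  which indecomposability of f_r enters: it speaks of normal subgroups that preserve every
  block.\<close>

locale monodromy_action = perm_group G for G :: "('a \<Rightarrow> 'a) set" +
  fixes A :: "'a set" and pr :: "'a \<Rightarrow> 'a" and \<sigma> :: "'a \<Rightarrow> 'a"
  assumes finA: "finite A" and neA: "A \<noteq> {}"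
    and GA: "\<lbrakk>g \<in> G; a \<in> A\<rbrakk> \<Longrightarrow> g a \<in> A"
    and pr: "\<lbrakk>g \<in> G; a \<in> A\<rbrakk> \<Longrightarrow> pr (g a) = g (pr a)"
    and \<sigma>: "\<sigma> \<in> G"
    and \<sigma>_trans: "\<lbrakk>a \<in> A; b \<in> A\<rbrakk> \<Longrightarrow> \<exists>k. (\<sigma> ^^ k) a = b"
    and fib_nontriv: "a \<in> A \<Longrightarrow> \<exists>b\<in>A. pr b = pr a \<and> b \<noteq> a"
    and prim: "\<lbrakk>perm_group N; N \<subseteq> G; \<And>g n. \<lbrakk>g \<in> G; n \<in> N\<rbrakk> \<Longrightarrow> g \<circ> n \<circ> finv g \<in> N;
        \<And>n a. \<lbrakk>n \<in> N; a \<in> A\<rbrakk> \<Longrightarrow> n (pr a) = pr a; a \<in> A\<rbrakk>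
      \<Longrightarrow> (\<lambda>n. n a) ` N = {a} \<or> (\<lambda>n. n a) ` N = {b \<in> A. pr b = pr a}"
begin

definition K where "K = {g \<in> G. \<forall>a\<in>A. g (pr a) = pr a}"

definition fib where "fib a = {b \<in> A. pr b = pr a}"

lemma K_G: "g \<in> K \<Longrightarrow> g \<in> G" by (simp add: K_def)

lemma K_pr: "\<lbrakk>g \<in> K; a \<in> A\<rbrakk> \<Longrightarrow> pr (g a) = pr a"
  using pr[OF K_G] by (simp add: K_def)

lemma K_group: "perm_group K"
proof (rule perm_groupI_finv[OF perm_group_axioms])
  fix g assume g: "g \<in> K"
  have "finv g (pr a) = pr a" if a: "a \<in> A" for a
    using g a finv_left[OF K_G[OF g], of "pr a"] by (simp add: K_def)
  then show "finv g \<in> K" using g by (simp add: K_def finv_mem)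
qed (auto simp: K_def id_mem comp_mem)

lemma K_normal:
  assumes g: "g \<in> G" and n: "n \<in> K"
  shows "g \<circ> n \<circ> finv g \<in> K"
proof -
  have "n (finv g (pr a)) = finv g (pr a)" if a: "a \<in> A" for a
    using n pr[OF finv_mem[OF g] a] GA[OF finv_mem[OF g] a] by (auto simp: K_def)
  then show ?thesis using conj_mem[OF g K_G[OF n]] g by (simp add: K_def)
qed

lemma fib_self: "a \<in> A \<Longrightarrow> a \<in> fib a" by (simp add: fib_def)

lemma fib_sub: "b \<in> fib a \<Longrightarrow> b \<in> A" by (simp add: fib_def)

lemma fib_eq: "b \<in> fib a \<Longrightarrow> fib b = fib a" by (auto simp: fib_def)

lemma K_fib: "\<lbrakk>g \<in> K; b \<in> fib a\<rbrakk> \<Longrightarrow> g b \<in> fib a"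
  using K_pr[of g b] GA[OF K_G, of g b] by (simp add: fib_def)

lemma G_fib: "\<lbrakk>g \<in> G; a \<in> A; b \<in> fib a\<rbrakk> \<Longrightarrow> g b \<in> fib (g a)"
  using GA[of g b] pr[of g b] pr[of g a] by (simp add: fib_def)

lemma fin_fib: "finite (fib a)" using finA by (simp add: fib_def)

lemma fib_image:
  assumes g: "g \<in> G" and a: "a \<in> A"
  shows "fib (g a) = g ` fib a"
proof
  show "g ` fib a \<subseteq> fib (g a)" using G_fib g a by auto
  show "fib (g a) \<subseteq> g ` fib a"
  proof
    fix b assume b: "b \<in> fib (g a)"
    have "finv g b \<in> fib (finv g (g a))" by (rule G_fib[OF finv_mem[OF g] GA[OF g a] b])
    then have "finv g b \<in> fib a" using g by simp
    then show "b \<in> g ` fib a" using g by (intro image_eqI[of _ _ "finv g b"]) simp_all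
  qed
qed

lemma card_fib_eq:
  assumes "a \<in> A" "b \<in> A"
  shows "card (fib a) = card (fib b)"
proof -
  obtain k where "(\<sigma> ^^ k) a = b" using \<sigma>_trans[OF assms] by blast
  then have "fib b = (\<sigma> ^^ k) ` fib a" using fib_image[OF funpow_mem[OF \<sigma>] assms(1), of k] by simp
  moreover have "inj (\<sigma> ^^ k)" using bij[OF funpow_mem[OF \<sigma>]] bij_is_inj by blast
  ultimately show ?thesis by (simp add: card_image inj_on_subset)
qed

lemma card_fib_dvd: "a \<in> A \<Longrightarrow> card (fib a) dvd card A"
proof -
  assume a: "a \<in> A"
  have "card (fib a) * card (fib ` A) = card (\<Union> (fib ` A))"
  proof (rule card_partition)
    show "card c = card (fib a)" if "c \<in> fib ` A" for c using that card_fib_eq a by blast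
    show "c \<inter> d = {}" if "c \<in> fib ` A" "d \<in> fib ` A" "c \<noteq> d" for c d
      using that fib_eq by blast
  qed (use finA fin_fib in auto)
  moreover have "\<Union> (fib ` A) = A" using fib_self fib_sub by blast
  ultimately show ?thesis by (metis dvd_triv_left)
qed

lemma \<sigma>_period: "\<exists>n>0. \<forall>a\<in>A. (\<sigma> ^^ n) a = a"
  by (rule finite_perm_period[OF finA GA[OF \<sigma>] bij_is_inj[OF bij[OF \<sigma>]]])

text \<open>Powers of \<open>\<sigma>\<close> commute and are transitive on \<open>A\<close>. Hence
  the least power that stabilises one block stabilises all of them, and it is a single cycle on
  each.\<close>

lemma fib_cyclic:
  assumes a: "a \<in> A"
  obtains j where "j > 0" "\<sigma> ^^ j \<in> K" "\<And>b. b \<in> A \<Longrightarrow> fib b = range (\<lambda>k. ((\<sigma> ^^ j) ^^ k) b)"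
proof -
  obtain n where n: "n > 0" "\<And>a. a \<in> A \<Longrightarrow> (\<sigma> ^^ n) a = a" using \<sigma>_period by blast
  have "(\<sigma> ^^ n) ` fib a = fib a" using n(2) fib_sub by force
  from cyclic_block_stabilizer[OF bij_is_inj[OF bij[OF \<sigma>]] n(1) this]
  obtain j where j: "j > 0" "(\<sigma> ^^ j) ` fib a = fib a" "\<And>i. (\<sigma> ^^ i) ` fib a = fib a \<Longrightarrow> j dvd i"
    by metis
  have sj: "\<sigma> ^^ j \<in> G" by (rule funpow_mem[OF \<sigma>])
  have prj: "(\<sigma> ^^ j) (pr b) = pr b" if b: "b \<in> A" for b
  proof -
    obtain k where k: "(\<sigma> ^^ k) a = b" using \<sigma>_trans[OF a b] by blast
    have sk: "\<sigma> ^^ k \<in> G" by (rule funpow_mem[OF \<sigma>])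
    have "(\<sigma> ^^ j) a \<in> fib a" using j(2) fib_self[OF a] by blast
    then have "(\<sigma> ^^ j) (pr a) = pr a" using pr[OF sj a] by (simp add: fib_def)
    moreover have "pr b = (\<sigma> ^^ k) (pr a)" using pr[OF sk a] k by simp
    moreover have "(\<sigma> ^^ j) ((\<sigma> ^^ k) (pr a)) = (\<sigma> ^^ k) ((\<sigma> ^^ j) (pr a))"
      by (metis add.commute comp_apply funpow_add)
    ultimately show ?thesis by simp
  qed
  then have K: "\<sigma> ^^ j \<in> K" using sj by (simp add: K_def)
  have cyc: "fib a = range (\<lambda>k. ((\<sigma> ^^ j) ^^ k) a)"
  proof
    show "range (\<lambda>k. ((\<sigma> ^^ j) ^^ k) a) \<subseteq> fib a"
      using K_fib[OF perm_group.funpow_mem[OF K_group K] fib_self[OF a]] by auto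
    show "fib a \<subseteq> range (\<lambda>k. ((\<sigma> ^^ j) ^^ k) a)"
    proof
      fix b assume b: "b \<in> fib a"
      then obtain k where k: "(\<sigma> ^^ k) a = b" using \<sigma>_trans[OF a fib_sub] by blast
      have "fib b = (\<sigma> ^^ k) ` fib a" using fib_image[OF funpow_mem[OF \<sigma>] a, of k] k by simp
      then have "j dvd k" using j(3) fib_eq[OF b] by simp
      then obtain i where "k = j * i" by (auto elim: dvdE)
      then have "b = ((\<sigma> ^^ j) ^^ i) a" using k by (simp add: funpow_mult mult.commute)
      then show "b \<in> range (\<lambda>k. ((\<sigma> ^^ j) ^^ k) a)" by blast
    qed
  qed
  have "fib b = range (\<lambda>k. ((\<sigma> ^^ j) ^^ k) b)" if b: "b \<in> A" for b
  proof -
    obtain l where l: "(\<sigma> ^^ l) a = b" using \<sigma>_trans[OF a b] by blast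
    have com: "((\<sigma> ^^ j) ^^ k) ((\<sigma> ^^ l) a) = (\<sigma> ^^ l) (((\<sigma> ^^ j) ^^ k) a)" for k
      by (metis (no_types, lifting) add.commute comp_apply funpow_add funpow_mult)
    have "fib b = (\<sigma> ^^ l) ` range (\<lambda>k. ((\<sigma> ^^ j) ^^ k) a)"
      using fib_image[OF funpow_mem[OF \<sigma>] a, of l] l cyc by simp
    also have "\<dots> = range (\<lambda>k. ((\<sigma> ^^ j) ^^ k) b)" using com l by (simp add: image_image)
    finally show ?thesis .
  qed
  with j(1) K show ?thesis by (rule that)
qed

text \<open>Since \<open>N0\<close> is abelian on \<open>A\<close>, its elements with trivial p-th
  power on \<open>A\<close> form a subgroup, and conjugation preserves it. The prime p divides the
  order k of \<open>n0\<close> on \<open>A\<close>, which makes n0^(k/p) a nontrivial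
  member.\<close>

lemma exponent_prime_normal:
  assumes N0: "perm_group N0" "N0 \<subseteq> K" "\<And>g n. \<lbrakk>g \<in> G; n \<in> N0\<rbrakk> \<Longrightarrow> g \<circ> n \<circ> finv g \<in> N0"
    and nontriv: "n0 \<in> N0" "a0 \<in> A" "n0 a0 \<noteq> a0"
    and ab: "\<And>n m a. \<lbrakk>n \<in> N0; m \<in> N0; a \<in> A\<rbrakk> \<Longrightarrow> n (m a) = m (n a)"
  obtains p N n where "prime (p::nat)" "perm_group N" "N \<subseteq> N0"
    "\<And>g n. \<lbrakk>g \<in> G; n \<in> N\<rbrakk> \<Longrightarrow> g \<circ> n \<circ> finv g \<in> N"
    "n \<in> N" "\<exists>a\<in>A. n a \<noteq> a" "\<And>n a. \<lbrakk>n \<in> N; a \<in> A\<rbrakk> \<Longrightarrow> (n ^^ p) a = a"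
proof -
  interpret N0: perm_group N0 by fact
  have n0G: "n0 \<in> G" using nontriv N0 K_G by blast
  define k where "k = (LEAST k. k > 0 \<and> (\<forall>a\<in>A. (n0 ^^ k) a = a))"
  have "\<exists>k>0. \<forall>a\<in>A. (n0 ^^ k) a = a"
    by (rule finite_perm_period[OF finA GA[OF n0G]]) (use bij[OF n0G] bij_is_inj in auto)
  then have k: "k > 0" "\<And>a. a \<in> A \<Longrightarrow> (n0 ^^ k) a = a"
    using LeastI_ex[of "\<lambda>k. k > 0 \<and> (\<forall>a\<in>A. (n0 ^^ k) a = a)"] by (auto simp: k_def)
  have least: "k \<le> m" if "m > 0" "\<forall>a\<in>A. (n0 ^^ m) a = a" for m
    unfolding k_def using that by (intro Least_le) auto
  have "k \<noteq> 1" using k(2)[OF nontriv(2)] nontriv(3) by auto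
  then obtain p where p: "prime p" "p dvd k" using prime_factor_nat by blast
  then obtain l where l: "k = l * p" by (auto simp: mult.commute elim: dvdE)
  define N where "N = {n \<in> N0. \<forall>a\<in>A. (n ^^ p) a = a}"
  have inA: "(n ^^ i) a \<in> A" if "n \<in> N0" "a \<in> A" for n i a
    using GA[OF funpow_mem] that N0(2) K_G by blast
  have N0G: "n \<in> G" if "n \<in> N0" for n using that N0(2) K_G by blast
  have comm_pow: "((n \<circ> m) ^^ i) a = (n ^^ i) ((m ^^ i) a)"
    if nm: "n \<in> N0" "m \<in> N0" "a \<in> A" for n m i a
  proof (induction i)
    case (Suc i)
    have "((n \<circ> m) ^^ Suc i) a = (n \<circ> m) (((n \<circ> m) ^^ i) a)" by simp
    also have "\<dots> = n (m ((n ^^ i) ((m ^^ i) a)))" unfolding Suc by (rule comp_apply)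
    also have "m ((n ^^ i) ((m ^^ i) a)) = (n ^^ i) (m ((m ^^ i) a))"
      by (rule ab[OF nm(2) N0.funpow_mem[OF nm(1)] inA[OF nm(2,3)]])
    finally show ?case by simp
  qed simp
  show ?thesis
  proof (rule that[of p N "n0 ^^ l"])
    show "perm_group N"
    proof (rule perm_groupI_finv[OF N0(1)])
      show "N \<subseteq> N0" by (auto simp: N_def)
      show "id \<in> N" by (simp add: N_def N0.id_mem)
      show "n \<circ> m \<in> N" if "n \<in> N" "m \<in> N" for n m
        using that comm_pow[of n m] N0.comp_mem[of n m] by (simp add: N_def)
      show "finv n \<in> N" if n: "n \<in> N" for n
      proof -
        have nN: "n \<in> N0" "\<And>a. a \<in> A \<Longrightarrow> (n ^^ p) a = a" using n by (auto simp: N_def)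
        have "(finv n ^^ i) ((n ^^ i) a) = a" for i a
        proof (induction i arbitrary: a)
          case (Suc i)
          have "(finv n ^^ Suc i) ((n ^^ Suc i) a) = (finv n ^^ i) (finv n (n ((n ^^ i) a)))"
          proof -
            have "finv n ^^ Suc i = finv n ^^ i \<circ> finv n" by (rule funpow_Suc_right)
            then show ?thesis by simp
          qed
          then show ?case using Suc[of a] N0.finv_left[OF nN(1)] by simp
        qed simp
        then have "(finv n ^^ p) a = a" if "a \<in> A" for a using nN(2)[OF that] by metis
        then show ?thesis using nN by (simp add: N_def N0.finv_mem)
      qed
    qed
    show "g \<circ> n \<circ> finv g \<in> N" if gn: "g \<in> G" "n \<in> N" for g n
    proof -
      have nN: "n \<in> N0" "\<And>a. a \<in> A \<Longrightarrow> (n ^^ p) a = a" using gn by (auto simp: N_def)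
      have "((g \<circ> n \<circ> finv g) ^^ p) a = a" if "a \<in> A" for a
        using conj_funpow[OF gn(1), where h = n and k = p and x = a] nN(2)[OF GA[OF finv_mem[OF gn(1)] that]] gn(1) by simp
      then show ?thesis using N0(3)[OF gn(1) nN(1)] by (simp add: N_def)
    qed
    have "l > 0" "l < k" using l k(1) prime_gt_1_nat[OF p(1)] by auto
    then have "\<not> (\<forall>a\<in>A. (n0 ^^ l) a = a)" using least[of l] by auto
    then show "\<exists>a\<in>A. (n0 ^^ l) a \<noteq> a" by simp
    show "n0 ^^ l \<in> N" using N0.funpow_mem[OF nontriv(1)] k(2) by (simp add: N_def funpow_mult l)
  qed (use p(1) in \<open>auto simp: N_def\<close>)
qed

end

section \<open>The normal subgroup \<open>N\<close>, its centraliser \<open>P\<close> and the orbit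
  of \<open>y\<close>\<close>

text \<open>Here \<open>y\<close> is a root of g(Y) - t. Minimal reducibility is encoded three
  times: \<open>not_trans\<close> says that k(x) and k(y) are not linearly disjoint,
  \<open>pr_trans\<close> comes from the pair k(f_r(x)), k(y), and \<open>faithful\<close> from
  minimality on the side of \<open>y\<close>. The assumption \<open>orbits\<close> records the
  points of g over infinity: one cycle of \<open>\<sigma>\<close> if g is a polynomial, otherwise at
  most two (of any three points two share a cycle) together with the odd degree of f.\<close>

locale monodromy_normal = monodromy_action G A pr \<sigma>
  for G :: "('a \<Rightarrow> 'a) set" and A pr \<sigma> +
  fixes N :: "('a \<Rightarrow> 'a) set" and p :: nat and y :: 'a and B :: "'a set"
  assumes p: "prime p"
    and N: "perm_group N" "N \<subseteq> K" "\<And>g n. \<lbrakk>g \<in> G; n \<in> N\<rbrakk> \<Longrightarrow> g \<circ> n \<circ> finv g \<in> N"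
    and N_nontriv: "\<exists>n\<in>N. \<exists>a\<in>A. n a \<noteq> a"
    and N_ab: "\<And>n m a. \<lbrakk>n \<in> N; m \<in> N; a \<in> A\<rbrakk> \<Longrightarrow> n (m a) = m (n a)"
    and N_exp: "\<And>n a. \<lbrakk>n \<in> N; a \<in> A\<rbrakk> \<Longrightarrow> (n ^^ p) a = a"
    and B: "B = (\<lambda>g. g y) ` G" "finite B"
    and not_trans: "\<exists>a\<in>A. \<exists>b\<in>A. \<forall>g\<in>G. g y = y \<longrightarrow> g a \<noteq> b"
    and pr_trans: "\<lbrakk>a \<in> A; b \<in> A\<rbrakk> \<Longrightarrow> \<exists>g\<in>G. g y = y \<and> g (pr a) = pr b"
    and faithful: "\<lbrakk>g \<in> G; \<And>a. a \<in> A \<Longrightarrow> g a = a\<rbrakk> \<Longrightarrow> g y = y"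
    and orbits: "(\<forall>b1\<in>B. \<forall>b2\<in>B. \<exists>k. (\<sigma> ^^ k) b1 = b2) \<or>
      odd (card A) \<and> (\<forall>b1\<in>B. \<forall>b2\<in>B. \<forall>b3\<in>B. \<exists>k. (\<sigma> ^^ k) b1 = b2 \<or> (\<sigma> ^^ k) b1 = b3 \<or> (\<sigma> ^^ k) b2 = b3)"
begin

sublocale N: perm_group N by (rule N(1))

lemma N_G: "n \<in> N \<Longrightarrow> n \<in> G" using N(2) K_G by blast

lemma normal_orbit:
  assumes M: "perm_group M" "M \<subseteq> K" "\<And>g n. \<lbrakk>g \<in> G; n \<in> M\<rbrakk> \<Longrightarrow> g \<circ> n \<circ> finv g \<in> M"
    and n: "n \<in> M" "a \<in> A" "n a \<noteq> a"
  shows "(\<lambda>n. n a) ` M = fib a"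
proof -
  have "M \<subseteq> G" using M(2) K_G by blast
  then have "(\<lambda>n. n a) ` M = {a} \<or> (\<lambda>n. n a) ` M = {b \<in> A. pr b = pr a}"
    using prim[OF M(1) _ M(3) _ n(2)] M(2) by (auto simp: K_def)
  then show ?thesis using n unfolding fib_def by blast
qed

text \<open>\<open>N\<close> moves some point of \<open>A\<close>; after conjugation by a power of
  \<open>\<sigma>\<close> it moves any given point, and primitivity applies there.\<close>

lemma N_orbit: "a \<in> A \<Longrightarrow> (\<lambda>n. n a) ` N = fib a"
proof -
  assume a: "a \<in> A"
  obtain n b where nb: "n \<in> N" "b \<in> A" "n b \<noteq> b" using N_nontriv by blast
  obtain k where k: "(\<sigma> ^^ k) b = a" using \<sigma>_trans[OF nb(2) a] by blast
  define g where "g = \<sigma> ^^ k"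
  have g: "g \<in> G" unfolding g_def by (rule funpow_mem[OF \<sigma>])
  have "(g \<circ> n \<circ> finv g) a \<noteq> a" using nb(3) g k[folded g_def] by auto
  then show ?thesis using normal_orbit[OF N(1,2,3)] N(3)[OF g nb(1)] a by blast
qed

lemma N_transD: "\<lbrakk>a \<in> A; b \<in> fib a\<rbrakk> \<Longrightarrow> \<exists>n\<in>N. n a = b"
  unfolding N_orbit[symmetric] by blast

lemma card_fib: "a \<in> A \<Longrightarrow> card (fib a) = p \<or> p = 2 \<and> card (fib a) = 4"
proof -
  assume a: "a \<in> A"
  obtain j where j: "j > 0" "\<sigma> ^^ j \<in> K" "\<And>b. b \<in> A \<Longrightarrow> fib b = range (\<lambda>k. ((\<sigma> ^^ j) ^^ k) b)"
    using fib_cyclic[OF a] by metis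
  have sj: "\<sigma> ^^ j \<in> G" using j K_G by blast
  have "card (fib a) = 1 \<or> card (fib a) = p \<or> p = 2 \<and> card (fib a) = 4"
  proof (rule N.orbit_affine_cycle)
    show "fib a = (\<lambda>g. g a) ` N" using N_orbit[OF a] by simp
    show "\<forall>g\<in>N. \<forall>h\<in>N. g (h a) = h (g a)" using N_ab a by blast
    show "(g ^^ p) a = a" if "g \<in> N" for g using N_exp that a by blast
    show "(\<sigma> ^^ j) \<circ> g \<circ> finv (\<sigma> ^^ j) \<in> N" if "g \<in> N" for g by (rule N(3)[OF sj that])
    show "fib a = range (\<lambda>k. ((\<sigma> ^^ j) ^^ k) a)" by (rule j(3)[OF a])
  qed (rule fin_fib p bij[OF sj])+
  moreover have "card (fib a) \<noteq> 1"
  proof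
    assume "card (fib a) = 1"
    then obtain x where "fib a = {x}" by (rule card_1_singletonE)
    moreover obtain b where "b \<in> fib a" "b \<noteq> a" using fib_nontriv[OF a] by (auto simp: fib_def)
    ultimately show False using fib_self[OF a] by auto
  qed
  ultimately show ?thesis by blast
qed

text \<open>Commutation is demanded on \<open>A\<close> only; \<open>agree_B\<close> carries
  identities over to \<open>B\<close>. Working with \<open>P\<close> instead of \<open>N\<close> has
  the advantage that membership can be tested by commutation, which \<open>diagonalI\<close> and
  \<open>K_eq_P_of_card2\<close> exploit.\<close>

definition P where "P = {g \<in> K. \<forall>n\<in>N. \<forall>a\<in>A. g (n a) = n (g a)}"

lemma P_K: "g \<in> P \<Longrightarrow> g \<in> K" by (simp add: P_def)

lemma P_G: "g \<in> P \<Longrightarrow> g \<in> G" using K_G P_K by blast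

lemma P_comm: "\<lbrakk>g \<in> P; n \<in> N; a \<in> A\<rbrakk> \<Longrightarrow> g (n a) = n (g a)" by (simp add: P_def)

lemma P_A: "\<lbrakk>g \<in> P; a \<in> A\<rbrakk> \<Longrightarrow> g a \<in> A" using GA P_G by blast

lemma N_P: "n \<in> N \<Longrightarrow> n \<in> P"
  using N(2) N_ab[of n] by (simp add: P_def subset_iff)

lemma P_group: "perm_group P"
proof (rule perm_groupI_finv[OF K_group])
  interpret K: perm_group K by (rule K_group)
  show "P \<subseteq> K" using P_K by blast
  show "id \<in> P" by (simp add: P_def K.id_mem)
  show "g \<circ> h \<in> P" if gh: "g \<in> P" "h \<in> P" for g h
  proof -
    have "(g \<circ> h) (n a) = n ((g \<circ> h) a)" if "n \<in> N" "a \<in> A" for n a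
      using P_comm[OF gh(2) that] P_comm[OF gh(1) that(1) P_A[OF gh(2) that(2)]] by simp
    then show ?thesis using K.comp_mem[OF P_K P_K] gh by (simp add: P_def)
  qed
  show "finv g \<in> P" if g: "g \<in> P" for g
  proof -
    have "finv g (n a) = n (finv g a)" if na: "n \<in> N" "a \<in> A" for n a
    proof -
      have "finv g a \<in> A" by (rule GA[OF finv_mem[OF P_G[OF g]] na(2)])
      from P_comm[OF g na(1) this] have "g (n (finv g a)) = n a" using P_G[OF g] by simp
      then show ?thesis using P_G[OF g] by (metis finv_left)
    qed
    then show ?thesis using K.finv_mem[OF P_K[OF g]] by (simp add: P_def)
  qed
qed

sublocale P: perm_group P by (rule P_group)

lemma P_normal:
  assumes g: "g \<in> G" and h: "h \<in> P"
  shows "g \<circ> h \<circ> finv g \<in> P"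
proof -
  have "(g \<circ> h \<circ> finv g) (n a) = n ((g \<circ> h \<circ> finv g) a)" if na: "n \<in> N" "a \<in> A" for n a
  proof -
    define n' where "n' = finv g \<circ> n \<circ> finv (finv g)"
    have n': "n' \<in> N" unfolding n'_def by (rule N(3)[OF finv_mem[OF g] na(1)])
    have eq: "finv g (n b) = n' (finv g b)" "n (g b) = g (n' b)" for b
      using g by (simp_all add: n'_def finv_finv)
    have "h (n' (finv g a)) = n' (h (finv g a))"
      by (rule P_comm[OF h n' GA[OF finv_mem[OF g] na(2)]])
    then show ?thesis using eq by simp
  qed
  then show ?thesis using K_normal[OF g P_K[OF h]] by (simp add: P_def)
qed

text \<open>\<open>N\<close> is transitive on the block and commutes with \<open>P\<close>, so one
  value determines an element of \<open>P\<close> on a whole block. Hence \<open>P\<close> acts on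
  each single block like \<open>N\<close> and inherits commutativity and exponent p, although the
  matching element of \<open>N\<close> may vary with the block.\<close>

lemma P_eq_on_fib:
  assumes "g \<in> P" "h \<in> P" "a \<in> A" "g a = h a" "b \<in> fib a"
  shows "g b = h b"
proof -
  obtain n where n: "n \<in> N" "n a = b" using N_transD assms by blast
  then show ?thesis using P_comm[OF assms(1) n(1) assms(3)] P_comm[OF assms(2) n(1) assms(3)] assms(4) by simp
qed

lemma P_as_N:
  assumes "g \<in> P" "a \<in> A"
  obtains n where "n \<in> N" "\<And>b. b \<in> fib a \<Longrightarrow> g b = n b"
proof -
  have "g a \<in> fib a" using K_fib[OF P_K[OF assms(1)] fib_self[OF assms(2)]] .
  then obtain n where n: "n \<in> N" "n a = g a" using N_transD assms by blast
  then show ?thesis using P_eq_on_fib[OF assms(1) N_P[OF n(1)] assms(2)] by (intro that) auto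
qed

lemma P_ab:
  assumes "g \<in> P" "h \<in> P" "a \<in> A"
  shows "g (h a) = h (g a)"
proof -
  obtain n where n: "n \<in> N" "\<And>b. b \<in> fib a \<Longrightarrow> h b = n b" using P_as_N[OF assms(2,3)] by metis
  have "g a \<in> fib a" using K_fib[OF P_K[OF assms(1)] fib_self[OF assms(3)]] .
  then show ?thesis using n(2) fib_self[OF assms(3)] P_comm[OF assms(1) n(1) assms(3)] by simp
qed

lemma P_exp:
  assumes "g \<in> P" "a \<in> A"
  shows "(g ^^ p) a = a"
proof -
  obtain n where n: "n \<in> N" "\<And>b. b \<in> fib a \<Longrightarrow> g b = n b" using P_as_N[OF assms] by metis
  have "(g ^^ k) a = (n ^^ k) a \<and> (g ^^ k) a \<in> fib a" for k
  proof (induction k)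
    case (Suc k)
    then have e: "(g ^^ k) a = (n ^^ k) a" and f: "(g ^^ k) a \<in> fib a" by auto
    show ?case using n(2)[OF f] K_fib[OF P_K[OF assms(1)] f] e by simp
  qed (use fib_self assms in simp)
  then show ?thesis using N_exp[OF n(1) assms(2)] by simp
qed

text \<open>The assumption \<open>faithful\<close> only concerns the point \<open>y\<close>. Applied
  to the quotient of g c and h c it covers c y, so that identities between elements of
  \<open>G\<close> pass from \<open>A\<close> to all of \<open>B\<close>.\<close>

lemma agree_B:
  assumes gh: "g \<in> G" "h \<in> G" and eq: "\<And>a. a \<in> A \<Longrightarrow> g a = h a" and b: "b \<in> B"
  shows "g b = h b"
proof -
  obtain c where c: "c \<in> G" "b = c y" using b B by blast
  define d where "d = finv (h \<circ> c) \<circ> (g \<circ> c)"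
  have hc: "h \<circ> c \<in> G" "g \<circ> c \<in> G" using gh c comp_mem by auto
  have "d y = y"
  proof (rule faithful)
    show "d \<in> G" unfolding d_def using hc comp_mem finv_mem by blast
    fix a assume a: "a \<in> A"
    have "d a = finv (h \<circ> c) ((h \<circ> c) a)" using eq[OF GA[OF c(1) a]] by (simp add: d_def)
    then show "d a = a" using finv_left[OF hc(1)] by simp
  qed
  then have "(h \<circ> c) (finv (h \<circ> c) ((g \<circ> c) y)) = (h \<circ> c) y" by (simp add: d_def)
  then have "(g \<circ> c) y = (h \<circ> c) y" using finv_right[OF hc(1)] by metis
  then show ?thesis using c by simp
qed

lemma P_ab_B:
  assumes "g \<in> P" "h \<in> P" "b \<in> B"
  shows "g (h b) = h (g b)"
proof -
  have "(g \<circ> h) b = (h \<circ> g) b"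
    by (rule agree_B[OF comp_mem[OF P_G[OF assms(1)] P_G[OF assms(2)]]
          comp_mem[OF P_G[OF assms(2)] P_G[OF assms(1)]] _ assms(3)])
      (simp add: P_ab[OF assms(1,2)])
  then show ?thesis by simp
qed

lemma P_exp_B:
  assumes "g \<in> P" "b \<in> B"
  shows "(g ^^ p) b = b"
proof -
  have "(g ^^ p) b = id b"
    by (rule agree_B[OF funpow_mem[OF P_G[OF assms(1)]] id_mem _ assms(2)])
      (simp add: P_exp[OF assms(1)])
  then show ?thesis by simp
qed

lemma y_B: "y \<in> B" unfolding B by (rule image_eqI[OF _ id_mem]) simp

definition Py where "Py = {g \<in> P. g y = y}"

lemma Py_group: "perm_group Py"
proof (rule perm_groupI_finv[OF P_group])
  show "finv g \<in> Py" if "g \<in> Py" for g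
    using that P.finv_mem[of g] P.finv_left[of g y] by (simp add: Py_def)
qed (auto simp: Py_def P.id_mem P.comp_mem)

sublocale Py: perm_group Py by (rule Py_group)

lemma Py_P: "g \<in> Py \<Longrightarrow> g \<in> P" by (simp add: Py_def)

lemma Py_normal:
  assumes g: "g \<in> G" "g y = y" and h: "h \<in> Py"
  shows "g \<circ> h \<circ> finv g \<in> Py"
proof -
  have "finv g y = y" using finv_left[OF g(1), of y] g(2) by simp
  then show ?thesis using P_normal[OF g(1) Py_P[OF h]] h g(2) by (simp add: Py_def)
qed

text \<open>The stabiliser of \<open>y\<close> in \<open>G\<close> is transitive on the blocks. If
  its subgroup \<open>Py\<close> were transitive on one block, it would therefore be transitive on
  \<open>A\<close>. This is how reducibility enters the group theory.\<close>

lemma Py_not_trans: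
  assumes a: "a \<in> A"
  shows "\<exists>b\<in>fib a. \<forall>g\<in>Py. g a \<noteq> b"
proof (rule ccontr)
  assume "\<not> ?thesis"
  then have tr: "\<exists>g\<in>Py. g a = b" if "b \<in> fib a" for b using that by blast
  have tr2: "\<exists>g\<in>Py. g c = d" if cd: "c \<in> fib a" "d \<in> fib a" for c d
  proof -
    obtain g h where gh: "g \<in> Py" "g a = c" "h \<in> Py" "h a = d" using tr cd by metis
    then have "h \<circ> finv g \<in> Py" "(h \<circ> finv g) c = d"
      using Py.comp_mem Py.finv_mem by (auto simp: Py.finv_left)
    then show ?thesis by blast
  qed
  have "\<exists>g\<in>G. g y = y \<and> g c = d" if cd: "c \<in> A" "d \<in> A" for c d
  proof -
    obtain g where g: "g \<in> G" "g y = y" "g (pr c) = pr d" using pr_trans[OF cd] by blast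
    obtain h where h: "h \<in> G" "h y = y" "h (pr a) = pr d" using pr_trans[OF a cd(2)] by blast
    have hi: "finv h \<in> G" "finv h y = y" "finv h (pr d) = pr a"
      using finv_mem h finv_left[OF h(1), of y] finv_left[OF h(1), of "pr a"] by auto
    \<comment> \<open>g takes c into the block of d, and h takes the block of a to the same block.
      The remaining motion is carried out in the block of a by an element of \<open>Py\<close> and
      transported back by h.\<close>
    have "finv h (g c) \<in> fib a" "finv h d \<in> fib a"
      using GA pr g hi cd by (auto simp: fib_def)
    then obtain u where u: "u \<in> Py" "u (finv h (g c)) = finv h d" using tr2 by blast
    have "(h \<circ> u \<circ> finv h \<circ> g) c = d" using u(2) finv_right[OF h(1)] by simp
    moreover have "(h \<circ> u \<circ> finv h \<circ> g) y = y" using u(1) g h hi by (simp add: Py_def)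
    moreover have "h \<circ> u \<circ> finv h \<circ> g \<in> G"
      using comp_mem h(1) g(1) hi(1) P_G[OF Py_P[OF u(1)]] by simp
    ultimately show ?thesis by blast
  qed
  then show False using not_trans by blast
qed

definition Oy where "Oy = (\<lambda>g. g y) ` P"

lemma Oy_B: "b \<in> Oy \<Longrightarrow> b \<in> B"
  unfolding Oy_def B using P_G by blast

lemma fin_Oy: "finite Oy"
  by (rule finite_subset[OF _ B(2)]) (use Oy_B in blast)

lemma y_Oy: "y \<in> Oy" unfolding Oy_def by (rule image_eqI[OF _ P.id_mem]) simp

lemma P_Oy:
  assumes "g \<in> P" "b \<in> Oy"
  shows "g b \<in> Oy"
proof -
  obtain h where h: "h \<in> P" "b = h y" using assms(2) unfolding Oy_def by blast
  have "g \<circ> h \<in> P" using P.comp_mem assms h by blast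
  then show ?thesis unfolding Oy_def h(2) by (rule rev_image_eqI) simp
qed

text \<open>As an orbit of the normal subgroup \<open>P\<close>, \<open>Oy\<close> is a block of
  \<open>G\<close> on \<open>B\<close>: a conjugate in \<open>P\<close> leads from g b to any other
  point of the image.\<close>

lemma Oy_block:
  assumes g: "g \<in> G" and b: "b \<in> Oy" "g b \<in> Oy"
  shows "g ` Oy = Oy"
proof (rule endo_inj_surj[OF fin_Oy])
  show "g ` Oy \<subseteq> Oy"
  proof
    fix d assume "d \<in> g ` Oy"
    then obtain c where c: "c \<in> P" "d = g (c y)" unfolding Oy_def by blast
    obtain h where h: "h \<in> P" "b = h y" using b unfolding Oy_def by blast
    define u where "u = g \<circ> (c \<circ> finv h) \<circ> finv g"
    have "u \<in> P" unfolding u_def by (rule P_normal[OF g P.comp_mem[OF c(1) P.finv_mem[OF h(1)]]])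
    moreover have "d = u (g b)" using h g c by (simp add: u_def)
    ultimately show "d \<in> Oy" using P_Oy b(2) by blast
  qed
  show "inj_on g Oy" using bij[OF g] bij_is_inj inj_on_subset by blast
qed

lemma \<sigma>_card: "a \<in> A \<Longrightarrow> (\<sigma> ^^ card A) a = a"
proof -
  assume a: "a \<in> A"
  obtain n where n: "n > 0" "\<And>a. a \<in> A \<Longrightarrow> (\<sigma> ^^ n) a = a" using \<sigma>_period by blast
  have "range (\<lambda>k. (\<sigma> ^^ k) a) = A"
    using \<sigma>_trans[OF a] GA[OF funpow_mem[OF \<sigma>] a] by blast
  then show ?thesis using cyclic_orbit(2)[OF bij_is_inj[OF bij[OF \<sigma>]] n(2)[OF a] n(1)] by simp
qed

lemma \<sigma>_card_B: "b \<in> B \<Longrightarrow> (\<sigma> ^^ card A) b = b"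
  by (rule agree_B[OF funpow_mem[OF \<sigma>] id_mem, simplified]) (rule \<sigma>_card)

lemma card_A_pos: "card A > 0" using finA neA by (simp add: card_gt_0_iff)

lemma Oy_prime_power: "\<exists>d. card Oy = p ^ d"
proof (rule P.orbit_prime_power[OF Oy_def _ fin_Oy p])
  show "\<forall>g\<in>P. \<forall>h\<in>P. g (h y) = h (g y)" using P_ab_B y_B by blast
  show "(g ^^ p) y = y" if "g \<in> P" for g using P_exp_B that y_B by blast
qed

text \<open>Two points of \<open>Oy\<close> in one cycle of \<open>\<sigma>\<close> are in one cycle
  of \<sigma>^j. Suppose that \<open>Oy\<close> met a second cycle. Then |A| is odd by
  \<open>orbits\<close>, both cycle lengths divide |A| and are odd, and |Oy| is even. But p divides
  the block size and hence |A|, so |Oy| is a power of an odd prime.\<close>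

lemma Oy_cyclic:
  obtains j where "j > 0" "(\<sigma> ^^ j) ` Oy = Oy" "\<And>i. (\<sigma> ^^ i) ` Oy = Oy \<Longrightarrow> j dvd i"
    "Oy = range (\<lambda>k. ((\<sigma> ^^ j) ^^ k) y)"
proof -
  have "(\<sigma> ^^ card A) ` Oy = Oy"
    using Oy_block[OF funpow_mem[OF \<sigma>] y_Oy, of "card A"] \<sigma>_card_B[OF y_B] y_Oy by simp
  from cyclic_block_stabilizer[OF bij_is_inj[OF bij[OF \<sigma>]] card_A_pos this]
  obtain j where j: "j > 0" "(\<sigma> ^^ j) ` Oy = Oy" "\<And>i. (\<sigma> ^^ i) ` Oy = Oy \<Longrightarrow> j dvd i"
    by metis
  define r where "r = \<sigma> ^^ j"
  have r: "r \<in> G" unfolding r_def by (rule funpow_mem[OF \<sigma>])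
  have rk: "(r ^^ k) b \<in> Oy" if "b \<in> Oy" for k b
    by (induction k) (use that j(2) in \<open>auto simp: r_def\<close>)
  have same: "\<exists>i. (r ^^ i) b = c" if bc: "b \<in> Oy" "c \<in> Oy" "(\<sigma> ^^ k) b = c" for b c k
  proof -
    have "(\<sigma> ^^ k) ` Oy = Oy" using Oy_block[OF funpow_mem[OF \<sigma>] bc(1)] bc by simp
    then have "j dvd k" by (rule j(3))
    then obtain i where "k = j * i" by (rule dvdE)
    then show ?thesis using bc(3) by (auto simp: r_def funpow_mult mult.commute)
  qed
  have "Oy \<subseteq> range (\<lambda>k. (r ^^ k) y)"
  proof (rule ccontr)
    assume "\<not> ?thesis"
    then obtain o1 where o1: "o1 \<in> Oy" "\<And>k. (r ^^ k) y \<noteq> o1" by blast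
    have "\<not> (\<exists>k. (\<sigma> ^^ k) y = o1)" using same[OF y_Oy o1(1)] o1(2) by blast
    then have orb: "odd (card A)" "\<And>b. b \<in> B \<Longrightarrow> \<exists>k. (\<sigma> ^^ k) y = b \<or> (\<sigma> ^^ k) o1 = b"
      using orbits y_B Oy_B[OF o1(1)] by blast+
    define R1 where "R1 = range (\<lambda>k. (r ^^ k) y)"
    define R2 where "R2 = range (\<lambda>k. (r ^^ k) o1)"
    have union: "Oy = R1 \<union> R2"
    proof
      show "R1 \<union> R2 \<subseteq> Oy" using rk y_Oy o1(1) by (auto simp: R1_def R2_def)
      show "Oy \<subseteq> R1 \<union> R2"
      proof
        fix b assume b: "b \<in> Oy"
        obtain k where "(\<sigma> ^^ k) y = b \<or> (\<sigma> ^^ k) o1 = b" using orb(2)[OF Oy_B[OF b]] by blast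
        then have "\<exists>i. (r ^^ i) y = b \<or> (r ^^ i) o1 = b" using same b y_Oy o1(1) by blast
        then show "b \<in> R1 \<union> R2" by (auto simp: R1_def R2_def)
      qed
    qed
    have rn: "(r ^^ card A) b = b" if "b \<in> B" for b
      using funpow_eq_mult[OF \<sigma>_card_B[OF that], of j] by (simp add: r_def funpow_mult mult.commute)
    have injr: "inj r" using bij[OF r] bij_is_inj by blast
    have disj: "R1 \<inter> R2 = {}"
    proof (rule ccontr)
      assume "R1 \<inter> R2 \<noteq> {}"
      then obtain i k where ik: "(r ^^ i) y = (r ^^ k) o1" by (auto simp: R1_def R2_def)
      \<comment> \<open>The power with exponent |A| k - k undoes r^k, because r^|A| is trivial on
        \<open>B\<close>.\<close>
      have "(r ^^ (card A * k - k + i)) y = (r ^^ (card A * k - k)) ((r ^^ i) y)" by (simp add: funpow_add)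
      also have "\<dots> = (r ^^ (card A * k - k + k)) o1" by (simp add: funpow_add ik)
      also have "card A * k - k + k = card A * k" using card_A_pos by simp
      also have "(r ^^ (card A * k)) o1 = o1" by (rule funpow_eq_mult[OF rn[OF Oy_B[OF o1(1)]]])
      finally show False using o1(2) by blast
    qed
    have "odd (card R1)" "odd (card R2)"
      using cyclic_orbit(1)[OF injr rn[OF y_B] card_A_pos] cyclic_orbit(1)[OF injr rn[OF Oy_B[OF o1(1)]] card_A_pos]
        orb(1) by (auto simp: R1_def R2_def dest: dvd_trans)
    moreover have "card Oy = card R1 + card R2"
      using union disj fin_Oy by (simp add: card_Un_disjoint)
    ultimately have "even (card Oy)" by simp
    obtain a where a: "a \<in> A" using neA by blast
    have "p dvd card (fib a)" using card_fib[OF a] by auto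
    then have "odd p" using card_fib_dvd[OF a] orb(1) dvd_trans by blast
    then have "odd (card Oy)" using Oy_prime_power by auto
    with \<open>even (card Oy)\<close> show False by simp
  qed
  then have "Oy = range (\<lambda>k. (r ^^ k) y)" using rk y_Oy by blast
  with j show ?thesis unfolding r_def by (rule that)
qed

lemma card_Oy: "card Oy = 1 \<or> card Oy = p \<or> p = 2 \<and> card Oy = 4"
proof -
  obtain j where j: "Oy = range (\<lambda>k. ((\<sigma> ^^ j) ^^ k) y)" by (rule Oy_cyclic)
  have sj: "\<sigma> ^^ j \<in> G" by (rule funpow_mem[OF \<sigma>])
  show ?thesis
  proof (rule P.orbit_affine_cycle[OF Oy_def _ fin_Oy p _ bij[OF sj] _ j])
    show "\<forall>g\<in>P. \<forall>h\<in>P. g (h y) = h (g y)" using P_ab_B y_B by blast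
    show "(g ^^ p) y = y" if "g \<in> P" for g using P_exp_B that y_B by blast
    show "(\<sigma> ^^ j) \<circ> g \<circ> finv (\<sigma> ^^ j) \<in> P" if "g \<in> P" for g by (rule P_normal[OF sj that])
  qed
qed

lemma P_fib_trans: "\<lbrakk>a \<in> A; b \<in> fib a\<rbrakk> \<Longrightarrow> \<exists>g\<in>P. g a = b"
  using N_transD N_P by blast

text \<open>Let g in \<open>K\<close> be trivial on the block of a. For n in \<open>N\<close> the
  commutator of g and n lies in \<open>N\<close> by normality, and it fixes a because g fixes both a
  and n^-1 a. Regularity of \<open>P\<close> makes it trivial on \<open>A\<close>, so g commutes
  with \<open>N\<close>, belongs to \<open>P\<close>, and is itself trivial.\<close>

lemma diagonalI:
  assumes reg: "\<And>g a. \<lbrakk>g \<in> P; a \<in> A; g a = a\<rbrakk> \<Longrightarrow> \<forall>b\<in>A. g b = b"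
    and g: "g \<in> K" "a \<in> A" "\<And>b. b \<in> fib a \<Longrightarrow> g b = b"
  shows "\<forall>b\<in>A. g b = b"
proof -
  interpret K: perm_group K by (rule K_group)
  have gG: "g \<in> G" using g K_G by blast
  have "g (n b) = n (g b)" if n: "n \<in> N" and b: "b \<in> A" for n b
  proof -
    define c where "c = (g \<circ> n \<circ> finv g) \<circ> finv n"
    have cP: "c \<in> P" unfolding c_def
      by (rule N_P[OF N.comp_mem[OF N(3)[OF gG n] N.finv_mem[OF n]]])
    have ni: "finv n a \<in> fib a"
      using K_fib[OF K.finv_mem fib_self[OF g(2)]] N(2) n by blast
    then have "finv g (finv n a) = finv n a" using g(3)[OF ni] finv_left[OF gG] by metis
    then have "c a = a" using g(3)[OF fib_self[OF g(2)]] N_G[OF n] by (simp add: c_def)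
    then have "c (n (g b)) = n (g b)" using reg[OF cP g(2)] GA N_G[OF n] gG b by blast
    moreover have "c (n (g b)) = g (n b)" using N_G[OF n] gG by (simp add: c_def)
    ultimately show ?thesis by simp
  qed
  then have "g \<in> P" using g(1) by (simp add: P_def)
  then show ?thesis using reg[OF _ g(2)] g(3)[OF fib_self[OF g(2)]] by blast
qed

lemma orbit_map:
  assumes triv: "\<forall>g\<in>Py. \<forall>a\<in>A. g a = a" and gh: "g \<in> P" "h \<in> P" "g y = h y" and a: "a \<in> A"
  shows "g a = h a"
proof -
  have "finv h \<circ> g \<in> Py"
    using P.comp_mem[OF P.finv_mem[OF gh(2)] gh(1)] gh P.finv_left[OF gh(2)] by (simp add: Py_def)
  from triv this a have "(finv h \<circ> g) a = a" by blast
  then have "h (finv h (g a)) = h a" by simp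
  then show ?thesis using P.finv_right[OF gh(2)] by simp
qed

text \<open>When \<open>Py\<close> acts trivially on \<open>A\<close>, the assignment g y -> g a is
  well defined. It is the equivariant surjection that compares the actions of \<open>P\<close> on
  \<open>Oy\<close> and on a block.\<close>

lemma orbit_to_fib:
  assumes triv: "\<forall>g\<in>Py. \<forall>a\<in>A. g a = a" and a: "a \<in> A"
  obtains F where "F ` Oy = fib a" "\<forall>g\<in>P. F (g y) = g a"
proof -
  define F where "F b = (SOME g. g \<in> P \<and> g y = b) a" for b
  have F: "F (g y) = g a" if g: "g \<in> P" for g
  proof -
    have "(SOME h. h \<in> P \<and> h y = g y) \<in> P \<and> (SOME h. h \<in> P \<and> h y = g y) y = g y"
      using someI_ex[of "\<lambda>h. h \<in> P \<and> h y = g y"] g by blast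
    then show ?thesis unfolding F_def by (intro orbit_map[OF triv _ g _ a]) auto
  qed
  have "F ` Oy = fib a"
  proof
    show "F ` Oy \<subseteq> fib a" using F K_fib[OF P_K fib_self[OF a]] by (auto simp: Oy_def)
    show "fib a \<subseteq> F ` Oy"
    proof
      fix b assume "b \<in> fib a"
      then obtain g where "g \<in> P" "g a = b" using P_fib_trans a by blast
      then show "b \<in> F ` Oy" using F by (force simp: Oy_def)
    qed
  qed
  then show ?thesis using F by (intro that) auto
qed

text \<open>Equal sizes make the surjection from \<open>Oy\<close> to the block injective, so an
  element of \<open>P\<close> that fixes a also fixes \<open>y\<close> and lies in
  \<open>Py\<close>.\<close>

lemma regular_of_card:
  assumes triv: "\<forall>g\<in>Py. \<forall>a\<in>A. g a = a" and a: "a \<in> A" and card: "card Oy = card (fib a)"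
    and g: "g \<in> P" "g a = a"
  shows "\<forall>b\<in>A. g b = b"
proof -
  obtain F where F: "F ` Oy = fib a" "\<forall>g\<in>P. F (g y) = g a"
    by (rule orbit_to_fib[OF triv a])
  have inj: "inj_on F Oy" using F(1) card fin_Oy by (metis eq_card_imp_inj_on)
  have "F (g y) = F (id y)" using F(2)[rule_format, OF g(1)] F(2)[rule_format, OF P.id_mem] g(2) by simp
  then have "g y = id y" using inj_onD[OF inj] P_Oy[OF g(1) y_Oy] y_Oy by simp
  then have "g \<in> Py" using g(1) by (simp add: Py_def)
  then show ?thesis using triv by blast
qed

end

section \<open>Comparison of the two actions according to the block size\<close>

context monodromy_normal begin

text \<open>A moved point would lie in a cycle of length p, which fills its block, contrary to
  \<open>Py_not_trans\<close>.\<close>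

lemma Py_trivial_of_prime:
  assumes q: "\<And>a. a \<in> A \<Longrightarrow> card (fib a) = p" and g: "g \<in> Py" and a: "a \<in> A"
  shows "g a = a"
proof (rule ccontr)
  assume ne: "g a \<noteq> a"
  have gP: "g \<in> P" using g Py_P by blast
  have inj: "inj g" using bij[OF P_G[OF gP]] bij_is_inj by blast
  have "card (range (\<lambda>k. (g ^^ k) a)) dvd p"
    by (rule cyclic_orbit(1)[OF inj P_exp[OF gP a]]) (use p prime_gt_0_nat in blast)
  moreover have "card (range (\<lambda>k. (g ^^ k) a)) \<noteq> 1"
  proof
    assume "card (range (\<lambda>k. (g ^^ k) a)) = 1"
    then obtain x where x: "range (\<lambda>k. (g ^^ k) a) = {x}" by (rule card_1_singletonE)
    have "(g ^^ 0) a \<in> {x}" "(g ^^ 1) a \<in> {x}" unfolding x[symmetric] by blast+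
    then show False using ne by simp
  qed
  ultimately have c: "card (range (\<lambda>k. (g ^^ k) a)) = p" using p by (auto simp: prime_nat_iff)
  have sub: "range (\<lambda>k. (g ^^ k) a) \<subseteq> fib a"
    using K_fib[OF P_K[OF P.funpow_mem[OF gP]] fib_self[OF a]] by blast
  have eq: "range (\<lambda>k. (g ^^ k) a) = fib a"
    by (rule card_subset_eq[OF fin_fib sub]) (simp add: c q[OF a])
  obtain b where b: "b \<in> fib a" "\<forall>g\<in>Py. g a \<noteq> b" using Py_not_trans[OF a] by blast
  obtain k where "b = (g ^^ k) a" using b(1) unfolding eq[symmetric] by blast
  then show False using b(2) Py.funpow_mem[OF g] by blast
qed

text \<open>On a block of two points there are only the identity and the swap, and these commute; so
  all of \<open>K\<close> centralises \<open>N\<close>.\<close>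

lemma K_eq_P_of_card2:
  assumes q: "\<And>a. a \<in> A \<Longrightarrow> card (fib a) = 2" and g: "g \<in> K"
  shows "g \<in> P" and "a \<in> A \<Longrightarrow> g (g a) = a"
proof -
  have two: "u = v" if uv: "a \<in> A" "u \<in> fib a" "v \<in> fib a" "u \<noteq> a" "v \<noteq> a" for a u v
  proof -
    obtain x z where xz: "fib a = {x, z}" using q[OF uv(1)] by (meson card_2_iff)
    then show ?thesis using uv fib_self[OF uv(1)] by auto
  qed
  have gG: "g \<in> G" using g K_G by blast
  have gf: "g b \<in> fib b" if "b \<in> A" for b using K_fib[OF g fib_self[OF that]] .
  have "g (n a) = n (g a)" if n: "n \<in> N" and a: "a \<in> A" for n a
  proof -
    have nG: "n \<in> G" "n \<in> K" using n N_G N(2) by auto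
    have nf: "n b \<in> fib b" if "b \<in> A" for b using K_fib[OF nG(2) fib_self[OF that]] .
    consider "g a = a" | "n a = a" | "g a \<noteq> a" "n a \<noteq> a" by blast
    then show ?thesis
    proof cases
      case 1
      show ?thesis
      proof (cases "n a = a")
        case False
        have "g (n a) \<in> fib a" by (rule K_fib[OF g nf[OF a]])
        moreover have "g (n a) \<noteq> a" using 1 False gG by (metis inj_iff)
        ultimately have "g (n a) = n a" using False by (intro two[OF a _ nf[OF a]])
        then show ?thesis using 1 by simp
      qed (use 1 in simp)
    next
      case 2
      show ?thesis
      proof (cases "g a = a")
        case False
        have "n (g a) \<in> fib a" by (rule K_fib[OF nG(2) gf[OF a]])
        moreover have "n (g a) \<noteq> a" using 2 False nG by (metis inj_iff)
        ultimately have "n (g a) = g a" using False by (intro two[OF a _ gf[OF a]])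
        then show ?thesis using 2 by simp
      qed (use 2 in simp)
    next
      case 3
      then have "g a = n a" by (intro two[OF a gf[OF a] nf[OF a]])
      moreover have "g (n a) = a" "n (g a) = a"
      proof -
        have "n a \<in> A" using nf[OF a] fib_sub by blast
        have "a \<in> fib (n a)" using nf[OF a] a by (simp add: fib_def)
        have "g (n a) \<in> fib (n a)" "n (n a) \<in> fib (n a)" using gf nf \<open>n a \<in> A\<close> by auto
        moreover have "g (n a) \<noteq> n a" using 3 \<open>g a = n a\<close> gG by (metis inj_iff)
        moreover have "n (n a) \<noteq> n a" using 3 nG by (metis inj_iff)
        ultimately have "g (n a) = a" "n (n a) = a"
          by (intro two[OF \<open>n a \<in> A\<close> _ \<open>a \<in> fib (n a)\<close> _ 3(2)[symmetric]]; simp)+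
        then show "g (n a) = a" "n (g a) = a" using \<open>g a = n a\<close> by auto
      qed
      ultimately show ?thesis by simp
    qed
  qed
  then show gP: "g \<in> P" using g by (simp add: P_def)
  assume a: "a \<in> A"
  have "p = 2" using card_fib[OF a] q[OF a] by auto
  then show "g (g a) = a" using P_exp[OF gP a] by (simp add: numeral_2_eq_2)
qed

text \<open>Two different images of a would give four distinct points a, e a, e' a, e (e' a), and
  \<open>Py\<close> would be transitive on the block.\<close>

lemma Py_unique_on_fib:
  assumes q: "card (fib a) = 4" "p = 2" and a: "a \<in> A"
    and e: "e \<in> Py" "e a \<noteq> a" and e': "e' \<in> Py" "e' a \<noteq> a"
  shows "e a = e' a"
proof (rule ccontr)
  assume ne: "e a \<noteq> e' a"
  have P: "e \<in> P" "e' \<in> P" using Py_P[OF e(1)] Py_P[OF e'(1)] by simp_all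
  have G: "e \<in> G" "e' \<in> G" using P_G[OF P(1)] P_G[OF P(2)] by simp_all
  have ee: "e (e a) = a" using P_exp[OF P(1) a] q(2) by (simp add: numeral_2_eq_2)
  have "e (e' a) \<noteq> a" using ne ee G by (metis inj_iff)
  moreover have "e (e' a) \<noteq> e a" using e'(2) G by (metis inj_iff)
  moreover have "e (e' a) \<noteq> e' a"
  proof -
    have "e (e' a) = e' (e a)" by (rule P_ab[OF P a])
    then show ?thesis using e(2) G by (metis inj_iff)
  qed
  ultimately have c: "card {a, e a, e' a, e (e' a)} = 4" using ne e(2) e'(2) by auto
  have mem: "e a \<in> fib a" "e' a \<in> fib a" "e (e' a) \<in> fib a"
    using K_fib[OF P_K[OF P(1)]] K_fib[OF P_K[OF P(2)]] fib_self[OF a] by blast+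
  have eq: "{a, e a, e' a, e (e' a)} = fib a"
    by (rule card_subset_eq[OF fin_fib]) (use mem fib_self[OF a] c q in auto)
  obtain b where b: "b \<in> fib a" "\<forall>g\<in>Py. g a \<noteq> b" using Py_not_trans[OF a] by blast
  then consider "b = id a" | "b = e a" | "b = e' a" | "b = (e \<circ> e') a" unfolding eq[symmetric] by auto
  then show False using b(2) Py.id_mem e(1) e'(1) Py.comp_mem[OF e(1) e'(1)] by cases metis+
qed

text \<open>The elements of \<open>P\<close> all of whose conjugates fix \<open>y\<close> form a
  normal subgroup \<open>R\<close> inside \<open>Py\<close>. By primitivity and
  \<open>Py_not_trans\<close> it is trivial on \<open>A\<close>. Now an element of \<open>P\<close>
  with a fixed point is trivial on a block, its conjugates are as well, and \<open>fix_y\<close>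
  shows that all of them fix \<open>y\<close>.\<close>

lemma card4_orbit2:
  assumes q: "\<And>a. a \<in> A \<Longrightarrow> card (fib a) = 4" and O2: "card Oy = 2"
    and g: "g \<in> P" "a \<in> A" "g a = a"
  shows "\<forall>b\<in>A. g b = b"
proof -
  \<comment> \<open>Otherwise h exchanges the two points of \<open>Oy\<close>. Take d in
    \<open>P\<close> with d c outside the orbit of c under \<open>Py\<close>. Either d or h^-1 d
    fixes \<open>y\<close>, and both take c to the same point, since h is trivial on the
    block.\<close>
  have fix_y: "h y = y" if h: "h \<in> P" "c \<in> A" "\<forall>b\<in>fib c. h b = b" for h c
  proof (rule ccontr)
    assume ne: "h y \<noteq> y"
    have "{y, h y} \<subseteq> Oy" using y_Oy P_Oy[OF h(1) y_Oy] by blast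
    moreover have "card {y, h y} = card Oy" using ne[symmetric] O2 by simp
    ultimately have "{y, h y} = Oy" by (rule card_subset_eq[OF fin_Oy])
    obtain b where b: "b \<in> fib c" "\<forall>g\<in>Py. g c \<noteq> b" using Py_not_trans[OF h(2)] by blast
    obtain d where d: "d \<in> P" "d c = b" using P_fib_trans[OF h(2) b(1)] by blast
    have "d y \<in> {y, h y}" unfolding \<open>{y, h y} = Oy\<close> by (rule P_Oy[OF d(1) y_Oy])
    then consider "d y = y" | "d y = h y" by auto
    then show False
    proof cases
      case 1
      then show False using b(2) d by (simp add: Py_def)
    next
      case 2
      have "finv h \<circ> d \<in> Py"
        using P.comp_mem[OF P.finv_mem[OF h(1)] d(1)] 2 P.finv_left[OF h(1)] by (simp add: Py_def)
      moreover have "(finv h \<circ> d) c = b" using d(2) h(3) b(1) P.finv_left[OF h(1), of b] by simp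
      ultimately show False using b(2) by blast
    qed
  qed
  define R where "R = {h \<in> P. \<forall>u\<in>G. (u \<circ> h \<circ> finv u) y = y}"
  have R: "perm_group R"
  proof (rule perm_groupI_finv[OF P_group])
    show "R \<subseteq> P" by (auto simp: R_def)
    show "id \<in> R" by (simp add: R_def P.id_mem)
    show "h \<circ> k \<in> R" if hk: "h \<in> R" "k \<in> R" for h k
    proof -
      have "(u \<circ> (h \<circ> k) \<circ> finv u) y = y" if u: "u \<in> G" for u
      proof -
        have "(u \<circ> (h \<circ> k) \<circ> finv u) y = (u \<circ> h \<circ> finv u) ((u \<circ> k \<circ> finv u) y)" using u by simp
        also have "(u \<circ> k \<circ> finv u) y = y" using hk(2) u by (simp add: R_def)
        also have "(u \<circ> h \<circ> finv u) y = y" using hk(1) u by (simp add: R_def)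
        finally show ?thesis .
      qed
      then show ?thesis using hk P.comp_mem by (simp add: R_def)
    qed
    show "finv h \<in> R" if h: "h \<in> R" for h
    proof -
      have hP: "h \<in> P" using h by (simp add: R_def)
      have "(u \<circ> finv h \<circ> finv u) y = y" if u: "u \<in> G" for u
      proof -
        have "u (h (finv u y)) = y" using h u by (simp add: R_def)
        then have "h (finv u y) = finv u y" using finv_left[OF u] by metis
        then have "finv h (finv u y) = finv u y" using P.finv_left[OF hP] by metis
        then show ?thesis using u by simp
      qed
      then show ?thesis using P.finv_mem[OF hP] by (simp add: R_def)
    qed
  qed
  have R_normal: "v \<circ> h \<circ> finv v \<in> R" if v: "v \<in> G" and h: "h \<in> R" for v h
  proof -
    have hP: "h \<in> P" using h by (simp add: R_def)
    have "(u \<circ> (v \<circ> h \<circ> finv v) \<circ> finv u) y = y" if u: "u \<in> G" for u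
    proof -
      have uv: "u \<circ> v \<in> G" by (rule comp_mem[OF u v])
      have "finv (u \<circ> v) = finv v \<circ> finv u" using bij[OF u] bij[OF v] by (simp add: o_inv_distrib)
      moreover have "((u \<circ> v) \<circ> h \<circ> finv (u \<circ> v)) y = y" using h uv by (simp add: R_def del: comp_apply)
      ultimately show ?thesis by simp
    qed
    then show ?thesis using P_normal[OF v hP] by (simp add: R_def)
  qed
  have RK: "R \<subseteq> K" using P_K by (auto simp: R_def)
  have R_triv: "h b = b" if h: "h \<in> R" and b: "b \<in> A" for h b
  proof (rule ccontr)
    assume "h b \<noteq> b"
    from normal_orbit[OF R RK R_normal h b this] have orb: "(\<lambda>n. n b) ` R = fib b" by simp
    obtain c where c: "c \<in> fib b" "\<forall>g\<in>Py. g b \<noteq> c" using Py_not_trans[OF b] by blast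
    then obtain n where n: "n \<in> R" "c = n b" unfolding orb[symmetric] by blast
    have "(id \<circ> n \<circ> finv id) y = y" using n(1) id_mem unfolding R_def by blast
    then have "n \<in> Py" using n(1) by (simp add: Py_def R_def)
    then show False using c n by blast
  qed
  have "g \<in> R"
  proof -
    have "(u \<circ> g \<circ> finv u) y = y" if u: "u \<in> G" for u
    proof (rule fix_y[OF P_normal[OF u g(1)] GA[OF u g(2)]])
      show "\<forall>b\<in>fib (u a). (u \<circ> g \<circ> finv u) b = b"
      proof
        fix b assume "b \<in> fib (u a)"
        then obtain c where c: "c \<in> fib a" "b = u c" unfolding fib_image[OF u g(2)] by blast
        have "g c = id c" by (rule P_eq_on_fib[OF g(1) P.id_mem g(2) _ c(1)]) (simp add: g(3))
        then show "(u \<circ> g \<circ> finv u) b = b" using u c(2) by simp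
      qed
    qed
    then show ?thesis using g(1) by (simp add: R_def)
  qed
  then show ?thesis using R_triv by blast
qed

text \<open>Some power \<open>\<tau>\<close> of \<open>\<sigma>\<close> in \<open>K\<close> is a
  4-cycle on every block. On each block its square is the unique involution induced by
  \<open>Py\<close>, and the same holds for the conjugates of \<open>\<tau>\<close>. So the square
  is invariant under conjugation on \<open>A\<close>, and the normal subgroup belonging to it has
  orbits of size 2 in blocks of size 4, against primitivity.\<close>

lemma card4_orbit4:
  assumes q: "\<And>a. a \<in> A \<Longrightarrow> card (fib a) = 4" and O4: "card Oy = 4"
    and tr: "\<And>b. b \<in> B \<Longrightarrow> \<exists>k. (\<sigma> ^^ k) y = b"
    and e0: "e0 \<in> Py" "a0 \<in> A" "e0 a0 \<noteq> a0"
  shows False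
proof -
  have p2: "p = 2" using card_fib[OF e0(2)] q[OF e0(2)] p by auto
  obtain j0 where j0: "j0 > 0" "\<sigma> ^^ j0 \<in> K" "\<And>b. b \<in> A \<Longrightarrow> fib b = range (\<lambda>k. ((\<sigma> ^^ j0) ^^ k) b)"
    using fib_cyclic[OF e0(2)] by metis
  define \<tau> where "\<tau> = \<sigma> ^^ j0"
  have \<tau>: "\<tau> \<in> K" "\<tau> \<in> G" "\<And>b. b \<in> A \<Longrightarrow> fib b = range (\<lambda>k. (\<tau> ^^ k) b)"
    using j0 K_G by (auto simp: \<tau>_def)
  have cyc4: "(t ^^ 4) b = b" "t (t b) \<noteq> b"
    if t: "t \<in> G" and b: "b \<in> A" and cyc: "fib b = range (\<lambda>k. (t ^^ k) b)" for t b
  proof -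
    have inj: "inj t" using bij[OF t] bij_is_inj by blast
    obtain n where n: "n > 0" "\<forall>a\<in>A. (t ^^ n) a = a"
      using finite_perm_period[OF finA GA[OF t] inj] by blast
    have nb: "(t ^^ n) b = b" using n(2) b by blast
    show "(t ^^ 4) b = b" using cyclic_orbit(2)[OF inj nb n(1)] q[OF b] cyc by simp
    show "t (t b) \<noteq> b"
    proof
      assume "t (t b) = b"
      then have "(t ^^ 2) b = b" by (simp add: numeral_2_eq_2)
      from cyclic_orbit(1)[OF inj this] have "card (fib b) dvd 2" using cyc by simp
      then show False using q[OF b] by simp
    qed
  qed
  obtain j where j: "j > 0" "(\<sigma> ^^ j) ` Oy = Oy" "\<And>i. (\<sigma> ^^ i) ` Oy = Oy \<Longrightarrow> j dvd i"
    "Oy = range (\<lambda>k. ((\<sigma> ^^ j) ^^ k) y)" using Oy_cyclic by metis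
  have sj: "\<sigma> ^^ j \<in> G" by (rule funpow_mem[OF \<sigma>])
  have "(\<sigma> ^^ (j0 * 4)) y = y"
  proof (rule faithful)
    show "\<sigma> ^^ (j0 * 4) \<in> G" by (rule funpow_mem[OF \<sigma>])
    show "(\<sigma> ^^ (j0 * 4)) a = a" if "a \<in> A" for a
      using cyc4(1)[OF \<tau>(2) that \<tau>(3)[OF that]] by (simp add: \<tau>_def funpow_mult mult.commute)
  qed
  then have y4: "(\<sigma> ^^ (j0 * 4)) y = y" .
  have "(\<sigma> ^^ (j0 * 4)) ` Oy = Oy"
    using Oy_block[OF funpow_mem[OF \<sigma>] y_Oy] y4 y_Oy by simp
  then have "j dvd j0 * 4" by (rule j(3))
  then obtain i where i: "j0 * 4 = j * i" by (rule dvdE)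
  have "((\<sigma> ^^ j) ^^ i) y = y" using y4 i by (simp add: funpow_mult mult.commute)
  moreover have "i > 0" using i j0(1) by (cases i) auto
  ultimately have "card (range (\<lambda>k. ((\<sigma> ^^ j) ^^ k) y)) dvd i"
    by (rule cyclic_orbit(1)[OF bij_is_inj[OF bij[OF sj]]])
  \<comment> \<open>\<sigma>^j is a 4-cycle on \<open>Oy\<close>, and its i-th power \<sigma>^(4 j0)
    fixes \<open>y\<close>. With 4 dividing i, \<open>\<tau>\<close> becomes a power of \<sigma>^j
    and preserves \<open>Oy\<close>.\<close>
  then have "4 dvd i" using O4 j(4) by simp
  then have "j dvd j0" using i by auto
  then obtain l where l: "j0 = j * l" by (rule dvdE)
  have \<tau>O: "\<tau> ` Oy = Oy"
  proof -
    have "((\<sigma> ^^ j) ^^ m) ` Oy = Oy" for m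
    proof (induction m)
      case (Suc m)
      have "((\<sigma> ^^ j) ^^ Suc m) ` Oy = (\<sigma> ^^ j) ` (((\<sigma> ^^ j) ^^ m) ` Oy)"
        by (simp only: funpow.simps(2) image_comp)
      then show ?case using Suc j(2) by simp
    qed simp
    from this[of l] show ?thesis by (simp add: \<tau>_def l funpow_mult mult.commute)
  qed
  have gO: "g ` Oy = (\<sigma> ^^ k) ` Oy" if g: "g \<in> G" "(\<sigma> ^^ k) y = g y" for g k
  proof -
    have sk: "\<sigma> ^^ k \<in> G" by (rule funpow_mem[OF \<sigma>])
    define u where "u = finv (\<sigma> ^^ k) \<circ> g"
    have "u \<in> G" unfolding u_def by (rule comp_mem[OF finv_mem[OF sk] g(1)])
    moreover have "u y = y" using finv_left[OF sk, of y] g(2) by (simp add: u_def)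
    ultimately have "u ` Oy = Oy" using Oy_block[OF _ y_Oy] y_Oy by simp
    then have "(\<sigma> ^^ k) ` Oy = (\<sigma> ^^ k) ` (u ` Oy)" by simp
    also have "\<dots> = g ` Oy" using finv_right[OF sk] by (simp add: image_image u_def)
    finally show ?thesis by simp
  qed
  \<comment> \<open>As \<open>\<sigma>\<close> is transitive on \<open>B\<close>, g maps
    \<open>Oy\<close> to the same block as some \<sigma>^k. Since \<open>\<tau>\<close> commutes
    with \<sigma>^k, it takes g y into the image of \<open>Oy\<close> under g.\<close>
  have conj_y: "(finv g \<circ> \<tau> \<circ> g) y \<in> Oy" if g: "g \<in> G" for g
  proof -
    have "g y \<in> B" unfolding B using g by blast
    then obtain k where k: "(\<sigma> ^^ k) y = g y" using tr by blast
    have com: "\<tau> ((\<sigma> ^^ k) b) = (\<sigma> ^^ k) (\<tau> b)" for b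
      by (metis \<tau>_def add.commute comp_apply funpow_add)
    have "\<tau> (g y) = (\<sigma> ^^ k) (\<tau> y)" using com k by metis
    also have "\<dots> \<in> (\<sigma> ^^ k) ` Oy" using \<tau>O y_Oy by blast
    also have "(\<sigma> ^^ k) ` Oy = g ` Oy" using gO[OF g k] by simp
    finally obtain b where "b \<in> Oy" "\<tau> (g y) = g b" by blast
    then show ?thesis using g by simp
  qed
  have nontriv: "\<exists>e\<in>Py. e a \<noteq> a" if a: "a \<in> A" for a
  proof -
    obtain g where g: "g \<in> G" "g y = y" "g (pr a0) = pr a" using pr_trans[OF e0(2) a] by blast
    define e where "e = g \<circ> e0 \<circ> finv g"
    have e: "e \<in> Py" unfolding e_def by (rule Py_normal[OF g(1,2) e0(1)])
    have "e (g a0) \<noteq> g a0" using e0(3) g(1) by (simp add: e_def)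
    moreover have "g a0 \<in> fib a" using GA[OF g(1) e0(2)] pr[OF g(1) e0(2)] g(3) by (simp add: fib_def)
    ultimately have "e a \<noteq> a"
      using P_eq_on_fib[OF Py_P[OF e] P.id_mem a] by auto
    then show ?thesis using e by blast
  qed
  \<comment> \<open>Write t = d \<beta> with d in \<open>P\<close> and \<beta> fixing
    \<open>y\<close>. Conjugation by \<beta> preserves \<open>Py\<close>, so by uniqueness on the
    block \<beta> commutes with e there, and so does d because \<open>P\<close> is abelian on
    \<open>A\<close>. A nontrivial involution that commutes with the 4-cycle t is its
    square.\<close>
  have sq: "t (t a) = e a"
    if t: "t \<in> K" "t y \<in> Oy" and a: "a \<in> A" and cyc: "fib a = range (\<lambda>k. (t ^^ k) a)"
      and e: "e \<in> Py" "e a \<noteq> a" for t a e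
  proof -
    have tG: "t \<in> G" using t(1) K_G by blast
    have eP: "e \<in> P" using Py_P[OF e(1)] .
    have move: "e b \<noteq> b" if b: "b \<in> fib a" for b
    proof
      assume eb: "e b = b"
      have ab: "a \<in> fib b" using fib_eq[OF b] fib_self[OF a] by simp
      have "e a = id a" by (rule P_eq_on_fib[OF eP P.id_mem fib_sub[OF b] _ ab]) (simp add: eb)
      then show False using e(2) by simp
    qed
    have com: "t (e b) = e (t b)" if b: "b \<in> fib a" for b
    proof -
      have bA: "b \<in> A" using fib_sub[OF b] .
      obtain d where d: "d \<in> P" "t y = d y" using t(2) unfolding Oy_def by blast
      define \<beta> where "\<beta> = finv d \<circ> t"
      have \<beta>: "\<beta> \<in> G" "\<beta> y = y"
        using comp_mem[OF finv_mem[OF P_G[OF d(1)]] tG] d P.finv_left[OF d(1)] by (auto simp: \<beta>_def)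
      have \<beta>K: "\<beta> \<in> K" unfolding \<beta>_def
        by (rule perm_group.comp_mem[OF K_group perm_group.finv_mem[OF K_group P_K[OF d(1)]] t(1)])
      define e' where "e' = \<beta> \<circ> e \<circ> finv \<beta>"
      have e': "e' \<in> Py" unfolding e'_def by (rule Py_normal[OF \<beta> e(1)])
      have \<beta>b: "\<beta> b \<in> fib a" by (rule K_fib[OF \<beta>K b])
      have e'b: "e' (\<beta> b) = \<beta> (e b)" using \<beta>(1) by (simp add: e'_def)
      have "e' (\<beta> b) \<noteq> \<beta> b" using move[OF b] \<beta>(1) e'b by simp
      then have "e' (\<beta> b) = e (\<beta> b)"
        using Py_unique_on_fib[OF q[OF fib_sub[OF \<beta>b]] p2 fib_sub[OF \<beta>b] e' _ e(1) move[OF \<beta>b]] by blast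
      then have "d (\<beta> (e b)) = d (e (\<beta> b))" using e'b by simp
      also have "\<dots> = e (d (\<beta> b))" by (rule P_ab[OF d(1) eP fib_sub[OF \<beta>b]])
      finally show ?thesis using P_G[OF d(1)] by (simp add: \<beta>_def)
    qed
    have tk: "(t ^^ k) a \<in> fib a" for k unfolding cyc by blast
    have comk: "e ((t ^^ k) a) = (t ^^ k) (e a)" for k
    proof (induction k)
      case (Suc k)
      show ?case using com[OF tk[of k]] Suc by simp
    qed simp
    have "e a \<in> fib a" by (rule K_fib[OF P_K[OF eP] fib_self[OF a]])
    then obtain k where k: "e a = (t ^^ k) a" unfolding cyc by blast
    have t4: "(t ^^ 4) a = a" by (rule cyc4(1)[OF tG a cyc])
    define m where "m = k mod 4"
    have m: "e a = (t ^^ m) a" "m < 4" using k funpow_mod[OF t4, of k] by (auto simp: m_def)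
    have "e (e a) = a" using P_exp[OF eP a] p2 by (simp add: numeral_2_eq_2)
    then have "(t ^^ (m + m)) a = a" using comk[of m] m(1) by (simp add: funpow_add)
    moreover have "m \<noteq> 0" using m(1) e(2) by (metis funpow_0)
    moreover have "t (t a) \<noteq> a" by (rule cyc4(2)[OF tG a cyc])
    then have "(t ^^ 2) a \<noteq> a" by (simp add: numeral_2_eq_2)
    ultimately have "m = 2"
    proof -
      assume mm: "(t ^^ (m + m)) a = a" and m0: "m \<noteq> 0" and ne: "(t ^^ 2) a \<noteq> a"
      have "m = 1 \<or> m = 2 \<or> m = 3" using m(2) m0 by auto
      moreover have "m \<noteq> 1" using mm ne by (auto simp: numeral_2_eq_2)
      moreover have "m \<noteq> 3"
      proof
        assume "m = 3"
        then have "(t ^^ 6) a = a" using mm by simp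
        then show False using ne funpow_mod[OF t4, of 6] by simp
      qed
      ultimately show ?thesis by blast
    qed
    then show ?thesis using m(1) by (simp add: numeral_2_eq_2)
  qed
  have conj_sq: "finv g (\<tau> (\<tau> (g a))) = \<tau> (\<tau> a)" if g: "g \<in> G" and a: "a \<in> A" for g a
  proof -
    obtain e where e: "e \<in> Py" "e a \<noteq> a" using nontriv[OF a] by blast
    define t where "t = finv g \<circ> \<tau> \<circ> finv (finv g)"
    have teq: "t = finv g \<circ> \<tau> \<circ> g" unfolding t_def using finv_finv[OF g] by simp
    have t: "t \<in> K" unfolding t_def by (rule K_normal[OF finv_mem[OF g] \<tau>(1)])
    have ty: "t y \<in> Oy" unfolding teq by (rule conj_y[OF g])
    have tpow: "(t ^^ k) a = finv g ((\<tau> ^^ k) (g a))" for k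
      using conj_funpow[OF finv_mem[OF g], where h = \<tau> and k = k and x = a] finv_finv[OF g]
      by (simp add: t_def)
    have "fib a = finv g ` fib (g a)" using fib_image[OF g a] g by (simp add: image_image)
    then have cyc: "fib a = range (\<lambda>k. (t ^^ k) a)"
      using \<tau>(3)[OF GA[OF g a]] by (simp add: image_image tpow)
    have "t (t a) = e a" by (rule sq[OF t ty a cyc e])
    moreover have "\<tau> (\<tau> a) = e a"
      by (rule sq[OF \<tau>(1) _ a \<tau>(3)[OF a] e]) (use \<tau>O y_Oy in blast)
    moreover have "t (t a) = finv g (\<tau> (\<tau> (g a)))" using g by (simp add: teq)
    ultimately show ?thesis by simp
  qed
  \<comment> \<open>The group of order two generated by the square of \<open>\<tau>\<close>,
    enlarged by the elements that are trivial on \<open>A\<close>.\<close>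
  define R where "R = {h \<in> K. (\<forall>a\<in>A. h a = a) \<or> (\<forall>a\<in>A. h a = \<tau> (\<tau> a))}"
  have \<tau>\<tau>: "\<tau> (\<tau> (\<tau> (\<tau> a))) = a" if "a \<in> A" for a
    using cyc4(1)[OF \<tau>(2) that \<tau>(3)[OF that]] by (simp add: numeral_eq_Suc)
  have \<tau>A: "\<tau> (\<tau> a) \<in> A" if "a \<in> A" for a using GA \<tau>(2) that by blast
  interpret K: perm_group K by (rule K_group)
  have R: "perm_group R"
  proof (rule perm_groupI_finv[OF K_group])
    show "h \<circ> k \<in> R" if "h \<in> R" "k \<in> R" for h k
      using that K.comp_mem[of h k] \<tau>\<tau> \<tau>A by (auto simp: R_def)
    show "finv h \<in> R" if h: "h \<in> R" for h
    proof -
      have hK: "h \<in> K" using h by (simp add: R_def)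
      from h consider "\<forall>a\<in>A. h a = a" | "\<forall>a\<in>A. h a = \<tau> (\<tau> a)" by (auto simp: R_def)
      then show ?thesis
      proof cases
        case 1
        then have "\<forall>a\<in>A. finv h a = a" using K.finv_left[OF hK] by metis
        then show ?thesis using K.finv_mem[OF hK] by (simp add: R_def)
      next
        case 2
        have "finv h a = \<tau> (\<tau> a)" if a: "a \<in> A" for a
        proof -
          have "h (\<tau> (\<tau> a)) = a" using 2 \<tau>A[OF a] \<tau>\<tau>[OF a] by simp
          then show ?thesis using K.finv_left[OF hK] by metis
        qed
        then show ?thesis using K.finv_mem[OF hK] by (simp add: R_def)
      qed
    qed
  qed (auto simp: R_def K.id_mem)
  have R_normal: "g \<circ> h \<circ> finv g \<in> R" if g: "g \<in> G" and h: "h \<in> R" for g h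
  proof -
    have hK: "h \<in> K" using h by (simp add: R_def)
    have gK: "g \<circ> h \<circ> finv g \<in> K" by (rule K_normal[OF g hK])
    from h consider "\<forall>a\<in>A. h a = a" | "\<forall>a\<in>A. h a = \<tau> (\<tau> a)" by (auto simp: R_def)
    then show ?thesis
    proof cases
      case 1
      then have "\<forall>a\<in>A. (g \<circ> h \<circ> finv g) a = a" using GA[OF finv_mem[OF g]] g by simp
      then show ?thesis using gK unfolding R_def by blast
    next
      case 2
      have "(g \<circ> h \<circ> finv g) a = \<tau> (\<tau> a)" if a: "a \<in> A" for a
        using 2 GA[OF finv_mem[OF g] a] conj_sq[OF finv_mem[OF g] a] finv_finv[OF g] by simp
      then show ?thesis using gK unfolding R_def by blast
    qed
  qed
  have ttR: "\<tau> \<circ> \<tau> \<in> R" using K.comp_mem[OF \<tau>(1) \<tau>(1)] by (simp add: R_def)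
  have "(\<tau> \<circ> \<tau>) a0 \<noteq> a0" using cyc4(2)[OF \<tau>(2) e0(2) \<tau>(3)[OF e0(2)]] by simp
  from normal_orbit[OF R _ R_normal ttR e0(2) this]
  have "(\<lambda>n. n a0) ` R = fib a0" by (auto simp: R_def)
  moreover have "(\<lambda>n. n a0) ` R \<subseteq> {a0, \<tau> (\<tau> a0)}" using e0(2) by (auto simp: R_def)
  ultimately have "card (fib a0) \<le> card {a0, \<tau> (\<tau> a0)}" by (intro card_mono) auto
  also have "\<dots> \<le> 2" by (simp add: card_insert_if)
  finally show False using q[OF e0(2)] by simp
qed

text \<open>Block size p: \<open>Py\<close> is trivial on \<open>A\<close>, so \<open>Oy\<close>
  maps onto a block and has p or 4 elements. The first gives regularity; the second, with p = 2, is
  the exceptional alternative, where the image of \<open>K\<close> on \<open>A\<close> corresponds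
  to \<open>Oy\<close>. Block size 4: if \<open>Py\<close> is trivial on \<open>A\<close>, the sizes
  agree again. Otherwise |A| is even, so \<open>\<sigma>\<close> is transitive on \<open>B\<close>,
  and the orbit sizes 1, 2 and 4 are settled one by one.\<close>

theorem kernel_dichotomy:
  "(\<forall>g\<in>K. \<forall>a\<in>A. (\<forall>b\<in>fib a. g b = b) \<longrightarrow> (\<forall>b\<in>A. g b = b)) \<or>
   (\<forall>a\<in>A. card (fib a) = 2) \<and> (\<forall>g\<in>K. \<forall>a\<in>A. g (g a) = a) \<and> card ((\<lambda>g. restrict g A) ` K) = 4"
proof -
  obtain a0 where a0: "a0 \<in> A" using neA by blast
  have qeq: "card (fib a) = card (fib a0)" if "a \<in> A" for a using card_fib_eq[OF that a0] .
  have diag: ?thesis if reg: "\<And>g a. \<lbrakk>g \<in> P; a \<in> A; g a = a\<rbrakk> \<Longrightarrow> \<forall>b\<in>A. g b = b"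
  proof -
    have "\<forall>b\<in>A. g b = b" if "g \<in> K" "a \<in> A" "\<forall>b\<in>fib a. g b = b" for g a
      by (rule diagonalI[OF _ that(1,2)]) (use reg that(3) in blast)+
    then show ?thesis by blast
  qed
  have surj: "card (fib a0) \<le> card Oy" if triv: "\<forall>g\<in>Py. \<forall>a\<in>A. g a = a"
  proof -
    obtain F where F: "F ` Oy = fib a0" "\<forall>g\<in>P. F (g y) = g a0" by (rule orbit_to_fib[OF triv a0])
    then show ?thesis using card_image_le[OF fin_Oy, of F] by simp
  qed
  have reg: ?thesis if triv: "\<forall>g\<in>Py. \<forall>a\<in>A. g a = a" and c: "card Oy = card (fib a0)"
  proof (rule diag)
    show "\<forall>b\<in>A. g b = b" if "g \<in> P" "a \<in> A" "g a = a" for g a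
      by (rule regular_of_card[OF triv that(2) _ that(1,3)]) (use c qeq[OF that(2)] in simp)
  qed
  from card_fib[OF a0] consider "card (fib a0) = p" | "p = 2" "card (fib a0) = 4" by blast
  then show ?thesis
  proof cases
    case 1
    have triv: "\<forall>g\<in>Py. \<forall>a\<in>A. g a = a" using Py_trivial_of_prime qeq 1 by auto
    from surj[OF triv] card_Oy 1 consider "card Oy = p" | "p = 2" "card Oy = 4"
      using prime_gt_1_nat[OF p] by auto
    then show ?thesis
    proof cases
      case 1
      then show ?thesis using reg[OF triv] \<open>card (fib a0) = p\<close> by simp
    next
      case 2
      have q2: "card (fib a) = 2" if "a \<in> A" for a using qeq[OF that] 1 2 by simp
      have KP: "g \<in> P" if "g \<in> K" for g by (rule K_eq_P_of_card2(1)[OF q2 that])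
      define F where "F b = restrict (SOME g. g \<in> P \<and> g y = b) A" for b
      have F: "F (g y) = restrict g A" if g: "g \<in> P" for g
      proof -
        have "(SOME h. h \<in> P \<and> h y = g y) \<in> P \<and> (SOME h. h \<in> P \<and> h y = g y) y = g y"
          using someI_ex[of "\<lambda>h. h \<in> P \<and> h y = g y"] g by blast
        then show ?thesis unfolding F_def by (intro restrict_ext) (rule orbit_map[OF triv _ g], auto)
      qed
      \<comment> \<open>g y determines g on \<open>A\<close> because \<open>Py\<close> is trivial
        there; conversely g on \<open>A\<close> determines g y by \<open>agree_B\<close>. Moreover
        \<open>K\<close> equals \<open>P\<close>.\<close>
      have "bij_betw F Oy ((\<lambda>g. restrict g A) ` K)"
      proof (rule bij_betw_imageI)
        show "inj_on F Oy"
        proof (rule inj_onI)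
          fix b c assume "b \<in> Oy" "c \<in> Oy" and eq: "F b = F c"
          then obtain g h where gh: "g \<in> P" "b = g y" "h \<in> P" "c = h y" unfolding Oy_def by blast
          have "restrict g A = restrict h A" using eq F gh by simp
          then have "g a = h a" if "a \<in> A" for a using that by (metis restrict_apply')
          then show "b = c" using agree_B[OF P_G[OF gh(1)] P_G[OF gh(3)] _ y_B] gh by blast
        qed
        show "F ` Oy = (\<lambda>g. restrict g A) ` K"
        proof
          show "F ` Oy \<subseteq> (\<lambda>g. restrict g A) ` K" using F P_K by (auto simp: Oy_def)
          show "(\<lambda>g. restrict g A) ` K \<subseteq> F ` Oy"
          proof
            fix x assume "x \<in> (\<lambda>g. restrict g A) ` K"
            then obtain g where g: "g \<in> K" "x = restrict g A" by blast
            then show "x \<in> F ` Oy" using F[OF KP[OF g(1)]] KP[OF g(1)] by (auto simp: Oy_def intro!: image_eqI[of _ _ "g y"])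
          qed
        qed
      qed
      then have "card ((\<lambda>g. restrict g A) ` K) = 4" using 2 bij_betw_same_card by fastforce
      then show ?thesis using K_eq_P_of_card2(2)[OF q2] q2 by blast
    qed
  next
    case 2
    have q4: "card (fib a) = 4" if "a \<in> A" for a using qeq[OF that] 2 by simp
    show ?thesis
    proof (cases "\<forall>g\<in>Py. \<forall>a\<in>A. g a = a")
      case True
      then have "card Oy = card (fib a0)" using surj[OF True] card_Oy 2 by auto
      then show ?thesis by (rule reg[OF True])
    next
      case False
      have "even (card A)" using card_fib_dvd[OF a0] 2(2) by (metis dvd_trans even_numeral)
      then have tr: "\<exists>k. (\<sigma> ^^ k) y = b" if "b \<in> B" for b using orbits y_B that by blast
      \<comment> \<open>If \<open>P\<close> fixed \<open>y\<close>, then \<open>Py\<close> would be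
        all of \<open>P\<close>, which is transitive on each block.\<close>
      have "card Oy \<noteq> 1"
      proof
        assume "card Oy = 1"
        then obtain x where x: "Oy = {x}" by (rule card_1_singletonE)
        have fixy: "g y = y" if "g \<in> P" for g using P_Oy[OF that y_Oy] y_Oy x by simp
        obtain b where b: "b \<in> fib a0" "\<forall>g\<in>Py. g a0 \<noteq> b" using Py_not_trans[OF a0] by blast
        obtain g where "g \<in> P" "g a0 = b" using P_fib_trans[OF a0 b(1)] by blast
        then show False using b(2) fixy by (auto simp: Py_def)
      qed
      then consider "card Oy = 2" | "card Oy = 4" using card_Oy 2(1) by auto
      then show ?thesis
      proof cases
        case 1
        show ?thesis by (rule diag) (rule card4_orbit2[OF q4 1])
      next
        case 2
        then show ?thesis using card4_orbit4[OF q4 2 tr] False by blast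
      qed
    qed
  qed
qed

end

section \<open>Extension of field homomorphisms\<close>

text \<open>Closure under \<open>inverse\<close> needs no exception at 0, since inverse 0 = 0. The
  predicate is a record-free form of \<open>subfield\<close>, linked to it by
  \<open>subfield_on_iff\<close>.\<close>

definition subfield_on :: "'a::field set \<Rightarrow> bool" where
  "subfield_on S \<longleftrightarrow> 0 \<in> S \<and> 1 \<in> S \<and> (\<forall>x\<in>S. \<forall>y\<in>S. x + y \<in> S \<and> x * y \<in> S) \<and>
     (\<forall>x\<in>S. - x \<in> S \<and> inverse x \<in> S)"

definition polys_over :: "'a::field set \<Rightarrow> 'a poly set" where
  "polys_over S = {p. \<forall>i. Polynomial.coeff p i \<in> S}"

definition algebraic_over :: "'a::field set \<Rightarrow> 'a \<Rightarrow> bool" where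
  "algebraic_over S x \<longleftrightarrow> (\<exists>p\<in>polys_over S. p \<noteq> 0 \<and> poly p x = 0)"

definition field_hom_on :: "'a::field set \<Rightarrow> ('a \<Rightarrow> 'b::field) \<Rightarrow> bool" where
  "field_hom_on S \<phi> \<longleftrightarrow> \<phi> 1 = 1 \<and> (\<forall>x\<in>S. \<forall>y\<in>S. \<phi> (x + y) = \<phi> x + \<phi> y \<and> \<phi> (x * y) = \<phi> x * \<phi> y)"

lemma subfield_onD:
  assumes "subfield_on S"
  shows "0 \<in> S" "1 \<in> S" "\<lbrakk>x \<in> S; y \<in> S\<rbrakk> \<Longrightarrow> x + y \<in> S" "\<lbrakk>x \<in> S; y \<in> S\<rbrakk> \<Longrightarrow> x * y \<in> S"
    "x \<in> S \<Longrightarrow> - x \<in> S" "x \<in> S \<Longrightarrow> inverse x \<in> S" "\<lbrakk>x \<in> S; y \<in> S\<rbrakk> \<Longrightarrow> x - y \<in> S"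
    "\<lbrakk>x \<in> S; y \<in> S\<rbrakk> \<Longrightarrow> x / y \<in> S" "x \<in> S \<Longrightarrow> x ^ n \<in> S"
proof -
  show 1: "0 \<in> S" "1 \<in> S" "\<lbrakk>x \<in> S; y \<in> S\<rbrakk> \<Longrightarrow> x + y \<in> S" "\<lbrakk>x \<in> S; y \<in> S\<rbrakk> \<Longrightarrow> x * y \<in> S"
    "x \<in> S \<Longrightarrow> - x \<in> S" "x \<in> S \<Longrightarrow> inverse x \<in> S" for x y
    using assms by (auto simp: subfield_on_def)
  show "\<lbrakk>x \<in> S; y \<in> S\<rbrakk> \<Longrightarrow> x - y \<in> S" using 1(3)[of x "- y"] 1(5) by simp
  show "\<lbrakk>x \<in> S; y \<in> S\<rbrakk> \<Longrightarrow> x / y \<in> S" using 1(4)[of x "inverse y"] 1(6) by (simp add: divide_inverse)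
  show "x \<in> S \<Longrightarrow> x ^ n \<in> S" by (induction n) (use 1 in auto)
qed

lemma subfield_on_sum:
  assumes "subfield_on S" "\<And>i. i \<in> I \<Longrightarrow> f i \<in> S"
  shows "sum f I \<in> S"
  using assms(2) by (induction I rule: infinite_finite_induct) (auto simp: subfield_onD[OF assms(1)])

lemma subfield_on_UNIV [simp]: "subfield_on UNIV" by (simp add: subfield_on_def)

lemma subfield_on_iff: "subfield_on S \<longleftrightarrow> subfield S cl_ring"
proof -
  interpret field "cl_ring :: 'a ring" by (rule field_from_type_algebra)
  have [simp]: "carrier (cl_ring :: 'a ring) = UNIV" "one (cl_ring :: 'a ring) = 1"
    "ring.zero (cl_ring :: 'a ring) = 0"
    "monoid.mult (cl_ring :: 'a ring) = (\<lambda>x y. x * y)" "ring.add (cl_ring :: 'a ring) = (\<lambda>x y. x + y)"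
    by (simp_all add: ring_of_type_algebra_def)
  have neg: "a_inv (cl_ring :: 'a ring) x = - x" for x
    using minus_equality[of "-x" x] by simp
  have inv: "m_inv (cl_ring :: 'a ring) x = inverse x" if "x \<noteq> 0" for x
    using comm_inv_char[of x "inverse x"] that by simp
  show ?thesis
  proof
    assume S: "subfield_on S"
    show "subfield S cl_ring"
    proof (rule subfieldI')
      show "subring S cl_ring"
        by (rule subringI) (use S in \<open>auto simp: subfield_on_def neg\<close>)
      show "m_inv cl_ring k \<in> S" if "k \<in> S - {ring.zero cl_ring}" for k
        using that S by (simp add: inv subfield_on_def)
    qed
  next
    assume S: "subfield S cl_ring"
    interpret S: subfield S cl_ring by fact
    have i: "inverse x \<in> S" if "x \<in> S" for x
    proof (cases "x = 0")
      case False
      then show ?thesis using subfield_m_inv(1)[OF S, of x] that inv by simp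
    qed (use that in simp)
    have n: "- x \<in> S" if "x \<in> S" for x
      using subringE(5)[OF subfieldE(1)[OF S] that] neg by simp
    show "subfield_on S"
      using subringE[OF subfieldE(1)[OF S]] i n by (auto simp: subfield_on_def)
  qed
qed

lemma polys_over_0 [simp]: "subfield_on S \<Longrightarrow> 0 \<in> polys_over S"
  by (simp add: polys_over_def subfield_onD)

lemma polys_over_add: "\<lbrakk>subfield_on S; p \<in> polys_over S; q \<in> polys_over S\<rbrakk> \<Longrightarrow> p + q \<in> polys_over S"
  by (simp add: polys_over_def subfield_onD)

lemma polys_over_uminus: "\<lbrakk>subfield_on S; p \<in> polys_over S\<rbrakk> \<Longrightarrow> - p \<in> polys_over S"
  by (simp add: polys_over_def subfield_onD)

lemma polys_over_mult: "\<lbrakk>subfield_on S; p \<in> polys_over S; q \<in> polys_over S\<rbrakk> \<Longrightarrow> p * q \<in> polys_over S"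
  by (auto simp: polys_over_def coeff_mult subfield_onD intro!: subfield_on_sum)

lemma polys_over_monom: "\<lbrakk>subfield_on S; c \<in> S\<rbrakk> \<Longrightarrow> Polynomial.monom c n \<in> polys_over S"
  by (simp add: polys_over_def subfield_onD)

lemma polys_over_pCons: "\<lbrakk>p \<in> polys_over S; c \<in> S\<rbrakk> \<Longrightarrow> pCons c p \<in> polys_over S"
  by (auto simp: polys_over_def coeff_pCons split: nat.splits)

lemma polys_over_const: "\<lbrakk>subfield_on S; c \<in> S\<rbrakk> \<Longrightarrow> [:c:] \<in> polys_over S"
  by (simp add: polys_over_pCons)

lemma poly_polys_over: "\<lbrakk>subfield_on S; p \<in> polys_over S; x \<in> S\<rbrakk> \<Longrightarrow> poly p x \<in> S"
  by (auto simp: polys_over_def poly_altdef subfield_onD intro!: subfield_on_sum)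

lemma field_hom_on_props:
  assumes S: "subfield_on S" and \<phi>: "field_hom_on S \<phi>"
  shows "\<phi> 1 = 1" "\<phi> 0 = 0" "\<lbrakk>x \<in> S; y \<in> S\<rbrakk> \<Longrightarrow> \<phi> (x + y) = \<phi> x + \<phi> y"
    "\<lbrakk>x \<in> S; y \<in> S\<rbrakk> \<Longrightarrow> \<phi> (x * y) = \<phi> x * \<phi> y" "x \<in> S \<Longrightarrow> \<phi> (- x) = - \<phi> x"
    "x \<in> S \<Longrightarrow> \<phi> (inverse x) = inverse (\<phi> x)" "\<lbrakk>x \<in> S; y \<in> S\<rbrakk> \<Longrightarrow> \<phi> (x - y) = \<phi> x - \<phi> y"
    "\<lbrakk>x \<in> S; y \<in> S\<rbrakk> \<Longrightarrow> \<phi> (x / y) = \<phi> x / \<phi> y" "x \<in> S \<Longrightarrow> \<phi> x = 0 \<longleftrightarrow> x = 0"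
    "\<lbrakk>x \<in> S; y \<in> S\<rbrakk> \<Longrightarrow> \<phi> x = \<phi> y \<longleftrightarrow> x = y" "x \<in> S \<Longrightarrow> \<phi> (x ^ n) = \<phi> x ^ n"
proof -
  show 1: "\<phi> 1 = 1" and a: "\<lbrakk>x \<in> S; y \<in> S\<rbrakk> \<Longrightarrow> \<phi> (x + y) = \<phi> x + \<phi> y"
    and m: "\<lbrakk>x \<in> S; y \<in> S\<rbrakk> \<Longrightarrow> \<phi> (x * y) = \<phi> x * \<phi> y" for x y
    using \<phi> by (auto simp: field_hom_on_def)
  show z: "\<phi> 0 = 0" using a[of 0 0] subfield_onD(1)[OF S] by (metis add.right_neutral add_left_cancel)
  show n: "\<phi> (- x) = - \<phi> x" if "x \<in> S" for x
    using a[of x "- x"] z that subfield_onD[OF S] by (simp add: eq_neg_iff_add_eq_0 add.commute)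
  have i0: "\<phi> x * \<phi> (inverse x) = 1" if "x \<in> S" "x \<noteq> 0" for x
    using m[of x "inverse x"] 1 that subfield_onD[OF S] by simp
  show i: "\<phi> (inverse x) = inverse (\<phi> x)" if "x \<in> S" for x
    using i0[OF that] z by (cases "x = 0") (auto simp: inverse_unique)
  show d: "\<phi> (x - y) = \<phi> x - \<phi> y" if "x \<in> S" "y \<in> S" for x y
    using a[of x "- y"] n that subfield_onD[OF S] by simp
  show "\<phi> (x / y) = \<phi> x / \<phi> y" if "x \<in> S" "y \<in> S" for x y
    using m[of x "inverse y"] i that subfield_onD[OF S] by (simp add: divide_inverse)
  show e: "\<phi> x = 0 \<longleftrightarrow> x = 0" if "x \<in> S" for x using i0[OF that] z by (cases "x = 0") auto
  show "\<phi> x = \<phi> y \<longleftrightarrow> x = y" if "x \<in> S" "y \<in> S" for x y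
    using e[of "x - y"] d that subfield_onD[OF S] by simp
  show "\<phi> (x ^ n) = \<phi> x ^ n" if "x \<in> S" for x n
    by (induction n) (use that 1 m subfield_onD[OF S] in auto)
qed

lemma field_hom_on_sum:
  assumes S: "subfield_on S" and \<phi>: "field_hom_on S \<phi>" and f: "\<And>i. i \<in> I \<Longrightarrow> f i \<in> S"
  shows "\<phi> (sum f I) = (\<Sum>i\<in>I. \<phi> (f i))"
  using f by (induction I rule: infinite_finite_induct)
    (auto simp: field_hom_on_props[OF S \<phi>] subfield_on_sum[OF S])

lemma map_poly_hom:
  assumes S: "subfield_on S" and \<phi>: "field_hom_on S \<phi>" and p: "p \<in> polys_over S" and q: "q \<in> polys_over S"
  shows "map_poly \<phi> (p + q) = map_poly \<phi> p + map_poly \<phi> q"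
    and "map_poly \<phi> (p * q) = map_poly \<phi> p * map_poly \<phi> q"
    and "map_poly \<phi> (- p) = - map_poly \<phi> p"
    and "x \<in> S \<Longrightarrow> poly (map_poly \<phi> p) (\<phi> x) = \<phi> (poly p x)"
    and "map_poly \<phi> p = 0 \<longleftrightarrow> p = 0"
    and "Polynomial.degree (map_poly \<phi> p) = Polynomial.degree p"
proof -
  have [simp]: "\<phi> 0 = 0" using field_hom_on_props(2)[OF S \<phi>] .
  have pq: "Polynomial.coeff p i \<in> S" "Polynomial.coeff q i \<in> S" for i using p q by (auto simp: polys_over_def)
  show "map_poly \<phi> (p + q) = map_poly \<phi> p + map_poly \<phi> q"
    by (rule poly_eqI) (simp add: coeff_map_poly pq field_hom_on_props[OF S \<phi>])
  show "map_poly \<phi> (- p) = - map_poly \<phi> p"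
    by (rule poly_eqI) (simp add: coeff_map_poly pq field_hom_on_props[OF S \<phi>])
  show "map_poly \<phi> (p * q) = map_poly \<phi> p * map_poly \<phi> q"
    by (rule poly_eqI) (simp add: coeff_map_poly coeff_mult pq field_hom_on_sum[OF S \<phi>]
        field_hom_on_props[OF S \<phi>] subfield_onD[OF S])
  show deg: "Polynomial.degree (map_poly \<phi> p) = Polynomial.degree p"
  proof (cases "p = 0")
    case False
    then have "Polynomial.coeff (map_poly \<phi> p) (Polynomial.degree p) \<noteq> 0"
      by (simp add: coeff_map_poly field_hom_on_props(9)[OF S \<phi>] pq)
    then have "Polynomial.degree p \<le> Polynomial.degree (map_poly \<phi> p)" by (rule le_degree)
    then show ?thesis by (intro antisym map_poly_degree_leq) simp_all
  qed simp
  show "x \<in> S \<Longrightarrow> poly (map_poly \<phi> p) (\<phi> x) = \<phi> (poly p x)"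
    by (simp add: poly_altdef deg coeff_map_poly pq field_hom_on_sum[OF S \<phi>]
        field_hom_on_props[OF S \<phi>] subfield_onD[OF S])
  show "map_poly \<phi> p = 0 \<longleftrightarrow> p = 0"
    using pq field_hom_on_props(9)[OF S \<phi>] by (auto simp: poly_eq_iff coeff_map_poly)
qed

text \<open>The graph of a ring homomorphism defined on a subring. Graphs make unions of chains
  immediate in Zorn's lemma, and the condition on (0, v) is single-valuedness in disguise.\<close>

definition ring_rel :: "('a::field \<times> 'b::field) set \<Rightarrow> bool" where
  "ring_rel R \<longleftrightarrow> (1, 1) \<in> R \<and> (\<forall>v. (0, v) \<in> R \<longrightarrow> v = 0) \<and>
     (\<forall>x u y v. (x, u) \<in> R \<longrightarrow> (y, v) \<in> R \<longrightarrow> (x + y, u + v) \<in> R \<and> (x * y, u * v) \<in> R) \<and>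
     (\<forall>x u. (x, u) \<in> R \<longrightarrow> (- x, - u) \<in> R)"

lemma ring_relD:
  assumes "ring_rel R"
  shows "(1, 1) \<in> R" "(0, v) \<in> R \<Longrightarrow> v = 0" "\<lbrakk>(x, u) \<in> R; (y, v) \<in> R\<rbrakk> \<Longrightarrow> (x + y, u + v) \<in> R"
    "\<lbrakk>(x, u) \<in> R; (y, v) \<in> R\<rbrakk> \<Longrightarrow> (x * y, u * v) \<in> R" "(x, u) \<in> R \<Longrightarrow> (- x, - u) \<in> R"
  using assms by (simp_all add: ring_rel_def)

lemma ring_relI:
  assumes "(1, 1) \<in> R" "\<And>v. (0, v) \<in> R \<Longrightarrow> v = 0"
    "\<And>x u y v. \<lbrakk>(x, u) \<in> R; (y, v) \<in> R\<rbrakk> \<Longrightarrow> (x + y, u + v) \<in> R \<and> (x * y, u * v) \<in> R"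
    "\<And>x u. (x, u) \<in> R \<Longrightarrow> (- x, - u) \<in> R"
  shows "ring_rel R"
  using assms by (simp add: ring_rel_def)

lemma ring_rel_unique:
  assumes R: "ring_rel R" and "(x, u) \<in> R" "(x, v) \<in> R"
  shows "u = v"
proof -
  have "(x + - x, u + - v) \<in> R" by (rule ring_relD(3)[OF R assms(2) ring_relD(5)[OF R assms(3)]])
  then show ?thesis using ring_relD(2)[OF R] by force
qed

lemma ring_rel_0: "ring_rel R \<Longrightarrow> (0, 0) \<in> R"
proof -
  assume R: "ring_rel R"
  have "(1 + - 1, 1 + - 1) \<in> R" using ring_relD(3)[OF R ring_relD(1)[OF R] ring_relD(5)[OF R ring_relD(1)[OF R]]] .
  then show ?thesis by simp
qed

text \<open>A ring between a field and an algebraic extension is a field: from a + x q(x) = 0 with a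
  nonzero in \<open>S\<close>, the inverse of x is a polynomial in x over \<open>S\<close>.\<close>

lemma ring_rel_domain:
  assumes R: "ring_rel R" and S: "subfield_on S" "S \<subseteq> Domain R" and alg: "\<And>x. algebraic_over S x"
  shows "subfield_on (Domain R)"
proof -
  have add: "x + y \<in> Domain R" and mult: "x * y \<in> Domain R" if xy: "x \<in> Domain R" "y \<in> Domain R" for x y
  proof -
    obtain u v where "(x, u) \<in> R" "(y, v) \<in> R" using xy by blast
    then show "x + y \<in> Domain R" "x * y \<in> Domain R"
      using DomainI[OF ring_relD(3)[OF R]] DomainI[OF ring_relD(4)[OF R]] by simp_all
  qed
  have neg: "- x \<in> Domain R" if "x \<in> Domain R" for x using that ring_relD(5)[OF R] by (auto simp: Domain_iff)
  have poly: "poly p x \<in> Domain R" if "p \<in> polys_over S" "x \<in> Domain R" for p x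
    using that(1)
  proof (induction p)
    case 0
    then show ?case using ring_rel_0[OF R] by auto
  next
    case (pCons a p)
    have "a \<in> S" using pCons.prems by (auto simp: polys_over_def dest: spec[of _ 0])
    moreover have "p \<in> polys_over S"
      unfolding polys_over_def using pCons.prems by (auto simp: polys_over_def coeff_pCons dest: spec[of _ "Suc _"])
    ultimately show ?case using pCons S(2) that(2) by (simp add: add mult subset_iff)
  qed
  have inv: "inverse x \<in> Domain R" if x: "x \<in> Domain R" "x \<noteq> 0" for x
  proof -
    obtain p where p: "p \<in> polys_over S" "p \<noteq> 0" "poly p x = 0" using alg[of x] by (auto simp: algebraic_over_def)
    \<comment> \<open>As x is nonzero, factors X can be cancelled until the constant term is
      nonzero.\<close>
    have "\<exists>p. p \<in> polys_over S \<and> poly p x = 0 \<and> Polynomial.coeff p 0 \<noteq> 0"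
      using p
    proof (induction p)
      case (pCons a p)
      show ?case
      proof (cases "a = 0")
        case True
        have "p \<in> polys_over S"
          using pCons.prems(1) by (auto simp: polys_over_def coeff_pCons dest: spec[of _ "Suc _"])
        then show ?thesis using pCons.IH pCons.prems True x(2) by auto
      qed (use pCons.prems in auto)
    qed simp
    then obtain p where p: "p \<in> polys_over S" "poly p x = 0" "Polynomial.coeff p 0 \<noteq> 0" by blast
    obtain a q where aq: "p = pCons a q" by (cases p)
    have a: "a \<in> S" "a \<noteq> 0" using p(1,3) by (auto simp: aq polys_over_def dest: spec[of _ 0])
    have q: "q \<in> polys_over S"
      using p(1) by (auto simp: aq polys_over_def coeff_pCons dest: spec[of _ "Suc _"])
    have "a + x * poly q x = 0" using p(2) by (simp add: aq)
    then have "inverse x = inverse (- a) * poly q x" using a(2) x(2) by (simp add: field_simps add_eq_0_iff)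
    moreover have "inverse (- a) \<in> Domain R" using subfield_onD(6)[OF S(1) subfield_onD(5)[OF S(1) a(1)]] S(2) by blast
    ultimately show ?thesis by (simp only: mult poly[OF q x(1)])
  qed
  have inv': "inverse x \<in> Domain R" if "x \<in> Domain R" for x
    using inv that by (cases "x = 0") auto
  show ?thesis using add mult neg inv' DomainI[OF ring_rel_0[OF R]] DomainI[OF ring_relD(1)[OF R]]
    by (simp add: subfield_on_def)
qed

definition minimal_for :: "'a::field set \<Rightarrow> 'a \<Rightarrow> 'a poly \<Rightarrow> bool" where
  "minimal_for S x p \<longleftrightarrow> p \<in> polys_over S \<and> p \<noteq> 0 \<and> poly p x = 0 \<and>
     (\<forall>q\<in>polys_over S. q \<noteq> 0 \<longrightarrow> poly q x = 0 \<longrightarrow> Polynomial.degree p \<le> Polynomial.degree q)"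

lemma minimal_for_ex: "algebraic_over S x \<Longrightarrow> \<exists>p. minimal_for S x p"
proof -
  assume "algebraic_over S x"
  then obtain p where "p \<in> polys_over S \<and> p \<noteq> 0 \<and> poly p x = 0" by (auto simp: algebraic_over_def)
  from arg_min_nat_lemma[of "\<lambda>p. p \<in> polys_over S \<and> p \<noteq> 0 \<and> poly p x = 0", OF this, of Polynomial.degree]
  show ?thesis unfolding minimal_for_def by blast
qed

lemma minimal_for_degree: "minimal_for S x p \<Longrightarrow> Polynomial.degree p > 0"
  by (rule gr0I) (auto simp: minimal_for_def elim!: degree_eq_zeroE)

text \<open>This makes the map q(x) -> \<phi>(q)(c) well defined. The division of q by the minimal
  polynomial proceeds one leading term at a time, because all quotients must keep their coefficients
  in \<open>S\<close>.\<close>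

lemma minimal_for_root:
  assumes S: "subfield_on S" and \<phi>: "field_hom_on S \<phi>" and p: "minimal_for S x p"
    and c: "poly (map_poly \<phi> p) c = 0" and q: "q \<in> polys_over S" "poly q x = 0"
  shows "poly (map_poly \<phi> q) c = 0"
  using q
proof (induction "Polynomial.degree q" arbitrary: q rule: less_induct)
  case less
  have pS: "p \<in> polys_over S" "p \<noteq> 0" "poly p x = 0" using p by (auto simp: minimal_for_def)
  show ?case
  proof (cases "q = 0")
    case False
    then have dg: "Polynomial.degree p \<le> Polynomial.degree q" using p less.prems by (auto simp: minimal_for_def)
    define m where "m = Polynomial.monom (Polynomial.lead_coeff q / Polynomial.lead_coeff p)
      (Polynomial.degree q - Polynomial.degree p)"
    have lS: "Polynomial.lead_coeff q / Polynomial.lead_coeff p \<in> S"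
      using less.prems(1) pS(1) subfield_onD[OF S] by (auto simp: polys_over_def)
    have m: "m \<in> polys_over S" unfolding m_def by (rule polys_over_monom[OF S lS])
    define r where "r = q + - (m * p)"
    have mp: "m * p \<in> polys_over S" by (rule polys_over_mult[OF S m pS(1)])
    have r: "r \<in> polys_over S" unfolding r_def
      by (rule polys_over_add[OF S less.prems(1) polys_over_uminus[OF S mp]])
    have rx: "poly r x = 0" using less.prems(2) pS(3) by (simp add: r_def)
    have rz: "poly (map_poly \<phi> r) c = 0"
    proof (cases "r = 0")
      case False
      have "Polynomial.degree (m * p) = Polynomial.degree q"
        using pS(2) \<open>q \<noteq> 0\<close> dg by (simp add: m_def degree_mult_eq degree_monom_eq)
      moreover have "Polynomial.lead_coeff (m * p) = Polynomial.lead_coeff q"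
        using pS(2) \<open>q \<noteq> 0\<close> by (simp add: m_def lead_coeff_mult degree_monom_eq)
      ultimately have "Polynomial.degree r < Polynomial.degree q"
      proof -
        assume dm: "Polynomial.degree (m * p) = Polynomial.degree q"
          and lm: "Polynomial.lead_coeff (m * p) = Polynomial.lead_coeff q"
        have "Polynomial.degree r \<le> Polynomial.degree q"
          unfolding r_def by (rule degree_add_le) (simp_all add: dm)
        moreover have "Polynomial.coeff r (Polynomial.degree q) = 0" using dm lm by (simp add: r_def)
        then have "Polynomial.degree r \<noteq> Polynomial.degree q" using False by (metis leading_coeff_0_iff)
        ultimately show ?thesis by simp
      qed
      then show ?thesis using less.hyps r rx by blast
    qed simp
    have "q = r + m * p" by (simp add: r_def)
    then have "map_poly \<phi> q = map_poly \<phi> r + map_poly \<phi> m * map_poly \<phi> p"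
      using map_poly_hom(1)[OF S \<phi> r mp] map_poly_hom(2)[OF S \<phi> m pS(1)] by simp
    then show ?thesis using rz c by simp
  qed simp
qed

lemma adjoin_root_rel:
  assumes S: "subfield_on S" and \<phi>: "field_hom_on S \<phi>" and p: "minimal_for S x p"
    and c: "poly (map_poly \<phi> p) c = 0"
  defines "R \<equiv> {(poly q x, poly (map_poly \<phi> q) c) | q. q \<in> polys_over S}"
  shows "ring_rel R" "(x, c) \<in> R" "\<And>s. s \<in> S \<Longrightarrow> (s, \<phi> s) \<in> R"
proof -
  have [simp]: "\<phi> 0 = 0" "\<phi> 1 = 1" using field_hom_on_props[OF S \<phi>] by auto
  show const: "(s, \<phi> s) \<in> R" if "s \<in> S" for s
    unfolding R_def using polys_over_const[OF S that] by (auto simp: map_poly_pCons intro!: exI[of _ "[:s:]"])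
  show "(x, c) \<in> R"
  proof -
    have "[:0, 1:] \<in> polys_over S" using S by (intro polys_over_pCons) (auto simp: subfield_onD)
    then show ?thesis unfolding R_def by (auto simp: map_poly_pCons intro!: exI[of _ "[:0, 1:]"])
  qed
  have one: "(1, 1) \<in> R" using const[of 1] subfield_onD[OF S] by simp
  have zero: "v = 0" if "(0, v) \<in> R" for v
    using that minimal_for_root[OF S \<phi> p c] by (force simp: R_def)
  have ops: "(y + z, u + v) \<in> R \<and> (y * z, u * v) \<in> R" if yz: "(y, u) \<in> R" "(z, v) \<in> R" for y z u v
  proof -
    obtain q r where q: "y = poly q x" "u = poly (map_poly \<phi> q) c" "q \<in> polys_over S"
      and r: "z = poly r x" "v = poly (map_poly \<phi> r) c" "r \<in> polys_over S" using yz by (auto simp: R_def)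
    have "y + z = poly (q + r) x" "u + v = poly (map_poly \<phi> (q + r)) c"
      "y * z = poly (q * r) x" "u * v = poly (map_poly \<phi> (q * r)) c"
      using q r by (simp_all add: map_poly_hom[OF S \<phi>])
    then show ?thesis unfolding R_def
      using polys_over_add[OF S q(3) r(3)] polys_over_mult[OF S q(3) r(3)] by blast
  qed
  have neg: "(- y, - u) \<in> R" if yu: "(y, u) \<in> R" for y u
  proof -
    obtain q where q: "y = poly q x" "u = poly (map_poly \<phi> q) c" "q \<in> polys_over S" using yu by (auto simp: R_def)
    have "- y = poly (- q) x" "- u = poly (map_poly \<phi> (- q)) c" using q by (simp_all add: map_poly_hom[OF S \<phi>])
    then show ?thesis unfolding R_def using polys_over_uminus[OF S q(3)] by blast
  qed
  show "ring_rel R" using one zero ops neg by (rule ring_relI)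
qed

text \<open>A maximal extension has a field as its domain. If some x were outside, a root of the
  transported minimal polynomial, available in the algebraically closed target, would extend it
  further.\<close>

theorem ring_rel_extend:
  fixes R :: "('a::field \<times> 'b::alg_closed_field) set"
  assumes R: "ring_rel R" and S: "subfield_on S" "S \<subseteq> Domain R" and alg: "\<And>x. algebraic_over S x"
  obtains \<psi> where "field_hom_on UNIV \<psi>" "\<And>x u. (x, u) \<in> R \<Longrightarrow> \<psi> x = u"
proof -
  define A where "A = {T. ring_rel T \<and> R \<subseteq> T}"
  have "\<exists>M\<in>A. \<forall>T\<in>A. M \<subseteq> T \<longrightarrow> T = M"
  proof (rule subset_Zorn_nonempty)
    show "A \<noteq> {}" using R by (auto simp: A_def)
    fix Ch assume Ch: "Ch \<noteq> {}" "subset.chain A Ch"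
    have mem: "ring_rel T" "R \<subseteq> T" if "T \<in> Ch" for T
      using that Ch(2) by (auto simp: A_def subset.chain_def)
    have common: "\<exists>T\<in>Ch. a \<in> T \<and> b \<in> T" if ab: "a \<in> \<Union>Ch" "b \<in> \<Union>Ch" for a b
    proof -
      obtain T1 T2 where T: "T1 \<in> Ch" "T2 \<in> Ch" "a \<in> T1" "b \<in> T2" using ab by blast
      then have "T1 \<subseteq> T2 \<or> T2 \<subseteq> T1" using Ch(2) unfolding subset.chain_def by blast
      then show ?thesis using T by blast
    qed
    have "ring_rel (\<Union>Ch)"
    proof -
      obtain T0 where "T0 \<in> Ch" using Ch(1) by blast
      then have "(1, 1) \<in> \<Union>Ch" using ring_relD(1)[OF mem(1)] by blast
      moreover have "v = 0" if "(0, v) \<in> \<Union>Ch" for v using that ring_relD(2)[OF mem(1)] by blast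
      moreover have "(x + y, u + v) \<in> \<Union>Ch \<and> (x * y, u * v) \<in> \<Union>Ch"
        if xy: "(x, u) \<in> \<Union>Ch" "(y, v) \<in> \<Union>Ch" for x y u v
      proof -
        obtain T where "T \<in> Ch" "(x, u) \<in> T" "(y, v) \<in> T" using common[OF xy] by blast
        then have "(x + y, u + v) \<in> T" "(x * y, u * v) \<in> T" by (simp_all add: ring_relD(3,4)[OF mem(1)])
        then show ?thesis using \<open>T \<in> Ch\<close> by blast
      qed
      moreover have "(- x, - u) \<in> \<Union>Ch" if "(x, u) \<in> \<Union>Ch" for x u
        using that ring_relD(5)[OF mem(1)] by blast
      ultimately show ?thesis by (rule ring_relI)
    qed
    moreover have "R \<subseteq> \<Union>Ch" using Ch(1) mem(2) by blast
    ultimately show "\<Union>Ch \<in> A" by (simp add: A_def)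
  qed
  then obtain M where M: "ring_rel M" "R \<subseteq> M" "\<forall>T. ring_rel T \<longrightarrow> M \<subseteq> T \<longrightarrow> T = M"
    by (auto simp: A_def)
  have SM: "S \<subseteq> Domain M" using S(2) M(2) by blast
  have D: "subfield_on (Domain M)" by (rule ring_rel_domain[OF M(1) S(1) SM alg])
  define \<phi> where "\<phi> x = (THE u. (x, u) \<in> M)" for x
  have \<phi>: "\<phi> x = u" if "(x, u) \<in> M" for x u
    unfolding \<phi>_def using that ring_rel_unique[OF M(1)] by blast
  have \<phi>M: "(x, \<phi> x) \<in> M" if "x \<in> Domain M" for x using that \<phi> by auto
  have hom: "field_hom_on (Domain M) \<phi>"
  proof -
    have "\<phi> (x + y) = \<phi> x + \<phi> y \<and> \<phi> (x * y) = \<phi> x * \<phi> y" if "x \<in> Domain M" "y \<in> Domain M" for x y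
      using \<phi>[OF ring_relD(3)[OF M(1) \<phi>M \<phi>M]] \<phi>[OF ring_relD(4)[OF M(1) \<phi>M \<phi>M]] that by simp
    then show ?thesis using \<phi>[OF ring_relD(1)[OF M(1)]] by (simp add: field_hom_on_def)
  qed
  have all: "x \<in> Domain M" for x
  proof (rule ccontr)
    assume x: "x \<notin> Domain M"
    have "algebraic_over (Domain M) x"
      using alg[of x] SM unfolding algebraic_over_def polys_over_def by blast
    then obtain p where p: "minimal_for (Domain M) x p" using minimal_for_ex by blast
    have pD: "p \<in> polys_over (Domain M)" using p by (simp add: minimal_for_def)
    have "Polynomial.degree (map_poly \<phi> p) > 0"
      using map_poly_hom(6)[OF D hom pD pD] minimal_for_degree[OF p] by simp
    then obtain c where c: "poly (map_poly \<phi> p) c = 0" using alg_closed_imp_poly_has_root by blast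
    define T where "T = {(poly q x, poly (map_poly \<phi> q) c) | q. q \<in> polys_over (Domain M)}"
    note T = adjoin_root_rel[OF D hom p c, folded T_def]
    have "M \<subseteq> T"
    proof
      fix a assume a: "a \<in> M"
      obtain y u where yu: "a = (y, u)" by (cases a)
      then show "a \<in> T" using T(3)[of y] \<phi>[of y u] a by auto
    qed
    then have "T = M" using M(3) T(1) by blast
    then show False using T(2) x by blast
  qed
  have "Domain M = UNIV" using all by blast
  then show ?thesis using that[of \<phi>] hom \<phi> M(2) by auto
qed

lemma map_poly_hom_UNIV:
  assumes "field_hom_on UNIV \<psi>"
  shows "map_poly \<psi> (p + q) = map_poly \<psi> p + map_poly \<psi> q"
    and "map_poly \<psi> (p * q) = map_poly \<psi> p * map_poly \<psi> q"
    and "poly (map_poly \<psi> p) (\<psi> x) = \<psi> (poly p x)"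
    and "map_poly \<psi> p = 0 \<longleftrightarrow> p = 0"
    and "Polynomial.degree (map_poly \<psi> p) = Polynomial.degree p"
  using map_poly_hom[OF subfield_on_UNIV assms, of p q] map_poly_hom[OF subfield_on_UNIV assms, of p p]
  by (simp_all add: polys_over_def)

lemma hom_UNIV_inj: "field_hom_on UNIV \<psi> \<Longrightarrow> inj \<psi>"
  using field_hom_on_props(10)[OF subfield_on_UNIV] by (auto simp: inj_def)

lemma map_poly_linear: "field_hom_on UNIV \<psi> \<Longrightarrow> map_poly \<psi> [:- r, 1:] = [:- \<psi> r, 1:]"
  using field_hom_on_props[OF subfield_on_UNIV, of \<psi>] by (simp add: map_poly_pCons)

text \<open>q splits before \<open>\<psi>\<close> is applied, so the roots of its image are the
  images of its roots. This takes the place of normality when an algebraic closure is embedded into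
  a larger field.\<close>

lemma root_in_range_hom:
  fixes q :: "'a::alg_closed_field poly"
  assumes \<psi>: "field_hom_on UNIV \<psi>" and q: "q \<noteq> 0" and c: "poly (map_poly \<psi> q) c = 0"
  shows "c \<in> range \<psi>"
  using q c
proof (induction "Polynomial.degree q" arbitrary: q rule: less_induct)
  case less
  have "Polynomial.degree q \<noteq> 0"
  proof
    assume "Polynomial.degree q = 0"
    then obtain a where a: "q = [:a:]" by (rule degree_eq_zeroE)
    then have "poly (map_poly \<psi> q) c = \<psi> a"
      using field_hom_on_props(2)[OF subfield_on_UNIV \<psi>] by (simp add: map_poly_pCons)
    then show False using less.prems a field_hom_on_props(9)[OF subfield_on_UNIV \<psi>, of a] by simp
  qed
  then obtain r where "poly q r = 0" using alg_closed_imp_poly_has_root by blast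
  then have "[:- r, 1:] dvd q" by (simp only: poly_eq_0_iff_dvd)
  then obtain q' where q': "q = [:- r, 1:] * q'" by (rule dvdE)
  have nz: "q' \<noteq> 0" using q' less.prems by auto
  have "Polynomial.degree q = Suc (Polynomial.degree q')" using nz unfolding q' by (subst degree_mult_eq) auto
  moreover have "map_poly \<psi> q = [:- \<psi> r, 1:] * map_poly \<psi> q'"
    unfolding q' by (simp only: map_poly_hom_UNIV(2)[OF \<psi>] map_poly_linear[OF \<psi>])
  then have "c = \<psi> r \<or> poly (map_poly \<psi> q') c = 0" using less.prems(2) by auto
  ultimately show ?case using less.hyps[of q'] nz by auto
qed

lemma hom_bij_if_algebraic:
  fixes \<psi> :: "'a::alg_closed_field \<Rightarrow> 'b::field"
  assumes \<psi>: "field_hom_on UNIV \<psi>" and alg: "\<And>c. algebraic_over (\<psi> ` S) c"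
  shows "bij \<psi>"
proof (rule bijI[OF hom_UNIV_inj[OF \<psi>]])
  have "c \<in> range \<psi>" for c
  proof -
    obtain p where p: "p \<in> polys_over (\<psi> ` S)" "p \<noteq> 0" "poly p c = 0"
      using alg[of c] by (auto simp: algebraic_over_def)
    have inv: "\<psi> (inv_into UNIV \<psi> a) = a" if "a \<in> \<psi> ` S" for a
      using that by (intro f_inv_into_f) auto
    have z: "inv_into UNIV \<psi> 0 = 0"
      using inv_f_f[OF hom_UNIV_inj[OF \<psi>], of 0] field_hom_on_props(2)[OF subfield_on_UNIV \<psi>] by simp
    define q where "q = map_poly (inv_into UNIV \<psi>) p"
    have pq: "map_poly \<psi> q = p"
      using p(1) by (intro poly_eqI)
        (auto simp: q_def coeff_map_poly z field_hom_on_props(2)[OF subfield_on_UNIV \<psi>] polys_over_def inv)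
    then have "q \<noteq> 0" using p(2) by auto
    then show ?thesis using root_in_range_hom[OF \<psi>] p(3) pq by metis
  qed
  then show "surj \<psi>" by blast
qed

section \<open>Automorphisms of an algebraic closure over a subfield\<close>

definition autos :: "'a::field set \<Rightarrow> ('a \<Rightarrow> 'a) set" where
  "autos S = {\<sigma>. bij \<sigma> \<and> field_hom_on UNIV \<sigma> \<and> (\<forall>s\<in>S. \<sigma> s = s)}"

lemma autosD:
  assumes "\<sigma> \<in> autos S"
  shows "bij \<sigma>" "field_hom_on UNIV \<sigma>" "s \<in> S \<Longrightarrow> \<sigma> s = s"
  using assms by (auto simp: autos_def)

lemma hom_comp:
  "field_hom_on UNIV \<phi> \<Longrightarrow> field_hom_on UNIV \<psi> \<Longrightarrow> field_hom_on UNIV (\<phi> \<circ> \<psi>)"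
  by (simp add: field_hom_on_def)

lemma hom_inv:
  assumes "bij \<phi>" "field_hom_on UNIV \<phi>"
  shows "field_hom_on UNIV (inv_into UNIV \<phi>)"
proof -
  have f: "\<phi> (inv_into UNIV \<phi> x) = x" for x using assms(1) by (simp add: bij_is_surj surj_f_inv_f)
  have g: "inv_into UNIV \<phi> (\<phi> x) = x" for x using assms(1) by (simp add: bij_is_inj)
  have "inv_into UNIV \<phi> 1 = 1" using g[of 1] assms(2) by (simp add: field_hom_on_def)
  moreover have "inv_into UNIV \<phi> (x + y) = inv_into UNIV \<phi> x + inv_into UNIV \<phi> y"
    "inv_into UNIV \<phi> (x * y) = inv_into UNIV \<phi> x * inv_into UNIV \<phi> y" for x y
    using g[of "inv_into UNIV \<phi> x + inv_into UNIV \<phi> y"] g[of "inv_into UNIV \<phi> x * inv_into UNIV \<phi> y"] assms(2)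
    by (simp_all add: field_hom_on_def f)
  ultimately show ?thesis by (simp add: field_hom_on_def)
qed

lemma autos_group: "perm_group (autos S)"
proof
  show "id \<in> autos S" by (simp add: autos_def field_hom_on_def)
  show "g \<circ> h \<in> autos S" if "g \<in> autos S" "h \<in> autos S" for g h
    using that hom_comp[of g h] bij_comp[of h g] by (simp add: autos_def)
  show "\<exists>h\<in>autos S. g \<circ> h = id \<and> h \<circ> g = id" if g: "g \<in> autos S" for g
  proof (intro bexI conjI)
    have b: "bij g" using g by (simp add: autos_def)
    show "g \<circ> finv g = id" "finv g \<circ> g = id" using b
      by (simp_all add: bij_is_surj surj_iff[symmetric] bij_is_inj)
    have "finv g s = s" if "s \<in> S" for s
      using inv_f_f[OF bij_is_inj[OF b], of s] g that by (simp add: autos_def)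
    then show "finv g \<in> autos S" using g hom_inv[of g] bij_imp_bij_inv[OF b] by (simp add: autos_def)
  qed
qed

lemma autos_mono: "S \<subseteq> T \<Longrightarrow> autos T \<subseteq> autos S" by (auto simp: autos_def)

lemma algebraic_over_mono: "algebraic_over S x \<Longrightarrow> S \<subseteq> T \<Longrightarrow> algebraic_over T x"
  by (auto simp: algebraic_over_def polys_over_def)

lemma auto_roots:
  assumes \<sigma>: "\<sigma> \<in> autos S" and p: "p \<in> polys_over S"
  shows "poly p (\<sigma> x) = \<sigma> (poly p x)"
proof -
  have "map_poly \<sigma> p = p"
    using p autosD(3)[OF \<sigma>] field_hom_on_props(2)[OF subfield_on_UNIV autosD(2)[OF \<sigma>]]
    by (intro poly_eqI) (simp add: coeff_map_poly polys_over_def)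
  then show ?thesis using map_poly_hom_UNIV(3)[OF autosD(2)[OF \<sigma>], of p x] by simp
qed

lemma orbit_finite:
  assumes "algebraic_over S x"
  shows "finite ((\<lambda>\<sigma>. \<sigma> x) ` autos S)"
proof -
  obtain p where p: "p \<in> polys_over S" "p \<noteq> 0" "poly p x = 0" using assms by (auto simp: algebraic_over_def)
  have "poly p (\<sigma> x) = 0" if "\<sigma> \<in> autos S" for \<sigma>
    using auto_roots[OF that p(1), of x] p(3) field_hom_on_props(2)[OF subfield_on_UNIV autosD(2)[OF that]] by simp
  then have "(\<lambda>\<sigma>. \<sigma> x) ` autos S \<subseteq> {c. poly p c = 0}" by auto
  then show ?thesis using poly_roots_finite[OF p(2)] finite_subset by blast
qed

text \<open>The whole type plays the role of an algebraic closure of \<open>S\<close>, and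
  characteristic 0 makes it Galois over \<open>S\<close>.\<close>

locale galois_closure =
  fixes S :: "'a::{alg_closed_field,field_char_0} set"
  assumes S: "subfield_on S" and alg: "\<And>x. algebraic_over S x"
begin

lemma extend_auto:
  assumes R: "ring_rel R" "\<And>s. s \<in> S \<Longrightarrow> (s, s) \<in> R"
  obtains \<sigma> where "\<sigma> \<in> autos S" "\<And>x u. (x, u) \<in> R \<Longrightarrow> \<sigma> x = u"
proof -
  have "S \<subseteq> Domain R" using R(2) by blast
  from ring_rel_extend[OF R(1) S this alg] obtain \<psi>
    where \<psi>: "field_hom_on UNIV \<psi>" "\<And>x u. (x, u) \<in> R \<Longrightarrow> \<psi> x = u" by metis
  have fixS: "\<psi> s = s" if "s \<in> S" for s using \<psi>(2)[OF R(2)[OF that]] .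
  have "\<psi> ` S = S" using fixS by force
  then have "bij \<psi>" using hom_bij_if_algebraic[OF \<psi>(1), of S] alg by simp
  then have "\<psi> \<in> autos S" using \<psi>(1) fixS by (simp add: autos_def)
  then show ?thesis using \<psi>(2) by (rule that)
qed

lemma extend_over: "galois_closure T" if "subfield_on T" "S \<subseteq> T"
  by unfold_locales (rule that(1), rule algebraic_over_mono[OF alg that(2)])

text \<open>If c were the only root of its minimal polynomial l (X - c)^n, the coefficient - n l c
  of X^(n-1) would put c into \<open>S\<close>, as n is invertible in characteristic 0. So there is
  another root c', and c -> c' extends to an automorphism.\<close>

lemma moved_by_auto:
  assumes c: "c \<notin> S"
  shows "\<exists>\<sigma>\<in>autos S. \<sigma> c \<noteq> c"
proof -
  obtain p where p: "minimal_for S c p" using minimal_for_ex[OF alg] by blast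
  have pS: "p \<in> polys_over S" "p \<noteq> 0" "poly p c = 0" using p by (auto simp: minimal_for_def)
  define n where "n = Polynomial.degree p"
  have n: "n > 0" using minimal_for_degree[OF p] by (simp add: n_def)
  obtain A where A: "size A = n" "p = Polynomial.smult (Polynomial.lead_coeff p) (\<Prod>x\<in>#A. [:- x, 1:])"
    using alg_closed_imp_factorization[OF pS(2)] by (auto simp: n_def)
  have "\<exists>c'. poly p c' = 0 \<and> c' \<noteq> c"
  proof (rule ccontr)
    assume no: "\<not> ?thesis"
    have "x = c" if "x \<in># A" for x
    proof -
      have "poly (\<Prod>x\<in>#A. [:- x, 1:]) x = 0" using that
        by (simp add: poly_prod_mset prod_mset_zero_iff image_iff)
      then have "poly p x = 0" by (subst A(2)) simp
      then show ?thesis using no by blast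
    qed
    then have "A = replicate_mset n c" using A(1) by (metis set_mset_subset_singletonD singletonI subsetI)
    then have peq: "p = Polynomial.smult (Polynomial.lead_coeff p) ([:- c, 1:] ^ n)" using A(2) by simp
    define l where "l = Polynomial.lead_coeff p"
    have l: "l \<in> S" "l \<noteq> 0" using pS by (auto simp: l_def polys_over_def)
    have "Polynomial.coeff p (n - 1) = l * (of_nat n * - c)"
    proof -
      have "n choose (n - 1) = n" using n by (cases n) auto
      moreover have "n - (n - 1) = 1" using n by simp
      ultimately have "Polynomial.coeff ([:- c, 1:] ^ n) (n - 1) = of_nat n * - c"
        by (subst coeff_linear_poly_power) simp_all
      then show ?thesis by (subst peq) (simp add: l_def)
    qed
    then have "c = - (Polynomial.coeff p (n - 1) / (l * of_nat n))" using l n by (simp add: field_simps)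
    moreover have "of_nat m \<in> S" for m by (induction m) (simp_all add: subfield_onD[OF S])
    moreover have "Polynomial.coeff p (n - 1) \<in> S" using pS by (simp add: polys_over_def)
    ultimately show False using c l(1) subfield_onD[OF S] by metis
  qed
  then obtain c' where c': "poly p c' = 0" "c' \<noteq> c" by blast
  have id: "field_hom_on S id" by (simp add: field_hom_on_def)
  have "poly (map_poly id p) c' = 0" using c' by simp
  note R = adjoin_root_rel[OF S id p this]
  define T where "T = {(poly q c, poly (map_poly id q) c') |q. q \<in> polys_over S}"
  note R = R[folded T_def]
  have "\<exists>\<sigma>\<in>autos S. \<sigma> c = c'"
  proof (rule extend_auto[OF R(1)])
    show "(s, s) \<in> T" if "s \<in> S" for s using R(3)[OF that] by simp
    show "\<exists>\<sigma>\<in>autos S. \<sigma> c = c'" if "\<sigma> \<in> autos S" "\<And>x u. (x, u) \<in> T \<Longrightarrow> \<sigma> x = u" for \<sigma>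
      using that(1) that(2)[OF R(2)] by blast
  qed
  then show ?thesis using c' by blast
qed

end

lemma subfield_fixed:
  assumes "H \<subseteq> autos S"
  shows "subfield_on {c. \<forall>\<sigma>\<in>H. \<sigma> c = c}"
proof -
  have h: "field_hom_on UNIV \<sigma>" if "\<sigma> \<in> H" for \<sigma> using autosD(2) assms that by blast
  show ?thesis by (auto simp: subfield_on_def field_hom_on_props(1-6)[OF subfield_on_UNIV h])
qed

section \<open>Linear disjointness and transitivity\<close>

lemma independent_iff:
  fixes M :: "'a::field set"
  assumes M: "subfield_on M"
  shows "ring.independent cl_ring M us \<longleftrightarrow>
    (\<forall>ks. length ks = length us \<longrightarrow> set ks \<subseteq> M \<longrightarrow> (\<Sum>i<length us. ks ! i * us ! i) = 0 \<longrightarrow> set ks \<subseteq> {0})"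
proof -
  interpret R: field "cl_ring :: 'a ring" by (rule field_from_type_algebra)
  have sf: "subfield M cl_ring" using M subfield_on_iff by blast
  have [simp]: "carrier (cl_ring :: 'a ring) = UNIV" "ring.zero (cl_ring :: 'a ring) = 0"
    "monoid.mult (cl_ring :: 'a ring) = (\<lambda>x y. x * y)" "ring.add (cl_ring :: 'a ring) = (\<lambda>x y. x + y)"
    by (simp_all add: ring_of_type_algebra_def)
  have comb: "R.combine ks us = (\<Sum>i<length us. ks ! i * us ! i)" if "length ks = length us" for ks us :: "'a list"
    using that
  proof (induction ks us rule: list_induct2)
    case (Cons k ks u us)
    then show ?case by (simp add: sum.lessThan_Suc_shift del: sum.lessThan_Suc)
  qed simp
  show ?thesis
  proof
    assume ind: "R.independent M us"
    show "\<forall>ks. length ks = length us \<longrightarrow> set ks \<subseteq> M \<longrightarrow> (\<Sum>i<length us. ks ! i * us ! i) = 0 \<longrightarrow> set ks \<subseteq> {0}"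
    proof (intro allI impI)
      fix ks assume ks: "length ks = length us" "set ks \<subseteq> M" "(\<Sum>i<length us. ks ! i * us ! i) = 0"
      then have "R.combine ks us = 0" using comb by simp
      then show "set ks \<subseteq> {0}"
        using R.independent_imp_trivial_combine[OF sf ind ks(2)] ks(1) by simp
    qed
  next
    assume h: "\<forall>ks. length ks = length us \<longrightarrow> set ks \<subseteq> M \<longrightarrow> (\<Sum>i<length us. ks ! i * us ! i) = 0 \<longrightarrow> set ks \<subseteq> {0}"
    show "R.independent M us"
    proof (rule ccontr)
      assume "\<not> R.independent M us"
      from R.dependent_imp_non_trivial_combine[OF sf _ this]
      obtain Ks where Ks: "length Ks = length us" "R.combine Ks us = 0" "set Ks \<subseteq> M" "set Ks \<noteq> {0}"
        by auto
      have "set Ks \<subseteq> {0}" using h Ks comb by simp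
      then have "Ks = []" using Ks(4) by (cases Ks) auto
      then have "us = []" using Ks(1) by simp
      then show False using \<open>\<not> R.independent M us\<close> by simp
    qed
  qed
qed

lemma map_poly_prod_linear:
  assumes "field_hom_on UNIV \<psi>" "finite W" "inj_on \<psi> W"
  shows "map_poly \<psi> (\<Prod>w\<in>W. [:- w, 1:]) = (\<Prod>w\<in>\<psi> ` W. [:- w, 1:])"
proof -
  have "map_poly \<psi> (\<Prod>w\<in>W. [:- w, 1:]) = (\<Prod>w\<in>W. [:- \<psi> w, 1:])"
    using assms(2)
  proof (induction W rule: finite_induct)
    case empty
    then show ?case using field_hom_on_props(1,2)[OF subfield_on_UNIV assms(1)] by (simp add: one_pCons map_poly_pCons)
  next
    case (insert w W)
    have "map_poly \<psi> (\<Prod>w\<in>insert w W. [:- w, 1:]) = map_poly \<psi> [:- w, 1:] * map_poly \<psi> (\<Prod>w\<in>W. [:- w, 1:])"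
      by (subst prod.insert[OF insert.hyps]) (rule map_poly_hom_UNIV(2)[OF assms(1)])
    then show ?case by (simp only: prod.insert[OF insert.hyps] map_poly_linear[OF assms(1)] insert.IH)
  qed
  also have "\<dots> = (\<Prod>w\<in>\<psi> ` W. [:- w, 1:])" using prod.reindex[OF assms(3), of "\<lambda>w. [:- w, 1:]"] by simp
  finally show ?thesis .
qed

lemma poly_prod_linear_0_iff:
  "finite W \<Longrightarrow> poly (\<Prod>w\<in>W. [:- w, 1:]) (x::'b::idom) = 0 \<longleftrightarrow> x \<in> W"
  by (auto simp: poly_prod)

lemma degree_prod_linear: "finite W \<Longrightarrow> Polynomial.degree (\<Prod>w\<in>W. [:- w, 1:] :: 'b::idom poly) = card W"
  by (subst degree_prod_eq_sum_degree) auto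

lemma lead_coeff_prod_linear: "Polynomial.lead_coeff (\<Prod>w\<in>W. [:- w, 1:] :: 'b::idom poly) = 1"
  by (simp add: lead_coeff_prod)

context galois_closure
begin

abbreviation G where "G \<equiv> autos S"

text \<open>By the Galois correspondence this is the field generated by x over \<open>S\<close>;
  \<open>fixed_by_adjoin\<close> proves it over k(t). The definition through the stabiliser keeps
  the transitivity arguments free of generated fields.\<close>

definition fixed_by :: "'a \<Rightarrow> 'a set" where
  "fixed_by x = {c. \<forall>\<sigma>\<in>G. \<sigma> x = x \<longrightarrow> \<sigma> c = c}"

sublocale G: perm_group G by (rule autos_group)

lemma fixed_by_subfield: "subfield_on (fixed_by x)"
proof -
  have "fixed_by x = {c. \<forall>\<sigma>\<in>{\<sigma> \<in> G. \<sigma> x = x}. \<sigma> c = c}" by (auto simp: fixed_by_def)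
  then show ?thesis using subfield_fixed[of "{\<sigma> \<in> G. \<sigma> x = x}" S] by simp
qed

lemma S_fixed_by: "S \<subseteq> fixed_by x" by (auto simp: fixed_by_def autos_def)

lemma self_fixed_by: "x \<in> fixed_by x" by (simp add: fixed_by_def)

lemma hom_sum: "\<sigma> \<in> G \<Longrightarrow> \<sigma> (sum f I) = (\<Sum>i\<in>I. \<sigma> (f i))"
  by (rule field_hom_on_sum[OF subfield_on_UNIV autosD(2)]) auto

lemma hom_mult: "\<sigma> \<in> G \<Longrightarrow> \<sigma> (a * b) = \<sigma> a * \<sigma> b"
  by (rule field_hom_on_props(4)[OF subfield_on_UNIV autosD(2)]) auto

lemma hom_zero: "\<sigma> \<in> G \<Longrightarrow> \<sigma> 0 = 0"
  by (rule field_hom_on_props(2)[OF subfield_on_UNIV autosD(2)])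

text \<open>Artin's argument with a relation of minimal support. Transitivity shows that a relation
  between the \<open>us\<close> over the field of y survives when its coefficients alone are
  replaced by conjugates; this is \<open>rel\<close>. A relation of this kind with minimal support,
  scaled to have an entry 1, has all its coefficients in \<open>S\<close>, against independence over
  \<open>S\<close>.\<close>

lemma linearly_disjoint_of_transitive:
  assumes tr: "\<And>\<tau>. \<tau> \<in> G \<Longrightarrow> \<exists>\<gamma>\<in>G. \<gamma> y = y \<and> \<gamma> x = \<tau> x"
  shows "linearly_disjoint S (fixed_by x) (fixed_by y)"
  unfolding linearly_disjoint_def
proof (intro allI impI, elim conjE)
  fix us assume us: "set us \<subseteq> fixed_by x" and ind: "ring.independent cl_ring S us"
  define r where "r = length us"
  define rel where "rel m \<longleftrightarrow> (\<forall>\<tau>\<in>G. (\<Sum>i<r. \<tau> (m i) * us ! i) = 0)" for m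
  have usx: "us ! i \<in> fixed_by x" if "i < r" for i using us that by (auto simp: r_def)
  have no: "\<forall>i<r. m i = 0" if "rel m" for m
  proof (rule ccontr)
    assume "\<not> ?thesis"
    then have "rel m \<and> (\<exists>i<r. m i \<noteq> 0)" using that by blast
    from arg_min_nat_lemma[of "\<lambda>m. rel m \<and> (\<exists>i<r. m i \<noteq> 0)", OF this, of "\<lambda>m. card {i. i < r \<and> m i \<noteq> 0}"]
    obtain m where m: "rel m" "\<exists>i<r. m i \<noteq> 0"
      and least: "\<And>m'. \<lbrakk>rel m'; \<exists>i<r. m' i \<noteq> 0\<rbrakk> \<Longrightarrow> card {i. i < r \<and> m i \<noteq> 0} \<le> card {i. i < r \<and> m' i \<noteq> 0}"
      by blast
    obtain j where j: "j < r" "m j \<noteq> 0" using m(2) by blast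
    define a where "a i = m i / m j" for i
    have rela: "rel a"
    proof -
      have "(\<Sum>i<r. \<tau> (a i) * us ! i) = 0" if \<tau>: "\<tau> \<in> G" for \<tau>
      proof -
        have "(\<Sum>i<r. \<tau> (a i) * us ! i) = (\<Sum>i<r. \<tau> (m i) * us ! i) / \<tau> (m j)"
          using field_hom_on_props(8)[OF subfield_on_UNIV autosD(2)[OF \<tau>]]
          by (simp add: a_def sum_divide_distrib)
        then show ?thesis using m(1) \<tau> by (simp add: rel_def)
      qed
      then show ?thesis by (simp add: rel_def)
    qed
    have aS: "a i \<in> S" if i: "i < r" for i
    proof (rule ccontr)
      assume "a i \<notin> S"
      then obtain \<sigma> where \<sigma>: "\<sigma> \<in> G" "\<sigma> (a i) \<noteq> a i" using moved_by_auto by blast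
      \<comment> \<open>The entry at j cancels because a j = 1, so this relation has smaller support
        than m.\<close>
      define b where "b l = \<sigma> (a l) - a l" for l
      have relb: "rel b"
      proof -
        have "(\<Sum>l<r. \<tau> (b l) * us ! l) = 0" if \<tau>: "\<tau> \<in> G" for \<tau>
        proof -
          have "\<tau> \<circ> \<sigma> \<in> G" using G.comp_mem \<tau> \<sigma> by blast
          then have "(\<Sum>l<r. (\<tau> \<circ> \<sigma>) (a l) * us ! l) = 0" using rela unfolding rel_def by blast
          moreover have "(\<Sum>l<r. \<tau> (a l) * us ! l) = 0" using rela \<tau> by (simp add: rel_def)
          ultimately show ?thesis
            using field_hom_on_props(7)[OF subfield_on_UNIV autosD(2)[OF \<tau>]]
            by (simp add: b_def left_diff_distrib sum_subtractf)
        qed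
        then show ?thesis by (simp add: rel_def)
      qed
      have "{l. l < r \<and> b l \<noteq> 0} \<subset> {l. l < r \<and> m l \<noteq> 0}"
      proof
        show "{l. l < r \<and> b l \<noteq> 0} \<subseteq> {l. l < r \<and> m l \<noteq> 0}"
          using hom_zero[OF \<sigma>(1)] by (auto simp: b_def a_def)
        have "b j = 0" using j field_hom_on_props(1)[OF subfield_on_UNIV autosD(2)[OF \<sigma>(1)]]
          by (simp add: b_def a_def)
        then show "{l. l < r \<and> b l \<noteq> 0} \<noteq> {l. l < r \<and> m l \<noteq> 0}" using j by blast
      qed
      then have "card {l. l < r \<and> b l \<noteq> 0} < card {l. l < r \<and> m l \<noteq> 0}" by (intro psubset_card_mono) auto
      moreover have "\<exists>l<r. b l \<noteq> 0" using i \<sigma>(2) by (auto simp: b_def)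
      ultimately show False using least[OF relb] by simp
    qed
    have "(\<Sum>i<r. a i * us ! i) = 0" using rela G.id_mem unfolding rel_def by (metis (no_types, lifting) id_apply sum.cong)
    then have sum0: "(\<Sum>i<length us. map a [0..<r] ! i * us ! i) = 0" by (simp add: r_def)
    have sub: "set (map a [0..<r]) \<subseteq> S" using aS by auto
    have len: "length (map a [0..<r]) = length us" by (simp add: r_def)
    have "set (map a [0..<r]) \<subseteq> {0}"
      using ind len sub sum0 unfolding independent_iff[OF S] by blast
    moreover have "a j \<in> set (map a [0..<r])" using j(1) by simp
    ultimately have "a j = 0" by blast
    then show False using j(2) by (simp add: a_def)
  qed
  show "ring.independent cl_ring (fixed_by y) us"
    unfolding independent_iff[OF fixed_by_subfield]
  proof (intro allI impI)
    fix ks assume ks: "length ks = length us" "set ks \<subseteq> fixed_by y" "(\<Sum>i<length us. ks ! i * us ! i) = 0"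
    have "rel (\<lambda>i. ks ! i)" unfolding rel_def
    proof
      fix \<tau> assume \<tau>: "\<tau> \<in> G"
      have \<tau>i: "finv \<tau> \<in> G" by (rule G.finv_mem[OF \<tau>])
      \<comment> \<open>\<tau> \<circ> \<gamma> fixes x and hence the \<open>us\<close>, while
        \<gamma> fixes the coefficients. So \<tau> \<circ> \<gamma> turns the relation into the one
        with coefficients \<tau> (ks ! i).\<close>
      obtain \<gamma> where \<gamma>: "\<gamma> \<in> G" "\<gamma> y = y" "\<gamma> x = finv \<tau> x" using tr[OF \<tau>i] by blast
      have g: "\<gamma> (us ! i) = finv \<tau> (us ! i)" if "i < r" for i
      proof -
        have "\<tau> \<circ> \<gamma> \<in> G" "(\<tau> \<circ> \<gamma>) x = x" using G.comp_mem \<tau> \<gamma> by auto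
        then have "\<tau> (\<gamma> (us ! i)) = us ! i" using usx[OF that] by (auto simp: fixed_by_def)
        then show ?thesis using G.finv_left[OF \<tau>] by metis
      qed
      have k: "\<gamma> (ks ! i) = ks ! i" if "i < r" for i
        using ks that \<gamma> by (auto simp: fixed_by_def r_def subset_iff)
      have "0 = \<gamma> (\<Sum>i<r. ks ! i * us ! i)" using ks(3) hom_zero[OF \<gamma>(1)] by (simp add: r_def)
      also have "\<dots> = (\<Sum>i<r. ks ! i * finv \<tau> (us ! i))"
        by (simp add: hom_sum[OF \<gamma>(1)] hom_mult[OF \<gamma>(1)] g k)
      finally have "\<tau> 0 = \<tau> (\<Sum>i<r. ks ! i * finv \<tau> (us ! i))" by simp
      then show "(\<Sum>i<r. \<tau> (ks ! i) * us ! i) = 0"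
        using hom_zero[OF \<tau>] G.finv_right[OF \<tau>] by (simp add: hom_sum[OF \<tau>] hom_mult[OF \<tau>])
    qed
    from no[OF this] show "set ks \<subseteq> {0}" using ks(1) by (auto simp: r_def in_set_conv_nth)
  qed
qed

text \<open>Otherwise the orbit \<open>O2\<close> of z under the stabiliser of y is smaller than the
  full orbit, of size e. The powers z^0, ..., z^(e-1) are independent over \<open>S\<close>, since a
  polynomial of degree below e with e roots is zero. They are dependent over the field of y, which
  contains the coefficients of the monic polynomial with root set \<open>O2\<close>.\<close>

lemma transitive_of_linearly_disjoint:
  assumes ld: "linearly_disjoint S L (fixed_by y)" and z: "z \<in> L" and L: "subfield_on L"
    and \<tau>: "\<tau> \<in> G"
  shows "\<exists>\<gamma>\<in>G. \<gamma> y = y \<and> \<gamma> z = \<tau> z"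
proof (rule ccontr)
  assume no: "\<not> ?thesis"
  define O1 where "O1 = (\<lambda>\<sigma>. \<sigma> z) ` G"
  define O2 where "O2 = (\<lambda>\<sigma>. \<sigma> z) ` {\<sigma> \<in> G. \<sigma> y = y}"
  have fin: "finite O1" unfolding O1_def by (rule orbit_finite[OF alg])
  have "\<tau> z \<in> O1" unfolding O1_def using \<tau> by blast
  moreover have "\<tau> z \<notin> O2"
  proof
    assume "\<tau> z \<in> O2"
    then obtain \<gamma> where "\<gamma> \<in> G" "\<gamma> y = y" "\<tau> z = \<gamma> z" unfolding O2_def by blast
    then show False using no by metis
  qed
  moreover have "O2 \<subseteq> O1" unfolding O1_def O2_def by blast
  ultimately have sub: "O2 \<subset> O1" by blast
  have fin2: "finite O2" using fin sub finite_subset by blast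
  define e where "e = card O1"
  have lt: "card O2 < e" unfolding e_def by (rule psubset_card_mono[OF fin sub])
  define us where "us = map (\<lambda>i. z ^ i) [0..<e]"
  have len: "length us = e" by (simp add: us_def)
  have usi: "us ! i = z ^ i" if "i < e" for i using that by (simp add: us_def)
  have usL: "set us \<subseteq> L" using z subfield_onD(9)[OF L] by (auto simp: us_def)
  have "ring.independent cl_ring S us"
    unfolding independent_iff[OF S] len
  proof (intro allI impI)
    fix ks assume ks: "length ks = e" "set ks \<subseteq> S" "(\<Sum>i<e. ks ! i * us ! i) = 0"
    define p where "p = (\<Sum>i<e. Polynomial.monom (ks ! i) i)"
    have cp: "Polynomial.coeff p i = (if i < e then ks ! i else 0)" for i
      by (simp add: p_def coeff_sum if_distrib sum.delta cong: if_cong)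
    have pS: "p \<in> polys_over S" using ks subfield_onD(1)[OF S] by (auto simp: polys_over_def cp)
    have pz: "poly p z = 0" using ks(3) usi by (simp add: p_def poly_sum poly_monom)
    have "poly p w = 0" if w: "w \<in> O1" for w
    proof -
      obtain \<sigma> where \<sigma>: "\<sigma> \<in> G" "w = \<sigma> z" using w unfolding O1_def by blast
      then show ?thesis using auto_roots[OF \<sigma>(1) pS, of z] pz hom_zero[OF \<sigma>(1)] by simp
    qed
    then have "O1 \<subseteq> {w. poly p w = 0}" by blast
    have "p = 0"
    proof (rule ccontr)
      assume "p \<noteq> 0"
      have "e > 0" using lt by simp
      have "card O1 \<le> card {w. poly p w = 0}"
        by (rule card_mono[OF poly_roots_finite[OF \<open>p \<noteq> 0\<close>]]) fact
      also have "\<dots> \<le> Polynomial.degree p" by (rule card_poly_roots_bound[OF \<open>p \<noteq> 0\<close>])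
      also have "\<dots> < e" using \<open>e > 0\<close> by (intro degree_lessI) (auto simp: cp)
      finally show False by (simp add: e_def)
    qed
    then show "set ks \<subseteq> {0}" using cp ks(1) by (auto simp: in_set_conv_nth) (metis coeff_0)
  qed
  then have ind: "ring.independent cl_ring (fixed_by y) us"
    using ld usL unfolding linearly_disjoint_def by blast
  define q where "q = (\<Prod>w\<in>O2. [:- w, 1:])"
  have qc: "Polynomial.coeff q i \<in> fixed_by y" for i
    unfolding fixed_by_def
  proof (intro CollectI ballI impI)
    fix \<sigma> assume \<sigma>: "\<sigma> \<in> G" "\<sigma> y = y"
    have inj: "inj_on \<sigma> O2" using autosD(1)[OF \<sigma>(1)] bij_is_inj inj_on_subset by blast
    have "\<sigma> ` O2 = O2"
    proof (rule endo_inj_surj[OF fin2 _ inj])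
      show "\<sigma> ` O2 \<subseteq> O2"
      proof
        fix w assume "w \<in> \<sigma> ` O2"
        then obtain \<delta> where \<delta>: "\<delta> \<in> G" "\<delta> y = y" "w = (\<sigma> \<circ> \<delta>) z" unfolding O2_def by auto
        moreover have "\<sigma> \<circ> \<delta> \<in> G" by (rule G.comp_mem[OF \<sigma>(1) \<delta>(1)])
        ultimately show "w \<in> O2" unfolding O2_def by (intro image_eqI[of _ _ "\<sigma> \<circ> \<delta>"]) (use \<sigma> \<delta> in auto)
      qed
    qed
    then have "map_poly \<sigma> q = q" unfolding q_def using map_poly_prod_linear[OF autosD(2)[OF \<sigma>(1)] fin2 inj] by simp
    then show "\<sigma> (Polynomial.coeff q i) = Polynomial.coeff q i"
      by (metis coeff_map_poly hom_zero[OF \<sigma>(1)])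
  qed
  have zO2: "z \<in> O2" unfolding O2_def by (rule image_eqI[of _ _ id]) (simp_all add: G.id_mem)
  have dq: "Polynomial.degree q = card O2" unfolding q_def by (rule degree_prod_linear[OF fin2])
  define ks where "ks = map (Polynomial.coeff q) [0..<e]"
  have "(\<Sum>i<e. ks ! i * us ! i) = (\<Sum>i<e. Polynomial.coeff q i * z ^ i)"
    by (rule sum.cong) (auto simp: ks_def us_def)
  also have "\<dots> = (\<Sum>i\<le>Polynomial.degree q. Polynomial.coeff q i * z ^ i)"
    by (rule sum.mono_neutral_right) (use lt dq in \<open>auto simp: coeff_eq_0\<close>)
  also have "\<dots> = poly q z" by (simp add: poly_altdef)
  also have "\<dots> = 0" unfolding q_def using zO2 poly_prod_linear_0_iff[OF fin2] by simp
  finally have "set ks \<subseteq> {0}"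
    using ind[unfolded independent_iff[OF fixed_by_subfield] len, rule_format, of ks] qc
    by (auto simp: ks_def)
  moreover have "ks ! card O2 = 1" using lt lead_coeff_prod_linear[of O2] dq by (simp add: ks_def q_def)
  moreover have "ks ! card O2 \<in> set ks" using lt by (simp add: ks_def)
  ultimately show False by auto
qed

text \<open>The generator is the value at an integer n of the monic polynomial with simple roots and
  root set \<open>W\<close>. Different subsets of \<open>A\<close> have different polynomials, so
  only finitely many n let two such values coincide. Hence setwise stabilisers are point
  stabilisers, and their fixed fields have the form \<open>fixed_by z\<close>.\<close>

lemma block_generator:
  assumes W: "finite W" "W \<subseteq> A" and A: "finite A" "\<And>\<sigma> a. \<lbrakk>\<sigma> \<in> G; a \<in> A\<rbrakk> \<Longrightarrow> \<sigma> a \<in> A"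
  obtains z where "\<forall>\<sigma>\<in>G. \<sigma> z = z \<longleftrightarrow> \<sigma> ` W = W" "\<forall>\<sigma>\<in>G. \<forall>\<tau>\<in>G. \<sigma> z = \<tau> z \<longrightarrow> \<sigma> ` W = \<tau> ` W"
proof -
  define pol where "pol U = (\<Prod>w\<in>U. [:- w, 1:])" for U :: "'a set"
  have finU: "finite U" if "U \<in> Pow A" for U using that A(1) finite_subset by blast
  have diff: "pol U \<noteq> pol V" if "U \<in> Pow A" "V \<in> Pow A" "U \<noteq> V" for U V
    using poly_prod_linear_0_iff[OF finU[OF that(1)]] poly_prod_linear_0_iff[OF finU[OF that(2)]] that(3)
    unfolding pol_def by (metis subsetI subset_antisym)
  define bad where "bad = (\<Union>(U, V)\<in>{(U, V). U \<in> Pow A \<and> V \<in> Pow A \<and> U \<noteq> V}. {c. poly (pol U - pol V) c = 0})"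
  have "finite bad" unfolding bad_def
  proof (rule finite_UN_I)
    show "finite {(U, V). U \<in> Pow A \<and> V \<in> Pow A \<and> U \<noteq> V}"
      by (rule finite_subset[of _ "Pow A \<times> Pow A"]) (use A(1) in auto)
    show "finite (case a of (U, V) \<Rightarrow> {c. poly (pol U - pol V) c = 0})"
      if aUV: "a \<in> {(U, V). U \<in> Pow A \<and> V \<in> Pow A \<and> U \<noteq> V}" for a
    proof -
      obtain U V where UV: "a = (U, V)" "U \<in> Pow A" "V \<in> Pow A" "U \<noteq> V" using aUV by blast
      then have "finite {c. poly (pol U - pol V) c = 0}"
        using diff[OF UV(2-4)] by (intro poly_roots_finite) simp
      then show ?thesis using UV(1) by simp
    qed
  qed
  moreover have "infinite (range (of_nat :: nat \<Rightarrow> 'a))"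
    using finite_imageD infinite_UNIV_nat inj_of_nat by blast
  ultimately obtain n where n: "of_nat n \<notin> bad" by (metis finite_subset image_subsetI)
  define z where "z = poly (pol W) (of_nat n)"
  have of_nat_fix: "\<sigma> (of_nat m) = of_nat m" if "\<sigma> \<in> G" for \<sigma> m
    using field_hom_on_props(1,2,3)[OF subfield_on_UNIV autosD(2)[OF that]] by (induction m) auto
  have sz: "\<sigma> z = poly (pol (\<sigma> ` W)) (of_nat n)" if \<sigma>: "\<sigma> \<in> G" for \<sigma>
  proof -
    have "inj_on \<sigma> W" using autosD(1)[OF \<sigma>] bij_is_inj inj_on_subset by blast
    then have "map_poly \<sigma> (pol W) = pol (\<sigma> ` W)"
      unfolding pol_def by (rule map_poly_prod_linear[OF autosD(2)[OF \<sigma>] W(1)])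
    then show ?thesis
      using map_poly_hom_UNIV(3)[OF autosD(2)[OF \<sigma>], of "pol W" "of_nat n"] of_nat_fix[OF \<sigma>] by (simp add: z_def)
  qed
  have inA: "\<sigma> ` W \<in> Pow A" if "\<sigma> \<in> G" for \<sigma> using A(2)[OF that] W(2) by auto
  have eq: "\<sigma> ` W = \<tau> ` W" if st: "\<sigma> \<in> G" "\<tau> \<in> G" "\<sigma> z = \<tau> z" for \<sigma> \<tau>
  proof (rule ccontr)
    assume ne: "\<sigma> ` W \<noteq> \<tau> ` W"
    have "poly (pol (\<sigma> ` W) - pol (\<tau> ` W)) (of_nat n) = 0" using st sz by simp
    then have "of_nat n \<in> bad" unfolding bad_def using ne inA[OF st(1)] inA[OF st(2)] by blast
    then show False using n by simp
  qed
  show ?thesis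
  proof (rule that)
    show "\<forall>\<sigma>\<in>G. \<sigma> z = z \<longleftrightarrow> \<sigma> ` W = W"
    proof
      fix \<sigma> assume \<sigma>: "\<sigma> \<in> G"
      show "\<sigma> z = z \<longleftrightarrow> \<sigma> ` W = W" using eq[OF \<sigma> G.id_mem] sz[OF \<sigma>] by (auto simp: z_def)
    qed
    show "\<forall>\<sigma>\<in>G. \<forall>\<tau>\<in>G. \<sigma> z = \<tau> z \<longrightarrow> \<sigma> ` W = \<tau> ` W" using eq by (intro ballI impI)
  qed
qed

end

section \<open>Fibres in the algebraic closure of \<open>k(t)\<close>\<close>

lemma subfield_on_range_hom:
  assumes "field_hom_on UNIV \<phi>"
  shows "subfield_on (range \<phi>)"
proof -
  note h = field_hom_on_props[OF subfield_on_UNIV assms, simplified]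
  have "0 \<in> range \<phi>" "1 \<in> range \<phi>" using h(1,2) by (metis rangeI)+
  moreover have "\<phi> x + \<phi> y \<in> range \<phi>" "\<phi> x * \<phi> y \<in> range \<phi>" "- \<phi> x \<in> range \<phi>" "inverse (\<phi> x) \<in> range \<phi>" for x y
    using h(3,4,5,6) by (metis rangeI)+
  ultimately show ?thesis by (auto simp: subfield_on_def)
qed

lemma hom_to_ac: "field_hom_on UNIV to_ac" by (simp add: field_hom_on_def)

lemma hom_ac_const: "field_hom_on UNIV (ac_const :: 'k::field \<Rightarrow> _)"
proof -
  have "[:c:] * [:d:] = [:c * d:]" "[:c:] + [:d:] = [:c + d:]" for c d :: 'k by auto
  then show ?thesis
    by (simp add: field_hom_on_def ac_const_def one_pCons[symmetric] to_fract_add[symmetric] to_fract_mult[symmetric]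
        flip: to_ac_add to_ac_mult)
qed

lemma ac_const_simps [simp]:
  "ac_const 0 = 0" "ac_const 1 = 1" "ac_const (a + b) = ac_const a + ac_const b"
  "ac_const (a * b) = ac_const a * ac_const b" "ac_const (- a) = - ac_const a"
  "ac_const a = ac_const b \<longleftrightarrow> a = b"
  using field_hom_on_props[OF subfield_on_UNIV hom_ac_const] by simp_all

lemma galois_closure_to_ac:
  "galois_closure (range (to_ac :: 'a::field_char_0 \<Rightarrow> 'a alg_closure))"
proof
  show "subfield_on (range (to_ac :: 'a \<Rightarrow> _))" by (rule subfield_on_range_hom[OF hom_to_ac])
  fix x :: "'a alg_closure"
  obtain p :: "'a poly" where p: "p \<noteq> 0" "poly (map_poly to_ac p) x = 0" by (rule alg_closure_algebraic)
  then show "algebraic_over (range to_ac) x"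
    unfolding algebraic_over_def polys_over_def
    by (intro bexI[of _ "map_poly to_ac p"]) (auto simp: coeff_map_poly map_poly_hom_UNIV[OF hom_to_ac])
qed

text \<open>This makes the Galois theory above applicable over k(t).\<close>

instance fract :: ("{idom,ring_char_0}") field_char_0
proof
  have "to_fract (of_nat n :: 'a) = of_nat n" for n by (induction n) auto
  then show "inj (of_nat :: nat \<Rightarrow> 'a fract)"
    by (intro injI) (metis of_nat_eq_iff to_fract_eq_iff)
qed

lemma adjoin_subfield: "subfield_on (adjoin x)"
proof -
  interpret field "cl_ring :: 'a func_ac ring" by (rule field_from_type_algebra)
  have [simp]: "carrier (cl_ring :: 'a func_ac ring) = UNIV" by (simp add: ring_of_type_algebra_def)
  show ?thesis unfolding subfield_on_iff adjoin_def by (rule generate_field_is_subfield) simp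
qed

lemma generate_field_least:
  assumes "subfield_on E" "U \<subseteq> E"
  shows "generate_field cl_ring U \<subseteq> (E :: 'a::field set)"
proof -
  interpret field "cl_ring :: 'a ring" by (rule field_from_type_algebra)
  have [simp]: "carrier (cl_ring :: 'a ring) = UNIV" by (simp add: ring_of_type_algebra_def)
  show ?thesis using generate_field_min_subfield1[of U E] assms unfolding subfield_on_iff by simp
qed

lemma generate_field_subfield: "subfield_on (generate_field cl_ring (U :: 'a::field set))"
proof -
  interpret field "cl_ring :: 'a ring" by (rule field_from_type_algebra)
  have [simp]: "carrier (cl_ring :: 'a ring) = UNIV" by (simp add: ring_of_type_algebra_def)
  show ?thesis unfolding subfield_on_iff by (rule generate_field_is_subfield) simp
qed

lemma adjoin_least: "\<lbrakk>subfield_on E; x \<in> E; range ac_const \<subseteq> E\<rbrakk> \<Longrightarrow> adjoin x \<subseteq> E"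
  unfolding adjoin_def by (rule generate_field_least) auto

lemma adjoin_self: "x \<in> adjoin x" unfolding adjoin_def by (rule generate_field.incl) simp

lemma adjoin_const: "ac_const c \<in> adjoin x" unfolding adjoin_def by (rule generate_field.incl) simp

lemma poly_const_adjoin: "poly (map_poly ac_const p) x \<in> adjoin x"
  by (intro poly_polys_over[OF adjoin_subfield _ adjoin_self])
    (auto simp: polys_over_def coeff_map_poly adjoin_const)

lemma to_ac_poly: "to_ac (to_fract p) = poly (map_poly ac_const p) ac_t"
proof (induction p)
  case (pCons a p)
  have "pCons a p = [:a:] + [:0, 1:] * p" by simp
  then have "to_ac (to_fract (pCons a p)) = ac_const a + ac_t * to_ac (to_fract p)"
    by (simp only: to_fract_add to_fract_mult to_ac_add to_ac_mult ac_const_def ac_t_def)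
  then show ?case using pCons by (simp add: map_poly_pCons)
qed simp

lemma adjoin_ac_t: "adjoin ac_t = range to_ac"
proof
  show "adjoin ac_t \<subseteq> range (to_ac :: 'a poly fract \<Rightarrow> _)"
    by (rule adjoin_least[OF subfield_on_range_hom[OF hom_to_ac]]) (auto simp: ac_t_def ac_const_def)
  show "range (to_ac :: 'a poly fract \<Rightarrow> _) \<subseteq> adjoin ac_t"
  proof clarify
    fix r :: "'a poly fract"
    obtain p q where "r = to_fract p / to_fract q" using rf_quot_ex[of r] by blast
    then have "to_ac r = poly (map_poly ac_const p) ac_t / poly (map_poly ac_const q) ac_t"
      by (simp add: to_ac_poly)
    then show "to_ac r \<in> adjoin ac_t" using poly_const_adjoin subfield_onD(8)[OF adjoin_subfield] by metis
  qed
qed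

lemma rf_num_den:
  "\<phi> = to_fract (rf_num \<phi>) / to_fract (rf_den \<phi>)" "coprime (rf_num \<phi>) (rf_den \<phi>)"
  "Polynomial.lead_coeff (rf_den \<phi>) = 1"
proof -
  obtain p q where pq: "\<phi> = to_fract p / to_fract q" "coprime p q" "Polynomial.lead_coeff q = 1"
    using rf_quot_ex[of \<phi>] by blast
  have "rf_num \<phi> = p" "rf_den \<phi> = q" unfolding rf_num_def rf_den_def pq(1) rf_quot_unique[OF pq(2,3)] by auto
  then show "\<phi> = to_fract (rf_num \<phi>) / to_fract (rf_den \<phi>)" "coprime (rf_num \<phi>) (rf_den \<phi>)"
    "Polynomial.lead_coeff (rf_den \<phi>) = 1" using pq by auto
qed

lemma rf_den_nonzero_at:
  assumes "x \<in> rf_fiber \<phi> s"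
  shows "poly (map_poly ac_const (rf_den \<phi>)) x \<noteq> 0"
proof
  assume d: "poly (map_poly ac_const (rf_den \<phi>)) x = 0"
  then have n: "poly (map_poly ac_const (rf_num \<phi>)) x = 0" using assms by (simp add: rf_fiber_def)
  obtain a b where ab: "a * rf_num \<phi> + b * rf_den \<phi> = 1" using coprime_poly_bezout[OF rf_num_den(2)] by blast
  have "poly (map_poly ac_const (a * rf_num \<phi> + b * rf_den \<phi>)) x = 0"
    by (simp add: map_poly_hom_UNIV[OF hom_ac_const] n d)
  then show False unfolding ab by (simp add: one_pCons map_poly_pCons)
qed

lemma fiber_value_in_adjoin:
  assumes "x \<in> rf_fiber \<phi> s"
  shows "s \<in> adjoin x"
proof -
  have "s = poly (map_poly ac_const (rf_num \<phi>)) x / poly (map_poly ac_const (rf_den \<phi>)) x"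
    using assms rf_den_nonzero_at[OF assms] by (simp add: rf_fiber_def field_simps)
  then show ?thesis using poly_const_adjoin subfield_onD(8)[OF adjoin_subfield] by metis
qed

lemma hom_poly_const:
  assumes \<psi>: "field_hom_on UNIV \<psi>" "\<And>c. \<psi> (ac_const c) = ac_const c"
  shows "\<psi> (poly (map_poly ac_const p) x) = poly (map_poly ac_const p) (\<psi> x)"
proof -
  have "map_poly \<psi> (map_poly ac_const p) = map_poly ac_const p"
    using field_hom_on_props(2)[OF subfield_on_UNIV \<psi>(1)] \<psi>(2)
    by (intro poly_eqI) (simp add: coeff_map_poly)
  then show ?thesis using map_poly_hom_UNIV(3)[OF \<psi>(1), of "map_poly ac_const p" x] by simp
qed

lemma hom_rf_fiber:
  assumes \<psi>: "field_hom_on UNIV \<psi>" "\<And>c. \<psi> (ac_const c) = ac_const c" and x: "x \<in> rf_fiber \<phi> s"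
  shows "\<psi> x \<in> rf_fiber \<phi> (\<psi> s)"
proof -
  have "\<psi> (poly (map_poly ac_const (rf_num \<phi>)) x - s * poly (map_poly ac_const (rf_den \<phi>)) x) = 0"
    using x field_hom_on_props(2)[OF subfield_on_UNIV \<psi>(1)] by (simp add: rf_fiber_def)
  then show ?thesis
    using field_hom_on_props(4,7)[OF subfield_on_UNIV \<psi>(1)] by (simp add: rf_fiber_def hom_poly_const[OF \<psi>])
qed

abbreviation GalT :: "('k::field_char_0 func_ac \<Rightarrow> 'k func_ac) set" where
  "GalT \<equiv> autos (range to_ac)"

lemma GalT_const: "\<sigma> \<in> GalT \<Longrightarrow> \<sigma> (ac_const c) = ac_const c"
  unfolding ac_const_def by (rule autosD(3)[OF _ rangeI])

lemma GalT_t: "\<sigma> \<in> GalT \<Longrightarrow> \<sigma> ac_t = ac_t"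
  unfolding ac_t_def by (rule autosD(3)[OF _ rangeI])

lemma GalT_fiber: "\<lbrakk>\<sigma> \<in> GalT; x \<in> rf_fiber \<phi> s\<rbrakk> \<Longrightarrow> \<sigma> x \<in> rf_fiber \<phi> (\<sigma> s)"
  by (rule hom_rf_fiber[OF autosD(2) GalT_const])

text \<open>As t lies in k(x), the automorphisms over k(t) that fix x are those over k(x), and
  \<open>moved_by_auto\<close> over k(x) rules out further fixed elements.\<close>

lemma fixed_by_adjoin:
  fixes x :: "'k::field_char_0 func_ac"
  assumes "ac_t \<in> adjoin x"
  shows "galois_closure.fixed_by (range to_ac) x = adjoin x"
proof -
  interpret galois_closure "range (to_ac :: 'k poly fract \<Rightarrow> _)" by (rule galois_closure_to_ac)
  have sub: "range to_ac \<subseteq> adjoin x"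
    unfolding adjoin_ac_t[symmetric] by (rule adjoin_least[OF adjoin_subfield assms]) (auto simp: adjoin_const)
  interpret E: galois_closure "adjoin x" by (rule extend_over[OF adjoin_subfield sub])
  show ?thesis
  proof
    show "adjoin x \<subseteq> fixed_by x"
    proof (rule adjoin_least[OF fixed_by_subfield self_fixed_by])
      show "range ac_const \<subseteq> fixed_by x" using S_fixed_by by (auto simp: ac_const_def)
    qed
    show "fixed_by x \<subseteq> adjoin x"
    proof
      fix c assume c: "c \<in> fixed_by x"
      show "c \<in> adjoin x"
      proof (rule ccontr)
        assume "c \<notin> adjoin x"
        then obtain \<sigma> where \<sigma>: "\<sigma> \<in> autos (adjoin x)" "\<sigma> c \<noteq> c" using E.moved_by_auto by blast
        have "\<sigma> \<in> GalT" using autos_mono[OF sub] \<sigma>(1) by blast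
        moreover have "\<sigma> x = x" by (rule autosD(3)[OF \<sigma>(1) adjoin_self])
        ultimately show False using c \<sigma>(2) by (simp add: fixed_by_def)
      qed
    qed
  qed
qed

text \<open>A set \<open>W\<close> that is preserved by the stabiliser of x and by some automorphism
  moving x has a fixed field strictly below k(x). Minimality makes that field disjoint from k(y),
  which says that the stabiliser of y is transitive on the translates of \<open>W\<close>. Dually,
  for sets of conjugates of y, the stabiliser of \<open>W\<close> is transitive on the conjugates of
  x. The remaining condition expresses that k(x) and k(y) are not disjoint.\<close>

theorem minimally_reducible_action:
  fixes \<phi> \<chi> :: "'k::field_char_0 poly fract"
  assumes mr: "minimally_reducible \<phi> \<chi>"
  obtains x y where "x \<in> rf_fiber \<phi> ac_t" "y \<in> rf_fiber \<chi> ac_t"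
    "\<exists>\<tau>\<in>GalT. \<forall>\<sigma>\<in>GalT. \<sigma> y = y \<longrightarrow> \<sigma> x \<noteq> \<tau> x"
    "\<forall>W \<tau>. W \<subseteq> (\<lambda>\<sigma>. \<sigma> x) ` GalT \<longrightarrow> (\<forall>\<sigma>\<in>GalT. \<sigma> x = x \<longrightarrow> \<sigma> ` W = W) \<longrightarrow> (\<exists>\<sigma>\<in>GalT. \<sigma> ` W = W \<and> \<sigma> x \<noteq> x) \<longrightarrow>
       \<tau> \<in> GalT \<longrightarrow> (\<exists>\<sigma>\<in>GalT. \<sigma> y = y \<and> \<sigma> ` W = \<tau> ` W)"
    "\<forall>W \<tau>. W \<subseteq> (\<lambda>\<sigma>. \<sigma> y) ` GalT \<longrightarrow> (\<forall>\<sigma>\<in>GalT. \<sigma> y = y \<longrightarrow> \<sigma> ` W = W) \<longrightarrow> (\<exists>\<sigma>\<in>GalT. \<sigma> ` W = W \<and> \<sigma> y \<noteq> y) \<longrightarrow>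
       \<tau> \<in> GalT \<longrightarrow> (\<exists>\<sigma>\<in>GalT. \<sigma> ` W = W \<and> \<sigma> x = \<tau> x)"
proof -
  interpret galois_closure "range (to_ac :: 'k poly fract \<Rightarrow> _)" by (rule galois_closure_to_ac)
  obtain x y where x: "x \<in> rf_fiber \<phi> ac_t" and y: "y \<in> rf_fiber \<chi> ac_t"
    and nld: "\<not> linearly_disjoint (adjoin ac_t) (adjoin x) (adjoin y)"
    and ld: "\<forall>L M. subfield L cl_ring \<and> adjoin ac_t \<subseteq> L \<and> L \<subseteq> adjoin x \<and>
               subfield M cl_ring \<and> adjoin ac_t \<subseteq> M \<and> M \<subseteq> adjoin y \<and>
               (L, M) \<noteq> (adjoin x, adjoin y) \<longrightarrow> linearly_disjoint (adjoin ac_t) L M"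
    using mr unfolding minimally_reducible_def by (elim bexE conjE) (rule that)
  have fx: "fixed_by x = adjoin x" and fy: "fixed_by y = adjoin y"
    using fixed_by_adjoin[OF fiber_value_in_adjoin[OF x]] fixed_by_adjoin[OF fiber_value_in_adjoin[OF y]] by simp_all
  have ld': "linearly_disjoint (range to_ac) (fixed_by u) (fixed_by v)"
    if uv: "fixed_by u \<subseteq> fixed_by x" "fixed_by v \<subseteq> fixed_by y"
      "fixed_by u \<noteq> fixed_by x \<or> fixed_by v \<noteq> fixed_by y" for u v
  proof -
    have "subfield (fixed_by u) cl_ring \<and> range to_ac \<subseteq> fixed_by u \<and> fixed_by u \<subseteq> fixed_by x \<and>
      subfield (fixed_by v) cl_ring \<and> range to_ac \<subseteq> fixed_by v \<and> fixed_by v \<subseteq> fixed_by y \<and>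
      (fixed_by u, fixed_by v) \<noteq> (fixed_by x, fixed_by y)"
      using uv S_fixed_by fixed_by_subfield unfolding subfield_on_iff by simp
    then show ?thesis using ld unfolding fx[symmetric] fy[symmetric] adjoin_ac_t by simp
  qed
  have M0: "\<exists>\<tau>\<in>GalT. \<forall>\<sigma>\<in>GalT. \<sigma> y = y \<longrightarrow> \<sigma> x \<noteq> \<tau> x"
  proof (rule ccontr)
    assume no: "\<not> ?thesis"
    have "linearly_disjoint (range to_ac) (fixed_by x) (fixed_by y)"
      by (rule linearly_disjoint_of_transitive) (use no in metis)
    then show False using nld unfolding fx fy adjoin_ac_t by blast
  qed
  have orb: "finite ((\<lambda>\<sigma>. \<sigma> u) ` GalT)" for u :: "'k func_ac" by (rule orbit_finite[OF alg])
  have orb_inv: "\<sigma> a \<in> (\<lambda>\<sigma>. \<sigma> u) ` GalT" if sa: "\<sigma> \<in> GalT" "a \<in> (\<lambda>\<sigma>. \<sigma> u) ` GalT" for \<sigma> a and u :: "'k func_ac"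
  proof -
    obtain \<tau> where "\<tau> \<in> GalT" "a = \<tau> u" using sa(2) by blast
    then show ?thesis using G.comp_mem[OF sa(1)] by (intro image_eqI[of _ _ "\<sigma> \<circ> \<tau>"]) auto
  qed
  have shrink: "fixed_by z \<subseteq> fixed_by u" "fixed_by z \<noteq> fixed_by u"
    if z: "\<And>\<sigma>. \<sigma> \<in> GalT \<Longrightarrow> \<sigma> z = z \<longleftrightarrow> \<sigma> ` W = W" and W: "\<forall>\<sigma>\<in>GalT. \<sigma> u = u \<longrightarrow> \<sigma> ` W = W"
      "\<exists>\<sigma>\<in>GalT. \<sigma> ` W = W \<and> \<sigma> u \<noteq> u" for z W and u :: "'k func_ac"
  proof -
    show "fixed_by z \<subseteq> fixed_by u" using z W(1) unfolding fixed_by_def by blast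
    have "u \<notin> fixed_by z" using z W(2) unfolding fixed_by_def by blast
    then show "fixed_by z \<noteq> fixed_by u" using self_fixed_by by blast
  qed
  have M1: "\<exists>\<sigma>\<in>GalT. \<sigma> y = y \<and> \<sigma> ` W = \<tau> ` W"
    if W: "W \<subseteq> (\<lambda>\<sigma>. \<sigma> x) ` GalT" "\<forall>\<sigma>\<in>GalT. \<sigma> x = x \<longrightarrow> \<sigma> ` W = W" "\<exists>\<sigma>\<in>GalT. \<sigma> ` W = W \<and> \<sigma> x \<noteq> x"
      and \<tau>: "\<tau> \<in> GalT" for W \<tau>
  proof -
    have "finite W" using W(1) orb finite_subset by blast
    then obtain z where z: "\<forall>\<sigma>\<in>GalT. \<sigma> z = z \<longleftrightarrow> \<sigma> ` W = W"
      "\<forall>\<sigma>\<in>GalT. \<forall>\<tau>\<in>GalT. \<sigma> z = \<tau> z \<longrightarrow> \<sigma> ` W = \<tau> ` W"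
      by (rule block_generator[OF _ W(1) orb[of x]]) (rule orb_inv, assumption+)
    note sh = shrink[OF z(1)[rule_format] W(2,3)]
    have "linearly_disjoint (range to_ac) (fixed_by z) (fixed_by y)" by (rule ld') (use sh in auto)
    from transitive_of_linearly_disjoint[OF this self_fixed_by fixed_by_subfield \<tau>]
    obtain \<sigma> where "\<sigma> \<in> GalT" "\<sigma> y = y" "\<sigma> z = \<tau> z" by blast
    then show ?thesis using z(2) \<tau> by blast
  qed
  have M2: "\<exists>\<sigma>\<in>GalT. \<sigma> ` W = W \<and> \<sigma> x = \<tau> x"
    if W: "W \<subseteq> (\<lambda>\<sigma>. \<sigma> y) ` GalT" "\<forall>\<sigma>\<in>GalT. \<sigma> y = y \<longrightarrow> \<sigma> ` W = W" "\<exists>\<sigma>\<in>GalT. \<sigma> ` W = W \<and> \<sigma> y \<noteq> y"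
      and \<tau>: "\<tau> \<in> GalT" for W \<tau>
  proof -
    have "finite W" using W(1) orb finite_subset by blast
    then obtain z where z: "\<forall>\<sigma>\<in>GalT. \<sigma> z = z \<longleftrightarrow> \<sigma> ` W = W"
      "\<forall>\<sigma>\<in>GalT. \<forall>\<tau>\<in>GalT. \<sigma> z = \<tau> z \<longrightarrow> \<sigma> ` W = \<tau> ` W"
      by (rule block_generator[OF _ W(1) orb[of y]]) (rule orb_inv, assumption+)
    note sh = shrink[OF z(1)[rule_format] W(2,3)]
    have "linearly_disjoint (range to_ac) (fixed_by x) (fixed_by z)" by (rule ld') (use sh in auto)
    from transitive_of_linearly_disjoint[OF this self_fixed_by fixed_by_subfield \<tau>]
    obtain \<sigma> where "\<sigma> \<in> GalT" "\<sigma> z = z" "\<sigma> x = \<tau> x" by blast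
    then show ?thesis using z by blast
  qed
  show ?thesis by (rule that[OF x y M0]) (use M1 M2 in blast)+
qed

text \<open>Let \<open>N\<close> be the kernel of the action on the conjugates of x, and
  \<open>W\<close> the orbit of y under \<open>N\<close>. If \<open>N\<close> moved y, minimality
  would make the stabiliser of \<open>W\<close> transitive on the conjugates of x. Each of its
  elements is a product of one in \<open>N\<close> and one fixing y, and \<open>N\<close> is trivial
  on those conjugates; so the stabiliser of y would be transitive as well.\<close>

lemma faithful_on_orbit:
  assumes G: "perm_group G"
    and M0: "\<exists>\<tau>\<in>G. \<forall>\<sigma>\<in>G. \<sigma> y = y \<longrightarrow> \<sigma> x \<noteq> \<tau> x"
    and M2: "\<forall>W \<tau>. W \<subseteq> (\<lambda>\<sigma>. \<sigma> y) ` G \<longrightarrow> (\<forall>\<sigma>\<in>G. \<sigma> y = y \<longrightarrow> \<sigma> ` W = W) \<longrightarrow> (\<exists>\<sigma>\<in>G. \<sigma> ` W = W \<and> \<sigma> y \<noteq> y) \<longrightarrow>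
       \<tau> \<in> G \<longrightarrow> (\<exists>\<sigma>\<in>G. \<sigma> ` W = W \<and> \<sigma> x = \<tau> x)"
    and g: "g \<in> G" "\<And>a. a \<in> (\<lambda>\<sigma>. \<sigma> x) ` G \<Longrightarrow> g a = a"
  shows "g y = y"
proof (rule ccontr)
  assume ne: "g y \<noteq> y"
  interpret perm_group G by fact
  define N where "N = {n \<in> G. \<forall>a\<in>(\<lambda>\<sigma>. \<sigma> x) ` G. n a = a}"
  define W where "W = (\<lambda>n. n y) ` N"
  have orb: "\<sigma> a \<in> (\<lambda>\<sigma>. \<sigma> x) ` G" if sa: "\<sigma> \<in> G" "a \<in> (\<lambda>\<sigma>. \<sigma> x) ` G" for \<sigma> a
  proof -
    obtain \<tau> where "\<tau> \<in> G" "a = \<tau> x" using sa(2) by blast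
    then show ?thesis using comp_mem[OF sa(1)] by (intro image_eqI[of _ _ "\<sigma> \<circ> \<tau>"]) auto
  qed
  have Nfix: "n a = a" if "n \<in> N" "a \<in> (\<lambda>\<sigma>. \<sigma> x) ` G" for n a
    using that unfolding N_def by blast
  have NI: "n \<in> N" if "n \<in> G" "\<And>a. a \<in> (\<lambda>\<sigma>. \<sigma> x) ` G \<Longrightarrow> n a = a" for n
    unfolding N_def using that by (intro CollectI conjI ballI)
  have NG: "n \<in> G" if "n \<in> N" for n using that by (simp add: N_def)
  have Ncomp: "n \<circ> m \<in> N" if "n \<in> N" "m \<in> N" for n m using that comp_mem by (simp add: N_def)
  have Ninv: "finv n \<in> N" if n: "n \<in> N" for n
  proof -
    have "finv n a = a" if "a \<in> (\<lambda>\<sigma>. \<sigma> x) ` G" for a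
      using Nfix[OF n that] finv_left[OF NG[OF n], of a] by simp
    then show ?thesis by (rule NI[OF finv_mem[OF NG[OF n]]])
  qed
  have conj: "\<sigma> \<circ> n \<circ> finv \<sigma> \<in> N" if s: "\<sigma> \<in> G" and n: "n \<in> N" for \<sigma> n
  proof -
    have "(\<sigma> \<circ> n \<circ> finv \<sigma>) a = a" if "a \<in> (\<lambda>\<sigma>. \<sigma> x) ` G" for a
      using Nfix[OF n orb[OF finv_mem[OF s] that]] s by simp
    then show ?thesis by (rule NI[OF conj_mem[OF s NG[OF n]]])
  qed
  have WG: "W \<subseteq> (\<lambda>\<sigma>. \<sigma> y) ` G" unfolding W_def N_def by blast
  have yW: "y \<in> W" unfolding W_def by (rule image_eqI[of _ _ id]) (simp_all add: N_def id_mem)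
  have stab_eq: "\<sigma> ` W = W" if s: "\<sigma> \<in> G" and sub: "\<And>\<tau>. \<tau> \<in> {\<sigma>, finv \<sigma>} \<Longrightarrow> \<tau> ` W \<subseteq> W" for \<sigma>
  proof
    show "\<sigma> ` W \<subseteq> W" using sub by blast
    show "W \<subseteq> \<sigma> ` W"
    proof
      fix w assume "w \<in> W"
      then have "finv \<sigma> w \<in> W" using sub[of "finv \<sigma>"] by blast
      then show "w \<in> \<sigma> ` W" using finv_right[OF s, of w] by (metis imageI)
    qed
  qed
  have Gy: "\<sigma> ` W = W" if s: "\<sigma> \<in> G" "\<sigma> y = y" for \<sigma>
  proof (rule stab_eq[OF s(1)])
    have yi: "finv \<sigma> y = y" using finv_left[OF s(1), of y] s(2) by simp
    fix \<tau> assume "\<tau> \<in> {\<sigma>, finv \<sigma>}"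
    then have t: "\<tau> \<in> G" "\<tau> y = y" using s yi finv_mem by auto
    have ti: "finv \<tau> y = y" using finv_left[OF t(1), of y] t(2) by simp
    show "\<tau> ` W \<subseteq> W"
    proof
      fix w assume "w \<in> \<tau> ` W"
      then obtain n where n: "n \<in> N" "w = \<tau> (n y)" unfolding W_def by blast
      then show "w \<in> W" unfolding W_def using conj[OF t(1) n(1)] ti
        by (intro image_eqI[of _ _ "\<tau> \<circ> n \<circ> finv \<tau>"]) auto
    qed
  qed
  have NW: "n ` W = W" if n: "n \<in> N" for n
  proof (rule stab_eq[OF NG[OF n]])
    fix \<tau> assume "\<tau> \<in> {n, finv n}"
    then have t: "\<tau> \<in> N" using n Ninv by auto
    show "\<tau> ` W \<subseteq> W"
    proof
      fix w assume "w \<in> \<tau> ` W"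
      then obtain m where m: "m \<in> N" "w = \<tau> (m y)" unfolding W_def by blast
      then show "w \<in> W" unfolding W_def using Ncomp[OF t m(1)] by (intro image_eqI[of _ _ "\<tau> \<circ> m"]) auto
    qed
  qed
  have gN: "g \<in> N" using g by (rule NI)
  obtain \<tau> where \<tau>: "\<tau> \<in> G" "\<forall>\<sigma>\<in>G. \<sigma> y = y \<longrightarrow> \<sigma> x \<noteq> \<tau> x" using M0 by blast
  have h2: "\<forall>\<sigma>\<in>G. \<sigma> y = y \<longrightarrow> \<sigma> ` W = W" using Gy by (intro ballI impI)
  have h3: "\<exists>\<sigma>\<in>G. \<sigma> ` W = W \<and> \<sigma> y \<noteq> y" using NW[OF gN] g(1) ne by blast
  obtain \<sigma> where \<sigma>: "\<sigma> \<in> G" "\<sigma> ` W = W" "\<sigma> x = \<tau> x"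
    using M2[THEN spec, THEN spec, THEN mp, OF WG, THEN mp, OF h2, THEN mp, OF h3, THEN mp, OF \<tau>(1)] by blast
  have "\<sigma> y \<in> W" using \<sigma>(2) yW by blast
  then obtain n where n: "n \<in> N" "\<sigma> y = n y" unfolding W_def by blast
  have "\<sigma> x \<in> (\<lambda>\<sigma>. \<sigma> x) ` G" using \<sigma>(1) by blast
  then have "(finv n \<circ> \<sigma>) x = \<sigma> x" using Nfix[OF Ninv[OF n(1)]] by simp
  moreover have "(finv n \<circ> \<sigma>) y = y" using n finv_left[OF NG[OF n(1)]] by simp
  moreover have "finv n \<circ> \<sigma> \<in> G" using comp_mem[OF finv_mem[OF NG[OF n(1)]] \<sigma>(1)] .
  ultimately show False using \<tau>(2) \<sigma>(3) by metis
qed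

section \<open>Inertia at infinity\<close>

lemma order_mult_primitive_root:
  fixes \<zeta> \<xi> :: "'a::field"
  assumes \<zeta>: "\<And>m. \<zeta> ^ m = 1 \<longleftrightarrow> M dvd m" and q: "prime (q::nat)" and \<xi>: "\<xi> ^ q = \<zeta>" "\<xi> ^ M \<noteq> 1"
  shows "\<xi> ^ m = 1 \<longleftrightarrow> q * M dvd m"
proof
  assume "q * M dvd m"
  then obtain k where "m = q * M * k" by (rule dvdE)
  then have "\<xi> ^ m = (\<zeta> ^ M) ^ k" by (simp add: power_mult \<xi>(1))
  then show "\<xi> ^ m = 1" using \<zeta>[of M] by simp
next
  assume m: "\<xi> ^ m = 1"
  have "\<zeta> ^ m = (\<xi> ^ m) ^ q" by (simp add: \<xi>(1)[symmetric] mult.commute flip: power_mult)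
  then have "M dvd m" using m \<zeta> by simp
  then obtain k where k: "m = M * k" by (rule dvdE)
  define w where "w = \<xi> ^ M"
  have wq: "w ^ q = 1" using \<zeta>[of M] by (simp add: w_def \<xi>(1)[symmetric] mult.commute flip: power_mult)
  have wk: "w ^ k = 1" using m by (simp add: k w_def power_mult)
  have "q dvd k"
  proof (rule ccontr)
    assume "\<not> q dvd k"
    then have "coprime k q" using q by (metis coprime_commute prime_imp_coprime)
    moreover have "k \<noteq> 0" using \<open>\<not> q dvd k\<close> by (metis dvd_0_right)
    ultimately obtain u v where uv: "k * u = q * v + 1" using bezout_nat[of k q] by (metis coprime_imp_gcd_eq_1)
    have "w = w ^ (q * v + 1)" using wq by (simp add: power_mult)
    also have "\<dots> = 1" unfolding uv[symmetric] using wk by (simp add: power_mult)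
    finally show False using \<xi>(2) by (simp add: w_def)
  qed
  then show "q * M dvd m" unfolding k by (metis mult.commute mult_dvd_mono dvd_refl)
qed

text \<open>Induction over the prime factors: a suitable q-th root of a root of unity of order M has
  order q M. If q divides M, every q-th root will do; otherwise a bad choice is corrected by a
  nontrivial q-th root of unity.\<close>

lemma primitive_root_exists:
  "N > 0 \<Longrightarrow> \<exists>\<zeta> :: 'a::{alg_closed_field,field_char_0}. \<forall>m. \<zeta> ^ m = 1 \<longleftrightarrow> N dvd m"
proof (induction N rule: less_induct)
  case (less N)
  show ?case
  proof (cases "N = 1")
    case False
    then obtain q where q: "prime q" "q dvd N" using prime_factor_nat by blast
    then obtain M where M: "N = q * M" by (auto elim: dvdE)
    have M0: "M > 0" "M < N" using less.prems M prime_gt_1_nat[OF q(1)] by auto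
    then obtain \<zeta> :: 'a where \<zeta>: "\<And>m. \<zeta> ^ m = 1 \<longleftrightarrow> M dvd m" using less.IH[of M] by blast
    obtain \<xi> where \<xi>: "\<xi> ^ q = \<zeta>" using nth_root_exists[of q \<zeta>] prime_gt_0_nat[OF q(1)] by blast
    have "\<exists>\<xi>. \<xi> ^ q = \<zeta> \<and> \<xi> ^ M \<noteq> 1"
    proof (cases "q dvd M")
      case True
      then obtain M' where M': "M = q * M'" by (rule dvdE)
      have "\<xi> ^ M = \<zeta> ^ M'" by (simp add: M' power_mult \<xi>)
      moreover have "\<not> M dvd M'" using M0 M' prime_gt_1_nat[OF q(1)] by (auto dest: dvd_imp_le)
      ultimately show ?thesis using \<zeta> \<xi> by metis
    next
      case False
      show ?thesis
      proof (cases "\<xi> ^ M = 1")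
        case True
        \<comment> \<open>The roots of 1 + X + ... + X^(q-1) are nontrivial q-th roots of unity: its
          value at 1 is q, which is nonzero in characteristic 0.\<close>
        define pol :: "'a poly" where "pol = (\<Sum>i<q. Polynomial.monom 1 i)"
        have "Polynomial.coeff pol i = (if i < q then 1 else 0)" for i
          by (simp add: pol_def coeff_sum if_distrib sum.delta cong: if_cong)
        then have "Polynomial.coeff pol 1 \<noteq> 0" using prime_gt_1_nat[OF q(1)] by simp
        then have "Polynomial.degree pol > 0" by (metis gr0I le_degree not_one_le_zero)
        then obtain \<eta> where \<eta>: "poly pol \<eta> = 0" using alg_closed_imp_poly_has_root by blast
        have s0: "(\<Sum>i<q. \<eta> ^ i) = 0" using \<eta> by (simp add: pol_def poly_sum poly_monom)
        have "\<eta> \<noteq> 1" using s0 prime_gt_0_nat[OF q(1)] by auto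
        have "(1 - \<eta>) * (\<Sum>i<q. \<eta> ^ i) = 1 - \<eta> ^ q" by (rule one_diff_power_eq[symmetric])
        then have \<eta>q: "\<eta> ^ q = 1" using s0 by simp
        have "\<eta> ^ M \<noteq> 1"
        proof
          assume "\<eta> ^ M = 1"
          have "coprime M q" using False q(1) by (metis coprime_commute prime_imp_coprime)
          then obtain u v where uv: "M * u = q * v + 1" using bezout_nat[of M q] M0 by (metis coprime_imp_gcd_eq_1 neq0_conv)
          have "\<eta> = \<eta> ^ (q * v + 1)" using \<eta>q by (simp add: power_mult)
          also have "\<dots> = 1" unfolding uv[symmetric] using \<open>\<eta> ^ M = 1\<close> by (simp add: power_mult)
          finally show False using \<open>\<eta> \<noteq> 1\<close> by simp
        qed
        then show ?thesis using True \<xi> \<eta>q by (intro exI[of _ "\<xi> * \<eta>"]) (simp add: power_mult_distrib)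
      qed (use \<xi> in blast)
    qed
    then obtain \<xi> where "\<xi> ^ q = \<zeta>" "\<xi> ^ M \<noteq> 1" by blast
    then show ?thesis using order_mult_primitive_root[OF \<zeta> q(1)] M by blast
  next
    case True
    then show ?thesis by (intro exI[of _ 1]) simp
  qed
qed

text \<open>Put U = A/B and let R be an e-th root of U. If W is the compositional inverse of X R,
  then W R(W) = X, and the e-th power of this identity is the claim.\<close>

lemma local_uniformizer:
  fixes A B :: "'c::{alg_closed_field,field_char_0} fps"
  assumes A: "fps_nth A 0 \<noteq> 0" and B: "fps_nth B 0 \<noteq> 0" and e: "e > 0"
  obtains W where "fps_nth W 0 = 0" "fps_nth W 1 \<noteq> 0" "W ^ e * (A oo W) = fps_X ^ e * (B oo W)"
proof -
  define U where "U = A * inverse B"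
  have U0: "fps_nth U 0 \<noteq> 0" using A B by (simp add: U_def)
  have UB: "U * B = A" using B by (simp add: U_def mult.assoc inverse_mult_eq_1)
  obtain k where k: "e = Suc k" using e by (cases e) auto
  obtain c where c: "c ^ e = fps_nth U 0" using nth_root_exists[of e] e by blast
  define R where "R = fps_radical (\<lambda>_ _. c) e U"
  have Re: "R ^ e = U" using power_radical[OF U0, of "\<lambda>_ _. c" k] c by (simp add: R_def k)
  have R0: "fps_nth R 0 \<noteq> 0" using Re U0 e by (metis fps_nth_power_0 power_0_left zero_power)
  define H where "H = fps_X * R"
  have H0: "fps_nth H 0 = 0" and H1: "fps_nth H 1 \<noteq> 0" using R0 by (simp_all add: H_def)
  define W where "W = fps_inv H"
  have W0: "fps_nth W 0 = 0" by (simp add: W_def fps_inv_def)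
  have W1: "fps_nth W 1 \<noteq> 0" using H1 by (simp add: W_def fps_inv_def)
  have "H oo W = fps_X" unfolding W_def by (rule fps_inv_right[OF H0 H1])
  then have "W * (R oo W) = fps_X" by (simp add: H_def fps_compose_mult_distrib[OF W0] W0)
  then have "W ^ e * (R oo W) ^ e = fps_X ^ e" by (metis power_mult_distrib)
  then have "W ^ e * (U oo W) = fps_X ^ e" by (simp add: fps_compose_power[OF W0] Re)
  then have "W ^ e * ((U oo W) * (B oo W)) = fps_X ^ e * (B oo W)" by (simp add: mult.assoc[symmetric])
  then have "W ^ e * (A oo W) = fps_X ^ e * (B oo W)"
    by (simp only: fps_compose_mult_distrib[OF W0, symmetric] UB)
  then show ?thesis by (rule that[OF W0 W1])
qed

section \<open>Puiseux expansions at the poles of a rational function\<close>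

lemma hom_fls_const: "field_hom_on UNIV (fls_const :: 'c::field \<Rightarrow> _)"
  by (simp add: field_hom_on_def fls_plus_const fls_const_mult_const)

lemma poly_fls_of_fps:
  fixes r :: "'c::field poly"
  assumes V: "fps_nth V 0 = 0"
  shows "poly (map_poly fls_const r) (fps_to_fls V) = fps_to_fls (fps_of_poly r oo V)"
proof (induction r)
  case (pCons c r)
  have eq: "fps_of_poly (pCons c r) = fps_const c + fps_X * fps_of_poly r" by (simp add: fps_of_poly_pCons mult.commute)
  have "fps_of_poly (pCons c r) oo V = fps_const c + V * (fps_of_poly r oo V)"
    unfolding eq by (simp add: fps_compose_add_distrib fps_compose_mult_distrib[OF V] fps_X_fps_compose_startby0[OF V])
  then show ?case using pCons by (simp add: map_poly_pCons fls_times_fps_to_fls)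
qed simp

lemma poly_roots_order_sum:
  fixes q :: "'c::alg_closed_field poly"
  assumes "q \<noteq> 0"
  shows "(\<Sum>a | poly q a = 0. Polynomial.order a q) = Polynomial.degree q"
proof -
  obtain A where A: "size A = Polynomial.degree q"
    "q = Polynomial.smult (Polynomial.lead_coeff q) (\<Prod>x\<in>#A. [:- x, 1:])"
    using alg_closed_imp_factorization[OF assms] by blast
  have "proots q = proots (\<Prod>x\<in>#A. [:- x, 1:])" using assms by (subst A(2)) simp
  also have "\<dots> = A"
  proof -
    have nz: "(\<Prod>x\<in>#A. [:- x, 1:]) \<noteq> 0" for A :: "'c multiset" by (auto simp: prod_mset_zero_iff)
    show ?thesis
    proof (induction A)
      case (add x A)
      have "proots (\<Prod>x\<in>#add_mset x A. [:- x, 1:]) = proots ([:- x, 1:] * (\<Prod>x\<in>#A. [:- x, 1:]))"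
        by (simp only: image_mset_add_mset prod_mset.add_mset)
      also have "\<dots> = proots [:- x, 1:] + proots (\<Prod>x\<in>#A. [:- x, 1:])" using nz by (intro proots_mult) auto
      finally show ?case using add by (simp only: proots_linear_factor) simp
    qed simp
  qed
  finally have pr: "proots q = A" .
  have "size A = (\<Sum>a\<in>set_mset A. count A a)" by (simp add: size_multiset_overloaded_eq)
  also have "\<dots> = (\<Sum>a | poly q a = 0. Polynomial.order a q)"
    unfolding pr[symmetric] using assms by simp
  finally show ?thesis using A(1) by simp
qed

text \<open>The substitution X -> \<zeta> X. If \<zeta>^N = 1, it fixes X^N; it plays the role of
  inertia at infinity when X is an N-th root of 1/t.\<close>

definition rot :: "'c::field \<Rightarrow> 'c fls \<Rightarrow> 'c fls" where
  "rot \<zeta> F = fls_compose_fps F (fps_const \<zeta> * fps_X)"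

lemma hom_rot: "\<zeta> \<noteq> 0 \<Longrightarrow> field_hom_on UNIV (rot \<zeta>)"
  by (simp add: field_hom_on_def rot_def fls_compose_fps_add fls_compose_fps_mult)

lemma rot_const: "rot \<zeta> (fls_const c) = fls_const c" by (simp add: rot_def)

lemma rot_fps:
  "\<zeta> \<noteq> 0 \<Longrightarrow> rot \<zeta> (fps_to_fls V) = fps_to_fls (V oo (fps_const \<zeta> * fps_X))"
  by (simp add: rot_def)

text \<open>The polynomial p(Y) - t q(Y) after the substitution t = X^(-N).\<close>

definition puiseux_eq :: "nat \<Rightarrow> 'c::field poly \<Rightarrow> 'c poly \<Rightarrow> 'c fls poly" where
  "puiseux_eq N p q = map_poly fls_const p - Polynomial.smult (inverse (fls_X ^ N)) (map_poly fls_const q)"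

definition poles :: "'c::field poly \<Rightarrow> 'c poly \<Rightarrow> 'c option set" where
  "poles p q = Some ` {a. poly q a = 0} \<union> (if Polynomial.degree p > Polynomial.degree q then {None} else {})"

text \<open>The ramification index over infinity at the pole \<open>P\<close> of p/q.\<close>

definition pole_mult :: "'c::field poly \<Rightarrow> 'c poly \<Rightarrow> 'c option \<Rightarrow> nat" where
  "pole_mult p q P = (case P of Some a \<Rightarrow> Polynomial.order a q | None \<Rightarrow> Polynomial.degree p - Polynomial.degree q)"

text \<open>\<open>V\<close> is the expansion in the local coordinate of the pole: Y - a at a finite
  point a, and 1/Y at infinity.\<close>

definition branch :: "'c::field option \<Rightarrow> 'c fps \<Rightarrow> 'c fls" where
  "branch P V = (case P of Some a \<Rightarrow> fls_const a + fps_to_fls V | None \<Rightarrow> inverse (fps_to_fls V))"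

lemma branch_eq_iff:
  assumes "fps_nth V 0 = 0" "fps_nth V' 0 = 0" "V \<noteq> 0" "V' \<noteq> 0"
  shows "branch P V = branch P' V' \<longleftrightarrow> P = P' \<and> V = V'"
proof -
  have const: "fls_const a + fps_to_fls U = fps_to_fls (fps_const a + U)" for a and U :: "'a fps"
    by simp
  have no: "fls_const a + fps_to_fls U \<noteq> inverse (fps_to_fls U')" if "fps_nth U' 0 = 0" "U' \<noteq> 0" for a and U U' :: "'a fps"
  proof
    assume h: "fls_const a + fps_to_fls U = inverse (fps_to_fls U')"
    have "fps_to_fls ((fps_const a + U) * U') = 1" by (simp add: fls_times_fps_to_fls h that(2))
    then have "(fps_const a + U) * U' = 1" by (simp only: fps_to_fls_eq_1_iff)
    then have "fps_nth ((fps_const a + U) * U') 0 = fps_nth 1 0" by simp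
    then show False using that(1) by simp
  qed
  show ?thesis
  proof (cases P; cases P')
    fix a a' assume P: "P = Some a" "P' = Some a'"
    have "a = a'" if eq: "fps_const a + V = fps_const a' + V'"
    proof -
      have "fps_nth (fps_const a + V) 0 = fps_nth (fps_const a' + V') 0" by (simp only: eq)
      then show ?thesis using assms(1,2) by simp
    qed
    moreover have "branch P V = branch P' V' \<longleftrightarrow> fps_const a + V = fps_const a' + V'"
      unfolding branch_def P option.case const by (rule fps_to_fls_eq_iff)
    ultimately show ?thesis using P by auto
  next
    fix a assume "P = None" "P' = Some a"
    then show ?thesis using no[OF assms(1,3), of a V'] by (auto simp: branch_def dest: sym)
  next
    fix a assume "P = Some a" "P' = None"
    then show ?thesis using no[OF assms(2,4), of a V] by (auto simp: branch_def)
  next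
    assume "P = None" "P' = None"
    then show ?thesis by (simp add: branch_def)
  qed
qed

text \<open>In the local coordinate the equation reads V^e r(V) = X^N u(V) with r and u nonzero at
  0. It is solved by \<open>local_uniformizer\<close> in the variable X^d, where d = N/e. The
  nonzero coefficient at d is recorded because it separates the e rotated branches.\<close>

lemma puiseux_branch:
  fixes p q :: "'c::{alg_closed_field,field_char_0} poly"
  assumes cop: "\<And>a. poly q a = 0 \<Longrightarrow> poly p a \<noteq> 0" and q: "q \<noteq> 0" and P: "P \<in> poles p q"
    and N: "pole_mult p q P dvd N" "N > 0"
  shows "\<exists>V. fps_nth V 0 = 0 \<and> fps_nth V (N div pole_mult p q P) \<noteq> 0 \<and>
    poly (puiseux_eq N p q) (branch P V) = 0"
proof -
  define e where "e = pole_mult p q P"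
  have e: "e > 0"
  proof (cases P)
    case None
    then show ?thesis using P by (auto simp: e_def poles_def pole_mult_def split: if_splits)
  next
    case (Some a)
    then have "poly q a = 0" using P by (auto simp: poles_def split: if_splits)
    then show ?thesis using Some q by (simp add: e_def pole_mult_def order_root)
  qed
  define d where "d = N div e"
  have Nd: "N = d * e" using N(1) by (simp add: d_def e_def)
  have d: "d > 0" using Nd N(2) by auto
  have key: "\<exists>V. fps_nth V 0 = 0 \<and> fps_nth V d \<noteq> 0 \<and>
      V ^ e * (fps_of_poly r oo V) = fps_X ^ N * (fps_of_poly u oo V)"
    if r: "poly r 0 \<noteq> 0" and u: "poly u 0 \<noteq> 0" for r u :: "'c poly"
  proof -
    obtain W where W: "fps_nth W 0 = 0" "fps_nth W 1 \<noteq> 0"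
      "W ^ e * (fps_of_poly r oo W) = fps_X ^ e * (fps_of_poly u oo W)"
      using local_uniformizer[of "fps_of_poly r" "fps_of_poly u" e] r u e by (auto simp: poly_0_coeff_0)
    define V where "V = W oo fps_X ^ d"
    have X0: "fps_nth (fps_X ^ d :: 'c fps) 0 = 0" using d by (simp add: fps_X_power_nth)
    have "(W ^ e * (fps_of_poly r oo W)) oo fps_X ^ d = (fps_X ^ e * (fps_of_poly u oo W)) oo fps_X ^ d"
      using W(3) by simp
    then have "V ^ e * (fps_of_poly r oo V) = fps_X ^ N * (fps_of_poly u oo V)"
      unfolding V_def fps_compose_mult_distrib[OF X0] fps_compose_power[OF X0, symmetric]
        fps_compose_assoc[OF X0 W(1), symmetric] fps_X_fps_compose_startby0[OF X0]
      by (simp add: Nd power_mult)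
    moreover have "fps_nth V 0 = 0" using W(1) by (simp add: V_def fps_nth_compose_X_power)
    moreover have "fps_nth V d \<noteq> 0" using W(2) d by (simp add: V_def fps_nth_compose_X_power)
    ultimately show ?thesis by blast
  qed
  have X: "fps_to_fls (fps_X ^ N) = (fls_X ^ N :: 'c fls)" by (simp add: fps_to_fls_power)
  show ?thesis
  proof (cases P)
    case (Some a)
    then have qa: "poly q a = 0" using P by (auto simp: poles_def split: if_splits)
    have ea: "e = Polynomial.order a q" using Some by (simp add: e_def pole_mult_def)
    obtain q1 where q1: "q = [:- a, 1:] ^ e * q1" "\<not> [:- a, 1:] dvd q1"
      using order_decomp[OF q, of a] ea by blast
    have q1a: "poly q1 a \<noteq> 0" using q1(2) by (simp add: poly_eq_0_iff_dvd)
    define r where "r = q1 \<circ>\<^sub>p [:a, 1:]"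
    define u where "u = p \<circ>\<^sub>p [:a, 1:]"
    have "poly r 0 \<noteq> 0" "poly u 0 \<noteq> 0" using q1a cop[OF qa] by (simp_all add: r_def u_def poly_pcompose)
    from key[OF this] obtain V where V: "fps_nth V 0 = 0" "fps_nth V d \<noteq> 0"
      "V ^ e * (fps_of_poly r oo V) = fps_X ^ N * (fps_of_poly u oo V)" by blast
    define y where "y = branch P V"
    have y: "y = fls_const a + fps_to_fls V" by (simp add: y_def branch_def Some)
    have shift: "poly (map_poly fls_const (s \<circ>\<^sub>p [:a, 1:])) (fps_to_fls V) = poly (map_poly fls_const s) y" for s
    proof (induction s)
      case (pCons c s)
      have "map_poly fls_const (pCons c s \<circ>\<^sub>p [:a, 1:]) =
          [:fls_const c:] + [:fls_const a, 1:] * map_poly fls_const (s \<circ>\<^sub>p [:a, 1:])"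
        unfolding pcompose_pCons map_poly_hom_UNIV(1,2)[OF hom_fls_const] by (simp add: map_poly_pCons)
      then show ?case using pCons by (simp add: y map_poly_pCons algebra_simps)
    qed simp
    have "fps_to_fls (V ^ e * (fps_of_poly r oo V)) = fps_to_fls (fps_X ^ N * (fps_of_poly u oo V))" by (simp only: V(3))
    then have eq: "fps_to_fls V ^ e * poly (map_poly fls_const q1) y = fls_X ^ N * poly (map_poly fls_const p) y"
      unfolding fls_times_fps_to_fls X fps_to_fls_power[of V] poly_fls_of_fps[OF V(1), symmetric] r_def u_def shift .
    have pw: "map_poly fls_const ([:- a, 1:] ^ e) = [:- fls_const a, 1:] ^ e"
    proof (induction e)
      case (Suc e)
      then show ?case by (simp only: power_Suc map_poly_hom_UNIV(2)[OF hom_fls_const] map_poly_linear[OF hom_fls_const])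
    qed (simp add: one_pCons map_poly_pCons)
    have "poly (map_poly fls_const q) y = fps_to_fls V ^ e * poly (map_poly fls_const q1) y"
      unfolding q1(1) map_poly_hom_UNIV(2)[OF hom_fls_const] pw by (simp add: y)
    then have "poly (puiseux_eq N p q) y = 0" using eq by (simp add: puiseux_eq_def)
    then show ?thesis using V(1,2) y_def d_def e_def by blast
  next
    case None
    then have dg: "Polynomial.degree p > Polynomial.degree q" using P by (auto simp: poles_def split: if_splits)
    have p0: "p \<noteq> 0" using dg by auto
    have ee: "e = Polynomial.degree p - Polynomial.degree q" using None by (simp add: e_def pole_mult_def)
    \<comment> \<open>At infinity the local coordinate 1/Y turns p and q into their reflected
      polynomials.\<close>
    have "poly (reflect_poly q) 0 \<noteq> 0" "poly (reflect_poly p) 0 \<noteq> 0" using q p0 by simp_all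
    from key[OF this] obtain V where V: "fps_nth V 0 = 0" "fps_nth V d \<noteq> 0"
      "V ^ e * (fps_of_poly (reflect_poly q) oo V) = fps_X ^ N * (fps_of_poly (reflect_poly p) oo V)" by blast
    have V0: "fps_to_fls V \<noteq> 0" using V(2) by auto
    define v where "v = fps_to_fls V"
    have v0: "v \<noteq> 0" using V0 by (simp add: v_def)
    define y where "y = branch P V"
    have y: "y = inverse v" by (simp add: y_def branch_def None v_def)
    have refl: "poly (map_poly fls_const (reflect_poly s)) v = v ^ Polynomial.degree s * poly (map_poly fls_const s) y" for s :: "'c poly"
    proof -
      have "map_poly fls_const (reflect_poly s) = reflect_poly (map_poly fls_const s)"
        using map_poly_hom_UNIV(5)[OF hom_fls_const, of s]
        by (intro poly_eqI) (simp add: coeff_map_poly coeff_reflect_poly)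
      then show ?thesis
        using poly_reflect_poly_nz[OF v0, of "map_poly fls_const s"] map_poly_hom_UNIV(5)[OF hom_fls_const, of s]
        by (simp add: y)
    qed
    have "fps_to_fls (V ^ e * (fps_of_poly (reflect_poly q) oo V)) = fps_to_fls (fps_X ^ N * (fps_of_poly (reflect_poly p) oo V))"
      by (simp only: V(3))
    then have "v ^ e * poly (map_poly fls_const (reflect_poly q)) v = fls_X ^ N * poly (map_poly fls_const (reflect_poly p)) v"
      by (simp add: fls_times_fps_to_fls fps_to_fls_power poly_fls_of_fps[OF V(1)] v_def)
    then have "v ^ Polynomial.degree p * poly (map_poly fls_const q) y = v ^ Polynomial.degree p * (fls_X ^ N * poly (map_poly fls_const p) y)"
      using dg by (simp add: refl ee mult.assoc[symmetric] power_add[symmetric] mult.left_commute)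
    then have "poly (map_poly fls_const q) y = fls_X ^ N * poly (map_poly fls_const p) y" using v0 by simp
    then have "poly (puiseux_eq N p q) y = 0" by (simp add: puiseux_eq_def)
    then show ?thesis using V(1,2) y_def d_def e_def by blast
  qed
qed

lemma rot_branch:
  fixes \<zeta> :: "'c::field"
  assumes "\<zeta> \<noteq> 0"
  shows "rot \<zeta> (branch P V) = branch P (V oo (fps_const \<zeta> * fps_X))"
proof (cases P)
  case None
  then show ?thesis
    using field_hom_on_props(6)[OF subfield_on_UNIV hom_rot[OF assms]] rot_fps[OF assms] by (simp add: branch_def)
next
  case (Some a)
  then show ?thesis
    using field_hom_on_props(3)[OF subfield_on_UNIV hom_rot[OF assms]] rot_fps[OF assms] by (simp add: branch_def rot_const)
qed

lemma rot_funpow_branch: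
  fixes \<zeta> :: "'c::field"
  assumes "\<zeta> \<noteq> 0"
  shows "(rot \<zeta> ^^ i) (branch P V) = branch P (V oo (fps_const (\<zeta> ^ i) * fps_X))"
proof (induction i)
  case (Suc i)
  have "(V oo (fps_const (\<zeta> ^ i) * fps_X)) oo (fps_const \<zeta> * fps_X) = V oo (fps_const (\<zeta> ^ Suc i) * fps_X)"
    by (rule fps_ext) (simp only: fps_nth_compose_linear power_Suc power_mult_distrib mult.assoc)
  then show ?case using Suc rot_branch[OF assms] by (simp del: fps_const_power)
qed simp

lemma rot_puiseux:
  fixes \<zeta> :: "'c::field"
  assumes \<zeta>: "\<zeta> \<noteq> 0" "\<zeta> ^ N = 1" and y: "poly (puiseux_eq N p q) y = 0"
  shows "poly (puiseux_eq N p q) (rot \<zeta> y) = 0"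
proof -
  note h = field_hom_on_props[OF subfield_on_UNIV hom_rot[OF \<zeta>(1)], simplified]
  have "rot \<zeta> fls_X = fls_const \<zeta> * fls_X" by (simp add: rot_def fls_times_fps_to_fls)
  then have "rot \<zeta> (fls_X ^ N) = fls_const (\<zeta> ^ N) * fls_X ^ N" using h(11)[of fls_X N]
    by (simp add: power_mult_distrib fls_const_power)
  then have t: "rot \<zeta> (inverse (fls_X ^ N)) = inverse (fls_X ^ N)" using h(6) \<zeta>(2) by simp
  have z0: "rot \<zeta> 0 = 0" by (rule h(2))
  have "map_poly (rot \<zeta>) (puiseux_eq N p q) = puiseux_eq N p q"
    by (rule poly_eqI) (simp add: puiseux_eq_def coeff_map_poly z0 h(7) h(4) t rot_const)
  then show ?thesis using map_poly_hom_UNIV(3)[OF hom_rot[OF \<zeta>(1)], of "puiseux_eq N p q" y] y h(2) by simp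
qed

lemma puiseux_eq_degree: "Polynomial.degree (puiseux_eq N p q) \<le> max (Polynomial.degree p) (Polynomial.degree q)"
  unfolding puiseux_eq_def
  by (rule order.trans[OF degree_diff_le_max])
    (use map_poly_hom_UNIV(5)[OF hom_fls_const, of p] map_poly_hom_UNIV(5)[OF hom_fls_const, of q]
      degree_smult_le[of "inverse (fls_X ^ N)" "map_poly fls_const q"] in auto)

lemma fls_X_power_not_const:
  assumes "N > 0"
  shows "inverse (fls_X ^ N) \<noteq> fls_const (c::'c::field)"
proof
  assume h: "inverse (fls_X ^ N) = fls_const c"
  have "fps_to_fls (fps_X ^ N * fps_const c) = fls_X ^ N * inverse (fls_X ^ N)"
    by (simp add: h fls_times_fps_to_fls fps_to_fls_power)
  also have "\<dots> = 1" by simp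
  finally have "fps_X ^ N * fps_const c = 1" by (simp only: fps_to_fls_eq_1_iff)
  then have "fps_nth (fps_X ^ N * fps_const c) 0 = fps_nth 1 0" by (simp only:)
  then show False using assms by (simp add: fps_X_power_nth)
qed

lemma puiseux_eq_nonzero:
  assumes "N > 0" "q \<noteq> 0"
  shows "puiseux_eq N p q \<noteq> (0 :: 'c::field fls poly)"
proof
  assume z: "puiseux_eq N p q = 0"
  define i where "i = Polynomial.degree q"
  have ne: "Polynomial.coeff q i \<noteq> 0" using assms(2) by (simp add: i_def)
  have "Polynomial.coeff (puiseux_eq N p q) i = 0" by (simp add: z)
  then have "inverse (fls_X ^ N) * fls_const (Polynomial.coeff q i) = fls_const (Polynomial.coeff p i)"
    by (simp add: puiseux_eq_def coeff_map_poly)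
  then have "inverse (fls_X ^ N) = fls_const (Polynomial.coeff p i) / fls_const (Polynomial.coeff q i)"
    using ne by (simp add: field_simps)
  also have "\<dots> = fls_const (Polynomial.coeff p i / Polynomial.coeff q i)"
    using field_hom_on_props(8)[OF subfield_on_UNIV hom_fls_const, of "Polynomial.coeff p i" "Polynomial.coeff q i"] by simp
  finally show False using fls_X_power_not_const[OF assms(1)] by blast
qed

lemma finite_poles: "q \<noteq> 0 \<Longrightarrow> finite (poles p q)"
  using poly_roots_finite[of q] by (simp add: poles_def)

lemma pole_mult_sum:
  fixes p q :: "'c::alg_closed_field poly"
  assumes "q \<noteq> 0"
  shows "(\<Sum>P\<in>poles p q. pole_mult p q P) = max (Polynomial.degree p) (Polynomial.degree q)"
proof -
  define T where "T = (if Polynomial.degree p > Polynomial.degree q then {None} else {} :: 'c option set)"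
  have "(\<Sum>P\<in>poles p q. pole_mult p q P) =
      (\<Sum>P\<in>Some ` {a. poly q a = 0}. pole_mult p q P) + (\<Sum>P\<in>T. pole_mult p q P)"
    unfolding poles_def T_def[symmetric]
    by (rule sum.union_disjoint) (use poly_roots_finite[OF assms] in \<open>auto simp: T_def split: if_splits\<close>)
  also have "(\<Sum>P\<in>Some ` {a. poly q a = 0}. pole_mult p q P) = (\<Sum>a | poly q a = 0. Polynomial.order a q)"
    by (subst sum.reindex) (auto simp: pole_mult_def)
  also have "\<dots> = Polynomial.degree q" by (rule poly_roots_order_sum[OF assms])
  also have "(\<Sum>P\<in>T. pole_mult p q P) = Polynomial.degree p - Polynomial.degree q"
    by (auto simp: T_def pole_mult_def)
  finally show ?thesis by simp
qed

text \<open>A pole of multiplicity e contributes e distinct rotations of its branch, different poles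
  are separated by \<open>branch_eq_iff\<close>, and the multiplicities add up to the degree. By
  counting, the roots fall into one cycle of \<open>rot \<zeta>\<close> for each pole.\<close>

lemma puiseux_all_roots:
  fixes p q :: "'c::{alg_closed_field,field_char_0} poly"
  assumes cop: "\<And>a. poly q a = 0 \<Longrightarrow> poly p a \<noteq> 0" and q: "q \<noteq> 0" and N: "N > 0"
    and dv: "\<And>P. P \<in> poles p q \<Longrightarrow> pole_mult p q P dvd N"
    and \<zeta>: "\<And>m. (\<zeta>::'c) ^ m = 1 \<longleftrightarrow> N dvd m"
  obtains Y where
    "(\<Union>P\<in>poles p q. (\<lambda>i. (rot \<zeta> ^^ i) (Y P)) ` {..<pole_mult p q P}) \<subseteq> {y. poly (puiseux_eq N p q) y = 0}"
    "card (\<Union>P\<in>poles p q. (\<lambda>i. (rot \<zeta> ^^ i) (Y P)) ` {..<pole_mult p q P}) = max (Polynomial.degree p) (Polynomial.degree q)"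
    "\<forall>P. (rot \<zeta> ^^ N) (Y P) = Y P"
proof -
  have \<zeta>0: "\<zeta> \<noteq> 0" using \<zeta>[of N] N by (auto simp: power_0_left)
  have \<zeta>N: "\<zeta> ^ N = 1" using \<zeta> by simp
  have "\<forall>P. \<exists>V. P \<in> poles p q \<longrightarrow> fps_nth V 0 = 0 \<and> fps_nth V (N div pole_mult p q P) \<noteq> 0 \<and>
      poly (puiseux_eq N p q) (branch P V) = 0"
    using puiseux_branch[OF cop q _ dv N] by blast
  then obtain V where V: "\<And>P. P \<in> poles p q \<Longrightarrow> fps_nth (V P) 0 = 0"
    "\<And>P. P \<in> poles p q \<Longrightarrow> fps_nth (V P) (N div pole_mult p q P) \<noteq> 0"
    "\<And>P. P \<in> poles p q \<Longrightarrow> poly (puiseux_eq N p q) (branch P (V P)) = 0"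
    unfolding choice_iff by blast
  define Y where "Y P = branch P (V P)" for P
  define Vi where "Vi P i = V P oo (fps_const (\<zeta> ^ i) * fps_X)" for P i
  have Yi: "(rot \<zeta> ^^ i) (Y P) = branch P (Vi P i)" for i P
    unfolding Y_def Vi_def by (rule rot_funpow_branch[OF \<zeta>0])
  have nth: "fps_nth (Vi P i) n = (\<zeta> ^ i) ^ n * fps_nth (V P) n" for P i n
    unfolding Vi_def by (rule fps_nth_compose_linear)
  have Vi0: "fps_nth (Vi P i) 0 = 0" "Vi P i \<noteq> 0" if "P \<in> poles p q" for P i
  proof -
    show "fps_nth (Vi P i) 0 = 0" using V(1)[OF that] by (simp add: nth)
    have "fps_nth (Vi P i) (N div pole_mult p q P) \<noteq> 0" using V(2)[OF that] \<zeta>0 by (simp add: nth)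
    then show "Vi P i \<noteq> 0" by auto
  qed
  have root: "poly (puiseux_eq N p q) ((rot \<zeta> ^^ i) (Y P)) = 0" if "P \<in> poles p q" for P i
    by (induction i) (simp_all add: Y_def V(3)[OF that] rot_puiseux[OF \<zeta>0 \<zeta>N])
  have inj: "inj_on (\<lambda>i. (rot \<zeta> ^^ i) (Y P)) {..<pole_mult p q P}" if P: "P \<in> poles p q" for P
  proof (rule linorder_inj_onI')
    fix i j assume ij: "i \<in> {..<pole_mult p q P}" "j \<in> {..<pole_mult p q P}" "i < j"
    show "(rot \<zeta> ^^ i) (Y P) \<noteq> (rot \<zeta> ^^ j) (Y P)"
    proof
      assume "(rot \<zeta> ^^ i) (Y P) = (rot \<zeta> ^^ j) (Y P)"
      then have "Vi P i = Vi P j" unfolding Yi using branch_eq_iff Vi0[OF P] by blast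
      define d where "d = N div pole_mult p q P"
      have Nd: "N = d * pole_mult p q P" using dv[OF P] by (simp add: d_def)
      have "fps_nth (Vi P i) d = fps_nth (Vi P j) d" using \<open>Vi P i = Vi P j\<close> by simp
      then have "\<zeta> ^ (i * d) = \<zeta> ^ (j * d)" using V(2)[OF P] by (simp add: nth d_def power_mult)
      moreover have "j * d = i * d + (j - i) * d" using ij(3) by (simp add: algebra_simps flip: add_mult_distrib)
      ultimately have "\<zeta> ^ (i * d) * 1 = \<zeta> ^ (i * d) * \<zeta> ^ ((j - i) * d)" by (simp add: power_add)
      then have "\<zeta> ^ ((j - i) * d) = 1" using \<zeta>0 by (simp only: mult_cancel_left power_not_zero) auto
      then have "N dvd (j - i) * d" using \<zeta> by simp
      then have "d * pole_mult p q P dvd d * (j - i)" unfolding Nd by (simp add: mult.commute)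
      moreover have "d \<noteq> 0" using Nd N by auto
      ultimately have "pole_mult p q P dvd j - i" by simp
      then show False using ij by (auto dest: dvd_imp_le)
    qed
  qed
  show ?thesis
  proof (rule that[of Y])
    show "(\<Union>P\<in>poles p q. (\<lambda>i. (rot \<zeta> ^^ i) (Y P)) ` {..<pole_mult p q P}) \<subseteq> {y. poly (puiseux_eq N p q) y = 0}"
      using root by auto
    have "card (\<Union>P\<in>poles p q. (\<lambda>i. (rot \<zeta> ^^ i) (Y P)) ` {..<pole_mult p q P}) =
        (\<Sum>P\<in>poles p q. card ((\<lambda>i. (rot \<zeta> ^^ i) (Y P)) ` {..<pole_mult p q P}))"
    proof (rule card_UN_disjoint)
      show "finite (poles p q)" by (rule finite_poles[OF q])
      show "\<forall>P\<in>poles p q. \<forall>P'\<in>poles p q. P \<noteq> P' \<longrightarrow>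
          (\<lambda>i. (rot \<zeta> ^^ i) (Y P)) ` {..<pole_mult p q P} \<inter> (\<lambda>i. (rot \<zeta> ^^ i) (Y P')) ` {..<pole_mult p q P'} = {}"
      proof (intro ballI impI)
        fix P P' assume P: "P \<in> poles p q" "P' \<in> poles p q" "P \<noteq> P'"
        have "(rot \<zeta> ^^ i) (Y P) \<noteq> (rot \<zeta> ^^ j) (Y P')" for i j
          unfolding Yi using branch_eq_iff[OF Vi0(1)[OF P(1)] Vi0(1)[OF P(2)] Vi0(2)[OF P(1)] Vi0(2)[OF P(2)]] P(3) by blast
        then show "(\<lambda>i. (rot \<zeta> ^^ i) (Y P)) ` {..<pole_mult p q P} \<inter> (\<lambda>i. (rot \<zeta> ^^ i) (Y P')) ` {..<pole_mult p q P'} = {}"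
          by blast
      qed
    qed auto
    also have "\<dots> = (\<Sum>P\<in>poles p q. pole_mult p q P)" by (rule sum.cong) (simp_all add: card_image[OF inj])
    also have "\<dots> = max (Polynomial.degree p) (Polynomial.degree q)" by (rule pole_mult_sum[OF q])
    finally show "card (\<Union>P\<in>poles p q. (\<lambda>i. (rot \<zeta> ^^ i) (Y P)) ` {..<pole_mult p q P}) = max (Polynomial.degree p) (Polynomial.degree q)" .
    show "\<forall>P. (rot \<zeta> ^^ N) (Y P) = Y P"
      unfolding Y_def rot_funpow_branch[OF \<zeta>0] \<zeta>N by simp
  qed
qed

lemma fract_hom:
  fixes j :: "'k::field \<Rightarrow> 'm::field"
  assumes j: "field_hom_on UNIV j" and tr: "\<And>p. p \<noteq> 0 \<Longrightarrow> poly (map_poly j p) \<tau> \<noteq> 0"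
  obtains \<iota> where "field_hom_on UNIV \<iota>" "\<And>p. \<iota> (to_fract p) = poly (map_poly j p) \<tau>"
proof -
  define ev where "ev p = poly (map_poly j p) \<tau>" for p
  have ev: "ev (p + q) = ev p + ev q" "ev (p * q) = ev p * ev q" for p q
    by (simp_all add: ev_def map_poly_hom_UNIV[OF j])
  have ev1: "ev 1 = 1" using field_hom_on_props(1,2)[OF subfield_on_UNIV j] by (simp add: ev_def one_pCons map_poly_pCons)
  have nz: "ev p \<noteq> 0" if "p \<noteq> 0" for p using tr[OF that] by (simp add: ev_def)
  define \<iota> where "\<iota> r = ev (rf_num r) / ev (rf_den r)" for r
  have den: "rf_den r \<noteq> 0" for r :: "'k poly fract" using rf_num_den(3)[of r] by auto
  have \<iota>: "\<iota> (to_fract p / to_fract q) = ev p / ev q" if q: "q \<noteq> 0" for p q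
  proof -
    define r where "r = to_fract p / to_fract q"
    have "to_fract (rf_num r) / to_fract (rf_den r) = to_fract p / to_fract q"
      using rf_num_den(1)[of r] by (simp add: r_def)
    then have "to_fract (rf_num r * q) = to_fract (p * rf_den r)"
      using den[of r] q by (simp add: frac_eq_eq)
    then have "rf_num r * q = p * rf_den r" by (simp only: to_fract_eq_iff)
    then have "ev (rf_num r) * ev q = ev p * ev (rf_den r)" by (simp only: ev(2)[symmetric])
    then show ?thesis using nz[OF q] nz[OF den[of r]] by (simp add: \<iota>_def frac_eq_eq flip: r_def)
  qed
  have rep: "\<exists>p q. q \<noteq> 0 \<and> r = to_fract p / to_fract q" for r :: "'k poly fract"
    using rf_num_den(1)[of r] den[of r] by blast
  show ?thesis
  proof (rule that[of \<iota>])
    show tf: "\<iota> (to_fract p) = poly (map_poly j p) \<tau>" for p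
      using \<iota>[of 1 p] ev1 by (simp add: ev_def)
    show "field_hom_on UNIV \<iota>" unfolding field_hom_on_def
    proof (intro conjI ballI)
      show "\<iota> 1 = 1" using \<iota>[of 1 1] ev1 by simp
      fix r s :: "'k poly fract"
      obtain p q where pq: "q \<noteq> 0" "r = to_fract p / to_fract q" using rep by blast
      obtain p' q' where pq': "q' \<noteq> 0" "s = to_fract p' / to_fract q'" using rep by blast
      have qq: "q * q' \<noteq> 0" using pq(1) pq'(1) by simp
      have "r + s = to_fract (p * q' + p' * q) / to_fract (q * q')"
        using pq(1) pq'(1) unfolding pq(2) pq'(2) by (simp add: add_frac_eq)
      then have "\<iota> (r + s) = ev (p * q' + p' * q) / ev (q * q')" by (simp only: \<iota>[OF qq])
      also have "\<dots> = \<iota> r + \<iota> s" using nz[OF pq(1)] nz[OF pq'(1)] unfolding pq(2) pq'(2) \<iota>[OF pq(1)] \<iota>[OF pq'(1)]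
        by (simp add: ev add_frac_eq)
      finally show "\<iota> (r + s) = \<iota> r + \<iota> s" .
      have "r * s = to_fract (p * p') / to_fract (q * q')" unfolding pq(2) pq'(2) by simp
      then have "\<iota> (r * s) = ev (p * p') / ev (q * q')" by (simp only: \<iota>[OF qq])
      also have "\<dots> = \<iota> r * \<iota> s" unfolding pq(2) pq'(2) \<iota>[OF pq(1)] \<iota>[OF pq'(1)] by (simp add: ev)
      finally show "\<iota> (r * s) = \<iota> r * \<iota> s" .
    qed
  qed
qed

lemma ring_rel_graph:
  assumes f: "field_hom_on UNIV f" and g: "field_hom_on UNIV g"
  shows "ring_rel {(f u, g u) | u. True}"
proof (rule ring_relI)
  note hf = field_hom_on_props[OF subfield_on_UNIV f, simplified] and hg = field_hom_on_props[OF subfield_on_UNIV g, simplified]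
  show "(1, 1) \<in> {(f u, g u) | u. True}" using hf(1) hg(1) by force
  show "v = 0" if "(0, v) \<in> {(f u, g u) | u. True}" for v using that hf(9) hg(2) by force
  show "(x + y, u + v) \<in> {(f u, g u) | u. True} \<and> (x * y, u * v) \<in> {(f u, g u) | u. True}"
    if xy: "(x, u) \<in> {(f u, g u) | u. True}" "(y, v) \<in> {(f u, g u) | u. True}" for x u y v
  proof -
    obtain a b where "x = f a" "u = g a" "y = f b" "v = g b" using xy by blast
    then have "x + y = f (a + b)" "u + v = g (a + b)" "x * y = f (a * b)" "u * v = g (a * b)"
      using hf(3,4) hg(3,4) by simp_all
    then show ?thesis by blast
  qed
  show "(- x, - u) \<in> {(f u, g u) | u. True}" if xu: "(x, u) \<in> {(f u, g u) | u. True}" for x u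
  proof -
    obtain a where "x = f a" "u = g a" using xu by blast
    then have "- x = f (- a)" "- u = g (- a)" using hf(5) hg(5) by simp_all
    then show ?thesis by blast
  qed
qed

lemma alg_closure_hom_extend:
  fixes g :: "'a::field_char_0 \<Rightarrow> 'm::alg_closed_field"
  assumes g: "field_hom_on UNIV g"
  obtains \<psi> where "field_hom_on UNIV \<psi>" "\<And>u. \<psi> (to_ac u) = g u"
proof -
  interpret galois_closure "range (to_ac :: 'a \<Rightarrow> _)" by (rule galois_closure_to_ac)
  have sub: "range (to_ac :: 'a \<Rightarrow> _) \<subseteq> Domain {(to_ac u, g u) | u. True}" by blast
  show ?thesis
  proof (rule ring_rel_extend[OF ring_rel_graph[OF hom_to_ac g] S sub alg])
    fix \<psi> :: "'a alg_closure \<Rightarrow> 'm"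
    assume h: "field_hom_on UNIV \<psi>" "\<And>x u. (x, u) \<in> {(to_ac u, g u) | u. True} \<Longrightarrow> \<psi> x = u"
    show thesis by (rule that[OF h(1)]) (rule h(2), blast)
  qed
qed

text \<open>The reflected polynomial replaces X^(-N) by X^N, and a nonzero power series stays
  nonzero under the substitution of X^N.\<close>

lemma puiseux_transcendental:
  fixes p :: "'c::field poly"
  assumes N: "N > 0" and p: "p \<noteq> 0"
  shows "poly (map_poly fls_const p) (inverse (fls_X ^ N)) \<noteq> 0"
proof
  assume z: "poly (map_poly fls_const p) (inverse (fls_X ^ N)) = 0"
  define v where "v = (fls_X ^ N :: 'c fls)"
  have v0: "v \<noteq> 0" by (simp add: v_def)
  have v: "v = fps_to_fls (fps_X ^ N)" by (simp add: v_def fps_to_fls_power)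
  have X0: "fps_nth (fps_X ^ N :: 'c fps) 0 = 0" using N by (simp add: fps_X_power_nth)
  have "map_poly fls_const (reflect_poly p) = reflect_poly (map_poly fls_const p)"
    using map_poly_hom_UNIV(5)[OF hom_fls_const, of p]
    by (intro poly_eqI) (simp add: coeff_map_poly coeff_reflect_poly)
  then have "poly (map_poly fls_const (reflect_poly p)) v = 0"
    using poly_reflect_poly_nz[OF v0, of "map_poly fls_const p"] z by (simp add: v_def)
  then have "fps_of_poly (reflect_poly p) oo fps_X ^ N = 0" unfolding v poly_fls_of_fps[OF X0] by simp
  then have "fps_of_poly (reflect_poly p) = 0" using fps_compose_eq_0_iff[OF X0, of "fps_of_poly (reflect_poly p)"] by simp
  then have "reflect_poly p = 0" by (metis fps_of_poly_0 fps_of_poly_eq_iff)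
  then show False using p by simp
qed

lemma rf_P1_None_iff:
  "rf_P1 \<phi> P = None \<longleftrightarrow> P \<in> poles (map_poly to_ac (rf_num \<phi>)) (map_poly to_ac (rf_den \<phi>))"
  by (cases P) (auto simp: rf_P1_def poles_def Let_def)

text \<open>\<open>rot \<zeta>\<close> is extended to the algebraic closure of the Laurent series
  field and pulled back along an embedding of the closure of k(t) with t -> X^(-N). The same
  \<sigma> has to serve f and g; this is the purpose of the bound \<open>D\<close> and of N = D!,
  which every multiplicity up to \<open>D\<close> divides. The function \<open>pole\<close> labels a
  root by the pole at which its expansion is centred.\<close>

theorem inertia_at_infinity:
  "\<exists>\<sigma>\<in>(GalT :: ('k::field_char_0 func_ac \<Rightarrow> _) set). \<forall>\<phi> :: 'k poly fract. rf_degree \<phi> \<le> D \<longrightarrow>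
     card (rf_fiber \<phi> ac_t) = rf_degree \<phi> \<and>
     (\<exists>pole. \<forall>x\<in>rf_fiber \<phi> ac_t. rf_P1 \<phi> (pole x) = None \<and>
        (\<forall>x'\<in>rf_fiber \<phi> ac_t. pole x = pole x' \<longrightarrow> (\<exists>k. (\<sigma> ^^ k) x = x')))"
proof -
  define N where "N = (fact D :: nat)"
  have N: "N > 0" by (simp add: N_def)
  obtain \<zeta> :: "'k alg_closure" where \<zeta>: "\<And>m. \<zeta> ^ m = 1 \<longleftrightarrow> N dvd m" using primitive_root_exists[OF N] by blast
  have \<zeta>0: "\<zeta> \<noteq> 0" using \<zeta>[of N] N by (auto simp: power_0_left)
  have \<zeta>N: "\<zeta> ^ N = 1" using \<zeta> by simp
  define tt where "tt = (inverse (fls_X ^ N) :: 'k alg_closure fls)"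
  define j where "j = (\<lambda>c::'k. fls_const (to_ac c))"
  have j: "field_hom_on UNIV j" using hom_comp[of fls_const to_ac] hom_fls_const hom_to_ac by (simp add: j_def comp_def)
  have jmap: "map_poly j p = map_poly fls_const (map_poly to_ac p)" for p
    by (rule poly_eqI) (simp add: j_def coeff_map_poly)
  have "poly (map_poly j p) tt \<noteq> 0" if "p \<noteq> 0" for p
    unfolding jmap tt_def by (rule puiseux_transcendental[OF N]) (simp add: that map_poly_hom_UNIV(4)[OF hom_to_ac])
  from fract_hom[OF j this] obtain \<iota> where \<iota>: "field_hom_on UNIV \<iota>" "\<And>p. \<iota> (to_fract p) = poly (map_poly j p) tt" by metis
  have g\<psi>: "field_hom_on UNIV (to_ac \<circ> \<iota>)" by (rule hom_comp[OF hom_to_ac \<iota>(1)])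
  obtain \<psi> where \<psi>: "field_hom_on UNIV \<psi>" "\<And>u. \<psi> (to_ac u) = to_ac (\<iota> u)"
    using alg_closure_hom_extend[OF g\<psi>] by (metis comp_apply)
  have gS: "field_hom_on UNIV (to_ac \<circ> rot \<zeta>)" by (rule hom_comp[OF hom_to_ac hom_rot[OF \<zeta>0]])
  obtain Rt where Rt: "field_hom_on UNIV Rt" "\<And>u. Rt (to_ac u) = to_ac (rot \<zeta> u)"
    using alg_closure_hom_extend[OF gS] by (metis comp_apply)
  have \<iota>_const: "\<iota> (to_fract [:c:]) = fls_const (to_ac c)" for c by (simp add: \<iota>(2) j_def map_poly_pCons)
  have \<iota>_t: "\<iota> (to_fract [:0, 1:]) = tt" by (simp add: \<iota>(2) j_def map_poly_pCons)
  have rot_tt: "rot \<zeta> tt = tt"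
  proof -
    note h = field_hom_on_props[OF subfield_on_UNIV hom_rot[OF \<zeta>0], simplified]
    have "rot \<zeta> fls_X = fls_const \<zeta> * fls_X" by (simp add: rot_def fls_times_fps_to_fls)
    then have "rot \<zeta> (fls_X ^ N) = fls_const (\<zeta> ^ N) * fls_X ^ N" using h(11)[of fls_X N]
      by (simp add: power_mult_distrib fls_const_power)
    then show ?thesis unfolding tt_def using h(6) \<zeta>N by simp
  qed
  have rot_\<iota>: "rot \<zeta> (\<iota> r) = \<iota> r" for r
  proof -
    note h = field_hom_on_props[OF subfield_on_UNIV hom_rot[OF \<zeta>0], simplified]
    note hi = field_hom_on_props[OF subfield_on_UNIV \<iota>(1), simplified]
    have pol: "rot \<zeta> (\<iota> (to_fract p)) = \<iota> (to_fract p)" for p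
    proof -
      have "map_poly (rot \<zeta>) (map_poly j p) = map_poly j p"
        by (rule poly_eqI) (simp add: coeff_map_poly h(2) j_def rot_const)
      then show ?thesis unfolding \<iota>(2) using map_poly_hom_UNIV(3)[OF hom_rot[OF \<zeta>0], of "map_poly j p" tt] rot_tt by simp
    qed
    show ?thesis by (subst (1 2) rf_num_den(1)[of r]) (simp only: hi(8) h(8) pol)
  qed
  have Rt_\<psi>: "Rt (\<psi> (to_ac r)) = \<psi> (to_ac r)" for r by (simp add: \<psi>(2) Rt(2) rot_\<iota>)
  have Rt\<psi>Hom: "field_hom_on UNIV (Rt \<circ> \<psi>)" by (rule hom_comp[OF Rt(1) \<psi>(1)])
  \<comment> \<open>\<open>Rt\<close> fixes the image of k(t), so it maps a root of a polynomial
    over that image to a root of the same polynomial, and such roots lie in the image of \<psi>.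
    Therefore \<open>Rt\<close> can be pulled back.\<close>
  have in_range: "Rt (\<psi> c) \<in> range \<psi>" for c
  proof -
    obtain p :: "'k poly fract poly" where p: "p \<noteq> 0" "poly (map_poly to_ac p) c = 0" by (rule alg_closure_algebraic)
    have "map_poly (Rt \<circ> \<psi>) (map_poly to_ac p) = map_poly \<psi> (map_poly to_ac p)"
      using field_hom_on_props(2)[OF subfield_on_UNIV Rt\<psi>Hom] field_hom_on_props(2)[OF subfield_on_UNIV \<psi>(1)] Rt_\<psi>
      by (intro poly_eqI) (simp add: coeff_map_poly)
    moreover have "poly (map_poly (Rt \<circ> \<psi>) (map_poly to_ac p)) ((Rt \<circ> \<psi>) c) = 0"
      using map_poly_hom_UNIV(3)[OF Rt\<psi>Hom, of "map_poly to_ac p" c] p(2) field_hom_on_props(2)[OF subfield_on_UNIV Rt\<psi>Hom] by simp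
    ultimately have "poly (map_poly \<psi> (map_poly to_ac p)) (Rt (\<psi> c)) = 0" by simp
    moreover have "map_poly to_ac p \<noteq> 0" using p(1) by (simp add: map_poly_hom_UNIV(4)[OF hom_to_ac])
    ultimately show ?thesis using root_in_range_hom[OF \<psi>(1)] by blast
  qed
  define \<sigma> where "\<sigma> c = inv_into UNIV \<psi> (Rt (\<psi> c))" for c
  have \<psi>\<sigma>: "\<psi> (\<sigma> c) = Rt (\<psi> c)" for c unfolding \<sigma>_def by (rule f_inv_into_f[OF in_range])
  note inj\<psi> = hom_UNIV_inj[OF \<psi>(1)]
  note h\<psi> = field_hom_on_props[OF subfield_on_UNIV \<psi>(1), simplified] and hR = field_hom_on_props[OF subfield_on_UNIV Rt(1), simplified]
  have \<sigma>hom: "field_hom_on UNIV \<sigma>"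
  proof -
    have "\<psi> (\<sigma> 1) = \<psi> 1" by (simp add: \<psi>\<sigma> h\<psi> hR)
    moreover have "\<psi> (\<sigma> (x + y)) = \<psi> (\<sigma> x + \<sigma> y)" "\<psi> (\<sigma> (x * y)) = \<psi> (\<sigma> x * \<sigma> y)" for x y
      by (simp_all only: \<psi>\<sigma> h\<psi>(3,4) hR(3,4))
    ultimately show ?thesis unfolding field_hom_on_def using injD[OF inj\<psi>] by blast
  qed
  have \<sigma>fix: "\<sigma> (to_ac r) = to_ac r" for r
    using injD[OF inj\<psi>, of "\<sigma> (to_ac r)" "to_ac r"] by (simp add: \<psi>\<sigma> Rt_\<psi>)
  interpret galois_closure "range (to_ac :: 'k poly fract \<Rightarrow> _)" by (rule galois_closure_to_ac)
  have "\<sigma> ` range to_ac = range to_ac" using \<sigma>fix by (simp add: image_image)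
  then have "bij \<sigma>" using hom_bij_if_algebraic[OF \<sigma>hom, of "range to_ac"] alg by simp
  then have \<sigma>G: "\<sigma> \<in> GalT" using \<sigma>hom \<sigma>fix by (auto simp: autos_def)
  have \<psi>pow: "\<psi> ((\<sigma> ^^ k) c) = (Rt ^^ k) (\<psi> c)" for k c by (induction k) (simp_all add: \<psi>\<sigma>)
  have Rtpow: "(Rt ^^ k) (to_ac u) = to_ac ((rot \<zeta> ^^ k) u)" for k u by (induction k) (simp_all add: Rt(2))
  have "card (rf_fiber \<phi> ac_t) = rf_degree \<phi> \<and>
     (\<exists>pole. \<forall>x\<in>rf_fiber \<phi> ac_t. rf_P1 \<phi> (pole x) = None \<and>
        (\<forall>x'\<in>rf_fiber \<phi> ac_t. pole x = pole x' \<longrightarrow> (\<exists>k. (\<sigma> ^^ k) x = x')))"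
    if deg: "rf_degree \<phi> \<le> D" for \<phi> :: "'k poly fract"
  proof -
    define p where "p = map_poly to_ac (rf_num \<phi>)"
    define q where "q = map_poly to_ac (rf_den \<phi>)"
    have dmax: "max (Polynomial.degree p) (Polynomial.degree q) = rf_degree \<phi>"
      by (simp add: p_def q_def rf_degree_def map_poly_hom_UNIV(5)[OF hom_to_ac])
    have q0: "q \<noteq> 0" using rf_num_den(3)[of \<phi>] by (auto simp: q_def map_poly_hom_UNIV(4)[OF hom_to_ac])
    have cop: "poly p a \<noteq> 0" if qa: "poly q a = 0" for a
    proof
      assume pa: "poly p a = 0"
      obtain u v where uv: "u * rf_num \<phi> + v * rf_den \<phi> = 1" using coprime_poly_bezout[OF rf_num_den(2)] by blast
      have "poly (map_poly to_ac (u * rf_num \<phi> + v * rf_den \<phi>)) a = 0"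
        using pa qa by (simp add: map_poly_hom_UNIV[OF hom_to_ac] p_def q_def)
      then show False unfolding uv by (simp add: one_pCons map_poly_pCons)
    qed
    have dv: "pole_mult p q P dvd N" if P: "P \<in> poles p q" for P
    proof -
      have "pole_mult p q P \<le> (\<Sum>P\<in>poles p q. pole_mult p q P)"
        by (rule member_le_sum[OF P _ finite_poles[OF q0]]) simp
      then have le: "pole_mult p q P \<le> D" using pole_mult_sum[OF q0] dmax deg by simp
      have "pole_mult p q P > 0"
        using P q0 by (auto simp: poles_def pole_mult_def order_root split: if_splits)
      then show ?thesis unfolding N_def using le by (intro dvd_fact) auto
    qed
    define RS where "RS Y = (\<Union>P\<in>poles p q. (\<lambda>i. (rot \<zeta> ^^ i) (Y P)) ` {..<pole_mult p q P})" for Y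
    obtain Y where Y: "RS Y \<subseteq> {y. poly (puiseux_eq N p q) y = 0}" "card (RS Y) = rf_degree \<phi>"
      "\<forall>P. (rot \<zeta> ^^ N) (Y P) = Y P"
      unfolding RS_def dmax[symmetric] by (rule puiseux_all_roots[OF cop q0 N dv \<zeta>])
    define E where "E = map_poly to_ac (puiseux_eq N p q)"
    have E0: "E \<noteq> 0" using puiseux_eq_nonzero[OF N q0, of p] by (simp add: E_def map_poly_hom_UNIV(4)[OF hom_to_ac])
    have degE: "Polynomial.degree E \<le> rf_degree \<phi>"
      using puiseux_eq_degree[of N p q] dmax by (simp add: E_def map_poly_hom_UNIV(5)[OF hom_to_ac])
    have roots: "{y. poly E y = 0} = to_ac ` RS Y"
    proof (rule sym, rule card_seteq[OF poly_roots_finite[OF E0]])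
      show "to_ac ` RS Y \<subseteq> {y. poly E y = 0}"
        using Y(1) by (auto simp: E_def map_poly_hom_UNIV(3)[OF hom_to_ac])
      have "card (to_ac ` RS Y) = rf_degree \<phi>" using Y(2) by (simp add: card_image[OF inj_on_subset[OF inj_to_ac subset_UNIV]])
      then show "card {y. poly E y = 0} \<le> card (to_ac ` RS Y)"
        using card_poly_roots_bound[OF E0] degE by simp
    qed
    define Q where "Q = map_poly ac_const (rf_num \<phi>) - Polynomial.smult ac_t (map_poly ac_const (rf_den \<phi>))"
    have fib: "rf_fiber \<phi> ac_t = {x. poly Q x = 0}" by (simp add: rf_fiber_def Q_def)
    have \<psi>c: "\<psi> (ac_const c) = to_ac (fls_const (to_ac c))" for c by (simp add: ac_const_def \<psi>(2) \<iota>_const)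
    have \<psi>t: "\<psi> ac_t = to_ac tt" by (simp add: ac_t_def \<psi>(2) \<iota>_t)
    have QE: "map_poly \<psi> Q = E"
      by (rule poly_eqI) (simp add: Q_def E_def puiseux_eq_def p_def q_def coeff_map_poly h\<psi> \<psi>c \<psi>t flip: tt_def)
    have Q\<psi>: "poly Q x = 0 \<longleftrightarrow> poly E (\<psi> x) = 0" for x
      using map_poly_hom_UNIV(3)[OF \<psi>(1), of Q x] QE h\<psi>(9) by simp
    have Q0: "Q \<noteq> 0" using E0 QE by auto
    have img: "\<psi> ` rf_fiber \<phi> ac_t = to_ac ` RS Y"
    proof
      show "\<psi> ` rf_fiber \<phi> ac_t \<subseteq> to_ac ` RS Y" unfolding roots[symmetric] fib using Q\<psi> by blast
      show "to_ac ` RS Y \<subseteq> \<psi> ` rf_fiber \<phi> ac_t"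
      proof
        fix w assume "w \<in> to_ac ` RS Y"
        then have w: "poly E w = 0" using roots by blast
        then have "w \<in> range \<psi>" using root_in_range_hom[OF \<psi>(1) Q0] QE by simp
        then obtain x where "w = \<psi> x" by blast
        then show "w \<in> \<psi> ` rf_fiber \<phi> ac_t" using w Q\<psi> unfolding fib by blast
      qed
    qed
    have "card (rf_fiber \<phi> ac_t) = card (\<psi> ` rf_fiber \<phi> ac_t)"
      using inj\<psi> by (simp add: card_image inj_on_subset)
    also have "\<dots> = rf_degree \<phi>" unfolding img using Y(2) by (simp add: card_image[OF inj_on_subset[OF inj_to_ac subset_UNIV]])
    finally have card: "card (rf_fiber \<phi> ac_t) = rf_degree \<phi>" .
    have "\<forall>x. \<exists>P. x \<in> rf_fiber \<phi> ac_t \<longrightarrow> P \<in> poles p q \<and> (\<exists>i. \<psi> x = to_ac ((rot \<zeta> ^^ i) (Y P)))"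
    proof
      fix x
      show "\<exists>P. x \<in> rf_fiber \<phi> ac_t \<longrightarrow> P \<in> poles p q \<and> (\<exists>i. \<psi> x = to_ac ((rot \<zeta> ^^ i) (Y P)))"
      proof (cases "x \<in> rf_fiber \<phi> ac_t")
        case True
        then have "\<psi> x \<in> to_ac ` RS Y" using img by blast
        then show ?thesis unfolding RS_def by blast
      qed blast
    qed
    then obtain pole where pole: "\<And>x. x \<in> rf_fiber \<phi> ac_t \<Longrightarrow> pole x \<in> poles p q"
      "\<And>x. x \<in> rf_fiber \<phi> ac_t \<Longrightarrow> \<exists>i. \<psi> x = to_ac ((rot \<zeta> ^^ i) (Y (pole x)))"
      unfolding choice_iff by blast
    have "\<exists>k. (\<sigma> ^^ k) x = x'" if x: "x \<in> rf_fiber \<phi> ac_t" "x' \<in> rf_fiber \<phi> ac_t" "pole x = pole x'" for x x'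
    proof -
      obtain i where i: "\<psi> x = to_ac ((rot \<zeta> ^^ i) (Y (pole x)))" using pole(2)[OF x(1)] by blast
      obtain l where l: "\<psi> x' = to_ac ((rot \<zeta> ^^ l) (Y (pole x)))" using pole(2)[OF x(2)] x(3) by auto
      \<comment> \<open>This is l - i modulo N as a natural number; the N-th power of the rotation
        fixes the branch.\<close>
      define k where "k = l + (N * i - i)"
      have "i \<le> N * i" using N by simp
      then have ki: "k + i = l + N * i" unfolding k_def by linarith
      have "\<psi> ((\<sigma> ^^ k) x) = to_ac ((rot \<zeta> ^^ k) ((rot \<zeta> ^^ i) (Y (pole x))))" by (simp add: \<psi>pow i Rtpow)
      also have "(rot \<zeta> ^^ k) ((rot \<zeta> ^^ i) (Y (pole x))) = (rot \<zeta> ^^ (l + N * i)) (Y (pole x))"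
        unfolding ki[symmetric] by (simp add: funpow_add)
      also have "\<dots> = (rot \<zeta> ^^ l) ((rot \<zeta> ^^ (N * i)) (Y (pole x)))" by (simp add: funpow_add)
      also have "(rot \<zeta> ^^ (N * i)) (Y (pole x)) = Y (pole x)" by (rule funpow_eq_mult[OF Y(3)[rule_format]])
      finally have "\<psi> ((\<sigma> ^^ k) x) = \<psi> x'" using l by simp
      then show ?thesis using injD[OF inj\<psi>] by blast
    qed
    then show ?thesis using card pole(1) unfolding rf_P1_None_iff p_def q_def by blast
  qed
  then show ?thesis using \<sigma>G by blast
qed

section \<open>Blocks and polynomial decompositions\<close>

lemma map_poly_ring_hom:
  fixes f :: "'a::comm_ring_1 \<Rightarrow> 'b::comm_ring_1"
  assumes f: "f 0 = 0" "\<And>a b. f (a + b) = f a + f b" "\<And>a b. f (a * b) = f a * f b"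
  shows "map_poly f (p + q) = map_poly f p + map_poly f q"
    and "map_poly f (p * q) = map_poly f p * map_poly f q"
    and "map_poly f (Polynomial.smult a p) = Polynomial.smult (f a) (map_poly f p)"
proof -
  have sum: "f (sum g I) = (\<Sum>i\<in>I. f (g i))" for g :: "nat \<Rightarrow> 'a" and I
    by (induction I rule: infinite_finite_induct) (simp_all add: f)
  show "map_poly f (p + q) = map_poly f p + map_poly f q"
    by (rule poly_eqI) (simp add: coeff_map_poly f)
  show "map_poly f (p * q) = map_poly f p * map_poly f q"
    by (rule poly_eqI) (simp add: coeff_map_poly coeff_mult f sum)
  show "map_poly f (Polynomial.smult a p) = Polynomial.smult (f a) (map_poly f p)"
    by (rule poly_eqI) (simp add: coeff_map_poly f)
qed

text \<open>For D(x, Y), with x the inner and Y the outer variable, this is D(xT, T) as a polynomial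
  in T. Its degree in T is the total degree of D, and since \<open>homog\<close> is multiplicative,
  total degrees add up under products.\<close>

definition homog :: "'k::field poly poly \<Rightarrow> 'k poly poly" where
  "homog D = poly (map_poly (\<lambda>p. Abs_poly (\<lambda>m. Polynomial.monom (Polynomial.coeff p m) m)) D) [:0, 1:]"

lemma coeff_diag: "Polynomial.coeff (Abs_poly (\<lambda>m. Polynomial.monom (Polynomial.coeff p m) m)) i = Polynomial.monom (Polynomial.coeff p i) i"
proof -
  have "\<forall>m>Polynomial.degree p. Polynomial.monom (Polynomial.coeff p m) m = 0" by (simp add: coeff_eq_0)
  from coeff_Abs_poly[OF this[rule_format]] show ?thesis by simp
qed

lemma homog_mult: "homog (D * E) = homog D * homog E"
proof -
  define g where "g p = Abs_poly (\<lambda>m. Polynomial.monom (Polynomial.coeff p m) m)" for p :: "'a poly"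
  have c: "Polynomial.coeff (g p) i = Polynomial.monom (Polynomial.coeff p i) i" for p i
    unfolding g_def by (rule coeff_diag)
  have "g 0 = 0" "g (a + b) = g a + g b" for a b
    by (rule poly_eqI; simp add: c add_monom)+
  moreover have "g (a * b) = g a * g b" for a b
  proof (rule poly_eqI)
    fix n
    have "Polynomial.coeff (g a * g b) n =
        (\<Sum>i\<le>n. Polynomial.monom (Polynomial.coeff a i * Polynomial.coeff b (n - i)) n)"
      unfolding coeff_mult by (rule sum.cong) (simp_all add: c mult_monom)
    also have "\<dots> = Polynomial.monom (Polynomial.coeff (a * b) n) n"
      by (rule poly_eqI) (simp add: coeff_sum coeff_mult)
    finally show "Polynomial.coeff (g (a * b)) n = Polynomial.coeff (g a * g b) n" by (simp add: c)
  qed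
  ultimately show ?thesis unfolding homog_def g_def[symmetric] by (simp add: map_poly_ring_hom(2))
qed

lemma coeff_homog:
  "Polynomial.coeff (Polynomial.coeff (homog D) m) i = (if i \<le> m then Polynomial.coeff (Polynomial.coeff D (m - i)) i else 0)"
proof -
  define g where "g p = Abs_poly (\<lambda>m. Polynomial.monom (Polynomial.coeff p m) m)" for p :: "'a poly"
  have c: "Polynomial.coeff (g p) i = Polynomial.monom (Polynomial.coeff p i) i" for p i
    unfolding g_def by (rule coeff_diag)
  have g0: "g 0 = 0" by (rule poly_eqI) (simp add: c)
  have X: "[:0, 1:] ^ j = Polynomial.monom (1::'a poly) j" for j by (simp add: monom_altdef)
  define K where "K = max m (Polynomial.degree (map_poly g D))"
  have "homog D = (\<Sum>j\<le>Polynomial.degree (map_poly g D). Polynomial.coeff (map_poly g D) j * Polynomial.monom 1 j)"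
    unfolding homog_def g_def[symmetric] by (simp add: poly_altdef X)
  also have "\<dots> = (\<Sum>j\<le>K. Polynomial.coeff (map_poly g D) j * Polynomial.monom 1 j)"
    by (rule sum.mono_neutral_left) (auto simp: K_def coeff_eq_0)
  also have "\<dots> = (\<Sum>j\<le>K. g (Polynomial.coeff D j) * Polynomial.monom 1 j)"
    by (simp add: coeff_map_poly g0)
  finally have "Polynomial.coeff (Polynomial.coeff (homog D) m) i =
      (\<Sum>j\<le>K. Polynomial.coeff (Polynomial.coeff (g (Polynomial.coeff D j) * Polynomial.monom 1 j) m) i)"
    by (simp add: coeff_sum)
  also have "\<dots> = (\<Sum>j\<le>K. if j = m - i then (if i \<le> m then Polynomial.coeff (Polynomial.coeff D (m - i)) i else 0) else 0)"
  proof (rule sum.cong)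
    fix j assume "j \<in> {..K}"
    show "Polynomial.coeff (Polynomial.coeff (g (Polynomial.coeff D j) * Polynomial.monom 1 j) m) i =
        (if j = m - i then (if i \<le> m then Polynomial.coeff (Polynomial.coeff D (m - i)) i else 0) else 0)"
      by (auto simp: mult.commute[of _ "Polynomial.monom 1 j"] coeff_monom_mult c)
  qed simp
  also have "\<dots> = (if i \<le> m then Polynomial.coeff (Polynomial.coeff D (m - i)) i else 0)" by (auto simp: K_def)
  finally show ?thesis .
qed

lemma degree_homog_ge:
  assumes "Polynomial.coeff (Polynomial.coeff D j) i \<noteq> 0"
  shows "i + j \<le> Polynomial.degree (homog D)"
proof (rule le_degree)
  have "Polynomial.coeff (Polynomial.coeff (homog D) (i + j)) i \<noteq> 0" using assms by (simp add: coeff_homog)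
  then show "Polynomial.coeff (homog D) (i + j) \<noteq> 0" by auto
qed

text \<open>Repeated division with remainder: the coefficients of \<open>Q\<close> are the digits of
  p in base v.\<close>

lemma poly_base_expansion:
  fixes p v :: "'k::field poly"
  assumes v: "Polynomial.degree v > 0"
  shows "\<exists>Q. p = poly Q v \<and> (\<forall>i. Polynomial.degree (Polynomial.coeff Q i) < Polynomial.degree v)"
proof (induction "Polynomial.degree p" arbitrary: p rule: less_induct)
  case less
  show ?case
  proof (cases "Polynomial.degree p < Polynomial.degree v")
    case True
    then show ?thesis using v by (intro exI[of _ "[:p:]"]) (auto simp: coeff_pCons split: nat.splits)
  next
    case False
    have v0: "v \<noteq> 0" using v by auto
    have p0: "p \<noteq> 0" using False v by auto
    have "Polynomial.degree (p div v) < Polynomial.degree p"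
    proof (cases "p div v = 0")
      case True
      then show ?thesis using False v by simp
    next
      case nz: False
      have "Polynomial.degree (p mod v) < Polynomial.degree v" using degree_mod_less[OF v0, of p] v by auto
      moreover have dm: "Polynomial.degree (v * (p div v)) = Polynomial.degree v + Polynomial.degree (p div v)"
        using nz v0 by (simp add: degree_mult_eq)
      ultimately have "Polynomial.degree (v * (p div v) + p mod v) = Polynomial.degree (v * (p div v))"
        by (intro degree_add_eq_left) simp
      then show ?thesis using dm v by simp
    qed
    then obtain Q where Q: "p div v = poly Q v" "\<forall>i. Polynomial.degree (Polynomial.coeff Q i) < Polynomial.degree v"
      using less by blast
    have "p = p mod v + v * poly Q v" using Q(1) by (metis mod_mult_div_eq add.commute mult.commute)
    moreover have "Polynomial.degree (p mod v) < Polynomial.degree v"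
      using degree_mod_less[OF v0, of p] v by auto
    ultimately show ?thesis using Q(2)
      by (intro exI[of _ "pCons (p mod v) Q"]) (auto simp: coeff_pCons split: nat.splits)
  qed
qed

lemma adjoin_quotient:
  assumes "c \<in> adjoin x"
  shows "\<exists>p q. poly (map_poly ac_const q) x \<noteq> 0 \<and> c = poly (map_poly ac_const p) x / poly (map_poly ac_const q) x"
proof -
  define ev where "ev p = poly (map_poly ac_const p) x" for p
  have ev: "ev (p + q) = ev p + ev q" "ev (p * q) = ev p * ev q" "ev (- p) = - ev p" for p q
    using map_poly_hom[OF subfield_on_UNIV hom_ac_const, of p q] by (simp_all add: ev_def polys_over_def)
  have ev0: "ev 0 = 0" "ev 1 = 1" "ev [:c:] = ac_const c" "ev [:0, 1:] = x" for c
    by (simp_all add: ev_def map_poly_pCons one_pCons)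
  define E where "E = {ev p / ev q | p q. ev q \<noteq> 0}"
  have EI: "ev p / ev q \<in> E" if "ev q \<noteq> 0" for p q using that by (auto simp: E_def)
  have EE: "\<exists>p q. ev q \<noteq> 0 \<and> a = ev p / ev q" if "a \<in> E" for a using that by (auto simp: E_def)
  have "subfield_on E" unfolding subfield_on_def
  proof (intro conjI ballI)
    show "0 \<in> E" "1 \<in> E" using EI[of 1 0] EI[of 1 1] by (simp_all add: ev0)
    fix a assume "a \<in> E"
    then obtain p q where p: "ev q \<noteq> 0" "a = ev p / ev q" using EE by blast
    show "- a \<in> E" using EI[OF p(1), of "- p"] by (simp add: p(2) ev(3))
    show "inverse a \<in> E"
    proof (cases "ev p = 0")
      case True
      then show ?thesis using p \<open>0 \<in> E\<close> by simp
    next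
      case False
      then show ?thesis using EI[OF False, of q] p by simp
    qed
    fix b assume "b \<in> E"
    then obtain p' q' where p': "ev q' \<noteq> 0" "b = ev p' / ev q'" using EE by blast
    have qq: "ev (q * q') \<noteq> 0" using p(1) p'(1) by (simp add: ev)
    have "a + b = ev (p * q' + p' * q) / ev (q * q')" using p p' by (simp add: ev add_frac_eq)
    then show "a + b \<in> E" using EI[OF qq] by simp
    have "a * b = ev (p * p') / ev (q * q')" using p p' by (simp add: ev)
    then show "a * b \<in> E" using EI[OF qq] by simp
  qed
  moreover have "x \<in> E" using EI[of 1 "[:0, 1:]"] by (simp add: ev0)
  moreover have "range ac_const \<subseteq> E" using EI[of 1] ev0 by (metis div_by_1 image_subsetI zero_neq_one)
  ultimately have "adjoin x \<subseteq> E" by (rule adjoin_least)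
  then show ?thesis using assms EE unfolding ev_def by blast
qed

lemma prod_linear_dvd:
  fixes P :: "'a::field poly"
  assumes "finite W" "\<forall>w\<in>W. poly P w = 0"
  shows "(\<Prod>w\<in>W. [:- w, 1:]) dvd P"
  using assms
proof (induction W rule: finite_induct)
  case (insert w W)
  then obtain R where R: "P = (\<Prod>w\<in>W. [:- w, 1:]) * R" by (auto elim: dvdE)
  have "poly P w = 0" using insert.prems by simp
  then have "poly R w = 0" using R poly_prod_linear_0_iff[OF insert.hyps(1), of w] insert.hyps(2) by simp
  then have "[:- w, 1:] dvd R" by (simp add: poly_eq_0_iff_dvd)
  then have "(\<Prod>w\<in>W. [:- w, 1:]) * [:- w, 1:] dvd P" unfolding R by (rule mult_dvd_mono[OF dvd_refl])
  then show ?case by (simp only: prod.insert[OF insert.hyps] mult.commute)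
qed simp

section \<open>A polynomial form of Lueroth's theorem\<close>

text \<open>For x transcendental over k, evaluation at x identifies k[X] with k[x]. Polynomials in
  two variables over k thus become the elements of k[x][Y], embedded by \<open>map_poly ev\<close>
  into the polynomials over k(x).\<close>

locale transcendental_point =
  fixes x :: "'k::field_char_0 func_ac"
  assumes tr: "p \<noteq> 0 \<Longrightarrow> poly (map_poly ac_const p) x \<noteq> 0"
begin

definition ev where "ev p = poly (map_poly ac_const p) x"

lemma ev_simps: "ev 0 = 0" "ev 1 = 1" "ev (p + q) = ev p + ev q" "ev (p * q) = ev p * ev q"
  "ev [:c:] = ac_const c" "ev [:0, 1:] = x" "ev (- p) = - ev p"
  using map_poly_hom[OF subfield_on_UNIV hom_ac_const, of p q]
  by (simp_all add: ev_def polys_over_def map_poly_pCons one_pCons)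

lemma ev_diff: "ev (p - q) = ev p - ev q"
  using ev_simps(3)[of p "- q"] by (simp add: ev_simps(7))

lemma ev_eq_0_iff: "ev p = 0 \<longleftrightarrow> p = 0" using tr ev_simps(1) by (auto simp: ev_def)

lemma ev_inj: "ev p = ev q \<longleftrightarrow> p = q"
  using ev_eq_0_iff[of "p + - q"] ev_simps(3)[of p "- q"] ev_simps(7)[of q] by simp

lemmas map_ev = map_poly_ring_hom[of ev, OF ev_simps(1) ev_simps(3) ev_simps(4)]

lemma map_ev_inj: "map_poly ev D = map_poly ev E \<longleftrightarrow> D = E"
  by (auto simp: poly_eq_iff coeff_map_poly ev_simps ev_inj)

lemma denominator_ex:
  assumes "D \<in> polys_over (adjoin x)"
  shows "\<exists>u E. u \<noteq> 0 \<and> map_poly ev E = Polynomial.smult (ev u) D"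
  using assms
proof (induction D)
  case 0
  then show ?case by (intro exI[of _ 1] exI[of _ 0]) simp
next
  case (pCons a D)
  have a: "a \<in> adjoin x" using pCons.prems by (auto simp: polys_over_def dest: spec[of _ 0])
  have "D \<in> polys_over (adjoin x)"
    using pCons.prems by (auto simp: polys_over_def coeff_pCons dest: spec[of _ "Suc _"])
  then obtain u E where uE: "u \<noteq> 0" "map_poly ev E = Polynomial.smult (ev u) D" using pCons.IH by blast
  obtain p q where pq: "ev q \<noteq> 0" "a = ev p / ev q" using adjoin_quotient[OF a] unfolding ev_def by blast
  have q0: "q \<noteq> 0" using pq(1) ev_simps(1) by auto
  have "map_poly ev (pCons (p * u) (Polynomial.smult q E)) = Polynomial.smult (ev (q * u)) (pCons a D)"
    using pq(1) by (simp add: map_poly_pCons ev_simps map_ev(3) uE(2) pq(2))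
  then show ?case using uE(1) q0 by (intro exI[of _ "q * u"]) auto
qed

definition is_den where "is_den D u E \<longleftrightarrow> u \<noteq> 0 \<and> map_poly ev E = Polynomial.smult (ev u) D"

lemma minimal_denominator:
  assumes "D \<in> polys_over (adjoin x)"
  obtains u E where "is_den D u E" "\<forall>u' E'. is_den D u' E' \<longrightarrow> Polynomial.degree u \<le> Polynomial.degree u'"
proof -
  obtain u E where "is_den D u E" using denominator_ex[OF assms] unfolding is_den_def by blast
  then have "\<exists>E. is_den D u E" by blast
  from arg_min_nat_lemma[of "\<lambda>u. \<exists>E. is_den D u E", OF this, of Polynomial.degree]
  show ?thesis using that by blast
qed

text \<open>A coefficient of \<open>D\<close> that is a constant c of k gives the coefficient u c of
  \<open>E\<close>. If all coefficients of \<open>E\<close> vanished at \<alpha>, so would u, and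
  the minimal polynomial of \<alpha> over k could be cancelled from u and \<open>E\<close>.\<close>

lemma minimal_denominator_content:
  fixes \<alpha> :: "'k alg_closure"
  assumes den: "is_den D u E" and min: "\<forall>u' E'. is_den D u' E' \<longrightarrow> Polynomial.degree u \<le> Polynomial.degree u'"
    and lc: "\<exists>i c. c \<noteq> 0 \<and> Polynomial.coeff D i = ac_const c"
  shows "\<exists>i. poly (map_poly to_ac (Polynomial.coeff E i)) \<alpha> \<noteq> 0"
proof (rule ccontr)
  assume no: "\<not> ?thesis"
  define I where "I = {p :: 'k poly. poly (map_poly to_ac p) \<alpha> = 0}"
  obtain i0 c where c: "c \<noteq> 0" "Polynomial.coeff D i0 = ac_const c" using lc by blast
  have "ev (Polynomial.coeff E i0) = ev u * ac_const c"
  proof -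
    have "Polynomial.coeff (map_poly ev E) i0 = Polynomial.coeff (Polynomial.smult (ev u) D) i0"
      using den by (simp add: is_den_def)
    then show ?thesis by (simp add: coeff_map_poly ev_simps c)
  qed
  then have "ev (Polynomial.coeff E i0) = ev (u * [:c:])" by (simp only: ev_simps)
  then have Ei0: "Polynomial.coeff E i0 = u * [:c:]" by (simp only: ev_inj)
  have "poly (map_poly to_ac (u * [:c:])) \<alpha> = 0" using no Ei0 by metis
  then have "poly (map_poly to_ac u) \<alpha> * to_ac c = 0"
    unfolding map_poly_hom_UNIV(2)[OF hom_to_ac] by (auto simp: map_poly_pCons)
  then have uI: "poly (map_poly to_ac u) \<alpha> = 0" using c(1) by simp
  have u0: "u \<noteq> 0" using den by (simp add: is_den_def)
  have "u \<in> I \<and> u \<noteq> 0" using uI u0 by (simp add: I_def)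
  from arg_min_nat_lemma[of "\<lambda>p. p \<in> I \<and> p \<noteq> 0", OF this, of Polynomial.degree]
  obtain m where m: "m \<in> I" "m \<noteq> 0" "\<And>p. \<lbrakk>p \<in> I; p \<noteq> 0\<rbrakk> \<Longrightarrow> Polynomial.degree m \<le> Polynomial.degree p" by blast
  have dm: "Polynomial.degree m > 0"
  proof (rule gr0I)
    assume "Polynomial.degree m = 0"
    then obtain a where "m = [:a:]" by (rule degree_eq_zeroE)
    then show False using m(1,2) by (simp add: I_def map_poly_pCons)
  qed
  have dvd: "m dvd p" if "p \<in> I" for p
  proof (rule ccontr)
    assume "\<not> m dvd p"
    then have nz: "p mod m \<noteq> 0" by (simp add: dvd_eq_mod_eq_0)
    have "p = m * (p div m) + p mod m" by simp
    then have "poly (map_poly to_ac (m * (p div m) + p mod m)) \<alpha> = 0" using that by (simp add: I_def)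
    then have "p mod m \<in> I" using m(1) unfolding map_poly_hom_UNIV(1,2)[OF hom_to_ac] by (simp add: I_def)
    then show False using m(3)[OF _ nz] degree_mod_less'[OF m(2) nz] by simp
  qed
  define E' where "E' = map_poly (\<lambda>p. p div m) E"
  have E: "E = Polynomial.smult m E'"
    using no dvd by (intro poly_eqI) (auto simp: E'_def coeff_map_poly I_def)
  define u' where "u' = u div m"
  have u: "u = m * u'" using dvd[of u] uI by (simp add: u'_def I_def)
  have u'0: "u' \<noteq> 0" using u u0 by auto
  have "Polynomial.smult (ev m) (map_poly ev E') = Polynomial.smult (ev m) (Polynomial.smult (ev u') D)"
    using den unfolding is_den_def E u map_ev(3) by (simp add: ev_simps)
  then have "map_poly ev E' = Polynomial.smult (ev u') D"
    using m(2) by (auto simp: poly_eq_iff ev_eq_0_iff)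
  then have "is_den D u' E'" using u'0 by (simp add: is_den_def)
  then have "Polynomial.degree u \<le> Polynomial.degree u'" using min by blast
  moreover have "Polynomial.degree u = Polynomial.degree m + Polynomial.degree u'"
    using m(2) u'0 by (simp add: u degree_mult_eq)
  ultimately show False using dm by simp
qed

text \<open>Gauss's lemma: a denominator of minimal degree has no root, since at a root of it one of the
  two factors, and hence its denominator, would be divisible by the minimal polynomial of the root.\<close>

lemma monic_factor_integral:
  assumes D1: "D1 \<in> polys_over (adjoin x)" "\<exists>i c. c \<noteq> 0 \<and> Polynomial.coeff D1 i = ac_const c"
    and D2: "D2 \<in> polys_over (adjoin x)" "\<exists>i c. c \<noteq> 0 \<and> Polynomial.coeff D2 i = ac_const c"
    and prod: "D1 * D2 = map_poly ev F"
  obtains E1 E2 where "D1 = map_poly ev E1" "D2 = map_poly ev E2" "F = E1 * E2"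
proof -
  obtain u1 E1 where d1: "is_den D1 u1 E1" "\<forall>u' E'. is_den D1 u' E' \<longrightarrow> Polynomial.degree u1 \<le> Polynomial.degree u'"
    by (rule minimal_denominator[OF D1(1)])
  obtain u2 E2 where d2: "is_den D2 u2 E2" "\<forall>u' E'. is_den D2 u' E' \<longrightarrow> Polynomial.degree u2 \<le> Polynomial.degree u'"
    by (rule minimal_denominator[OF D2(1)])
  have nz: "u1 \<noteq> 0" "u2 \<noteq> 0" using d1 d2 by (auto simp: is_den_def)
  have "map_poly ev (E1 * E2) = map_poly ev (Polynomial.smult (u1 * u2) F)"
    using d1(1) d2(1) unfolding is_den_def map_ev(2,3) by (simp add: ev_simps mult.commute flip: prod)
  then have EF: "E1 * E2 = Polynomial.smult (u1 * u2) F" by (simp only: map_ev_inj)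
  have no_root: "poly (map_poly to_ac (u1 * u2)) \<alpha> \<noteq> 0" for \<alpha>
  proof
    assume root: "poly (map_poly to_ac (u1 * u2)) \<alpha> = 0"
    define th where "th p = poly (map_poly to_ac p) \<alpha>" for p :: "'k poly"
    have th: "th 0 = 0" "th (a + b) = th a + th b" "th (a * b) = th a * th b" for a b
      by (simp_all add: th_def map_poly_hom_UNIV[OF hom_to_ac])
    note map_th = map_poly_ring_hom[of th, OF th]
    have "map_poly th E1 * map_poly th E2 = 0"
      using root by (simp add: EF map_th(2)[symmetric] map_th(3) th_def)
    then consider "map_poly th E1 = 0" | "map_poly th E2 = 0" by auto
    then show False
    proof cases
      case 1
      then have "th (Polynomial.coeff E1 i) = 0" for i using th(1) by (metis coeff_0 coeff_map_poly)
      then show False using minimal_denominator_content[OF d1 D1(2), of \<alpha>] by (simp add: th_def)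
    next
      case 2
      then have "th (Polynomial.coeff E2 i) = 0" for i using th(1) by (metis coeff_0 coeff_map_poly)
      then show False using minimal_denominator_content[OF d2 D2(2), of \<alpha>] by (simp add: th_def)
    qed
  qed
  have "Polynomial.degree (map_poly to_ac (u1 * u2)) = 0"
    using no_root alg_closed_imp_poly_has_root by blast
  then have "Polynomial.degree (u1 * u2) = 0" by (simp add: map_poly_hom_UNIV(5)[OF hom_to_ac])
  then have dg: "Polynomial.degree u1 = 0" "Polynomial.degree u2 = 0" using nz by (simp_all add: degree_mult_eq)
  obtain a1 where a1: "u1 = [:a1:]" using dg(1) by (rule degree_eq_zeroE)
  obtain a2 where a2: "u2 = [:a2:]" using dg(2) by (rule degree_eq_zeroE)
  have a0: "a1 \<noteq> 0" "a2 \<noteq> 0" using nz a1 a2 by auto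
  have scale: "D = map_poly ev (Polynomial.smult [:inverse a:] E)" if "is_den D [:a:] E" "a \<noteq> 0" for D E a
  proof -
    have "map_poly ev (Polynomial.smult [:inverse a:] E) = Polynomial.smult (ev [:inverse a:] * ev [:a:]) D"
      using that(1) by (simp add: is_den_def map_ev(3))
    also have "ev [:inverse a:] * ev [:a:] = ev ([:inverse a:] * [:a:])" by (simp only: ev_simps)
    also have "[:inverse a:] * [:a:] = 1" using that(2) by (simp add: one_pCons)
    finally show ?thesis by (simp add: ev_simps)
  qed
  define F1 where "F1 = Polynomial.smult [:inverse a1:] E1"
  define F2 where "F2 = Polynomial.smult [:inverse a2:] E2"
  have D: "D1 = map_poly ev F1" "D2 = map_poly ev F2"
    using scale d1(1) d2(1) a1 a2 a0 by (simp_all add: F1_def F2_def)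
  then have "map_poly ev F = map_poly ev (F1 * F2)" using prod map_ev(2) by simp
  then have "F = F1 * F2" by (simp only: map_ev_inj)
  with D show ?thesis by (rule that)
qed

text \<open>The product D1 of the factors Y - w over the block divides f_r(Y) - f_r(x), and by
  Gauss's lemma its coefficients lie in k[x]. A count of total degrees bounds their degrees by |W|.
  One of them, v, is not constant because x is transcendental. Since v(x) is invariant under the
  maps \<nu>, v takes the same value at all points of \<open>W\<close>, which forces deg v = |W|.
  The digits of f_r in base v then turn out to be constants.\<close>

lemma block_decomposition:
  assumes fr: "Polynomial.degree fr > 0"
    and W: "finite W" "x \<in> W" "\<And>w. w \<in> W \<Longrightarrow> poly (map_poly ac_const fr) w = ev fr"
    and H: "\<And>w. w \<in> W \<Longrightarrow> \<exists>\<nu>. field_hom_on UNIV \<nu> \<and> (\<forall>c. \<nu> (ac_const c) = ac_const c) \<and> \<nu> ` W = W \<and> \<nu> x = w"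
    and coeffs: "(\<Prod>w\<in>W. [:- w, 1:]) \<in> polys_over (adjoin x)"
    and quot: "\<And>D. map_poly ac_const fr - [:ev fr:] = (\<Prod>w\<in>W. [:- w, 1:]) * D \<Longrightarrow> D \<in> polys_over (adjoin x)"
  obtains u v where "fr = u \<circ>\<^sub>p v" "Polynomial.degree v = card W"
proof -
  define d where "d = card W"
  define n where "n = Polynomial.degree fr"
  have d: "d > 0" using W(1,2) by (auto simp: d_def card_gt_0_iff)
  define D1 where "D1 = (\<Prod>w\<in>W. [:- w, 1:])"
  define Fc where "Fc = map_poly ac_const fr - [:ev fr:]"
  have D1c: "Polynomial.coeff D1 d = 1" "Polynomial.degree D1 = d"
    using lead_coeff_prod_linear[of W] degree_prod_linear[OF W(1)] by (simp_all add: D1_def d_def)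
  have "D1 dvd Fc"
  proof -
    have "\<forall>w\<in>W. poly Fc w = 0" using W(3) by (simp add: Fc_def)
    then show ?thesis unfolding D1_def by (rule prod_linear_dvd[OF W(1)])
  qed
  then obtain D2 where D2: "Fc = D1 * D2" by (rule dvdE)
  have D2S: "D2 \<in> polys_over (adjoin x)" using quot[of D2] D2 by (simp add: D1_def Fc_def)
  define F where "F = map_poly (\<lambda>c. [:c:]) fr - [:fr:]"
  have F: "map_poly ev F = Fc"
    by (rule poly_eqI) (simp add: F_def Fc_def coeff_map_poly ev_simps coeff_pCons ev_diff split: nat.split)
  have fr0: "fr \<noteq> 0" using fr by auto
  have Fcn: "Polynomial.degree Fc = n" "Polynomial.coeff Fc n = ac_const (Polynomial.lead_coeff fr)"
  proof -
    have dn: "Polynomial.degree (map_poly ac_const fr) = n" by (simp add: n_def map_poly_hom_UNIV(5)[OF hom_ac_const])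
    then show "Polynomial.degree Fc = n" unfolding Fc_def using fr
      by (subst diff_conv_add_uminus, subst degree_add_eq_left) (simp_all add: n_def)
    show "Polynomial.coeff Fc n = ac_const (Polynomial.lead_coeff fr)"
      using fr by (cases n) (simp_all add: Fc_def n_def coeff_map_poly)
  qed
  have nz: "D1 \<noteq> 0" "D2 \<noteq> 0" using D2 Fcn(1) fr by (auto simp: n_def)
  have dD2: "Polynomial.degree D2 = n - d" "d \<le> n" using Fcn(1) D1c(2) nz by (auto simp: D2 degree_mult_eq)
  have lcD2: "Polynomial.coeff D2 (n - d) = ac_const (Polynomial.lead_coeff fr)"
  proof -
    have "Polynomial.coeff Fc n = Polynomial.lead_coeff D1 * Polynomial.lead_coeff D2"
      using Fcn(1) unfolding D2 by (metis lead_coeff_mult)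
    then show ?thesis using Fcn(2) D1c dD2 by simp
  qed
  have "\<exists>i c. c \<noteq> 0 \<and> Polynomial.coeff D1 i = ac_const c" using D1c(1) by (intro exI[of _ d] exI[of _ 1]) simp
  moreover have "\<exists>i c. c \<noteq> 0 \<and> Polynomial.coeff D2 i = ac_const c" using lcD2 fr0 by (metis leading_coeff_0_iff)
  ultimately obtain E1 E2 where E: "D1 = map_poly ev E1" "D2 = map_poly ev E2" "F = E1 * E2"
    using monic_factor_integral[OF _ _ D2S, of D1 F] coeffs D2 F unfolding D1_def by metis
  have E1c: "Polynomial.coeff E1 d = 1"
  proof -
    have "ev (Polynomial.coeff E1 d) = ev 1" using D1c(1) E(1) by (simp add: coeff_map_poly ev_simps)
    then show ?thesis by (simp only: ev_inj)
  qed
  have E2c: "Polynomial.coeff E2 (n - d) = [:Polynomial.lead_coeff fr:]"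
  proof -
    have "ev (Polynomial.coeff E2 (n - d)) = ev [:Polynomial.lead_coeff fr:]" using lcD2 E(2) by (simp add: coeff_map_poly ev_simps)
    then show ?thesis by (simp only: ev_inj)
  qed
  \<comment> \<open>f_r(Y) - f_r(x) has total degree at most n, and \<open>E2\<close> has total
    degree at least n - d because of its leading term. So \<open>E1\<close> has total degree at most
    d.\<close>
  have deg: "Polynomial.degree (Polynomial.coeff E1 j) \<le> d" for j
  proof (rule ccontr)
    assume no: "\<not> ?thesis"
    define i where "i = Polynomial.degree (Polynomial.coeff E1 j)"
    have "Polynomial.coeff (Polynomial.coeff E1 j) i \<noteq> 0" using no by (auto simp: i_def)
    then have g1: "i + j \<le> Polynomial.degree (homog E1)" by (rule degree_homog_ge)
    have "Polynomial.coeff (Polynomial.coeff E2 (n - d)) 0 \<noteq> 0" using E2c fr0 by simp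
    then have g2: "0 + (n - d) \<le> Polynomial.degree (homog E2)" by (rule degree_homog_ge)
    have hn: "homog E1 \<noteq> 0" "homog E2 \<noteq> 0"
    proof -
      have "Polynomial.coeff (Polynomial.coeff (homog E1) d) 0 \<noteq> 0" by (simp add: coeff_homog E1c)
      then show "homog E1 \<noteq> 0" by auto
      have "Polynomial.coeff (Polynomial.coeff (homog E2) (n - d)) 0 \<noteq> 0" using fr0 by (simp add: coeff_homog E2c)
      then show "homog E2 \<noteq> 0" by auto
    qed
    have "Polynomial.degree (homog F) = Polynomial.degree (homog E1) + Polynomial.degree (homog E2)"
      unfolding E(3) homog_mult using hn by (rule degree_mult_eq)
    moreover have "Polynomial.degree (homog F) \<le> n"
    proof (rule degree_le, intro allI impI)
      fix m assume m: "n < m"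
      show "Polynomial.coeff (homog F) m = 0"
      proof (rule poly_eqI)
        fix i
        show "Polynomial.coeff (Polynomial.coeff (homog F) m) i = Polynomial.coeff 0 i"
        proof (cases "i \<le> m")
          case True
          have z: "Polynomial.coeff fr m = 0" using m by (simp add: n_def coeff_eq_0)
          show ?thesis using True z
            by (cases "m - i") (auto simp: coeff_homog F_def coeff_map_poly coeff_pCons split: nat.split)
        qed (simp add: coeff_homog)
      qed
    qed
    ultimately show False using g1 g2 no dD2(2) by (simp add: i_def)
  qed
  have "\<exists>j. Polynomial.degree (Polynomial.coeff E1 j) > 0"
  proof (rule ccontr)
    assume no: "\<not> ?thesis"
    define r where "r = map_poly (\<lambda>p. Polynomial.coeff p 0) E1"
    have "Polynomial.coeff D1 j = ac_const (Polynomial.coeff r j)" for j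
    proof -
      have "Polynomial.degree (Polynomial.coeff E1 j) = 0" using no by simp
      then obtain a where "Polynomial.coeff E1 j = [:a:]" by (rule degree_eq_zeroE)
      then show ?thesis by (simp add: E(1) r_def coeff_map_poly ev_simps)
    qed
    then have "D1 = map_poly ac_const r" by (intro poly_eqI) (simp add: coeff_map_poly)
    moreover have "poly D1 x = 0" using poly_prod_linear_0_iff[OF W(1)] W(2) by (simp add: D1_def)
    ultimately have "r = 0" using tr[of r] by auto
    moreover have "Polynomial.coeff r d = 1" by (simp add: r_def coeff_map_poly E1c)
    ultimately show False by simp
  qed
  then obtain j where j: "Polynomial.degree (Polynomial.coeff E1 j) > 0" by blast
  define v where "v = Polynomial.coeff E1 j"
  have v0: "Polynomial.degree v > 0" using j by (simp add: v_def)
  have vx: "ev v = Polynomial.coeff D1 j" by (simp add: v_def E(1) coeff_map_poly ev_simps)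
  have vW: "poly (map_poly ac_const v) w = ev v" if w: "w \<in> W" for w
  proof -
    obtain \<nu> where \<nu>: "field_hom_on UNIV \<nu>" "\<forall>c. \<nu> (ac_const c) = ac_const c" "\<nu> ` W = W" "\<nu> x = w" using H[OF w] by blast
    have "inj_on \<nu> W" using hom_UNIV_inj[OF \<nu>(1)] inj_on_subset by blast
    then have "map_poly \<nu> D1 = D1" unfolding D1_def using map_poly_prod_linear[OF \<nu>(1) W(1)] \<nu>(3) by simp
    then have "\<nu> (Polynomial.coeff D1 j) = Polynomial.coeff D1 j"
      using field_hom_on_props(2)[OF subfield_on_UNIV \<nu>(1)] by (metis coeff_map_poly)
    then have "\<nu> (ev v) = ev v" by (simp only: vx)
    moreover have "\<nu> (ev v) = poly (map_poly ac_const v) w"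
      unfolding ev_def using hom_poly_const[OF \<nu>(1)] \<nu>(2,4) by metis
    ultimately show ?thesis by simp
  qed
  have degv: "Polynomial.degree v = d"
  proof (rule antisym)
    show "Polynomial.degree v \<le> d" unfolding v_def by (rule deg)
    define T where "T = map_poly ac_const v - [:ev v:]"
    have dT: "Polynomial.degree T = Polynomial.degree v"
      unfolding T_def using v0 by (subst diff_conv_add_uminus, subst degree_add_eq_left)
        (simp_all add: map_poly_hom_UNIV(5)[OF hom_ac_const])
    then have T0: "T \<noteq> 0" using v0 by auto
    have "W \<subseteq> {w. poly T w = 0}" using vW by (auto simp: T_def)
    then have "card W \<le> card {w. poly T w = 0}" by (rule card_mono[OF poly_roots_finite[OF T0]])
    then show "d \<le> Polynomial.degree v" using card_poly_roots_bound[OF T0] dT by (simp add: d_def)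
  qed
  obtain Q where Q: "fr = poly Q v" "\<forall>i. Polynomial.degree (Polynomial.coeff Q i) < Polynomial.degree v"
    using poly_base_expansion[OF v0] by blast
  define K where "K = Polynomial.degree Q"
  \<comment> \<open>The base-v expansion of f_r(Y) with v(Y) replaced by v(x), minus f_r(x). Its
    degree is below d and it vanishes at the d points of \<open>W\<close>, so it is zero.\<close>
  define T where "T = (\<Sum>i\<le>K. Polynomial.smult (ev v ^ i) (map_poly ac_const (Polynomial.coeff Q i))) - [:ev fr:]"
  have Tw: "poly T w = 0" if w: "w \<in> W" for w
  proof -
    define evw where "evw p = poly (map_poly ac_const p) w" for p
    have evw: "evw 0 = 0" "evw 1 = 1" "evw (p + q) = evw p + evw q" "evw (p * q) = evw p * evw q" for p q
      by (simp_all add: evw_def map_poly_hom_UNIV[OF hom_ac_const] one_pCons map_poly_pCons)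
    have evwp: "evw (p ^ i) = evw p ^ i" for p i by (induction i) (simp_all add: evw)
    have evws: "evw (sum g I) = (\<Sum>i\<in>I. evw (g i))" for g :: "nat \<Rightarrow> 'k poly" and I
      by (induction I rule: infinite_finite_induct) (simp_all add: evw)
    have "evw fr = (\<Sum>i\<le>K. evw (Polynomial.coeff Q i) * evw v ^ i)"
      unfolding Q(1) poly_altdef K_def by (simp add: evws evw evwp)
    moreover have "evw fr = ev fr" "evw v = ev v" using W(3)[OF w] vW[OF w] by (simp_all add: evw_def)
    ultimately show ?thesis by (simp add: T_def poly_sum evw_def mult.commute)
  qed
  have T0: "T = 0"
  proof (rule ccontr)
    assume T0: "T \<noteq> 0"
    have "W \<subseteq> {w. poly T w = 0}" using Tw by auto
    then have "card W \<le> card {w. poly T w = 0}" by (rule card_mono[OF poly_roots_finite[OF T0]])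
    also have "\<dots> \<le> Polynomial.degree T" by (rule card_poly_roots_bound[OF T0])
    also have "\<dots> < d"
    proof (rule degree_lessI)
      show "T \<noteq> 0 \<or> d > 0" using d by simp
      show "\<forall>i\<ge>d. Polynomial.coeff T i = 0"
      proof (intro allI impI)
        fix i assume i: "d \<le> i"
        have "Polynomial.coeff (Polynomial.coeff Q l) i = 0" for l
          using Q(2)[rule_format, of l] i degv by (simp add: coeff_eq_0)
        then show "Polynomial.coeff T i = 0" using i d
          by (cases i) (simp_all add: T_def coeff_sum coeff_map_poly)
      qed
    qed
    finally show False by (simp add: d_def)
  qed
  \<comment> \<open>The coefficient of Y^m in T = 0 is a polynomial relation over k for v(x). It
    must be trivial, since v is not constant and x is transcendental.\<close>
  have const: "Polynomial.coeff (Polynomial.coeff Q l) m = 0" if m: "m > 0" for l m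
  proof -
    define r where "r = map_poly (\<lambda>q. Polynomial.coeff q m) Q"
    have "Polynomial.coeff T m = (\<Sum>i\<le>K. ev v ^ i * ac_const (Polynomial.coeff (Polynomial.coeff Q i) m))"
      using m by (cases m) (simp_all add: T_def coeff_sum coeff_map_poly)
    then have "(\<Sum>i\<le>K. ac_const (Polynomial.coeff r i) * ev v ^ i) = 0" using T0 by (simp add: r_def coeff_map_poly mult.commute)
    moreover have "Polynomial.degree (map_poly ac_const r) \<le> K"
      unfolding map_poly_hom_UNIV(5)[OF hom_ac_const] K_def r_def by (rule map_poly_degree_leq)
    ultimately have "poly (map_poly ac_const r) (ev v) = 0"
      by (subst poly_altdef, subst sum.mono_neutral_left[of "{..K}"]) (auto simp: coeff_map_poly coeff_eq_0 map_poly_hom_UNIV(5)[OF hom_ac_const])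
    moreover have "poly (map_poly ac_const r) (ev v) = ev (r \<circ>\<^sub>p v)"
    proof (induction r)
      case (pCons a r)
      then show ?case by (simp add: pcompose_pCons ev_simps map_poly_pCons)
    qed (simp add: ev_simps)
    ultimately have "r \<circ>\<^sub>p v = 0" by (simp add: ev_eq_0_iff)
    then have "r = 0" using v0 by (simp add: pcompose_eq_0_iff)
    then show ?thesis by (metis r_def coeff_0 coeff_map_poly)
  qed
  define u where "u = map_poly (\<lambda>q. Polynomial.coeff q 0) Q"
  have "Polynomial.coeff Q l = [:Polynomial.coeff u l:]" for l
    using const by (intro poly_eqI) (auto simp: u_def coeff_map_poly coeff_pCons split: nat.split)
  then have "Q = map_poly (\<lambda>c. [:c:]) u" by (intro poly_eqI) (simp add: coeff_map_poly)
  then have "fr = u \<circ>\<^sub>p v" using Q(1) by (simp add: pcompose_altdef)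
  then show ?thesis using degv by (intro that) (simp_all add: d_def)
qed

end

lemma rf_compose_poly: "rf_compose (to_fract u) (to_fract v) = to_fract (u \<circ>\<^sub>p v)"
proof -
  have "poly (map_poly rf_const u) (to_fract v) = to_fract (u \<circ>\<^sub>p v)"
    by (induction u) (simp_all add: pcompose_pCons map_poly_pCons rf_const_def)
  moreover have "rf_const 1 = (1 :: 'a poly fract)" by (simp add: rf_const_def flip: one_pCons)
  ultimately show ?thesis by (simp add: rf_compose_def map_poly_1')
qed

text \<open>The orbit \<open>W\<close> of x under \<open>N\<close> is a block, and
  \<open>block_decomposition\<close> turns it into a decomposition of f_r whose right factor has
  degree |W|. Indecomposability leaves |W| = 1 or |W| = deg f_r.\<close>

lemma fiber_primitive:
  fixes fr :: "'k::field_char_0 poly"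
  assumes ind: "indecomposable (to_fract fr)"
    and x: "ac_t \<in> adjoin x" "\<And>p. p \<noteq> 0 \<Longrightarrow> poly (map_poly ac_const p) x \<noteq> 0"
    and N: "perm_group N" "N \<subseteq> GalT" "\<And>g n. \<lbrakk>g \<in> GalT; n \<in> N\<rbrakk> \<Longrightarrow> g \<circ> n \<circ> finv g \<in> N"
    and fixes_base: "\<And>n. n \<in> N \<Longrightarrow> n (poly (map_poly ac_const fr) x) = poly (map_poly ac_const fr) x"
  shows "(\<lambda>n. n x) ` N = {x} \<or> (\<lambda>n. n x) ` N = {w. poly (map_poly ac_const fr) w = poly (map_poly ac_const fr) x}"
proof -
  interpret G: galois_closure "range (to_ac :: 'k poly fract \<Rightarrow> _)" by (rule galois_closure_to_ac)
  interpret N: perm_group N by (rule N(1))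
  interpret transcendental_point x by unfold_locales (rule x(2))
  define W where "W = (\<lambda>n. n x) ` N"
  define R where "R = {w. poly (map_poly ac_const fr) w = ev fr}"
  define Fc where "Fc = map_poly ac_const fr - [:ev fr:]"
  have dfr: "Polynomial.degree fr > 1"
    and dec: "\<not> (\<exists>\<alpha> \<beta>. rf_degree \<alpha> > 1 \<and> rf_degree \<beta> > 1 \<and> to_fract fr = rf_compose \<alpha> \<beta>)"
    using ind by (simp_all add: indecomposable_def)
  have dFc: "Polynomial.degree Fc = Polynomial.degree fr"
    unfolding Fc_def using dfr by (subst diff_conv_add_uminus, subst degree_add_eq_left)
      (simp_all add: map_poly_hom_UNIV(5)[OF hom_ac_const])
  then have Fc0: "Fc \<noteq> 0" using dfr by auto
  have R: "R = {w. poly Fc w = 0}" by (auto simp: R_def Fc_def)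
  have finR: "finite R" unfolding R by (rule poly_roots_finite[OF Fc0])
  have cardR: "card R \<le> Polynomial.degree fr" using card_poly_roots_bound[OF Fc0] dFc by (simp add: R)
  have WR: "W \<subseteq> R"
  proof
    fix w assume "w \<in> W"
    then obtain n where n: "n \<in> N" "w = n x" by (auto simp: W_def)
    then have nG: "n \<in> GalT" using N(2) by blast
    have "n (ev fr) = poly (map_poly ac_const fr) (n x)"
      unfolding ev_def using hom_poly_const[OF autosD(2)[OF nG]] GalT_const[OF nG] by metis
    then show "w \<in> R" using fixes_base[OF n(1)] n(2) by (simp add: R_def ev_def)
  qed
  have finW: "finite W" using WR finR by (rule finite_subset)
  have xW: "x \<in> W" unfolding W_def by (rule image_eqI[of _ _ id]) (simp_all add: N.id_mem)
  have stab: "g ` W = W" if g: "g \<in> GalT" and sub: "g ` W \<subseteq> W" for g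
    by (rule endo_inj_surj[OF finW sub]) (use hom_UNIV_inj[OF autosD(2)[OF g]] inj_on_subset in blast)
  have NW: "n ` W = W" if n: "n \<in> N" for n
  proof (rule stab)
    show "n \<in> GalT" using n N(2) by blast
    show "n ` W \<subseteq> W"
    proof
      fix w assume "w \<in> n ` W"
      then obtain m where m: "m \<in> N" "w = n (m x)" unfolding W_def by blast
      then show "w \<in> W" unfolding W_def using N.comp_mem[OF n m(1)] by (intro image_eqI[of _ _ "n \<circ> m"]) auto
    qed
  qed
  have GW: "g ` W = W" if g: "g \<in> GalT" "g x = x" for g
  proof (rule stab[OF g(1)])
    have gi: "finv g x = x" using G.G.finv_left[OF g(1), of x] g(2) by simp
    show "g ` W \<subseteq> W"
    proof
      fix w assume "w \<in> g ` W"
      then obtain n where n: "n \<in> N" "w = g (n x)" unfolding W_def by blast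
      then show "w \<in> W" unfolding W_def using N(3)[OF g(1) n(1)] gi
        by (intro image_eqI[of _ _ "g \<circ> n \<circ> finv g"]) auto
    qed
  qed
  have inv_coeffs: "P \<in> polys_over (adjoin x)" if P: "\<And>g. \<lbrakk>g \<in> GalT; g x = x\<rbrakk> \<Longrightarrow> map_poly g P = P" for P
  proof -
    have "Polynomial.coeff P i \<in> G.fixed_by x" for i
    proof -
      have "g (Polynomial.coeff P i) = Polynomial.coeff P i" if g: "g \<in> GalT" "g x = x" for g
        using P[OF g] field_hom_on_props(2)[OF subfield_on_UNIV autosD(2)[OF g(1)]] by (metis coeff_map_poly)
      then show ?thesis by (simp add: G.fixed_by_def)
    qed
    then show ?thesis unfolding fixed_by_adjoin[OF x(1)] polys_over_def by blast
  qed
  define D1 where "D1 = (\<Prod>w\<in>W. [:- w, 1:])"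
  have D1g: "map_poly g D1 = D1" if g: "g \<in> GalT" "g x = x" for g
  proof -
    note h = autosD(2)[OF g(1)]
    have "inj_on g W" using hom_UNIV_inj[OF h] inj_on_subset by blast
    then show ?thesis unfolding D1_def using map_poly_prod_linear[OF h finW] GW[OF g] by simp
  qed
  have D1c: "D1 \<in> polys_over (adjoin x)" by (rule inv_coeffs[OF D1g])
  have D10: "D1 \<noteq> 0" using lead_coeff_prod_linear[of W] by (auto simp: D1_def)
  have quot: "D \<in> polys_over (adjoin x)" if D: "map_poly ac_const fr - [:ev fr:] = D1 * D" for D
  proof (rule inv_coeffs)
    fix g assume g: "g \<in> GalT" "g x = x"
    note h = autosD(2)[OF g(1)]
    have gev: "g (ev fr) = ev fr"
      unfolding ev_def using hom_poly_const[OF h] GalT_const[OF g(1)] g(2) by metis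
    have g0: "g 0 = 0" by (rule field_hom_on_props(2)[OF subfield_on_UNIV h])
    have "map_poly g (map_poly ac_const fr) = map_poly ac_const fr"
      by (rule poly_eqI) (simp add: coeff_map_poly g0 GalT_const[OF g(1)])
    then have "map_poly g Fc = Fc" unfolding Fc_def diff_conv_add_uminus using gev g0 field_hom_on_props(5)[OF subfield_on_UNIV h]
      by (simp add: map_poly_hom_UNIV[OF h] map_poly_pCons)
    then have "D1 * map_poly g D = D1 * D"
      using D D1g[OF g] map_poly_hom_UNIV[OF h] by (simp add: Fc_def)
    then show "map_poly g D = D" using D10 by simp
  qed
  have Hn: "\<exists>\<nu>. field_hom_on UNIV \<nu> \<and> (\<forall>c. \<nu> (ac_const c) = ac_const c) \<and> \<nu> ` W = W \<and> \<nu> x = w" if "w \<in> W" for w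
  proof -
    obtain n where n: "n \<in> N" "w = n x" using \<open>w \<in> W\<close> by (auto simp: W_def)
    then have nG: "n \<in> GalT" using N(2) by blast
    show ?thesis using autosD(2)[OF nG] GalT_const[OF nG] NW[OF n(1)] n(2) by (intro exI[of _ n]) auto
  qed
  have "Polynomial.degree fr > 0" using dfr by simp
  then obtain u v where uv: "fr = u \<circ>\<^sub>p v" "Polynomial.degree v = card W"
    by (rule block_decomposition[OF _ finW xW _ Hn D1c[unfolded D1_def] quot[unfolded D1_def]])
      (use WR in \<open>auto simp: R_def\<close>)
  have deg: "Polynomial.degree fr = Polynomial.degree u * card W" by (simp add: uv(1) uv(2)[symmetric] degree_pcompose)
  have "\<not> (Polynomial.degree u > 1 \<and> card W > 1)"
    using dec rf_degree_poly[of u] rf_degree_poly[of v] rf_compose_poly[of u v] uv by metis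
  then consider "card W \<le> 1" | "Polynomial.degree u \<le> 1" by linarith
  then show ?thesis
  proof cases
    case 1
    then have "W = {x}" using xW finW by (auto simp: card_le_Suc0_iff_eq)
    then show ?thesis by (simp add: W_def)
  next
    case 2
    then have "Polynomial.degree fr \<le> card W" using deg by (cases "Polynomial.degree u") auto
    then have "W = R" using card_subset_eq[OF finR WR] cardR card_mono[OF finR WR] by linarith
    then show ?thesis by (simp add: W_def R_def ev_def)
  qed
qed

section \<open>Monodromy groups\<close>

lemma subfield_vimage_hom:
  assumes \<sigma>: "field_hom_on UNIV \<sigma>" and L: "subfield_on L"
  shows "subfield_on {c. \<sigma> c \<in> L}"
  by (simp add: subfield_on_def field_hom_on_props(1-6)[OF subfield_on_UNIV \<sigma>] subfield_onD[OF L])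

lemma subfield_equalizer:
  assumes \<sigma>: "field_hom_on UNIV \<sigma>" and \<tau>: "field_hom_on UNIV \<tau>"
  shows "subfield_on {c. \<sigma> c = \<tau> c}"
  by (simp add: subfield_on_def field_hom_on_props(1-6)[OF subfield_on_UNIV \<sigma>] field_hom_on_props(1-6)[OF subfield_on_UNIV \<tau>])

lemma split_field_subfield: "subfield_on (split_field \<phi> s)"
  unfolding split_field_def by (rule generate_field_subfield)

lemma split_field_incl: "adjoin s \<subseteq> split_field \<phi> s" "rf_fiber \<phi> s \<subseteq> split_field \<phi> s"
  unfolding split_field_def by (auto intro: generate_field.incl)

lemma split_field_least: "\<lbrakk>subfield_on E; adjoin s \<subseteq> E; rf_fiber \<phi> s \<subseteq> E\<rbrakk> \<Longrightarrow> split_field \<phi> s \<subseteq> E"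
  unfolding split_field_def by (rule generate_field_least) auto

lemma autos_adjoin_iff:
  "\<sigma> \<in> autos (adjoin s) \<longleftrightarrow> bij \<sigma> \<and> field_hom_on UNIV \<sigma> \<and> (\<forall>c. \<sigma> (ac_const c) = ac_const c) \<and> \<sigma> s = s"
proof
  assume "\<sigma> \<in> autos (adjoin s)"
  then show "bij \<sigma> \<and> field_hom_on UNIV \<sigma> \<and> (\<forall>c. \<sigma> (ac_const c) = ac_const c) \<and> \<sigma> s = s"
    using adjoin_self[of s] adjoin_const[of _ s] by (simp add: autos_def)
next
  assume r: "bij \<sigma> \<and> field_hom_on UNIV \<sigma> \<and> (\<forall>c. \<sigma> (ac_const c) = ac_const c) \<and> \<sigma> s = s"
  have "field_hom_on UNIV (id :: 'a func_ac \<Rightarrow> _)" by (simp add: field_hom_on_def)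
  then have "subfield_on {c. \<sigma> c = id c}" using r subfield_equalizer by blast
  then have "adjoin s \<subseteq> {c. \<sigma> c = id c}" by (rule adjoin_least) (use r in auto)
  then show "\<sigma> \<in> autos (adjoin s)" using r by (auto simp: autos_def)
qed

lemma autos_adjoin_fiber:
  assumes \<sigma>: "\<sigma> \<in> autos (adjoin s)" and x: "x \<in> rf_fiber \<phi> s"
  shows "\<sigma> x \<in> rf_fiber \<phi> s"
  using hom_rf_fiber[of \<sigma> x \<phi> s] \<sigma> x unfolding autos_adjoin_iff by simp

lemma autos_split_field_mem:
  assumes \<sigma>: "\<sigma> \<in> autos (adjoin s)" and c: "c \<in> split_field \<phi> s"
  shows "\<sigma> c \<in> split_field \<phi> s"
proof -
  have "split_field \<phi> s \<subseteq> {c. \<sigma> c \<in> split_field \<phi> s}"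
  proof (rule split_field_least[OF subfield_vimage_hom[OF autosD(2)[OF \<sigma>] split_field_subfield]])
    show "adjoin s \<subseteq> {c. \<sigma> c \<in> split_field \<phi> s}" using split_field_incl(1)[of s \<phi>] autosD(3)[OF \<sigma>] by auto
    show "rf_fiber \<phi> s \<subseteq> {c. \<sigma> c \<in> split_field \<phi> s}" using split_field_incl(2) autos_adjoin_fiber[OF \<sigma>] by blast
  qed
  then show ?thesis using c by blast
qed

lemma autos_agree:
  assumes \<sigma>: "\<sigma> \<in> autos (adjoin s)" and \<tau>: "\<tau> \<in> autos (adjoin s)"
    and eq: "\<forall>x\<in>rf_fiber \<phi> s. \<sigma> x = \<tau> x" and c: "c \<in> split_field \<phi> s"
  shows "\<sigma> c = \<tau> c"
proof -
  have "split_field \<phi> s \<subseteq> {c. \<sigma> c = \<tau> c}"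
    using autosD(3)[OF \<sigma>] autosD(3)[OF \<tau>] eq
    by (intro split_field_least subfield_equalizer autosD(2)[OF \<sigma>] autosD(2)[OF \<tau>]) auto
  then show ?thesis using c by blast
qed

lemma autos_restrict_Bij:
  assumes \<sigma>: "\<sigma> \<in> autos (adjoin s)"
  shows "restrict \<sigma> (split_field \<phi> s) \<in> Bij (split_field \<phi> s)"
proof -
  interpret perm_group "autos (adjoin s)" by (rule autos_group)
  have "bij_betw \<sigma> (split_field \<phi> s) (split_field \<phi> s)"
    by (rule bij_betw_byWitness[of _ "finv \<sigma>"])
      (use \<sigma> autos_split_field_mem[OF \<sigma>] autos_split_field_mem[OF finv_mem[OF \<sigma>]] in auto)
  then show ?thesis by (simp add: Bij_def bij_betw_restrict_eq)
qed

lemma cl_ring_carrier_update: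
  "carrier (cl_ring\<lparr>carrier := L\<rparr>) = L" "monoid.mult (cl_ring\<lparr>carrier := L\<rparr>) = (*)"
  "add (cl_ring\<lparr>carrier := L\<rparr>) = (+)" "one (cl_ring\<lparr>carrier := L\<rparr>) = 1"
  by (simp_all add: ring_of_type_algebra_def)

lemma monodromy_carrier:
  "carrier (monodromy_group \<phi> s) = {\<sigma> \<in> Bij (split_field \<phi> s). field_hom_on (split_field \<phi> s) \<sigma> \<and> (\<forall>a\<in>adjoin s. \<sigma> a = a)}"
proof -
  have "\<sigma> \<in> ring_hom (cl_ring\<lparr>carrier := L\<rparr>) (cl_ring\<lparr>carrier := L\<rparr>) \<longleftrightarrow> field_hom_on L \<sigma>" if "\<sigma> \<in> Bij L" for \<sigma> and L :: "'a func_ac set"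
    using Bij_imp_funcset[OF that] by (auto simp: ring_hom_def cl_ring_carrier_update field_hom_on_def)
  then show ?thesis by (auto simp: monodromy_group_def galois_group_def)
qed

lemma monodromy_mult:
  "\<lbrakk>\<sigma> \<in> Bij (split_field \<phi> s); \<tau> \<in> Bij (split_field \<phi> s)\<rbrakk> \<Longrightarrow> \<sigma> \<otimes>\<^bsub>monodromy_group \<phi> s\<^esub> \<tau> = compose (split_field \<phi> s) \<sigma> \<tau>"
  by (simp add: monodromy_group_def galois_group_def BijGroup_def)

lemma monodromy_one: "\<one>\<^bsub>monodromy_group \<phi> s\<^esub> = restrict id (split_field \<phi> s)"
  by (simp add: monodromy_group_def galois_group_def BijGroup_def id_def)

lemma restrict_in_monodromy:
  assumes \<sigma>: "\<sigma> \<in> autos (adjoin s)"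
  shows "restrict \<sigma> (split_field \<phi> s) \<in> carrier (monodromy_group \<phi> s)"
proof -
  have "field_hom_on (split_field \<phi> s) (restrict \<sigma> (split_field \<phi> s))"
    using autosD(2)[OF \<sigma>] subfield_onD[OF split_field_subfield[of \<phi> s]] by (simp add: field_hom_on_def)
  moreover have "restrict \<sigma> (split_field \<phi> s) a = a" if "a \<in> adjoin s" for a
    using that split_field_incl(1)[of s \<phi>] autosD(3)[OF \<sigma>] by auto
  ultimately show ?thesis using autos_restrict_Bij[OF \<sigma>] by (simp add: monodromy_carrier)
qed

lemma restrict_mult:
  assumes \<sigma>: "\<sigma> \<in> autos (adjoin s)" and \<tau>: "\<tau> \<in> autos (adjoin s)"
  shows "restrict \<sigma> (split_field \<phi> s) \<otimes>\<^bsub>monodromy_group \<phi> s\<^esub> restrict \<tau> (split_field \<phi> s) = restrict (\<sigma> \<circ> \<tau>) (split_field \<phi> s)"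
  using autos_split_field_mem[OF \<tau>]
  by (auto simp: monodromy_mult[OF autos_restrict_Bij[OF \<sigma>] autos_restrict_Bij[OF \<tau>]] compose_def fun_eq_iff)

text \<open>Partial automorphisms extend to the algebraic closure. In this way statements on the
  record groups become statements on automorphisms of the whole closure.\<close>

lemma monodromy_lift:
  fixes s :: "'k::field_char_0 func_ac"
  assumes t: "ac_t \<in> adjoin s" and \<tau>: "\<tau> \<in> carrier (monodromy_group \<phi> s)"
  obtains \<sigma> where "\<sigma> \<in> autos (adjoin s)" "\<tau> = restrict \<sigma> (split_field \<phi> s)"
proof -
  interpret T: galois_closure "range (to_ac :: 'k poly fract \<Rightarrow> _)" by (rule galois_closure_to_ac)
  have "range to_ac \<subseteq> adjoin s"
    unfolding adjoin_ac_t[symmetric] by (rule adjoin_least[OF adjoin_subfield t]) (auto simp: adjoin_const)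
  then interpret galois_closure "adjoin s" by (rule T.extend_over[OF adjoin_subfield])
  define L where "L = split_field \<phi> s"
  have L: "subfield_on L" by (simp add: L_def split_field_subfield)
  have \<tau>': "\<tau> \<in> extensional L" "field_hom_on L \<tau>" "\<forall>a\<in>adjoin s. \<tau> a = a"
    using \<tau> by (auto simp: monodromy_carrier L_def Bij_def)
  have R: "ring_rel {(c, \<tau> c) | c. c \<in> L}"
    by (rule ring_relI) (use field_hom_on_props[OF L \<tau>'(2)] subfield_onD[OF L] in auto)
  obtain \<sigma> where \<sigma>: "\<sigma> \<in> autos (adjoin s)" "\<And>x u. (x, u) \<in> {(c, \<tau> c) | c. c \<in> L} \<Longrightarrow> \<sigma> x = u"
    by (rule extend_auto[OF R]) (use \<tau>'(3) split_field_incl(1)[of s \<phi>] in \<open>auto simp: L_def\<close>)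
  have "\<tau> = restrict \<sigma> L" using \<tau>'(1) \<sigma>(2) by (intro extensionalityI[of _ L]) auto
  then show ?thesis using \<sigma>(1) by (intro that[of \<sigma>]) (simp_all add: L_def)
qed

lemma monodromy_group_is_group:
  fixes s :: "'k::field_char_0 func_ac"
  assumes t: "ac_t \<in> adjoin s"
  shows "group (monodromy_group \<phi> s)"
proof (rule groupI)
  interpret perm_group "autos (adjoin s)" by (rule autos_group)
  let ?L = "split_field \<phi> s"
  fix a assume "a \<in> carrier (monodromy_group \<phi> s)"
  then obtain \<sigma> where \<sigma>: "\<sigma> \<in> autos (adjoin s)" "a = restrict \<sigma> ?L" by (rule monodromy_lift[OF t])
  have e: "\<one>\<^bsub>monodromy_group \<phi> s\<^esub> = restrict id ?L" by (rule monodromy_one)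
  show "\<one>\<^bsub>monodromy_group \<phi> s\<^esub> \<otimes>\<^bsub>monodromy_group \<phi> s\<^esub> a = a"
    unfolding e \<sigma>(2) restrict_mult[OF id_mem \<sigma>(1)] by simp
  have "finv \<sigma> \<circ> \<sigma> = id" using finv_left[OF \<sigma>(1)] by auto
  then have "restrict (finv \<sigma>) ?L \<otimes>\<^bsub>monodromy_group \<phi> s\<^esub> a = \<one>\<^bsub>monodromy_group \<phi> s\<^esub>"
    unfolding e \<sigma>(2) restrict_mult[OF finv_mem[OF \<sigma>(1)] \<sigma>(1)] by simp
  then show "\<exists>y\<in>carrier (monodromy_group \<phi> s). y \<otimes>\<^bsub>monodromy_group \<phi> s\<^esub> a = \<one>\<^bsub>monodromy_group \<phi> s\<^esub>"
    using restrict_in_monodromy[OF finv_mem[OF \<sigma>(1)]] by blast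
  fix b assume "b \<in> carrier (monodromy_group \<phi> s)"
  then obtain \<tau> where \<tau>: "\<tau> \<in> autos (adjoin s)" "b = restrict \<tau> ?L" by (rule monodromy_lift[OF t])
  show "a \<otimes>\<^bsub>monodromy_group \<phi> s\<^esub> b \<in> carrier (monodromy_group \<phi> s)"
    unfolding \<sigma>(2) \<tau>(2) restrict_mult[OF \<sigma>(1) \<tau>(1)] by (rule restrict_in_monodromy[OF comp_mem[OF \<sigma>(1) \<tau>(1)]])
  fix c assume "c \<in> carrier (monodromy_group \<phi> s)"
  then obtain \<rho> where \<rho>: "\<rho> \<in> autos (adjoin s)" "c = restrict \<rho> ?L" by (rule monodromy_lift[OF t])
  show "a \<otimes>\<^bsub>monodromy_group \<phi> s\<^esub> b \<otimes>\<^bsub>monodromy_group \<phi> s\<^esub> c = a \<otimes>\<^bsub>monodromy_group \<phi> s\<^esub> (b \<otimes>\<^bsub>monodromy_group \<phi> s\<^esub> c)"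
    unfolding \<sigma>(2) \<tau>(2) \<rho>(2)
    by (simp add: restrict_mult \<sigma> \<tau> \<rho> comp_mem comp_assoc)
next
  interpret perm_group "autos (adjoin s)" by (rule autos_group)
  show "\<one>\<^bsub>monodromy_group \<phi> s\<^esub> \<in> carrier (monodromy_group \<phi> s)"
    unfolding monodromy_one by (rule restrict_in_monodromy[OF id_mem])
qed

text \<open>z is transcendental over k and the closure is algebraic over k(z), so the isomorphism t
  -> z over k extends to an automorphism of the closure. It carries the fibre of f_r over t to the
  fibre over z.\<close>

lemma transport_to_point:
  fixes z :: "'k::field_char_0 func_ac"
  assumes tr: "\<And>p. p \<noteq> 0 \<Longrightarrow> poly (map_poly ac_const p) z \<noteq> 0" and t: "ac_t \<in> adjoin z"
  obtains \<psi> where "bij \<psi>" "field_hom_on UNIV \<psi>" "\<And>c. \<psi> (ac_const c) = ac_const c" "\<psi> ac_t = z"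
proof -
  interpret T: galois_closure "range (to_ac :: 'k poly fract \<Rightarrow> _)" by (rule galois_closure_to_ac)
  have sub: "range to_ac \<subseteq> adjoin z"
    unfolding adjoin_ac_t[symmetric] by (rule adjoin_least[OF adjoin_subfield t]) (auto simp: adjoin_const)
  obtain \<iota> where \<iota>: "field_hom_on UNIV \<iota>" "\<And>p. \<iota> (to_fract p) = poly (map_poly ac_const p) z"
    using fract_hom[OF hom_ac_const tr] by blast
  obtain \<psi> where \<psi>: "field_hom_on UNIV \<psi>" "\<And>u. \<psi> (to_ac u) = \<iota> u" using alg_closure_hom_extend[OF \<iota>(1)] by blast
  have c: "\<psi> (ac_const c) = ac_const c" for c by (simp add: ac_const_def[of c] \<psi> \<iota> map_poly_pCons)
  have z: "\<psi> ac_t = z" by (simp add: ac_t_def \<psi> \<iota> map_poly_pCons)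
  have S: "subfield_on (\<psi> ` range to_ac)"
    using subfield_on_range_hom[OF hom_comp[OF \<psi>(1) hom_to_ac]] by (simp add: image_comp)
  have "adjoin z \<subseteq> \<psi> ` range to_ac"
  proof (rule adjoin_least[OF S])
    show "z \<in> \<psi> ` range to_ac" using z unfolding ac_t_def by blast
    show "range ac_const \<subseteq> \<psi> ` range to_ac" 
    proof (rule image_subsetI)
      fix a :: 'k
      have "ac_const a = \<psi> (to_ac (to_fract [:a:]))" using c[of a] by (simp only: ac_const_def)
      then show "ac_const a \<in> \<psi> ` range to_ac" by (rule image_eqI) (rule rangeI)
    qed
  qed
  then have "algebraic_over (\<psi> ` range to_ac) a" for a
    using T.alg[of a] sub by (metis algebraic_over_mono)
  then have "bij \<psi>" by (rule hom_bij_if_algebraic[OF \<psi>(1)])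
  then show ?thesis using \<psi>(1) c z by (rule that)
qed

section \<open>Solvability and the kernel\<close>

text \<open>The record form of a permutation group gives access to derived series and
  solvability.\<close>

definition comp_group :: "('a \<Rightarrow> 'a) set \<Rightarrow> ('a \<Rightarrow> 'a) monoid" where
  "comp_group G = \<lparr>carrier = G, monoid.mult = (\<circ>), one = id\<rparr>"

lemma comp_group_simps [simp]:
  "carrier (comp_group G) = G" "monoid.mult (comp_group G) = (\<circ>)" "one (comp_group G) = id"
  "(comp_group G)\<lparr>carrier := K\<rparr> = comp_group K"
  by (simp_all add: comp_group_def)

lemma (in perm_group) comp_group: "group (comp_group G)"
proof (rule groupI)
  fix g assume "g \<in> carrier (comp_group G)"
  then have g: "g \<in> G" by simp
  have "finv g \<circ> g = id" using finv_left[OF g] by auto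
  then show "\<exists>h\<in>carrier (comp_group G). h \<otimes>\<^bsub>comp_group G\<^esub> g = \<one>\<^bsub>comp_group G\<^esub>" using finv_mem[OF g] by auto
qed (auto simp: id_mem comp_mem comp_assoc)

lemma (in perm_group) comp_group_inv: "g \<in> G \<Longrightarrow> inv\<^bsub>comp_group G\<^esub> g = finv g"
  by (rule group.inv_equality[OF comp_group]) (auto simp: finv_mem)

text \<open>The last member of the derived series of \<open>K\<close> that acts nontrivially on \<open>A\<close>.\<close>

lemma abelian_normal_of_solvable:
  fixes M :: "('b, 'c) monoid_scheme"
  assumes G: "perm_group G" and K: "perm_group K" "K \<subseteq> G" "\<And>g k. \<lbrakk>g \<in> G; k \<in> K\<rbrakk> \<Longrightarrow> g \<circ> k \<circ> finv g \<in> K"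
    and A: "\<And>g a. \<lbrakk>g \<in> G; a \<in> A\<rbrakk> \<Longrightarrow> g a \<in> A"
    and M: "group M" "solvable M"
    and T: "\<And>a. a \<in> A \<Longrightarrow> \<exists>T\<in>hom (comp_group K) M. \<forall>k\<in>K. T k = \<one>\<^bsub>M\<^esub> \<longrightarrow> k a = a"
    and nontriv: "\<exists>k\<in>K. \<exists>a\<in>A. k a \<noteq> a"
  shows "\<exists>N. perm_group N \<and> N \<subseteq> K \<and> (\<forall>g\<in>G. \<forall>n\<in>N. g \<circ> n \<circ> finv g \<in> N) \<and>
    (\<exists>n\<in>N. \<exists>a\<in>A. n a \<noteq> a) \<and> (\<forall>n\<in>N. \<forall>m\<in>N. \<forall>a\<in>A. n (m a) = m (n a))"
proof -
  interpret G: perm_group G by fact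
  interpret K: perm_group K by fact
  interpret M: group M by fact
  interpret Gr: group "comp_group G" by (rule G.comp_group)
  interpret Kr: group "comp_group K" by (rule K.comp_group)
  define D where "D n = (derived (comp_group G) ^^ n) K" for n
  have KG: "k \<in> G" if "k \<in> K" for k using that K(2) by blast
  have Ksub: "subgroup K (comp_group G)"
    by (rule Gr.subgroupI) (use K(2) K.id_mem K.comp_mem K.finv_mem G.comp_group_inv KG in auto)
  have Knorm: "K \<lhd> comp_group G"
    unfolding Gr.normal_inv_iff using Ksub K(3) G.comp_group_inv by simp
  have Dn: "D n \<lhd> comp_group G" for n
    by (induction n) (simp_all add: D_def Knorm Gr.derived_is_normal)
  then have Dsub: "subgroup (D n) (comp_group G)" for n by (simp add: Gr.normal_inv_iff)
  have DK: "D n \<subseteq> K" for n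
  proof (induction n)
    case (Suc n)
    then show ?case using Gr.derived_incl[OF _ Ksub] by (simp add: D_def)
  qed (simp add: D_def)
  have cons: "(derived (comp_group K) ^^ n) K = D n" for n
  proof (induction n)
    case (Suc n)
    have "derived (comp_group K) (D n) = derived (comp_group G) (D n)"
      using Gr.derived_consistent[OF DK Ksub, of n] by simp
    then show ?case using Suc by (simp add: D_def)
  qed (simp add: D_def)
  obtain m where m: "(derived M ^^ m) (carrier M) = {\<one>\<^bsub>M\<^esub>}"
    using M.solvable_iff_trivial_derived_seq M(2) by blast
  \<comment> \<open>For each point a there is a homomorphism to the solvable group M whose kernel
    fixes a. It kills the m-th derived subgroup, and m depends on M alone.\<close>
  have triv: "k a = a" if k: "k \<in> D m" and a: "a \<in> A" for k a
  proof -
    obtain T where T: "T \<in> hom (comp_group K) M" "\<forall>k\<in>K. T k = \<one>\<^bsub>M\<^esub> \<longrightarrow> k a = a" using T[OF a] by blast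
    interpret T: group_hom "comp_group K" M T by unfold_locales (rule T(1))
    have "T ` K \<subseteq> carrier M" using T(1) by (auto simp: hom_def)
    then have "(derived M ^^ m) (T ` K) \<subseteq> {\<one>\<^bsub>M\<^esub>}" using M.mono_exp_of_derived m by metis
    then have "T ` D m \<subseteq> {\<one>\<^bsub>M\<^esub>}" using T.exp_of_derived_img[of K m] by (simp add: cons)
    then show ?thesis using k T(2) DK by blast
  qed
  define i where "i = (LEAST i. \<forall>k\<in>D i. \<forall>a\<in>A. k a = a)"
  have i: "\<forall>k\<in>D i. \<forall>a\<in>A. k a = a" unfolding i_def by (rule LeastI[of _ m]) (use triv in blast)
  have "i \<noteq> 0" using i nontriv by (auto simp: D_def intro: ccontr)
  then obtain j where j: "i = Suc j" using not0_implies_Suc by blast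
  have "\<not> (\<forall>k\<in>D j. \<forall>a\<in>A. k a = a)" using not_less_Least[of j "\<lambda>i. \<forall>k\<in>D i. \<forall>a\<in>A. k a = a"] j by (simp add: i_def)
  then obtain n a where na: "n \<in> D j" "a \<in> A" "n a \<noteq> a" by blast
  show ?thesis
  proof (intro exI[of _ "D j"] conjI ballI)
    have mem: "id \<in> D j" "\<And>g h. \<lbrakk>g \<in> D j; h \<in> D j\<rbrakk> \<Longrightarrow> g \<circ> h \<in> D j" "\<And>g. g \<in> D j \<Longrightarrow> finv g \<in> D j"
      using subgroup.one_closed[OF Dsub[of j]] subgroup.m_closed[OF Dsub[of j]] subgroup.m_inv_closed[OF Dsub[of j]]
        G.comp_group_inv DK KG by (simp, simp, metis subsetD)
    show "perm_group (D j)" by (rule perm_groupI_finv[OF K(1) DK]) (rule mem, assumption?, assumption?)+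
    show "D j \<subseteq> K" by (rule DK)
    show "g \<circ> n \<circ> finv g \<in> D j" if "g \<in> G" "n \<in> D j" for g n
      using Dn[of j] that G.comp_group_inv unfolding Gr.normal_inv_iff by fastforce
    show "n (k a) = k (n a)" if n: "n \<in> D j" and k: "k \<in> D j" and a: "a \<in> A" for n k a
    proof -
      have nG: "n \<in> G" and kG: "k \<in> G" using n k DK KG by blast+
      have "n \<circ> k \<circ> finv n \<circ> finv k \<in> derived_set (comp_group G) (D j)"
        using n k G.comp_group_inv nG kG by (intro UN_I[of n] UN_I[of k]) auto
      then have "n \<circ> k \<circ> finv n \<circ> finv k \<in> D i"
        unfolding j D_def by (simp add: derived_def generate.incl flip: D_def)
      then have "(n \<circ> k \<circ> finv n \<circ> finv k) (k (n a)) = k (n a)" using i A nG kG a by blast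
      then show ?thesis using nG kG by simp
    qed
    show "\<exists>n\<in>D j. \<exists>a\<in>A. n a \<noteq> a" using na by blast
  qed
qed

lemma klein_four_iso:
  fixes G (structure)
  assumes G: "group G" and card: "card (carrier G) = 4" and sq: "\<And>a. a \<in> carrier G \<Longrightarrow> a \<otimes> a = \<one>"
  shows "G \<cong> integer_mod_group 2 \<times>\<times> integer_mod_group 2"
proof -
  interpret group G by fact
  have fin: "finite (carrier G)" using card by (intro card_ge_0_finite) simp
  have "\<not> carrier G \<subseteq> {\<one>}" using card card_mono[of "{\<one>}" "carrier G"] by auto
  then obtain a where a: "a \<in> carrier G" "a \<noteq> \<one>" by blast
  have "card {\<one>, a} \<le> 2" by (simp add: card_insert_if)
  then have "\<not> carrier G \<subseteq> {\<one>, a}" using card card_mono[of "{\<one>, a}" "carrier G"] by auto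
  then obtain b where b: "b \<in> carrier G" "b \<noteq> \<one>" "b \<noteq> a" by blast
  have comm: "u \<otimes> v = v \<otimes> u" if "u \<in> carrier G" "v \<in> carrier G" for u v
  proof -
    have "inv w = w" if "w \<in> carrier G" for w using inv_equality[OF sq[OF that] that that] .
    then show ?thesis using inv_mult_group[OF that] that by simp
  qed
  define F where "F = (\<lambda>(i :: int, j :: int). (if i = 0 then \<one> else a) \<otimes> (if j = 0 then \<one> else b) )"
  define S where "S = {0, 1 :: int} \<times> {0, 1 :: int}"
  have carr: "carrier (integer_mod_group 2 \<times>\<times> integer_mod_group 2) = S"
    by (auto simp: S_def carrier_integer_mod_group)
  have ab: "a \<otimes> b \<in> carrier G" "a \<otimes> b \<noteq> \<one>" "a \<otimes> b \<noteq> a" "a \<otimes> b \<noteq> b"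
  proof -
    show "a \<otimes> b \<in> carrier G" using a b by simp
    show "a \<otimes> b \<noteq> a" "a \<otimes> b \<noteq> b" using a b l_cancel_one r_cancel_one by auto
    show "a \<otimes> b \<noteq> \<one>" using a b sq[OF a(1)] by (metis l_cancel)
  qed
  have inj: "inj_on F S" using a b ab by (auto simp: inj_on_def F_def S_def)
  have FS: "F ` S \<subseteq> carrier G" using a b ab by (auto simp: F_def S_def)
  have "card (F ` S) = 4" by (simp add: card_image[OF inj]) (simp add: S_def)
  then have img: "F ` S = carrier G" using card_subset_eq[OF fin FS] card by simp
  have aab: "a \<otimes> (a \<otimes> b) = b" using a b sq[OF a(1)] by (metis m_assoc l_one)
  have "F (u \<otimes>\<^bsub>integer_mod_group 2 \<times>\<times> integer_mod_group 2\<^esub> v) = F u \<otimes> F v" if "u \<in> S" "v \<in> S" for u v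
  proof -
    have r: "(a \<otimes> b) \<otimes> (a \<otimes> b) = \<one>" "b \<otimes> a = a \<otimes> b" "(a \<otimes> b) \<otimes> a = b" "(a \<otimes> b) \<otimes> b = a" "b \<otimes> (a \<otimes> b) = a"
    proof -
      show "(a \<otimes> b) \<otimes> (a \<otimes> b) = \<one>" using sq ab(1) by blast
      show c: "b \<otimes> a = a \<otimes> b" using comm a b by blast
      show "(a \<otimes> b) \<otimes> a = b" using comm[OF ab(1) a(1)] aab by simp
      show d: "(a \<otimes> b) \<otimes> b = a" using a b sq[OF b(1)] by (simp add: m_assoc)
      show "b \<otimes> (a \<otimes> b) = a" using comm[OF b(1) ab(1)] d by simp
    qed
    show ?thesis using that a b sq r aab ab by (auto simp: S_def F_def mult_integer_mod_group)
  qed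
  then have "F \<in> iso (integer_mod_group 2 \<times>\<times> integer_mod_group 2) G"
    using inj img FS unfolding iso_def hom_def bij_betw_def carr by auto
  then have "integer_mod_group 2 \<times>\<times> integer_mod_group 2 \<cong> G" by (rule is_isoI)
  then show ?thesis by (rule group.iso_sym[OF DirProd_group[OF group_integer_mod_group group_integer_mod_group]])
qed

section \<open>Fibres and kernel of a polynomial composition\<close>

lemma rf_fiber_poly: "rf_fiber (to_fract p) s = {x. poly (map_poly ac_const p) x = s}"
  by (simp add: rf_fiber_def map_poly_1')

lemma poly_const_pcompose:
  "poly (map_poly ac_const (p \<circ>\<^sub>p q)) x = poly (map_poly ac_const p) (poly (map_poly ac_const q) x)"
  by (induction p) (simp_all add: pcompose_pCons map_poly_pCons map_poly_hom_UNIV[OF hom_ac_const])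

text \<open>If a were algebraic over k, it would lie in a copy of the algebraic closure of k. So
  would t = p(a), which would then be a root of a nonzero polynomial over k.\<close>

lemma transcendental_of_value:
  fixes a :: "'k::field_char_0 func_ac"
  assumes a: "poly (map_poly ac_const p) a = ac_t" and q: "q \<noteq> 0"
  shows "poly (map_poly ac_const q) a \<noteq> 0"
proof
  assume q0: "poly (map_poly ac_const q) a = 0"
  obtain \<psi> :: "'k alg_closure \<Rightarrow> 'k func_ac" where \<psi>: "field_hom_on UNIV \<psi>" "\<And>u. \<psi> (to_ac u) = ac_const u"
    using alg_closure_hom_extend[OF hom_ac_const] by blast
  interpret galois_closure "range (to_ac :: 'k \<Rightarrow> _)" by (rule galois_closure_to_ac)
  have \<psi>0: "\<psi> 0 = 0" by (rule field_hom_on_props(2)[OF subfield_on_UNIV \<psi>(1)])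
  have mp: "map_poly \<psi> (map_poly to_ac r) = map_poly ac_const r" for r
    by (rule poly_eqI) (simp add: coeff_map_poly \<psi>(2) \<psi>0)
  have ev: "poly (map_poly ac_const r) (\<psi> b) = \<psi> (poly (map_poly to_ac r) b)" for r b
    using map_poly_hom_UNIV(3)[OF \<psi>(1), of "map_poly to_ac r" b] by (simp add: mp)
  have "map_poly to_ac q \<noteq> 0" using q by (simp add: map_poly_hom_UNIV(4)[OF hom_to_ac])
  then have "a \<in> range \<psi>" using root_in_range_hom[OF \<psi>(1), of "map_poly to_ac q" a] q0 by (simp add: mp)
  then obtain b where b: "a = \<psi> b" by blast
  define c where "c = poly (map_poly to_ac p) b"
  have t: "ac_t = \<psi> c" using a by (simp add: b ev c_def)
  obtain r where r: "r \<in> polys_over (range to_ac)" "r \<noteq> 0" "poly r c = 0" using alg[of c] by (auto simp: algebraic_over_def)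
  define r' where "r' = map_poly (inv_into UNIV to_ac) r"
  have injac: "inj (to_ac :: 'k \<Rightarrow> _)" by (rule hom_UNIV_inj[OF hom_to_ac])
  have ac0: "inv_into UNIV to_ac 0 = (0 :: 'k)" using inv_f_f[OF injac, of 0] by simp
  have rr': "r = map_poly to_ac r'"
  proof (rule poly_eqI)
    fix i
    obtain u where "Polynomial.coeff r i = to_ac u" using r(1) unfolding polys_over_def by blast
    then show "Polynomial.coeff r i = Polynomial.coeff (map_poly to_ac r') i"
      by (simp add: r'_def coeff_map_poly ac0 inv_f_f[OF injac])
  qed
  have "poly (map_poly ac_const r') ac_t = 0" using r(3) \<psi>0 by (simp add: t ev flip: rr')
  then have "to_ac (to_fract r') = 0" by (simp only: to_ac_poly)
  then have "r' = 0" by simp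
  then show False using r(2) rr' by simp
qed

lemma poly_pole_unique: "rf_P1 (to_fract p) P = None \<Longrightarrow> P = None"
  by (cases P) (simp_all add: rf_P1_def map_poly_1' Let_def)

lemma finite_rf_poles: "finite {P. rf_P1 g P = None}"
proof -
  define q where "q = map_poly to_ac (rf_den g)"
  have "rf_den g \<noteq> 0" using rf_num_den(3)[of g] by auto
  then have "q \<noteq> 0" by (simp add: q_def map_poly_hom_UNIV(4)[OF hom_to_ac])
  have "{P. rf_P1 g P = None} \<subseteq> insert None (Some ` {a. poly q a = 0})"
  proof
    fix P assume "P \<in> {P. rf_P1 g P = None}"
    then show "P \<in> insert None (Some ` {a. poly q a = 0})"
      by (cases P) (auto simp: rf_P1_def Let_def q_def split: if_splits)
  qed
  then show ?thesis using poly_roots_finite[OF \<open>q \<noteq> 0\<close>] by (meson finite.insertI finite_imageI finite_subset)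
qed

lemma poly_const_root_ex:
  fixes fr :: "'k::field_char_0 poly"
  assumes "Polynomial.degree fr > 0"
  shows "\<exists>a. poly (map_poly ac_const fr) a = z"
proof -
  have "Polynomial.degree (map_poly ac_const fr - [:z:]) = Polynomial.degree fr"
    using assms by (subst diff_conv_add_uminus, subst degree_add_eq_left)
      (simp_all add: map_poly_hom_UNIV(5)[OF hom_ac_const])
  then obtain a where "poly (map_poly ac_const fr - [:z:]) a = 0" using assms alg_closed_imp_poly_has_root by metis
  then show ?thesis by (intro exI[of _ a]) simp
qed

lemma fiber_card_transport:
  fixes z :: "'k::field_char_0 func_ac"
  assumes tr: "\<And>p. p \<noteq> 0 \<Longrightarrow> poly (map_poly ac_const p) z \<noteq> 0" and t: "ac_t \<in> adjoin z"
  shows "card (rf_fiber \<phi> z) = card (rf_fiber \<phi> ac_t)"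
proof -
  obtain \<psi> where \<psi>: "bij \<psi>" "field_hom_on UNIV \<psi>" "\<And>c. \<psi> (ac_const c) = ac_const c" "\<psi> ac_t = z"
    by (rule transport_to_point[OF tr t], assumption) (rule that)
  have inv: "finv \<psi> (\<psi> c) = c" "\<psi> (finv \<psi> c) = c" for c
    using \<psi>(1) by (simp_all add: bij_is_inj bij_is_surj surj_f_inv_f)
  have ic: "finv \<psi> (ac_const c) = ac_const c" for c using inv(1)[of "ac_const c"] \<psi>(3) by simp
  have iz: "finv \<psi> z = ac_t" using inv(1)[of ac_t] \<psi>(4) by simp
  have "bij_betw \<psi> (rf_fiber \<phi> ac_t) (rf_fiber \<phi> z)"
    by (rule bij_betw_byWitness[of _ "finv \<psi>"])
      (use inv hom_rf_fiber[OF \<psi>(2,3), of _ \<phi> ac_t] hom_rf_fiber[OF hom_inv[OF \<psi>(1,2)] ic, of _ \<phi> z] \<psi>(4) iz in auto)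
  then show ?thesis by (simp add: bij_betw_same_card)
qed

text \<open>Conjugation by the automorphism with t -> z moves the action on the fibre over z to the
  fibre over t. The solvability hypothesis, stated over t, thus becomes available on every
  block.\<close>

lemma kernel_hom_to_monodromy:
  fixes z :: "'k::field_char_0 func_ac"
  assumes tr: "\<And>p. p \<noteq> 0 \<Longrightarrow> poly (map_poly ac_const p) z \<noteq> 0" and t: "ac_t \<in> adjoin z"
    and K: "K \<subseteq> autos (adjoin z)" and a: "a \<in> rf_fiber \<phi> z"
  shows "\<exists>T\<in>hom (comp_group K) (Mon \<phi>). \<forall>k\<in>K. T k = \<one>\<^bsub>Mon \<phi>\<^esub> \<longrightarrow> k a = a"
proof -
  obtain \<psi> where \<psi>: "bij \<psi>" "field_hom_on UNIV \<psi>" "\<And>c. \<psi> (ac_const c) = ac_const c" "\<psi> ac_t = z"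
    by (rule transport_to_point[OF tr t], assumption) (rule that)
  have inv: "finv \<psi> (\<psi> c) = c" "\<psi> (finv \<psi> c) = c" for c
    using \<psi>(1) by (simp_all add: bij_is_inj bij_is_surj surj_f_inv_f)
  have ic: "finv \<psi> (ac_const c) = ac_const c" for c using inv(1)[of "ac_const c"] \<psi>(3) by simp
  have iz: "finv \<psi> z = ac_t" using inv(1)[of ac_t] \<psi>(4) by simp
  define L where "L = split_field \<phi> ac_t"
  define T where "T k = restrict (finv \<psi> \<circ> k \<circ> \<psi>) L" for k
  have mem: "finv \<psi> \<circ> k \<circ> \<psi> \<in> autos (adjoin ac_t)" if k: "k \<in> K" for k
  proof -
    have kz: "k \<in> autos (adjoin z)" using k K by blast
    then have "bij k" "field_hom_on UNIV k" "\<forall>c. k (ac_const c) = ac_const c" "k z = z"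
      unfolding autos_adjoin_iff by blast+
    then show ?thesis unfolding autos_adjoin_iff
      using \<psi> iz ic hom_comp[OF hom_comp[OF hom_inv[OF \<psi>(1,2)]] \<psi>(2), of k] bij_imp_bij_inv[OF \<psi>(1)]
      by (simp add: bij_comp)
  qed
  have "T \<in> hom (comp_group K) (Mon \<phi>)"
  proof (rule homI)
    show "T k \<in> carrier (Mon \<phi>)" if "k \<in> carrier (comp_group K)" for k
      using restrict_in_monodromy[OF mem] that by (simp add: T_def L_def)
    show "T (k \<otimes>\<^bsub>comp_group K\<^esub> l) = T k \<otimes>\<^bsub>Mon \<phi>\<^esub> T l" if kl: "k \<in> carrier (comp_group K)" "l \<in> carrier (comp_group K)" for k l
    proof -
      have "(finv \<psi> \<circ> k \<circ> \<psi>) \<circ> (finv \<psi> \<circ> l \<circ> \<psi>) = finv \<psi> \<circ> (k \<circ> l) \<circ> \<psi>" by (simp add: fun_eq_iff inv)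
      then show ?thesis using restrict_mult[OF mem mem, of k l \<phi>] kl by (simp add: T_def L_def)
    qed
  qed
  moreover have "k a = a" if k: "k \<in> K" "T k = \<one>\<^bsub>Mon \<phi>\<^esub>" for k
  proof -
    have "finv \<psi> a \<in> L" using hom_rf_fiber[OF hom_inv[OF \<psi>(1,2)] ic a] split_field_incl(2)[of \<phi> ac_t] iz by (auto simp: L_def)
    then have "finv \<psi> (k (\<psi> (finv \<psi> a))) = finv \<psi> a"
      using k(2) unfolding T_def monodromy_one by (metis L_def comp_apply id_apply restrict_apply')
    then have "finv \<psi> (k a) = finv \<psi> a" by (simp only: inv)
    then show ?thesis using inv(2) by metis
  qed
  ultimately show ?thesis by blast
qed

locale poly_composition =
  fixes f h fr :: "'k::field_char_0 poly"
  assumes comp: "f = h \<circ>\<^sub>p fr" and deg_fr: "Polynomial.degree fr > 0"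
begin

definition A where "A = rf_fiber (to_fract f) ac_t"
definition Z where "Z = rf_fiber (to_fract h) ac_t"
definition pr where "pr a = poly (map_poly ac_const fr) a"
text \<open>The preimage in \<open>GalT\<close> of the kernel K of the theorem; K itself arises by
  restriction to the splitting field of f(X) - t, see \<open>mon_kernel_eq\<close>.\<close>

definition Ker where "Ker = {g \<in> GalT. \<forall>a\<in>A. g (pr a) = pr a}"

lemma A_iff: "a \<in> A \<longleftrightarrow> poly (map_poly ac_const h) (pr a) = ac_t"
  unfolding A_def rf_fiber_poly pr_def by (simp add: comp poly_const_pcompose)

lemma Z_iff: "z \<in> Z \<longleftrightarrow> poly (map_poly ac_const h) z = ac_t"
  by (simp add: Z_def rf_fiber_poly)

lemma pr_Z: "a \<in> A \<Longrightarrow> pr a \<in> Z" by (simp add: A_iff Z_iff)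

lemma Z_lift:
  assumes "z \<in> Z"
  obtains a where "a \<in> A" "pr a = z"
  using poly_const_root_ex[OF deg_fr, of z] assms by (auto simp: A_iff Z_iff pr_def)

lemma fiber_eq: "z \<in> Z \<Longrightarrow> rf_fiber (to_fract fr) z = {a \<in> A. pr a = z}"
  by (auto simp: rf_fiber_poly A_iff Z_iff pr_def)

lemma Z_transcendental: "\<lbrakk>z \<in> Z; p \<noteq> 0\<rbrakk> \<Longrightarrow> poly (map_poly ac_const p) z \<noteq> 0"
  using transcendental_of_value[of h z p] by (simp add: Z_iff)

lemma A_transcendental: "\<lbrakk>a \<in> A; p \<noteq> 0\<rbrakk> \<Longrightarrow> poly (map_poly ac_const p) a \<noteq> 0"
  using transcendental_of_value[of f a p] by (simp add: A_def rf_fiber_poly)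

lemma Z_adjoin: "z \<in> Z \<Longrightarrow> ac_t \<in> adjoin z" unfolding Z_def by (rule fiber_value_in_adjoin)

lemma A_adjoin: "a \<in> A \<Longrightarrow> ac_t \<in> adjoin a" unfolding A_def by (rule fiber_value_in_adjoin)

lemma GalT_eq: "GalT = autos (adjoin (ac_t :: 'k func_ac))" by (simp add: adjoin_ac_t)

lemma GalT_A: "\<lbrakk>g \<in> GalT; a \<in> A\<rbrakk> \<Longrightarrow> g a \<in> A"
  using GalT_fiber[of g a "to_fract f" ac_t] by (simp add: A_def GalT_t)

lemma GalT_pr: "g \<in> GalT \<Longrightarrow> g (pr a) = pr (g a)"
  unfolding pr_def by (rule hom_poly_const[OF autosD(2) GalT_const])

lemma Ker_autos: "\<lbrakk>g \<in> Ker; z \<in> Z\<rbrakk> \<Longrightarrow> g \<in> autos (adjoin z)"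
  unfolding autos_adjoin_iff using autosD[of g] GalT_const[of g] by (auto simp: Ker_def elim!: Z_lift)

lemma Ker_group: "perm_group Ker"
proof (rule perm_groupI_finv[OF autos_group])
  interpret perm_group "GalT :: ('k func_ac \<Rightarrow> _) set" by (rule autos_group)
  show "Ker \<subseteq> GalT" by (auto simp: Ker_def)
  show "id \<in> Ker" by (simp add: Ker_def id_mem)
  show "g \<circ> k \<in> Ker" if "g \<in> Ker" "k \<in> Ker" for g k using that by (simp add: Ker_def comp_mem)
  show "finv g \<in> Ker" if g: "g \<in> Ker" for g
  proof -
    have gG: "g \<in> GalT" and gp: "\<forall>a\<in>A. g (pr a) = pr a" using g by (simp_all add: Ker_def)
    have "finv g (pr a) = pr a" if a: "a \<in> A" for a using finv_left[OF gG, of "pr a"] gp a by simp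
    then show ?thesis using finv_mem[OF gG] by (simp add: Ker_def)
  qed
qed

lemma pr_in_split: "a \<in> A \<Longrightarrow> adjoin (pr a) \<subseteq> split_field (to_fract f) ac_t"
proof -
  assume a: "a \<in> A"
  let ?L = "split_field (to_fract f) ac_t"
  have c: "range ac_const \<subseteq> ?L" using split_field_incl(1)[of ac_t "to_fract f"] adjoin_const by blast
  have "a \<in> ?L" using split_field_incl(2) a unfolding A_def by blast
  then have "adjoin a \<subseteq> ?L" using c by (intro adjoin_least split_field_subfield)
  then have "pr a \<in> ?L" unfolding pr_def using poly_const_adjoin by blast
  then show ?thesis using c by (intro adjoin_least split_field_subfield)
qed

lemma split_h_sub: "split_field (to_fract h) ac_t \<subseteq> split_field (to_fract f) ac_t"
proof (rule split_field_least[OF split_field_subfield split_field_incl(1)])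
  show "rf_fiber (to_fract h) ac_t \<subseteq> split_field (to_fract f) ac_t"
  proof
    fix z assume "z \<in> rf_fiber (to_fract h) ac_t"
    then obtain a where "a \<in> A" "pr a = z" using Z_lift[unfolded Z_def] by blast
    then show "z \<in> split_field (to_fract f) ac_t" using pr_in_split adjoin_self by blast
  qed
qed

lemma split_fr_sub:
  assumes z: "z \<in> Z"
  shows "split_field (to_fract fr) z \<subseteq> split_field (to_fract f) ac_t"
proof (rule split_field_least[OF split_field_subfield])
  show "adjoin z \<subseteq> split_field (to_fract f) ac_t" using Z_lift[OF z] pr_in_split by metis
  show "rf_fiber (to_fract fr) z \<subseteq> split_field (to_fract f) ac_t"
    unfolding fiber_eq[OF z] using split_field_incl(2)[of "to_fract f" ac_t] by (auto simp: A_def)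
qed

lemma mon_kernel_eq: "mon_kernel (to_fract f) (to_fract h) = (\<lambda>g. restrict g (split_field (to_fract f) ac_t)) ` Ker"
  (is "_ = (\<lambda>g. restrict g ?L) ` Ker")
proof
  let ?M = "split_field (to_fract h) ac_t"
  show "mon_kernel (to_fract f) (to_fract h) \<subseteq> (\<lambda>g. restrict g ?L) ` Ker"
  proof
    fix \<tau> assume "\<tau> \<in> mon_kernel (to_fract f) (to_fract h)"
    then have \<tau>: "\<tau> \<in> carrier (Mon (to_fract f))" "restrict \<tau> ?M = restrict id ?M"
      by (simp_all add: mon_kernel_def kernel_def monodromy_one)
    obtain g where g: "g \<in> autos (adjoin ac_t)" "\<tau> = restrict g ?L" by (rule monodromy_lift[OF adjoin_self \<tau>(1)])
    have "g (pr a) = pr a" if a: "a \<in> A" for a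
    proof -
      have m: "pr a \<in> ?M" using pr_Z[OF a] split_field_incl(2)[of "to_fract h" ac_t] by (auto simp: Z_def)
      then have "pr a \<in> ?L" using split_h_sub by blast
      then have "g (pr a) = restrict \<tau> ?M (pr a)" using m g(2) by simp
      also have "\<dots> = pr a" using \<tau>(2) m by simp
      finally show ?thesis .
    qed
    then have "g \<in> Ker" using g(1) by (simp add: Ker_def GalT_eq)
    then show "\<tau> \<in> (\<lambda>g. restrict g ?L) ` Ker" using g(2) by blast
  qed
  show "(\<lambda>g. restrict g ?L) ` Ker \<subseteq> mon_kernel (to_fract f) (to_fract h)"
  proof (rule image_subsetI)
    fix g assume g: "g \<in> Ker"
    then have gG: "g \<in> autos (adjoin ac_t)" by (simp add: Ker_def GalT_eq)
    have idG: "id \<in> autos (adjoin (ac_t :: 'k func_ac))" using perm_group.id_mem[OF autos_group] .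
    have "\<forall>z\<in>rf_fiber (to_fract h) ac_t. g z = id z"
    proof
      fix z assume "z \<in> rf_fiber (to_fract h) ac_t"
      then obtain a where "a \<in> A" "pr a = z" using Z_lift[unfolded Z_def] by blast
      then show "g z = id z" using g by (auto simp: Ker_def)
    qed
    then have "g c = c" if "c \<in> ?M" for c using autos_agree[OF gG idG _ that] by simp
    then have "restrict (restrict g ?L) ?M = restrict id ?M" using split_h_sub by (auto simp: fun_eq_iff)
    then show "restrict g ?L \<in> mon_kernel (to_fract f) (to_fract h)"
      using restrict_in_monodromy[OF gG] by (simp add: mon_kernel_def kernel_def monodromy_one)
  qed
qed

lemma Ker_restrict_mult:
  assumes "g \<in> Ker" "k \<in> Ker"
  shows "restrict g (split_field (to_fract f) ac_t) \<otimes>\<^bsub>Mon (to_fract f)\<^esub> restrict k (split_field (to_fract f) ac_t)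
    = restrict (g \<circ> k) (split_field (to_fract f) ac_t)"
  using assms by (intro restrict_mult) (simp_all add: Ker_def GalT_eq)

lemma Ker_agree:
  assumes "g \<in> Ker" "k \<in> Ker" "\<forall>a\<in>A. g a = k a"
  shows "restrict g (split_field (to_fract f) ac_t) = restrict k (split_field (to_fract f) ac_t)"
  using assms autos_agree[of g ac_t k "to_fract f"] by (auto simp: Ker_def GalT_eq A_def fun_eq_iff)

lemma block_embedding_restrict:
  assumes "z \<in> Z"
  shows "block_embedding (to_fract h) (to_fract fr) (restrict g (split_field (to_fract f) ac_t)) z
    = restrict g (split_field (to_fract fr) z)"
  using assms split_fr_sub[OF assms] by (auto simp: block_embedding_def Z_def fun_eq_iff)

text \<open>Equality of two coordinates reduces, by passing to a quotient in \<open>Ker\<close>, to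
  an element that is trivial on one block. Triviality on \<open>A\<close> then suffices, because the
  roots determine the restriction to the splitting field.\<close>

lemma diagonal_kernelI:
  assumes ne: "Z \<noteq> {}"
    and diag: "\<And>g z. \<lbrakk>g \<in> Ker; z \<in> Z; \<forall>a\<in>A. pr a = z \<longrightarrow> g a = a\<rbrakk> \<Longrightarrow> \<forall>a\<in>A. g a = a"
  shows "diagonal_kernel (to_fract f) (to_fract h) (to_fract fr)"
proof -
  interpret Ker: perm_group Ker by (rule Ker_group)
  let ?L = "split_field (to_fract f) ac_t"
  let ?b = "block_embedding (to_fract h) (to_fract fr)"
  let ?mk = "mon_kernel (to_fract f) (to_fract h)"
  have inj: "inj_on (\<lambda>\<tau>. ?b \<tau> z) ?mk" if z: "z \<in> Z" for z
  proof (rule inj_onI)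
    fix \<tau> \<tau>' assume "\<tau> \<in> ?mk" "\<tau>' \<in> ?mk" and eq: "?b \<tau> z = ?b \<tau>' z"
    then obtain g k where gk: "g \<in> Ker" "\<tau> = restrict g ?L" "k \<in> Ker" "\<tau>' = restrict k ?L" by (auto simp: mon_kernel_eq)
    have res: "restrict g (split_field (to_fract fr) z) = restrict k (split_field (to_fract fr) z)"
      using eq block_embedding_restrict[OF z] by (simp add: gk)
    have "\<forall>a\<in>A. pr a = z \<longrightarrow> (finv k \<circ> g) a = a"
    proof (intro ballI impI)
      fix a assume "a \<in> A" "pr a = z"
      then have "a \<in> split_field (to_fract fr) z" using fiber_eq[OF z] split_field_incl(2)[of "to_fract fr" z] by blast
      then have "g a = k a" using res by (metis restrict_apply')
      then show "(finv k \<circ> g) a = a" using gk(3) by simp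
    qed
    then have fx: "\<forall>a\<in>A. (finv k \<circ> g) a = a" by (rule diag[OF Ker.comp_mem[OF Ker.finv_mem[OF gk(3)] gk(1)] z])
    have "g a = k a" if "a \<in> A" for a
    proof -
      have "k (finv k (g a)) = k a" using fx that by simp
      then show ?thesis using gk(3) by simp
    qed
    then show "\<tau> = \<tau>'" unfolding gk(2,4) by (intro Ker_agree[OF gk(1,3)] ballI)
  qed
  have emb: "?b (restrict g ?L) = (\<lambda>z\<in>Z. restrict g (split_field (to_fract fr) z))" for g
  proof
    fix z show "?b (restrict g ?L) z = (\<lambda>z\<in>Z. restrict g (split_field (to_fract fr) z)) z"
      by (cases "z \<in> Z") (use block_embedding_restrict[of z g] in \<open>simp_all add: block_embedding_def Z_def\<close>)
  qed
  have "?b \<in> hom ((Mon (to_fract f))\<lparr>carrier := ?mk\<rparr>) (product_group Z (monodromy_group (to_fract fr)))"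
  proof (rule homI)
    fix \<tau> assume "\<tau> \<in> carrier ((Mon (to_fract f))\<lparr>carrier := ?mk\<rparr>)"
    then obtain g where g: "g \<in> Ker" "\<tau> = restrict g ?L" by (auto simp: mon_kernel_eq)
    show "?b \<tau> \<in> carrier (product_group Z (monodromy_group (to_fract fr)))"
      unfolding g(2) emb using restrict_in_monodromy[OF Ker_autos[OF g(1)]] by simp
    fix \<tau>' assume "\<tau>' \<in> carrier ((Mon (to_fract f))\<lparr>carrier := ?mk\<rparr>)"
    then obtain k where k: "k \<in> Ker" "\<tau>' = restrict k ?L" by (auto simp: mon_kernel_eq)
    have "?b (\<tau> \<otimes>\<^bsub>Mon (to_fract f)\<^esub> \<tau>') = (\<lambda>z\<in>Z. restrict (g \<circ> k) (split_field (to_fract fr) z))"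
      unfolding g(2) k(2) Ker_restrict_mult[OF g(1) k(1)] emb by (rule refl)
    also have "\<dots> = (\<lambda>z\<in>Z. restrict g (split_field (to_fract fr) z) \<otimes>\<^bsub>monodromy_group (to_fract fr) z\<^esub> restrict k (split_field (to_fract fr) z))"
      using restrict_mult[OF Ker_autos[OF g(1)] Ker_autos[OF k(1)]] by (intro restrict_ext) simp
    finally show "?b (\<tau> \<otimes>\<^bsub>(Mon (to_fract f))\<lparr>carrier := ?mk\<rparr>\<^esub> \<tau>') = ?b \<tau> \<otimes>\<^bsub>product_group Z (monodromy_group (to_fract fr))\<^esub> ?b \<tau>'"
      unfolding g(2) k(2) emb by (simp cong: restrict_cong)
  qed
  moreover have "inj_on ?b ?mk"
  proof -
    obtain z where z: "z \<in> Z" using ne by blast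
    show ?thesis by (rule inj_onI) (rule inj_onD[OF inj[OF z]], simp_all)
  qed
  ultimately show ?thesis using inj unfolding diagonal_kernel_def mon_def Z_def by simp
qed

lemma kernel_klein_four:
  assumes sq: "\<And>g a. \<lbrakk>g \<in> Ker; a \<in> A\<rbrakk> \<Longrightarrow> g (g a) = a" and card: "card ((\<lambda>g. restrict g A) ` Ker) = 4"
  shows "(Mon (to_fract f))\<lparr>carrier := mon_kernel (to_fract f) (to_fract h)\<rparr> \<cong> integer_mod_group 2 \<times>\<times> integer_mod_group 2"
proof (rule klein_four_iso)
  interpret Ker: perm_group Ker by (rule Ker_group)
  interpret M: group "Mon (to_fract f)" by (rule monodromy_group_is_group[OF adjoin_self])
  let ?L = "split_field (to_fract f) ac_t"
  let ?mk = "mon_kernel (to_fract f) (to_fract h)"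
  have AL: "A \<subseteq> ?L" using split_field_incl(2)[of "to_fract f" ac_t] by (simp add: A_def)
  have sub: "?mk \<subseteq> carrier (Mon (to_fract f))" by (auto simp: mon_kernel_def kernel_def)
  have sq': "a \<otimes>\<^bsub>Mon (to_fract f)\<^esub> a = \<one>\<^bsub>Mon (to_fract f)\<^esub>" if a: "a \<in> ?mk" for a
  proof -
    obtain g where g: "g \<in> Ker" "a = restrict g ?L" using a by (auto simp: mon_kernel_eq)
    have "restrict (g \<circ> g) ?L = restrict id ?L" by (rule Ker_agree[OF Ker.comp_mem[OF g(1) g(1)] Ker.id_mem]) (use sq[OF g(1)] in simp)
    then show ?thesis unfolding g(2) Ker_restrict_mult[OF g(1) g(1)] monodromy_one .
  qed
  have "subgroup ?mk (Mon (to_fract f))"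
  proof (rule M.subgroupI[OF sub])
    show "?mk \<noteq> {}" using Ker.id_mem by (auto simp: mon_kernel_eq)
    show "inv\<^bsub>Mon (to_fract f)\<^esub> a \<in> ?mk" if "a \<in> ?mk" for a
      using M.inv_equality[OF sq'[OF that]] that sub by auto
    show "a \<otimes>\<^bsub>Mon (to_fract f)\<^esub> b \<in> ?mk" if "a \<in> ?mk" "b \<in> ?mk" for a b
      using that Ker_restrict_mult Ker.comp_mem by (auto simp: mon_kernel_eq)
  qed
  then show "group ((Mon (to_fract f))\<lparr>carrier := ?mk\<rparr>)" by (rule M.subgroup_imp_group)
  \<comment> \<open>An element of the monodromy group is determined by its action on the roots, so
    counting restrictions to \<open>A\<close> counts the kernel.\<close>
  have "inj_on (\<lambda>\<tau>. restrict \<tau> A) ?mk"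
  proof (rule inj_onI)
    fix \<tau> \<tau>' assume "\<tau> \<in> ?mk" "\<tau>' \<in> ?mk" and eq: "restrict \<tau> A = restrict \<tau>' A"
    then obtain g k where gk: "g \<in> Ker" "\<tau> = restrict g ?L" "k \<in> Ker" "\<tau>' = restrict k ?L" by (auto simp: mon_kernel_eq)
    have "g a = k a" if "a \<in> A" for a using fun_cong[OF eq, of a] that AL by (auto simp: gk)
    then show "\<tau> = \<tau>'" unfolding gk(2,4) by (intro Ker_agree[OF gk(1,3)] ballI)
  qed
  moreover have "(\<lambda>\<tau>. restrict \<tau> A) ` ?mk = (\<lambda>g. restrict g A) ` Ker"
    unfolding mon_kernel_eq image_image using AL by (intro image_cong) (auto simp: fun_eq_iff)
  ultimately have "card ?mk = 4" using card card_image by metis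
  then show "card (carrier ((Mon (to_fract f))\<lparr>carrier := ?mk\<rparr>)) = 4" by simp
  show "a \<otimes>\<^bsub>(Mon (to_fract f))\<lparr>carrier := ?mk\<rparr>\<^esub> a = \<one>\<^bsub>(Mon (to_fract f))\<lparr>carrier := ?mk\<rparr>\<^esub>" if "a \<in> carrier ((Mon (to_fract f))\<lparr>carrier := ?mk\<rparr>)" for a
    using sq' that by simp
qed

end

lemma (in monodromy_action) exponent_prime_normal_ex:
  assumes N0: "perm_group N0" "N0 \<subseteq> K" "\<forall>g\<in>G. \<forall>n\<in>N0. g \<circ> n \<circ> finv g \<in> N0"
    "\<exists>n\<in>N0. \<exists>a\<in>A. n a \<noteq> a" "\<forall>n\<in>N0. \<forall>m\<in>N0. \<forall>a\<in>A. n (m a) = m (n a)"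
  shows "\<exists>p N. prime (p::nat) \<and> perm_group N \<and> N \<subseteq> N0 \<and> (\<forall>g\<in>G. \<forall>n\<in>N. g \<circ> n \<circ> finv g \<in> N) \<and>
    (\<exists>n\<in>N. \<exists>a\<in>A. n a \<noteq> a) \<and> (\<forall>n\<in>N. \<forall>a\<in>A. (n ^^ p) a = a)"
proof -
  obtain n0 a0 where n0: "n0 \<in> N0" "a0 \<in> A" "n0 a0 \<noteq> a0" using N0(4) by blast
  show ?thesis
  proof (rule exponent_prime_normal)
    show "perm_group N0" "N0 \<subseteq> K" "n0 \<in> N0" "a0 \<in> A" "n0 a0 \<noteq> a0" by (fact N0(1) N0(2) n0)+
    show "g \<circ> n \<circ> finv g \<in> N0" if "g \<in> G" "n \<in> N0" for g n using N0(3) that by blast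
    show "n (m a) = m (n a)" if "n \<in> N0" "m \<in> N0" "a \<in> A" for n m a using N0(5) that by blast
    fix p :: nat and N n
    assume h: "prime p" "perm_group N" "N \<subseteq> N0" "\<And>g n. \<lbrakk>g \<in> G; n \<in> N\<rbrakk> \<Longrightarrow> g \<circ> n \<circ> finv g \<in> N"
      "n \<in> N" "\<exists>a\<in>A. n a \<noteq> a" "\<And>n a. \<lbrakk>n \<in> N; a \<in> A\<rbrakk> \<Longrightarrow> (n ^^ p) a = a"
    show ?thesis
    proof (intro exI[of _ p] exI[of _ N] conjI ballI)
      show "\<exists>n\<in>N. \<exists>a\<in>A. n a \<noteq> a" using h(6) by (intro bexI[of _ n] h(5))
    qed (rule h, assumption?, assumption?)+
  qed
qed

theorem theorem4p1:
  fixes f h fr :: "'k::field_char_0 poly" and g :: "'k poly fract"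
  assumes "siegel_function g"
    and "minimally_reducible (to_fract f) g"
    and "f = h \<circ>\<^sub>p fr"
    and "indecomposable (to_fract fr)"
    and "solvable (Mon (to_fract fr))"
    and "g \<notin> range to_fract \<Longrightarrow> odd (Polynomial.degree f)"
  shows "diagonal_kernel (to_fract f) (to_fract h) (to_fract fr) \<or>
         Polynomial.degree fr = 2 \<and>
         (Mon (to_fract f))\<lparr>carrier := mon_kernel (to_fract f) (to_fract h)\<rparr> \<cong>
           integer_mod_group 2 \<times>\<times> integer_mod_group 2"
proof -
  have d1: "Polynomial.degree fr > 1" using assms(4) by (simp add: indecomposable_def)
  interpret poly_composition f h fr by unfold_locales (use assms(3) d1 in auto)
  interpret T: galois_closure "range (to_ac :: 'k poly fract \<Rightarrow> _)" by (rule galois_closure_to_ac)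
  obtain x y where xA: "x \<in> A" and yB: "y \<in> rf_fiber g ac_t"
    and M0: "\<exists>\<tau>\<in>GalT. \<forall>\<sigma>\<in>GalT. \<sigma> y = y \<longrightarrow> \<sigma> x \<noteq> \<tau> x"
    and M1: "\<forall>W \<tau>. W \<subseteq> (\<lambda>\<sigma>. \<sigma> x) ` GalT \<longrightarrow> (\<forall>\<sigma>\<in>GalT. \<sigma> x = x \<longrightarrow> \<sigma> ` W = W) \<longrightarrow> (\<exists>\<sigma>\<in>GalT. \<sigma> ` W = W \<and> \<sigma> x \<noteq> x) \<longrightarrow>
       \<tau> \<in> GalT \<longrightarrow> (\<exists>\<sigma>\<in>GalT. \<sigma> y = y \<and> \<sigma> ` W = \<tau> ` W)"
    and M2: "\<forall>W \<tau>. W \<subseteq> (\<lambda>\<sigma>. \<sigma> y) ` GalT \<longrightarrow> (\<forall>\<sigma>\<in>GalT. \<sigma> y = y \<longrightarrow> \<sigma> ` W = W) \<longrightarrow> (\<exists>\<sigma>\<in>GalT. \<sigma> ` W = W \<and> \<sigma> y \<noteq> y) \<longrightarrow>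
       \<tau> \<in> GalT \<longrightarrow> (\<exists>\<sigma>\<in>GalT. \<sigma> ` W = W \<and> \<sigma> x = \<tau> x)"
    by (rule minimally_reducible_action[OF assms(2), folded A_def]) (rule that)
  \<comment> \<open>A bound for all degrees involved, so that one automorphism \<open>s\<close>
    serves f, g and f_r.\<close>
  define D where "D = Polynomial.degree f + rf_degree g + Polynomial.degree fr"
  obtain s where s: "s \<in> GalT" and inertia: "\<forall>\<phi> :: 'k poly fract. rf_degree \<phi> \<le> D \<longrightarrow>
     card (rf_fiber \<phi> ac_t) = rf_degree \<phi> \<and>
     (\<exists>pole. \<forall>x\<in>rf_fiber \<phi> ac_t. rf_P1 \<phi> (pole x) = None \<and>
        (\<forall>x'\<in>rf_fiber \<phi> ac_t. pole x = pole x' \<longrightarrow> (\<exists>k. (s ^^ k) x = x')))"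
    using inertia_at_infinity[of D] by blast
  \<comment> \<open>A polynomial has infinity as its only pole, hence a single cycle.\<close>
  have one_cycle: "\<exists>k. (s ^^ k) a = b"
    if p: "Polynomial.degree p \<le> D" "a \<in> rf_fiber (to_fract p) ac_t" "b \<in> rf_fiber (to_fract p) ac_t" for p a b
  proof -
    obtain pole where pole: "\<forall>x\<in>rf_fiber (to_fract p) ac_t. rf_P1 (to_fract p) (pole x) = None \<and>
        (\<forall>x'\<in>rf_fiber (to_fract p) ac_t. pole x = pole x' \<longrightarrow> (\<exists>k. (s ^^ k) x = x'))"
      using inertia p(1) by (metis rf_degree_poly)
    then have "pole a = None" "pole b = None" using p(2,3) poly_pole_unique by blast+
    then show ?thesis using pole p(2,3) by simp
  qed
  have cardA: "card A = Polynomial.degree f" using inertia[rule_format, of "to_fract f"] by (simp add: A_def D_def)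
  have s_trans: "\<exists>k. (s ^^ k) a = b" if "a \<in> A" "b \<in> A" for a b
    using one_cycle[of f a b] that by (simp add: A_def D_def)
  have card_fr: "card (rf_fiber (to_fract fr) ac_t) = Polynomial.degree fr"
    using inertia[rule_format, of "to_fract fr"] by (simp add: D_def)
  \<comment> \<open>The inertia theorem counts roots over t only; transport carries the count to the
    fibres of f_r over the roots of h(X) - t.\<close>
  have card_fib: "card {b \<in> A. pr b = pr a} = Polynomial.degree fr" if a: "a \<in> A" for a
    using fiber_card_transport[OF Z_transcendental[OF pr_Z[OF a]] Z_adjoin[OF pr_Z[OF a]], of "to_fract fr"] card_fr
    by (simp add: fiber_eq[OF pr_Z[OF a]])
  have xf: "poly (map_poly ac_const f) x = ac_t" using xA by (simp add: A_def rf_fiber_poly)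
  have deg_f: "Polynomial.degree f > 0"
  proof (rule ccontr)
    assume "\<not> ?thesis"
    then obtain c where "f = [:c:]" using degree_eq_zeroE by blast
    then have "ac_const c = ac_t" using xf by (simp add: map_poly_pCons)
    then show False by (simp add: ac_const_def ac_t_def)
  qed
  have finA: "finite A" using cardA deg_f by (intro card_ge_0_finite) simp
  have fibN: "\<exists>b\<in>A. pr b = pr a \<and> b \<noteq> a" if a: "a \<in> A" for a
  proof (rule ccontr)
    assume "\<not> ?thesis"
    then have "{b \<in> A. pr b = pr a} \<subseteq> {a}" by blast
    then have "card {b \<in> A. pr b = pr a} \<le> card {a}" by (rule card_mono[rotated]) simp
    then show False using card_fib[OF a] d1 by simp
  qed
  have fib_all: "{w. pr w = pr a} = {b \<in> A. pr b = pr a}" if "a \<in> A" for a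
    using that by (auto simp: A_iff)
  interpret MA: monodromy_action GalT A pr s
  proof
    show "finite A" by (rule finA)
    show "A \<noteq> {}" using xA by blast
    show "k a \<in> A" if "k \<in> GalT" "a \<in> A" for k a using that by (rule GalT_A)
    show "pr (k a) = k (pr a)" if "k \<in> GalT" "a \<in> A" for k a using GalT_pr[OF that(1)] by simp
    show "s \<in> GalT" by (rule s)
    show "\<exists>k. (s ^^ k) a = b" if "a \<in> A" "b \<in> A" for a b using that by (rule s_trans)
    show "\<exists>b\<in>A. pr b = pr a \<and> b \<noteq> a" if "a \<in> A" for a using that by (rule fibN)
    show "(\<lambda>n. n a) ` N = {a} \<or> (\<lambda>n. n a) ` N = {b \<in> A. pr b = pr a}"
      if N: "perm_group N" "N \<subseteq> GalT" "\<And>k n. \<lbrakk>k \<in> GalT; n \<in> N\<rbrakk> \<Longrightarrow> k \<circ> n \<circ> finv k \<in> N"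
        "\<And>n a. \<lbrakk>n \<in> N; a \<in> A\<rbrakk> \<Longrightarrow> n (pr a) = pr a" and a: "a \<in> A" for N a
      using fiber_primitive[OF assms(4) A_adjoin[OF a] A_transcendental[OF a] N(1-3), folded pr_def] N(4)[OF _ a]
      unfolding fib_all[OF a] by simp
  qed
  have KK: "MA.K = Ker" by (simp add: MA.K_def Ker_def)
  have fibfib: "MA.fib a = {b \<in> A. pr b = pr a}" for a by (simp add: MA.fib_def)
  have Ka: "\<exists>T\<in>hom (comp_group Ker) (Mon (to_fract fr)). \<forall>k\<in>Ker. T k = \<one>\<^bsub>Mon (to_fract fr)\<^esub> \<longrightarrow> k a = a" if a: "a \<in> A" for a
  proof (rule kernel_hom_to_monodromy[OF Z_transcendental[OF pr_Z[OF a]] Z_adjoin[OF pr_Z[OF a]]])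
    show "Ker \<subseteq> autos (adjoin (pr a))" using Ker_autos[OF _ pr_Z[OF a]] by blast
    show "a \<in> rf_fiber (to_fract fr) (pr a)" using a by (simp add: fiber_eq[OF pr_Z[OF a]])
  qed
  \<comment> \<open>A power of \<open>s\<close> in the kernel is a full cycle on each block, and
    blocks have more than one point.\<close>
  have K_nontriv: "\<exists>k\<in>Ker. \<exists>a\<in>A. k a \<noteq> a"
  proof -
    obtain j where j: "s ^^ j \<in> MA.K" "\<And>b. b \<in> A \<Longrightarrow> MA.fib b = range (\<lambda>k. ((s ^^ j) ^^ k) b)"
      using MA.fib_cyclic[OF xA] by metis
    have "(s ^^ j) x \<noteq> x"
    proof
      assume fx: "(s ^^ j) x = x"
      have "((s ^^ j) ^^ k) x = x" for k by (induction k) (simp_all add: fx)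
      then have "MA.fib x \<subseteq> {x}" using j(2)[OF xA] by auto
      then show False using fibN[OF xA] by (auto simp: fibfib)
    qed
    then show ?thesis using j(1) xA unfolding KK by blast
  qed
  have Ksub: "Ker \<subseteq> GalT" by (auto simp: Ker_def)
  have Knorm: "k \<circ> n \<circ> finv k \<in> Ker" if "k \<in> GalT" "n \<in> Ker" for k n using MA.K_normal that unfolding KK .
  have "\<exists>N. perm_group N \<and> N \<subseteq> Ker \<and> (\<forall>k\<in>GalT. \<forall>n\<in>N. k \<circ> n \<circ> finv k \<in> N) \<and>
    (\<exists>n\<in>N. \<exists>a\<in>A. n a \<noteq> a) \<and> (\<forall>n\<in>N. \<forall>m\<in>N. \<forall>a\<in>A. n (m a) = m (n a))"
  proof (rule abelian_normal_of_solvable)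
    show "perm_group GalT" by (rule autos_group)
    show "perm_group Ker" by (rule Ker_group)
    show "Ker \<subseteq> GalT" by (rule Ksub)
    show "k \<circ> n \<circ> finv k \<in> Ker" if "k \<in> GalT" "n \<in> Ker" for k n using that by (rule Knorm)
    show "k a \<in> A" if "k \<in> GalT" "a \<in> A" for k a using that by (rule GalT_A)
    show "group (Mon (to_fract fr))" by (rule monodromy_group_is_group[OF adjoin_self])
    show "solvable (Mon (to_fract fr))" by (rule assms(5))
    show "\<exists>T\<in>hom (comp_group Ker) (Mon (to_fract fr)). \<forall>k\<in>Ker. T k = \<one>\<^bsub>Mon (to_fract fr)\<^esub> \<longrightarrow> k a = a" if "a \<in> A" for a
      using that by (rule Ka)
    show "\<exists>k\<in>Ker. \<exists>a\<in>A. k a \<noteq> a" by (rule K_nontriv)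
  qed
  then obtain N0 where N0: "perm_group N0" "N0 \<subseteq> Ker" "\<forall>k\<in>GalT. \<forall>n\<in>N0. k \<circ> n \<circ> finv k \<in> N0"
    "\<exists>n\<in>N0. \<exists>a\<in>A. n a \<noteq> a" "\<forall>n\<in>N0. \<forall>m\<in>N0. \<forall>a\<in>A. n (m a) = m (n a)" by (elim exE conjE) (rule that)
  obtain p N where p: "prime (p::nat)" and N: "perm_group N" "N \<subseteq> N0" "\<forall>k\<in>GalT. \<forall>n\<in>N. k \<circ> n \<circ> finv k \<in> N"
    "\<exists>n\<in>N. \<exists>a\<in>A. n a \<noteq> a" "\<forall>n\<in>N. \<forall>a\<in>A. (n ^^ p) a = a"
    using MA.exponent_prime_normal_ex[OF N0(1) N0(2)[folded KK] N0(3-5)] by (elim exE conjE) (rule that)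
  define B where "B = (\<lambda>k. k y) ` GalT"
  have BG: "B \<subseteq> rf_fiber g ac_t" using GalT_fiber[OF _ yB] by (auto simp: B_def GalT_t)
  have reach: "\<exists>k\<in>GalT. k x = a" if "a \<in> A" for a
  proof -
    obtain k where "(s ^^ k) x = a" using s_trans[OF xA \<open>a \<in> A\<close>] by blast
    then show ?thesis by (intro bexI[of _ "s ^^ k"] T.G.funpow_mem[OF s])
  qed
  have orbA: "(\<lambda>k. k x) ` GalT = A"
  proof
    show "(\<lambda>k. k x) ` GalT \<subseteq> A" using GalT_A[OF _ xA] by blast
    show "A \<subseteq> (\<lambda>k. k x) ` GalT"
    proof
      fix a assume a: "a \<in> A"
      obtain k where "k \<in> GalT" "k x = a" using reach[OF a] by (elim bexE) (rule that)
      then show "a \<in> (\<lambda>k. k x) ` GalT" by (intro image_eqI[of _ _ k]) simp_all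
    qed
  qed
  have fib_move: "k ` {w. pr w = c} = {w. pr w = k c}" if k: "k \<in> GalT" for k c
  proof -
    have "w \<in> k ` {w. pr w = c}" if "pr w = k c" for w
    proof (rule image_eqI[of _ _ "finv k w"])
      show "w = k (finv k w)" using T.G.finv_right[OF k] by simp
      have "pr (finv k w) = finv k (pr w)" using GalT_pr[OF T.G.finv_mem[OF k]] by simp
      then show "finv k w \<in> {w. pr w = c}" using that T.G.finv_left[OF k] by simp
    qed
    then show ?thesis using GalT_pr[OF k] by auto
  qed
  \<comment> \<open>Minimality on the side of x is applied to the block of x. An automorphism that
    moves x and preserves the block exists because the block has a second point.\<close>
  have pt0: "\<exists>k\<in>GalT. k y = y \<and> k (pr x) = \<tau> (pr x)" if \<tau>: "\<tau> \<in> GalT" for \<tau>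
  proof -
    define W where "W = {w. pr w = pr x}"
    have WA: "W \<subseteq> (\<lambda>k. k x) ` GalT" unfolding W_def fib_all[OF xA] orbA by blast
    have W1: "\<forall>k\<in>GalT. k x = x \<longrightarrow> k ` W = W"
    proof (intro ballI impI)
      fix k assume k: "k \<in> GalT" "k x = x"
      then show "k ` W = W" unfolding W_def fib_move[OF k(1)] GalT_pr[OF k(1)] by simp
    qed
    have W2: "\<exists>k\<in>GalT. k ` W = W \<and> k x \<noteq> x"
    proof -
      obtain b where b: "b \<in> A" "pr b = pr x" "b \<noteq> x" using fibN[OF xA] by blast
      obtain k where k: "k \<in> GalT" "k x = b" using reach[OF b(1)] by (elim bexE) (rule that)
      have "k ` W = W" using b(2) unfolding W_def fib_move[OF k(1)] GalT_pr[OF k(1)] by (simp add: k(2))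
      then show ?thesis using k b(3) by blast
    qed
    obtain k where k: "k \<in> GalT" "k y = y" "k ` W = \<tau> ` W"
      using M1[THEN spec, THEN spec, THEN mp, OF WA, THEN mp, OF W1, THEN mp, OF W2, THEN mp, OF \<tau>] by blast
    have "k x \<in> \<tau> ` W" using k(3) by (auto simp: W_def)
    then have "pr (k x) = \<tau> (pr x)" unfolding W_def fib_move[OF \<tau>] by simp
    then show ?thesis using k(1,2) GalT_pr[OF k(1)] by (intro bexI[of _ k]) simp_all
  qed
  have pt: "\<exists>k\<in>GalT. k y = y \<and> k (pr a) = pr b" if a: "a \<in> A" and b: "b \<in> A" for a b
  proof -
    obtain \<tau> where \<tau>: "\<tau> \<in> GalT" "\<tau> x = a" using reach[OF a] by (elim bexE) (rule that)
    obtain \<tau>' where \<tau>': "\<tau>' \<in> GalT" "\<tau>' x = b" using reach[OF b] by (elim bexE) (rule that)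
    obtain k where k: "k \<in> GalT" "k y = y" "k (pr x) = \<tau> (pr x)" using pt0[OF \<tau>(1)] by blast
    obtain l where l: "l \<in> GalT" "l y = y" "l (pr x) = \<tau>' (pr x)" using pt0[OF \<tau>'(1)] by blast
    have "k (pr x) = pr a" "l (pr x) = pr b" using k(3) l(3) GalT_pr[OF \<tau>(1)] GalT_pr[OF \<tau>'(1)] \<tau>(2) \<tau>'(2) by simp_all
    then have "(l \<circ> finv k) (pr a) = pr b" using T.G.finv_left[OF k(1), of "pr x"] by simp
    moreover have "(l \<circ> finv k) y = y" using T.G.finv_left[OF k(1), of y] k(2) l(2) by simp
    moreover have "l \<circ> finv k \<in> GalT" by (rule T.G.comp_mem[OF l(1) T.G.finv_mem[OF k(1)]])
    ultimately show ?thesis by blast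
  qed
  have orbits: "(\<forall>b1\<in>B. \<forall>b2\<in>B. \<exists>k. (s ^^ k) b1 = b2) \<or>
      odd (card A) \<and> (\<forall>b1\<in>B. \<forall>b2\<in>B. \<forall>b3\<in>B. \<exists>k. (s ^^ k) b1 = b2 \<or> (s ^^ k) b1 = b3 \<or> (s ^^ k) b2 = b3)"
  proof (cases "g \<in> range to_fract")
    case True
    then obtain gp where gp: "g = to_fract gp" by blast
    have "Polynomial.degree gp \<le> D" by (simp add: D_def gp)
    then have "\<exists>k. (s ^^ k) b1 = b2" if "b1 \<in> B" "b2 \<in> B" for b1 b2
      using one_cycle[of gp b1 b2] that BG gp by blast
    then show ?thesis by blast
  next
    case False
    have "rf_degree g \<le> D" by (simp add: D_def)
    then obtain pole where pole: "\<forall>x\<in>rf_fiber g ac_t. rf_P1 g (pole x) = None \<and>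
        (\<forall>x'\<in>rf_fiber g ac_t. pole x = pole x' \<longrightarrow> (\<exists>k. (s ^^ k) x = x'))" using inertia by blast
    have c2: "card {P. rf_P1 g P = None} \<le> 2" using assms(1) by (simp add: siegel_function_def)
    \<comment> \<open>A Siegel function has at most two poles, so two of the three roots belong to
      the same pole and share a cycle.\<close>
    have three: "\<exists>k. (s ^^ k) b1 = b2 \<or> (s ^^ k) b1 = b3 \<or> (s ^^ k) b2 = b3" if b: "b1 \<in> B" "b2 \<in> B" "b3 \<in> B" for b1 b2 b3
    proof -
      have bF: "b1 \<in> rf_fiber g ac_t" "b2 \<in> rf_fiber g ac_t" "b3 \<in> rf_fiber g ac_t" using b BG by blast+
      have "{pole b1, pole b2, pole b3} \<subseteq> {P. rf_P1 g P = None}" using pole bF by simp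
      then have "card {pole b1, pole b2, pole b3} \<le> 2" using card_mono[OF finite_rf_poles] c2 le_trans by blast
      then have "pole b1 = pole b2 \<or> pole b1 = pole b3 \<or> pole b2 = pole b3" by (auto simp: card_insert_if split: if_splits)
      then show ?thesis using pole bF by blast
    qed
    have "odd (card A)" using assms(6)[OF False] by (simp add: cardA)
    then show ?thesis by (intro disjI2 conjI ballI three)
  qed
  interpret MN: monodromy_normal GalT A pr s N p y B
  proof (intro monodromy_normal.intro monodromy_normal_axioms.intro)
    show "monodromy_action GalT A pr s" by (rule MA.monodromy_action_axioms)
    show "prime p" by (rule p)
    show "perm_group N" by (rule N(1))
    show "N \<subseteq> MA.K" unfolding KK using N(2) N0(2) by blast
    show "k \<circ> n \<circ> finv k \<in> N" if "k \<in> GalT" "n \<in> N" for k n using N(3) that by blast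
    show "\<exists>n\<in>N. \<exists>a\<in>A. n a \<noteq> a" by (rule N(4))
    show "n (m a) = m (n a)" if "n \<in> N" "m \<in> N" "a \<in> A" for n m a using N0(5) that N(2) by blast
    show "(n ^^ p) a = a" if "n \<in> N" "a \<in> A" for n a using N(5) that by blast
    show "B = (\<lambda>k. k y) ` GalT" by (rule B_def)
    show "finite B" unfolding B_def by (rule orbit_finite[OF T.alg])
    show "\<exists>a\<in>A. \<exists>b\<in>A. \<forall>k\<in>GalT. k y = y \<longrightarrow> k a \<noteq> b" using M0 xA GalT_A[OF _ xA] by blast
    show "\<exists>k\<in>GalT. k y = y \<and> k (pr a) = pr b" if "a \<in> A" "b \<in> A" for a b using that by (rule pt)
    show "k y = y" if k: "k \<in> GalT" "\<And>a. a \<in> A \<Longrightarrow> k a = a" for k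
      by (rule faithful_on_orbit[OF autos_group M0 M2 k(1)]) (rule k(2), simp add: orbA)
    show "(\<forall>b1\<in>B. \<forall>b2\<in>B. \<exists>k. (s ^^ k) b1 = b2) \<or>
      odd (card A) \<and> (\<forall>b1\<in>B. \<forall>b2\<in>B. \<forall>b3\<in>B. \<exists>k. (s ^^ k) b1 = b2 \<or> (s ^^ k) b1 = b3 \<or> (s ^^ k) b2 = b3)" by (rule orbits)
  qed
  from MN.kernel_dichotomy show ?thesis
  proof (elim disjE conjE)
    assume d: "\<forall>k\<in>MA.K. \<forall>a\<in>A. (\<forall>b\<in>MA.fib a. k b = b) \<longrightarrow> (\<forall>b\<in>A. k b = b)"
    have "diagonal_kernel (to_fract f) (to_fract h) (to_fract fr)"
    proof (rule diagonal_kernelI)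
      show "Z \<noteq> {}" using pr_Z[OF xA] by blast
      fix k z assume k: "k \<in> Ker" "z \<in> Z" "\<forall>a\<in>A. pr a = z \<longrightarrow> k a = a"
      obtain a where a: "a \<in> A" "pr a = z" by (rule Z_lift[OF k(2)])
      have "\<forall>b\<in>MA.fib a. k b = b" using k(3) a by (simp add: fibfib)
      then show "\<forall>a\<in>A. k a = a" using d k(1) a(1) unfolding KK by blast
    qed
    then show ?thesis by blast
  next
    assume d: "\<forall>a\<in>A. card (MA.fib a) = 2" "\<forall>k\<in>MA.K. \<forall>a\<in>A. k (k a) = a" "card ((\<lambda>k. restrict k A) ` MA.K) = 4"
    have "Polynomial.degree fr = 2" using d(1) xA card_fib[OF xA] by (simp add: fibfib)
    moreover have "(Mon (to_fract f))\<lparr>carrier := mon_kernel (to_fract f) (to_fract h)\<rparr> \<cong> integer_mod_group 2 \<times>\<times> integer_mod_group 2"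
      by (rule kernel_klein_four) (use d(2,3) in \<open>auto simp: KK\<close>)
    ultimately show ?thesis by blast
  qed
qed

end
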